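(* Let $n\geq 1$ be an arbitrary integer. Then: (1) There exists a unique functor $t_{n}:\mathcal H\rightarrow \mathcal H$ such that $t_n\circ \mathrm{Ho}=\mathrm{Ho}\circ \tau_n$ as functors $\mathcal M\to\mathcal H$. (2) There exists a unique functor $s_{n}:\mathcal H\rightarrow \mathcal H$ such that $s_n\circ \mathrm{Ho}=\mathrm{Ho}\circ \tilde s_n$ as functors $\mathcal M\to\mathcal H$.
   Context: $X$ is a Noetherian separated base scheme of finite Krull dimension, and $Sm_X$ is the category of smooth schemes of finite type over $X$, regarded as a site with the Nisnevich topology. Closed subsets are considered as closed subschemes with the reduced structure. $\mathcal M$ is the category of pointed simplicial presheaves on $Sm_X$ with Jardine's motivic (injective) model structure: cofibrations are the monomorphisms and weak equivalences are the motivic ($\mathbb A^1$-local Nisnevich) weak equivalences; $\mathcal H$ is its homotopy category and $\mathrm{Ho}:\mathcal M\to\mathcal H$ the localization functor. For $Y\in Sm_X$, $Y_+$ denotes the presheaf represented by $Y$ with a disjoint base point. For $Z$ closed in $Y$, $codim_Y Z$ is the infimum of $\dim \mathcal O_{Y,z}$ over the generic points $z$ of $Z$ (so it is $\infty$ if $Z=\emptyset$). For $n\ge 0$, $WB_n$ is the set of maps $\iota_{U,Y}:U_+\to Y_+$ induced by open immersions $U\to Y$ with $Y\in Sm_X$ irreducible, $Z=Y\setminus U\in Sm_X$ and $codim_Y Z\ge n+1$; $WB_n\mathcal M$ is the left Bousfield localization of $\mathcal M$ with respect to $WB_n$. The functors $\tau_n:\mathcal M\to\mathcal M$ ($n\ge1$),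 with natural transformations $\tau_{\le n}:id\to\tau_n$ and $\nu_n:\tau_{n+1}\to\tau_n$, are defined inductively using the functorial factorizations (trivial cofibration followed by fibration): $A\xrightarrow{\tau_{\le 1}^A}\tau_1A\to *$ is the factorization of $A\to *$ in $WB_0\mathcal M$; and given $\tau_{\le n}^A:A\to\tau_nA$, it is factored in $WB_n\mathcal M$ as a trivial cofibration $\tau_{\le n+1}^A:A\to\tau_{n+1}A$ followed by a fibration $\nu_n^A:\tau_{n+1}A\to\tau_nA$. For $n\ge 1$, $\tilde s_nA$ is the pullback in $\mathcal M$ of $\nu_n^A:\tau_{n+1}A\to\tau_nA$ along the base point $*\to\tau_nA$; this defines a functor $\tilde s_n:\mathcal M\to\mathcal M$. *)

theory Defs
  imports
    "HOL-Algebra.Ring_Divisibility"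
    "HOL-Analysis.Abstract_Topology"
    "HOL-Library.Extended_Nat"
    "HOL-Library.FuncSet"
begin

section \<open>Universe\<close>

text \<open>
  The type variable \<open>'u\<close> carries the universe: a set (over any type) is small if its cardinality
  is below that of \<open>'u\<close>, and \<open>universe\<close> says that this cardinality is strongly inaccessible, i.e.
  that the small sets behave like the elements of a Grothendieck universe. Schemes have a small
  underlying set and small rings of sections, and presheaves take small values.
\<close>

definition small :: "'u itself \<Rightarrow> 'a set \<Rightarrow> bool" where
  "small u A \<longleftrightarrow> (card_of A, card_of (UNIV :: 'u set)) \<in> ordLess"

definition universe :: "'u itself \<Rightarrow> bool" where
  "universe u \<longleftrightarrow>
     (\<exists>A :: 'u set. infinite A \<and> small u A) \<and>
     (\<forall>A :: 'u set. small u A \<longrightarrow> small u (Pow A)) \<and>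
     (\<forall>(A :: 'u set) (F :: 'u \<Rightarrow> 'u set).
        small u A \<and> (\<forall>a\<in>A. small u (F a)) \<longrightarrow> small u (\<Union>a\<in>A. F a))"


section \<open>Commutative algebra\<close>

definition local_ring :: "('r, 'm) ring_scheme \<Rightarrow> bool" where
  "local_ring R \<longleftrightarrow> cring R \<and> (\<exists>!I. maximalideal I R)"

definition krull_dim :: "('r, 'm) ring_scheme \<Rightarrow> enat" where
  "krull_dim R =
     Sup {enat n | n. \<exists>P. (\<forall>i\<le>n. primeideal (P i) R) \<and> (\<forall>i<n. P i \<subset> P (Suc i))}"

text \<open>Polynomials over \<open>A\<close> in \<open>n\<close> variables: coefficient functions on exponent vectors
  \<open>nat \<Rightarrow> nat\<close> vanishing from \<open>n\<close> on.\<close>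

definition mpoly :: "'r ring \<Rightarrow> nat \<Rightarrow> ((nat \<Rightarrow> nat) \<Rightarrow> 'r) ring" where
  "mpoly A n =
     \<lparr>carrier = {p. (\<forall>a. p a \<in> carrier A) \<and> finite {a. p a \<noteq> \<zero>\<^bsub>A\<^esub>} \<and>
                    (\<forall>a. p a \<noteq> \<zero>\<^bsub>A\<^esub> \<longrightarrow> (\<forall>i\<ge>n. a i = 0))},
      mult = (\<lambda>p q c. finsum A (\<lambda>a. p a \<otimes>\<^bsub>A\<^esub> q (\<lambda>i. c i - a i))
                          {a. p a \<noteq> \<zero>\<^bsub>A\<^esub> \<and> (\<forall>i. a i \<le> c i)}),
      one = (\<lambda>a. if a = (\<lambda>_. 0) then \<one>\<^bsub>A\<^esub> else \<zero>\<^bsub>A\<^esub>),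
      zero = (\<lambda>_. \<zero>\<^bsub>A\<^esub>),
      add = (\<lambda>p q a. p a \<oplus>\<^bsub>A\<^esub> q a)\<rparr>"

definition mpoly_const :: "'r ring \<Rightarrow> 'r \<Rightarrow> (nat \<Rightarrow> nat) \<Rightarrow> 'r" where
  "mpoly_const A c = (\<lambda>a. if a = (\<lambda>_. 0) then c else \<zero>\<^bsub>A\<^esub>)"

definition mpoly_presentation ::
  "'r ring \<Rightarrow> 's ring \<Rightarrow> ('r \<Rightarrow> 's) \<Rightarrow> nat \<Rightarrow> (((nat \<Rightarrow> nat) \<Rightarrow> 'r) \<Rightarrow> 's) \<Rightarrow> bool" where
  "mpoly_presentation A B \<phi> n h \<longleftrightarrow>
     h \<in> ring_hom (mpoly A n) B \<and> h ` carrier (mpoly A n) = carrier B \<and>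
     (\<forall>c\<in>carrier A. h (mpoly_const A c) = \<phi> c)"

definition finite_type_ring :: "'r ring \<Rightarrow> 's ring \<Rightarrow> ('r \<Rightarrow> 's) \<Rightarrow> bool" where
  "finite_type_ring A B \<phi> \<longleftrightarrow> (\<exists>n h. mpoly_presentation A B \<phi> n h)"

definition finite_presentation_ring :: "'r ring \<Rightarrow> 's ring \<Rightarrow> ('r \<Rightarrow> 's) \<Rightarrow> bool" where
  "finite_presentation_ring A B \<phi> \<longleftrightarrow>
     (\<exists>n h. mpoly_presentation A B \<phi> n h \<and>
        (\<exists>S. finite S \<and> S \<subseteq> carrier (mpoly A n) \<and>
             {p \<in> carrier (mpoly A n). h p = \<zero>\<^bsub>B\<^esub>} = genideal (mpoly A n) S))"

text \<open>The localization of \<open>A\<close> at the complement of a prime ideal \<open>p\<close>: a fraction is the set of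
  all pairs (numerator, denominator) representing it.\<close>

definition fraction :: "'r ring \<Rightarrow> 'r set \<Rightarrow> 'r \<Rightarrow> 'r \<Rightarrow> ('r \<times> 'r) set" where
  "fraction A p a f =
     {(b, g). b \<in> carrier A \<and> g \<in> carrier A - p \<and>
        (\<exists>h\<in>carrier A - p. h \<otimes>\<^bsub>A\<^esub> (g \<otimes>\<^bsub>A\<^esub> a) = h \<otimes>\<^bsub>A\<^esub> (f \<otimes>\<^bsub>A\<^esub> b))}"

definition loc_ring :: "'r ring \<Rightarrow> 'r set \<Rightarrow> ('r \<times> 'r) set ring" where
  "loc_ring A p =
     \<lparr>carrier = {fraction A p a f | a f. a \<in> carrier A \<and> f \<in> carrier A - p},
      mult = (\<lambda>c d. \<Union>(a, f)\<in>c. \<Union>(b, g)\<in>d. fraction A p (a \<otimes>\<^bsub>A\<^esub> b) (f \<otimes>\<^bsub>A\<^esub> g)),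
      one = fraction A p \<one>\<^bsub>A\<^esub> \<one>\<^bsub>A\<^esub>,
      zero = fraction A p \<zero>\<^bsub>A\<^esub> \<one>\<^bsub>A\<^esub>,
      add = (\<lambda>c d. \<Union>(a, f)\<in>c. \<Union>(b, g)\<in>d.
               fraction A p (a \<otimes>\<^bsub>A\<^esub> g \<oplus>\<^bsub>A\<^esub> b \<otimes>\<^bsub>A\<^esub> f) (f \<otimes>\<^bsub>A\<^esub> g))\<rparr>"


section \<open>Ringed spaces\<close>

record ('p, 'r) rspace =
  spc :: "'p topology"
  sct :: "'p set \<Rightarrow> 'r ring"
  res :: "'p set \<Rightarrow> 'p set \<Rightarrow> 'r \<Rightarrow> 'r"   \<comment> \<open>\<open>res X U V\<close> restricts from \<open>U\<close> to \<open>V\<close>\<close>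

definition ringed_space :: "('p, 'r) rspace \<Rightarrow> bool" where
  "ringed_space X \<longleftrightarrow>
     (\<forall>U. openin (spc X) U \<longrightarrow> cring (sct X U)) \<and>
     (\<forall>U V. openin (spc X) U \<and> openin (spc X) V \<and> V \<subseteq> U \<longrightarrow>
        res X U V \<in> ring_hom (sct X U) (sct X V)) \<and>
     (\<forall>U. openin (spc X) U \<longrightarrow> (\<forall>s\<in>carrier (sct X U). res X U U s = s)) \<and>
     (\<forall>U V W. openin (spc X) U \<and> openin (spc X) V \<and> openin (spc X) W \<and> W \<subseteq> V \<and> V \<subseteq> U \<longrightarrow>
        (\<forall>s\<in>carrier (sct X U). res X V W (res X U V s) = res X U W s)) \<and>
     (\<forall>\<U> s. (\<forall>U\<in>\<U>. openin (spc X) U \<and> s U \<in> carrier (sct X U)) \<and>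
            (\<forall>U\<in>\<U>. \<forall>V\<in>\<U>. res X U (U \<inter> V) (s U) = res X V (U \<inter> V) (s V)) \<longrightarrow>
        (\<exists>!t. t \<in> carrier (sct X (\<Union>\<U>)) \<and> (\<forall>U\<in>\<U>. res X (\<Union>\<U>) U t = s U)))"

definition open_sub :: "('p, 'r) rspace \<Rightarrow> 'p set \<Rightarrow> ('p, 'r) rspace" where
  "open_sub X U = X\<lparr>spc := subtopology (spc X) U\<rparr>"

definition germ :: "('p, 'r) rspace \<Rightarrow> 'p \<Rightarrow> 'p set \<Rightarrow> 'r \<Rightarrow> ('p set \<times> 'r) set" where
  "germ X x U s =
     {(V, t). openin (spc X) V \<and> x \<in> V \<and> t \<in> carrier (sct X V) \<and>
        (\<exists>W. openin (spc X) W \<and> x \<in> W \<and> W \<subseteq> U \<inter> V \<and> res X U W s = res X V W t)}"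

definition stalk :: "('p, 'r) rspace \<Rightarrow> 'p \<Rightarrow> ('p set \<times> 'r) set ring" where
  "stalk X x =
     \<lparr>carrier = {germ X x U s | U s. openin (spc X) U \<and> x \<in> U \<and> s \<in> carrier (sct X U)},
      mult = (\<lambda>c d. \<Union>{germ X x U (s \<otimes>\<^bsub>sct X U\<^esub> t) | U s t. (U, s) \<in> c \<and> (U, t) \<in> d}),
      one = germ X x (topspace (spc X)) \<one>\<^bsub>sct X (topspace (spc X))\<^esub>,
      zero = germ X x (topspace (spc X)) \<zero>\<^bsub>sct X (topspace (spc X))\<^esub>,
      add = (\<lambda>c d. \<Union>{germ X x U (s \<oplus>\<^bsub>sct X U\<^esub> t) | U s t. (U, s) \<in> c \<and> (U, t) \<in> d})\<rparr>"

text \<open>Morphisms are made extensional, so that equality of records is equality of morphisms.\<close>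

record ('p, 'r, 'q, 's) rmor =
  pmap :: "'p \<Rightarrow> 'q"
  smap :: "'q set \<Rightarrow> 's \<Rightarrow> 'r"

definition vim :: "('p, 'r) rspace \<Rightarrow> ('p, 'r, 'q, 's) rmor \<Rightarrow> 'q set \<Rightarrow> 'p set" where
  "vim X f V = {x \<in> topspace (spc X). pmap f x \<in> V}"

definition rmorphism ::
  "('p, 'r) rspace \<Rightarrow> ('q, 's) rspace \<Rightarrow> ('p, 'r, 'q, 's) rmor \<Rightarrow> bool" where
  "rmorphism X Y f \<longleftrightarrow>
     continuous_map (spc X) (spc Y) (pmap f) \<and> pmap f \<in> extensional (topspace (spc X)) \<and>
     (\<forall>V. openin (spc Y) V \<longrightarrow>
        smap f V \<in> ring_hom (sct Y V) (sct X (vim X f V)) \<and>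
        smap f V \<in> extensional (carrier (sct Y V))) \<and>
     (\<forall>V. \<not> openin (spc Y) V \<longrightarrow> smap f V = (\<lambda>_. undefined)) \<and>
     (\<forall>V W. openin (spc Y) V \<and> openin (spc Y) W \<and> W \<subseteq> V \<longrightarrow>
        (\<forall>s\<in>carrier (sct Y V).
           smap f W (res Y V W s) = res X (vim X f V) (vim X f W) (smap f V s)))"

definition rident :: "('p, 'r) rspace \<Rightarrow> ('p, 'r, 'p, 'r) rmor" where
  "rident X =
     \<lparr>pmap = (\<lambda>x\<in>topspace (spc X). x),
      smap = (\<lambda>V. if openin (spc X) V then (\<lambda>s\<in>carrier (sct X V). s) else (\<lambda>_. undefined))\<rparr>"

definition rcomp ::
  "('p, 'r) rspace \<Rightarrow> ('q, 's) rspace \<Rightarrow> ('x, 'y) rspace \<Rightarrow>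
   ('q, 's, 'x, 'y) rmor \<Rightarrow> ('p, 'r, 'q, 's) rmor \<Rightarrow> ('p, 'r, 'x, 'y) rmor" where
  "rcomp X Y Z g f =
     \<lparr>pmap = (\<lambda>x\<in>topspace (spc X). pmap g (pmap f x)),
      smap = (\<lambda>W. if openin (spc Z) W
                  then (\<lambda>s\<in>carrier (sct Z W). smap f (vim Y g W) (smap g W s))
                  else (\<lambda>_. undefined))\<rparr>"

definition rspace_iso :: "('p, 'r) rspace \<Rightarrow> ('q, 's) rspace \<Rightarrow> bool" where
  "rspace_iso X Y \<longleftrightarrow>
     (\<exists>f g. rmorphism X Y f \<and> rmorphism Y X g \<and>
            rcomp X Y X g f = rident X \<and> rcomp Y X Y f g = rident Y)"

definition stalk_map ::
  "('p, 'r) rspace \<Rightarrow> ('p, 'r, 'q, 's) rmor \<Rightarrow> 'p \<Rightarrow> ('q set \<times> 's) set \<Rightarrow> ('p set \<times> 'r) set" where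
  "stalk_map X f x c = (\<Union>(V, s)\<in>c. germ X x (vim X f V) (smap f V s))"

definition locally_ringed_space :: "('p, 'r) rspace \<Rightarrow> bool" where
  "locally_ringed_space X \<longleftrightarrow>
     ringed_space X \<and> (\<forall>x\<in>topspace (spc X). local_ring (stalk X x))"

definition lrmorphism ::
  "('p, 'r) rspace \<Rightarrow> ('q, 's) rspace \<Rightarrow> ('p, 'r, 'q, 's) rmor \<Rightarrow> bool" where
  "lrmorphism X Y f \<longleftrightarrow>
     rmorphism X Y f \<and>
     (\<forall>x\<in>topspace (spc X). \<forall>c\<in>carrier (stalk Y (pmap f x)).
        stalk_map X f x c \<in> Units (stalk X x) \<longrightarrow> c \<in> Units (stalk Y (pmap f x)))"


section \<open>Schemes\<close>

definition Spec_top :: "'r ring \<Rightarrow> 'r set topology" where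
  "Spec_top A =
     topology (\<lambda>U. \<exists>S\<subseteq>carrier A. U = {p. primeideal p A \<and> \<not> S \<subseteq> p})"

definition Spec_sections :: "'r ring \<Rightarrow> 'r set set \<Rightarrow> ('r set \<Rightarrow> ('r \<times> 'r) set) ring" where
  "Spec_sections A U =
     \<lparr>carrier = {s \<in> (\<Pi>\<^sub>E p\<in>U. carrier (loc_ring A p)).
                  \<forall>p\<in>U. \<exists>V. openin (Spec_top A) V \<and> p \<in> V \<and> V \<subseteq> U \<and>
                    (\<exists>a\<in>carrier A. \<exists>f\<in>carrier A. \<forall>q\<in>V. f \<notin> q \<and> s q = fraction A q a f)},
      mult = (\<lambda>s t. \<lambda>p\<in>U. s p \<otimes>\<^bsub>loc_ring A p\<^esub> t p),
      one = (\<lambda>p\<in>U. \<one>\<^bsub>loc_ring A p\<^esub>),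
      zero = (\<lambda>p\<in>U. \<zero>\<^bsub>loc_ring A p\<^esub>),
      add = (\<lambda>s t. \<lambda>p\<in>U. s p \<oplus>\<^bsub>loc_ring A p\<^esub> t p)\<rparr>"

definition Spec :: "'r ring \<Rightarrow> ('r set, 'r set \<Rightarrow> ('r \<times> 'r) set) rspace" where
  "Spec A = \<lparr>spc = Spec_top A, sct = Spec_sections A, res = (\<lambda>U V s. restrict s V)\<rparr>"

definition affine_scheme :: "('p, 'r) rspace \<Rightarrow> bool" where
  "affine_scheme X \<longleftrightarrow>
     locally_ringed_space X \<and> (\<exists>A :: 'r ring. cring A \<and> rspace_iso X (Spec A))"

definition affine_open :: "('p, 'r) rspace \<Rightarrow> 'p set \<Rightarrow> bool" where
  "affine_open X U \<longleftrightarrow> openin (spc X) U \<and> affine_scheme (open_sub X U)"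

definition is_scheme :: "('p, 'r) rspace \<Rightarrow> bool" where
  "is_scheme X \<longleftrightarrow>
     locally_ringed_space X \<and> (\<forall>x\<in>topspace (spc X). \<exists>U. affine_open X U \<and> x \<in> U)"

type_synonym 'u sch = "('u, 'u) rspace"
type_synonym 'u smor = "('u, 'u, 'u, 'u) rmor"

definition small_scheme :: "'u sch \<Rightarrow> bool" where
  "small_scheme X \<longleftrightarrow>
     is_scheme X \<and> small TYPE('u) (topspace (spc X)) \<and>
     (\<forall>U. openin (spc X) U \<longrightarrow> small TYPE('u) (carrier (sct X U)))"

definition noetherian_scheme :: "('p, 'r) rspace \<Rightarrow> bool" where
  "noetherian_scheme X \<longleftrightarrow>
     is_scheme X \<and>
     (\<exists>\<U>. finite \<U> \<and> \<Union>\<U> = topspace (spc X) \<and>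
        (\<forall>U\<in>\<U>. openin (spc X) U \<and>
           (\<exists>A :: 'r ring. cring A \<and> noetherian_ring A \<and> rspace_iso (open_sub X U) (Spec A))))"

definition reduced_scheme :: "('p, 'r) rspace \<Rightarrow> bool" where
  "reduced_scheme X \<longleftrightarrow>
     is_scheme X \<and>
     (\<forall>U. openin (spc X) U \<longrightarrow>
        (\<forall>s\<in>carrier (sct X U). \<forall>n :: nat.
           s [^]\<^bsub>sct X U\<^esub> n = \<zero>\<^bsub>sct X U\<^esub> \<longrightarrow> s = \<zero>\<^bsub>sct X U\<^esub>))"

definition irreducible_in :: "'p topology \<Rightarrow> 'p set \<Rightarrow> bool" where
  "irreducible_in T S \<longleftrightarrow>
     S \<subseteq> topspace T \<and> S \<noteq> {} \<and>
     (\<forall>C D. closedin T C \<and> closedin T D \<and> S \<subseteq> C \<union> D \<longrightarrow> S \<subseteq> C \<or> S \<subseteq> D)"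

definition irreducible_scheme :: "('p, 'r) rspace \<Rightarrow> bool" where
  "irreducible_scheme X \<longleftrightarrow> is_scheme X \<and> irreducible_in (spc X) (topspace (spc X))"

definition finite_krull_dim :: "('p, 'r) rspace \<Rightarrow> bool" where
  "finite_krull_dim X \<longleftrightarrow>
     (\<exists>N :: nat. \<forall>n C. (\<forall>i\<le>n. closedin (spc X) (C i) \<and> irreducible_in (spc X) (C i)) \<and>
                       (\<forall>i<n. C i \<subset> C (Suc i)) \<longrightarrow> n \<le> N)"

text \<open>Generic points of the irreducible components of a closed subset.\<close>

definition generic_points :: "'p topology \<Rightarrow> 'p set \<Rightarrow> 'p set" where
  "generic_points T Z =
     {z \<in> Z. irreducible_in T (T closure_of {z}) \<and> T closure_of {z} \<subseteq> Z \<and>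
        (\<forall>S. irreducible_in T S \<and> S \<subseteq> Z \<and> T closure_of {z} \<subseteq> S \<longrightarrow> S = T closure_of {z})}"

definition codim :: "('p, 'r) rspace \<Rightarrow> 'p set \<Rightarrow> enat" where
  "codim Y Z = (INF z\<in>generic_points (spc Y) Z. krull_dim (stalk Y z))"

definition open_immersion ::
  "('p, 'r) rspace \<Rightarrow> ('q, 's) rspace \<Rightarrow> ('p, 'r, 'q, 's) rmor \<Rightarrow> bool" where
  "open_immersion U Y j \<longleftrightarrow>
     lrmorphism U Y j \<and> embedding_map (spc U) (spc Y) (pmap j) \<and>
     openin (spc Y) (pmap j ` topspace (spc U)) \<and>
     (\<forall>V. openin (spc Y) V \<and> V \<subseteq> pmap j ` topspace (spc U) \<longrightarrow>
        bij_betw (smap j V) (carrier (sct Y V)) (carrier (sct U (vim U j V))))"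

text \<open>The last clause says that \<open>\<O>\<^sub>Y \<rightarrow> i\<^sub>* \<O>\<^sub>Z\<close> is surjective as a map of sheaves.\<close>

definition closed_immersion ::
  "('p, 'r) rspace \<Rightarrow> ('q, 's) rspace \<Rightarrow> ('p, 'r, 'q, 's) rmor \<Rightarrow> bool" where
  "closed_immersion Z Y i \<longleftrightarrow>
     lrmorphism Z Y i \<and> embedding_map (spc Z) (spc Y) (pmap i) \<and>
     closedin (spc Y) (pmap i ` topspace (spc Z)) \<and>
     (\<forall>V. openin (spc Y) V \<longrightarrow> (\<forall>s\<in>carrier (sct Z (vim Z i V)). \<forall>y\<in>V.
        \<exists>W t. openin (spc Y) W \<and> y \<in> W \<and> W \<subseteq> V \<and> t \<in> carrier (sct Y W) \<and>
              smap i W t = res Z (vim Z i V) (vim Z i W) s))"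

text \<open>The absolute product of schemes is the fibre product over the terminal scheme
  \<open>Spec \<int>\<close>, so separatedness of a scheme is expressed with the diagonal into it.\<close>

definition scheme_product ::
  "'u sch \<Rightarrow> 'u sch \<Rightarrow> 'u sch \<Rightarrow> 'u smor \<Rightarrow> 'u smor \<Rightarrow> bool" where
  "scheme_product X Y P p q \<longleftrightarrow>
     small_scheme P \<and> lrmorphism P X p \<and> lrmorphism P Y q \<and>
     (\<forall>(T :: 'u sch) a b. small_scheme T \<and> lrmorphism T X a \<and> lrmorphism T Y b \<longrightarrow>
        (\<exists>!h. lrmorphism T P h \<and> rcomp T P X p h = a \<and> rcomp T P Y q h = b))"

definition separated_scheme :: "'u sch \<Rightarrow> bool" where
  "separated_scheme X \<longleftrightarrow>
     (\<exists>P p q d. scheme_product X X P p q \<and> lrmorphism X P d \<and>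
        rcomp X P X p d = rident X \<and> rcomp X P X q d = rident X \<and> closed_immersion X P d)"


subsection \<open>Smooth and etale morphisms\<close>

definition affine_ring_map ::
  "('p, 'r) rspace \<Rightarrow> ('p, 'r, 'q, 's) rmor \<Rightarrow> 'p set \<Rightarrow> 'q set \<Rightarrow> 's \<Rightarrow> 'r" where
  "affine_ring_map Y f V U = (\<lambda>s. res Y (vim Y f U) V (smap f U s))"

definition finite_type_morphism ::
  "('p, 'r) rspace \<Rightarrow> ('q, 's) rspace \<Rightarrow> ('p, 'r, 'q, 's) rmor \<Rightarrow> bool" where
  "finite_type_morphism Y X f \<longleftrightarrow>
     (\<forall>x\<in>topspace (spc X). \<exists>U. affine_open X U \<and> x \<in> U \<and>
        (\<exists>\<V>. finite \<V> \<and> \<Union>\<V> = vim Y f U \<and>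
           (\<forall>V\<in>\<V>. affine_open Y V \<and>
              finite_type_ring (sct X U) (sct Y V) (affine_ring_map Y f V U))))"

definition locally_finite_presentation ::
  "('p, 'r) rspace \<Rightarrow> ('q, 's) rspace \<Rightarrow> ('p, 'r, 'q, 's) rmor \<Rightarrow> bool" where
  "locally_finite_presentation Y X f \<longleftrightarrow>
     (\<forall>y\<in>topspace (spc Y). \<exists>U V. affine_open X U \<and> affine_open Y V \<and> y \<in> V \<and>
        V \<subseteq> vim Y f U \<and>
        finite_presentation_ring (sct X U) (sct Y V) (affine_ring_map Y f V U))"

text \<open>Smooth and etale morphisms are defined as in EGA IV, 17.1 and 17.3, by infinitesimal
  lifting along closed immersions into affine schemes with nilpotent ideal.\<close>

definition nilpotent_thickening :: "'u sch \<Rightarrow> 'u sch \<Rightarrow> 'u smor \<Rightarrow> bool" where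
  "nilpotent_thickening T\<^sub>0 T i \<longleftrightarrow>
     small_scheme T\<^sub>0 \<and> small_scheme T \<and> affine_scheme T \<and> closed_immersion T\<^sub>0 T i \<and>
     (\<exists>n :: nat. \<forall>s :: nat \<Rightarrow> 'u.
        (\<forall>k<n. s k \<in> carrier (sct T (topspace (spc T))) \<and>
               smap i (topspace (spc T)) (s k) = \<zero>\<^bsub>sct T\<^sub>0 (topspace (spc T\<^sub>0))\<^esub>) \<longrightarrow>
        finprod (sct T (topspace (spc T))) s {..<n} = \<zero>\<^bsub>sct T (topspace (spc T))\<^esub>)"

definition formally_smooth :: "'u sch \<Rightarrow> 'u sch \<Rightarrow> 'u smor \<Rightarrow> bool" where
  "formally_smooth Y X f \<longleftrightarrow>
     (\<forall>(T\<^sub>0 :: 'u sch) (T :: 'u sch) i a b. nilpotent_thickening T\<^sub>0 T i \<and> lrmorphism T X a \<and> lrmorphism T\<^sub>0 Y b \<and>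
          rcomp T\<^sub>0 Y X f b = rcomp T\<^sub>0 T X a i \<longrightarrow>
        (\<exists>h. lrmorphism T Y h \<and> rcomp T Y X f h = a \<and> rcomp T\<^sub>0 T Y h i = b))"

definition formally_etale :: "'u sch \<Rightarrow> 'u sch \<Rightarrow> 'u smor \<Rightarrow> bool" where
  "formally_etale Y X f \<longleftrightarrow>
     (\<forall>(T\<^sub>0 :: 'u sch) (T :: 'u sch) i a b. nilpotent_thickening T\<^sub>0 T i \<and> lrmorphism T X a \<and> lrmorphism T\<^sub>0 Y b \<and>
          rcomp T\<^sub>0 Y X f b = rcomp T\<^sub>0 T X a i \<longrightarrow>
        (\<exists>!h. lrmorphism T Y h \<and> rcomp T Y X f h = a \<and> rcomp T\<^sub>0 T Y h i = b))"

definition smooth_morphism :: "'u sch \<Rightarrow> 'u sch \<Rightarrow> 'u smor \<Rightarrow> bool" where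
  "smooth_morphism Y X f \<longleftrightarrow>
     lrmorphism Y X f \<and> locally_finite_presentation Y X f \<and> formally_smooth Y X f"

definition etale_morphism :: "'u sch \<Rightarrow> 'u sch \<Rightarrow> 'u smor \<Rightarrow> bool" where
  "etale_morphism Y X f \<longleftrightarrow>
     lrmorphism Y X f \<and> locally_finite_presentation Y X f \<and> formally_etale Y X f"

text \<open>The projection \<open>\<bbbA>\<^sup>1\<^sub>Y \<rightarrow> Y\<close>: the \<open>Y\<close>-scheme with a coordinate \<open>t\<close> such that
  \<open>Y\<close>-morphisms \<open>T \<rightarrow> \<bbbA>\<^sup>1\<^sub>Y\<close> correspond to global functions on \<open>T\<close> via pullback of \<open>t\<close>.\<close>

definition affine_line :: "'u sch \<Rightarrow> 'u sch \<Rightarrow> 'u smor \<Rightarrow> bool" where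
  "affine_line Y P p \<longleftrightarrow>
     small_scheme P \<and> lrmorphism P Y p \<and>
     (\<exists>t\<in>carrier (sct P (topspace (spc P))).
        \<forall>(T :: 'u sch) g s. small_scheme T \<and> lrmorphism T Y g \<and> s \<in> carrier (sct T (topspace (spc T))) \<longrightarrow>
          (\<exists>!h. lrmorphism T P h \<and> rcomp T P Y p h = g \<and> smap h (topspace (spc P)) t = s))"

text \<open>For a morphism of schemes, the field extension \<open>\<kappa>(f v) \<rightarrow> \<kappa>(v)\<close> is an isomorphism as
  soon as it is surjective; the maximal ideal of a local ring consists of its non-units.\<close>

definition trivial_residue_extension :: "'u sch \<Rightarrow> 'u sch \<Rightarrow> 'u smor \<Rightarrow> 'u \<Rightarrow> bool" where
  "trivial_residue_extension V Y f v \<longleftrightarrow>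
     (\<forall>a\<in>carrier (stalk V v). \<exists>b\<in>carrier (stalk Y (pmap f v)).
        a \<ominus>\<^bsub>stalk V v\<^esub> stalk_map V f v b \<notin> Units (stalk V v))"


section \<open>Categories and functors\<close>

record ('o, 'a) cat =
  Ob :: "'o set"
  Ar :: "'a set"
  Dom :: "'a \<Rightarrow> 'o"
  Cod :: "'a \<Rightarrow> 'o"
  Idn :: "'o \<Rightarrow> 'a"
  Cmp :: "'a \<Rightarrow> 'a \<Rightarrow> 'a"   \<comment> \<open>\<open>Cmp C g f\<close> is \<open>g\<close> after \<open>f\<close>\<close>

definition homs :: "('o, 'a) cat \<Rightarrow> 'o \<Rightarrow> 'o \<Rightarrow> 'a set" where
  "homs C A B = {f \<in> Ar C. Dom C f = A \<and> Cod C f = B}"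

text \<open>A functor is the pair of its object map and its arrow map, both extensional.\<close>

type_synonym ('o, 'a, 'p, 'b) fnctr = "('o \<Rightarrow> 'p) \<times> ('a \<Rightarrow> 'b)"

definition is_functor ::
  "('o, 'a) cat \<Rightarrow> ('p, 'b) cat \<Rightarrow> ('o, 'a, 'p, 'b) fnctr \<Rightarrow> bool" where
  "is_functor C D F \<longleftrightarrow>
     fst F \<in> Ob C \<rightarrow>\<^sub>E Ob D \<and> snd F \<in> Ar C \<rightarrow>\<^sub>E Ar D \<and>
     (\<forall>f\<in>Ar C. Dom D (snd F f) = fst F (Dom C f) \<and> Cod D (snd F f) = fst F (Cod C f)) \<and>
     (\<forall>A\<in>Ob C. snd F (Idn C A) = Idn D (fst F A)) \<and>
     (\<forall>f\<in>Ar C. \<forall>g\<in>Ar C. Cod C f = Dom C g \<longrightarrow>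
        snd F (Cmp C g f) = Cmp D (snd F g) (snd F f))"

definition functor_comp ::
  "('o, 'a) cat \<Rightarrow> ('p, 'b, 'q, 'c) fnctr \<Rightarrow> ('o, 'a, 'p, 'b) fnctr \<Rightarrow> ('o, 'a, 'q, 'c) fnctr" where
  "functor_comp C G F = (\<lambda>A\<in>Ob C. fst G (fst F A), \<lambda>f\<in>Ar C. snd G (snd F f))"

definition has_lift :: "('o, 'a) cat \<Rightarrow> 'a \<Rightarrow> 'a \<Rightarrow> bool" where
  "has_lift C i p \<longleftrightarrow>
     (\<forall>a\<in>homs C (Dom C i) (Dom C p). \<forall>b\<in>homs C (Cod C i) (Cod C p).
        Cmp C p a = Cmp C b i \<longrightarrow>
        (\<exists>h\<in>homs C (Cod C i) (Dom C p). Cmp C h i = a \<and> Cmp C p h = b))"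

text \<open>A functorial factorization sends an arrow \<open>f\<close> to \<open>fleft f\<close> followed by \<open>fright f\<close>, and a
  commutative square \<open>(a, b)\<close> from \<open>f\<close> to \<open>g\<close> to the arrow \<open>fmid f g a b\<close> between the middle objects.\<close>

record 'a ffact =
  fleft :: "'a \<Rightarrow> 'a"
  fright :: "'a \<Rightarrow> 'a"
  fmid :: "'a \<Rightarrow> 'a \<Rightarrow> 'a \<Rightarrow> 'a \<Rightarrow> 'a"

definition square :: "('o, 'a) cat \<Rightarrow> 'a \<Rightarrow> 'a \<Rightarrow> 'a \<Rightarrow> 'a \<Rightarrow> bool" where
  "square C f g a b \<longleftrightarrow>
     f \<in> Ar C \<and> g \<in> Ar C \<and> a \<in> homs C (Dom C f) (Dom C g) \<and> b \<in> homs C (Cod C f) (Cod C g) \<and>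
     Cmp C g a = Cmp C b f"

definition functorial_factorization ::
  "('o, 'a) cat \<Rightarrow> 'a set \<Rightarrow> 'a set \<Rightarrow> 'a ffact \<Rightarrow> bool" where
  "functorial_factorization C L R F \<longleftrightarrow>
     (\<forall>f\<in>Ar C. fleft F f \<in> L \<inter> Ar C \<and> fright F f \<in> R \<inter> Ar C \<and>
        Dom C (fleft F f) = Dom C f \<and> Cod C (fleft F f) = Dom C (fright F f) \<and>
        Cod C (fright F f) = Cod C f \<and> Cmp C (fright F f) (fleft F f) = f \<and>
        fmid F f f (Idn C (Dom C f)) (Idn C (Cod C f)) = Idn C (Cod C (fleft F f))) \<and>
     (\<forall>f g a b. square C f g a b \<longrightarrow>
        fmid F f g a b \<in> homs C (Cod C (fleft F f)) (Cod C (fleft F g)) \<and>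
        Cmp C (fmid F f g a b) (fleft F f) = Cmp C (fleft F g) a \<and>
        Cmp C (fright F g) (fmid F f g a b) = Cmp C b (fright F f)) \<and>
     (\<forall>f g h a b c d. square C f g a b \<and> square C g h c d \<longrightarrow>
        fmid F f h (Cmp C c a) (Cmp C d b) = Cmp C (fmid F g h c d) (fmid F f g a b))"


subsection \<open>Localization of a category\<close>

text \<open>The Gabriel--Zisman localization \<open>C[W\<^sup>-\<^sup>1]\<close>: it has the objects of \<open>C\<close>, and its arrows are
  zigzags of arrows of \<open>C\<close>, those against the direction belonging to \<open>W\<close>, modulo the congruence
  generated by the identities and composites of \<open>C\<close> and by inverting \<open>W\<close>.\<close>

datatype 'a zig = Fwd 'a | Bwd 'a

inductive zpath :: "('o, 'a) cat \<Rightarrow> 'a set \<Rightarrow> 'o \<Rightarrow> 'a zig list \<Rightarrow> 'o \<Rightarrow> bool"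
  for C :: "('o, 'a) cat" and W :: "'a set" where
  "A \<in> Ob C \<Longrightarrow> zpath C W A [] A"
| "f \<in> homs C A B \<Longrightarrow> zpath C W B xs D \<Longrightarrow> zpath C W A (Fwd f # xs) D"
| "w \<in> W \<Longrightarrow> w \<in> homs C B A \<Longrightarrow> zpath C W B xs D \<Longrightarrow> zpath C W A (Bwd w # xs) D"

inductive zeq :: "('o, 'a) cat \<Rightarrow> 'a set \<Rightarrow> 'o \<Rightarrow> 'o \<Rightarrow> 'a zig list \<Rightarrow> 'a zig list \<Rightarrow> bool"
  for C :: "('o, 'a) cat" and W :: "'a set" where
  "zpath C W A xs B \<Longrightarrow> zeq C W A B xs xs"
| "zeq C W A B xs ys \<Longrightarrow> zeq C W A B ys xs"
| "zeq C W A B xs ys \<Longrightarrow> zeq C W A B ys zs \<Longrightarrow> zeq C W A B xs zs"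
| "zpath C W A us A' \<Longrightarrow> zeq C W A' B' xs ys \<Longrightarrow> zpath C W B' vs B \<Longrightarrow>
     zeq C W A B (us @ xs @ vs) (us @ ys @ vs)"
| "A \<in> Ob C \<Longrightarrow> zeq C W A A [Fwd (Idn C A)] []"
| "f \<in> homs C A B \<Longrightarrow> g \<in> homs C B D \<Longrightarrow> zeq C W A D [Fwd f, Fwd g] [Fwd (Cmp C g f)]"
| "w \<in> W \<Longrightarrow> w \<in> homs C A B \<Longrightarrow> zeq C W A A [Fwd w, Bwd w] []"
| "w \<in> W \<Longrightarrow> w \<in> homs C A B \<Longrightarrow> zeq C W B B [Bwd w, Fwd w] []"

definition localization ::
  "('o, 'a) cat \<Rightarrow> 'a set \<Rightarrow> ('o, 'o \<times> 'a zig list set \<times> 'o) cat" where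
  "localization C W =
     \<lparr>Ob = Ob C,
      Ar = {(A, {ys. zeq C W A B xs ys}, B) | A xs B. zpath C W A xs B},
      Dom = fst,
      Cod = (\<lambda>f. snd (snd f)),
      Idn = (\<lambda>A. (A, {ys. zeq C W A A [] ys}, A)),
      Cmp = (\<lambda>(B', d, D) (A, c, B). (A, {zs. \<exists>xs\<in>c. \<exists>ys\<in>d. zeq C W A D (xs @ ys) zs}, D))\<rparr>"

definition loc_functor ::
  "('o, 'a) cat \<Rightarrow> 'a set \<Rightarrow> ('o, 'a, 'o, 'o \<times> 'a zig list set \<times> 'o) fnctr" where
  "loc_functor C W =
     (\<lambda>A\<in>Ob C. A,
      \<lambda>f\<in>Ar C. (Dom C f, {ys. zeq C W (Dom C f) (Cod C f) [Fwd f] ys}, Cod C f))"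


section \<open>Simplicial sets\<close>

definition Dmap :: "nat \<Rightarrow> nat \<Rightarrow> (nat \<Rightarrow> nat) set" where
  "Dmap m n = {\<theta> \<in> {..m} \<rightarrow>\<^sub>E {..n}. mono_on {..m} \<theta>}"

text \<open>\<open>act K m n \<theta>\<close> is the operator \<open>K\<^sub>n \<rightarrow> K\<^sub>m\<close> of \<open>\<theta> : [m] \<rightarrow> [n]\<close>.\<close>

record 'a sset =
  cells :: "nat \<Rightarrow> 'a set"
  act :: "nat \<Rightarrow> nat \<Rightarrow> (nat \<Rightarrow> nat) \<Rightarrow> 'a \<Rightarrow> 'a"

definition is_sset :: "'a sset \<Rightarrow> bool" where
  "is_sset K \<longleftrightarrow>
     (\<forall>m n. \<forall>\<theta>\<in>Dmap m n. \<forall>x\<in>cells K n. act K m n \<theta> x \<in> cells K m) \<and>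
     (\<forall>n. \<forall>x\<in>cells K n. act K n n (\<lambda>i\<in>{..n}. i) x = x) \<and>
     (\<forall>l m n. \<forall>\<eta>\<in>Dmap l m. \<forall>\<theta>\<in>Dmap m n. \<forall>x\<in>cells K n.
        act K l m \<eta> (act K m n \<theta> x) = act K l n (compose {..l} \<theta> \<eta>) x)"

definition sset_map :: "'a sset \<Rightarrow> 'b sset \<Rightarrow> (nat \<Rightarrow> 'a \<Rightarrow> 'b) \<Rightarrow> bool" where
  "sset_map K L f \<longleftrightarrow>
     (\<forall>n. \<forall>x\<in>cells K n. f n x \<in> cells L n) \<and>
     (\<forall>m n. \<forall>\<theta>\<in>Dmap m n. \<forall>x\<in>cells K n. f m (act K m n \<theta> x) = act L m n \<theta> (f n x))"

definition sset_prod :: "'a sset \<Rightarrow> 'b sset \<Rightarrow> ('a \<times> 'b) sset" where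
  "sset_prod K L =
     \<lparr>cells = (\<lambda>n. cells K n \<times> cells L n),
      act = (\<lambda>m n \<theta> (x, y). (act K m n \<theta> x, act L m n \<theta> y))\<rparr>"

definition simplex :: "nat \<Rightarrow> (nat \<Rightarrow> nat) sset" where
  "simplex n = \<lparr>cells = (\<lambda>m. Dmap m n), act = (\<lambda>l m \<eta> \<theta>. compose {..l} \<theta> \<eta>)\<rparr>"

definition horn :: "nat \<Rightarrow> nat \<Rightarrow> (nat \<Rightarrow> nat) sset" where
  "horn n k =
     (simplex n)\<lparr>cells := (\<lambda>m. {\<theta> \<in> Dmap m n. \<not> {..n} - {k} \<subseteq> \<theta> ` {..m}})\<rparr>"

definition kan_complex :: "'a sset \<Rightarrow> bool" where
  "kan_complex Z \<longleftrightarrow>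
     is_sset Z \<and>
     (\<forall>n\<ge>1. \<forall>k\<le>n. \<forall>f. sset_map (horn n k) Z f \<longrightarrow>
        (\<exists>g. sset_map (simplex n) Z g \<and> (\<forall>m. \<forall>\<theta>\<in>cells (horn n k) m. g m \<theta> = f m \<theta>)))"

definition sset_homotopic ::
  "'a sset \<Rightarrow> 'b sset \<Rightarrow> (nat \<Rightarrow> 'a \<Rightarrow> 'b) \<Rightarrow> (nat \<Rightarrow> 'a \<Rightarrow> 'b) \<Rightarrow> bool" where
  "sset_homotopic K L f g \<longleftrightarrow>
     (\<exists>h. sset_map (sset_prod K (simplex 1)) L h \<and>
        (\<forall>n. \<forall>x\<in>cells K n. h n (x, \<lambda>i\<in>{..n}. 0) = f n x \<and> h n (x, \<lambda>i\<in>{..n}. 1) = g n x))"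

text \<open>Weak homotopy equivalences: bijectivity of \<open>\<pi>\<^sub>0 Fun(L, Z) \<rightarrow> \<pi>\<^sub>0 Fun(K, Z)\<close> for all Kan
  complexes \<open>Z\<close>. Homotopy of maps into a Kan complex is an equivalence relation. Test objects
  \<open>Z\<close> over the type of \<open>K\<close> and \<open>L\<close> suffice if that type is infinite, since \<open>K\<close> and \<open>L\<close> then have
  fibrant replacements over it; all types at which this is used below are infinite.\<close>

definition sset_weq :: "'a sset \<Rightarrow> 'a sset \<Rightarrow> (nat \<Rightarrow> 'a \<Rightarrow> 'a) \<Rightarrow> bool" where
  "sset_weq K L f \<longleftrightarrow>
     is_sset K \<and> is_sset L \<and> sset_map K L f \<and>
     (\<forall>Z :: 'a sset. kan_complex Z \<longrightarrow>
        (\<forall>g. sset_map K Z g \<longrightarrow>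
           (\<exists>h. sset_map L Z h \<and> sset_homotopic K Z (\<lambda>n x. h n (f n x)) g)) \<and>
        (\<forall>h h'. sset_map L Z h \<and> sset_map L Z h' \<and>
                sset_homotopic K Z (\<lambda>n x. h n (f n x)) (\<lambda>n x. h' n (f n x)) \<longrightarrow>
           sset_homotopic L Z h h'))"


section \<open>Pointed simplicial presheaves\<close>

text \<open>Two records that differ only outside the objects, arrows and simplices in question are distinct
  but isomorphic presheaves; the maps between presheaves are extensional.\<close>

record ('o, 'a, 'v) spre =
  sec :: "'o \<Rightarrow> 'v sset"
  rst :: "'a \<Rightarrow> nat \<Rightarrow> 'v \<Rightarrow> 'v"
  bpt :: "'o \<Rightarrow> nat \<Rightarrow> 'v"

definition pointed_spre :: "'u itself \<Rightarrow> ('o, 'a) cat \<Rightarrow> ('o, 'a, 'v) spre \<Rightarrow> bool" where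
  "pointed_spre u C A \<longleftrightarrow>
     (\<forall>Y\<in>Ob C. is_sset (sec A Y) \<and> (\<forall>n. small u (cells (sec A Y) n))) \<and>
     (\<forall>f\<in>Ar C. sset_map (sec A (Cod C f)) (sec A (Dom C f)) (rst A f)) \<and>
     (\<forall>Y\<in>Ob C. \<forall>n. \<forall>x\<in>cells (sec A Y) n. rst A (Idn C Y) n x = x) \<and>
     (\<forall>f\<in>Ar C. \<forall>g\<in>Ar C. Cod C f = Dom C g \<longrightarrow>
        (\<forall>n. \<forall>x\<in>cells (sec A (Cod C g)) n. rst A (Cmp C g f) n x = rst A f n (rst A g n x))) \<and>
     (\<forall>Y\<in>Ob C. \<forall>n. bpt A Y n \<in> cells (sec A Y) n) \<and>
     (\<forall>Y\<in>Ob C. \<forall>m n. \<forall>\<theta>\<in>Dmap m n. act (sec A Y) m n \<theta> (bpt A Y n) = bpt A Y m) \<and>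
     (\<forall>f\<in>Ar C. \<forall>n. rst A f n (bpt A (Cod C f) n) = bpt A (Dom C f) n)"

type_synonym ('o, 'a, 'v) smap_arr =
  "('o, 'a, 'v) spre \<times> ('o \<Rightarrow> nat \<Rightarrow> 'v \<Rightarrow> 'v) \<times> ('o, 'a, 'v) spre"

definition spre_map ::
  "('o, 'a) cat \<Rightarrow> ('o, 'a, 'v) spre \<Rightarrow> ('o \<Rightarrow> nat \<Rightarrow> 'v \<Rightarrow> 'v) \<Rightarrow> ('o, 'a, 'v) spre \<Rightarrow> bool" where
  "spre_map C A \<phi> B \<longleftrightarrow>
     (\<forall>Y\<in>Ob C. sset_map (sec A Y) (sec B Y) (\<phi> Y)) \<and>
     (\<forall>f\<in>Ar C. \<forall>n. \<forall>x\<in>cells (sec A (Cod C f)) n.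
        \<phi> (Dom C f) n (rst A f n x) = rst B f n (\<phi> (Cod C f) n x)) \<and>
     (\<forall>Y\<in>Ob C. \<forall>n. \<phi> Y n (bpt A Y n) = bpt B Y n) \<and>
     (\<forall>Y n x. \<not> (Y \<in> Ob C \<and> x \<in> cells (sec A Y) n) \<longrightarrow> \<phi> Y n x = undefined)"

definition spre_ext ::
  "('o, 'a) cat \<Rightarrow> ('o, 'a, 'v) spre \<Rightarrow> ('o \<Rightarrow> nat \<Rightarrow> 'v \<Rightarrow> 'v) \<Rightarrow> 'o \<Rightarrow> nat \<Rightarrow> 'v \<Rightarrow> 'v" where
  "spre_ext C A \<phi> = (\<lambda>Y n x. if Y \<in> Ob C \<and> x \<in> cells (sec A Y) n then \<phi> Y n x else undefined)"

definition sPre ::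
  "'u itself \<Rightarrow> ('o, 'a) cat \<Rightarrow> (('o, 'a, 'v) spre, ('o, 'a, 'v) smap_arr) cat" where
  "sPre u C =
     \<lparr>Ob = {A. pointed_spre u C A},
      Ar = {(A, \<phi>, B). pointed_spre u C A \<and> pointed_spre u C B \<and> spre_map C A \<phi> B},
      Dom = fst,
      Cod = (\<lambda>f. snd (snd f)),
      Idn = (\<lambda>A. (A, spre_ext C A (\<lambda>Y n x. x), A)),
      Cmp = (\<lambda>(B', \<psi>, D) (A, \<phi>, B). (A, spre_ext C A (\<lambda>Y n x. \<psi> Y n (\<phi> Y n x)), D))\<rparr>"

definition spre_monos ::
  "'u itself \<Rightarrow> ('o, 'a) cat \<Rightarrow> ('o, 'a, 'v) smap_arr set" where
  "spre_monos u C =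
     {(A, \<phi>, B) \<in> Ar (sPre u C). \<forall>Y\<in>Ob C. \<forall>n. inj_on (\<phi> Y n) (cells (sec A Y) n)}"

text \<open>From here on the values are sets over the type \<open>'a option\<close>, where \<open>'a\<close> is the type of arrows
  of the site. In this way \<open>Y\<^sub>+\<close> needs no encoding: \<open>None\<close> is the added base point.\<close>

type_synonym ('o, 'a) ppre = "('o, 'a, 'a option) spre"
type_synonym ('o, 'a) parr = "('o, 'a, 'a option) smap_arr"

definition pt_spre :: "('o, 'a) ppre" where
  "pt_spre = \<lparr>sec = (\<lambda>Y. \<lparr>cells = (\<lambda>n. {None}), act = (\<lambda>m n \<theta> x. x)\<rparr>),
              rst = (\<lambda>f n x. x), bpt = (\<lambda>Y n. None)\<rparr>"

definition to_pt :: "('o, 'a) cat \<Rightarrow> ('o, 'a) ppre \<Rightarrow> ('o, 'a) parr" where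
  "to_pt C A = (A, spre_ext C A (\<lambda>Y n x. None), pt_spre)"

definition rep_plus :: "('o, 'a) cat \<Rightarrow> 'o \<Rightarrow> ('o, 'a) ppre" where
  "rep_plus C Y =
     \<lparr>sec = (\<lambda>V. \<lparr>cells = (\<lambda>n. insert None (Some ` homs C V Y)), act = (\<lambda>m n \<theta> x. x)\<rparr>),
      rst = (\<lambda>f n. map_option (\<lambda>h. Cmp C h f)),
      bpt = (\<lambda>V n. None)\<rparr>"

definition rep_plus_map :: "('o, 'a) cat \<Rightarrow> 'a \<Rightarrow> ('o, 'a) parr" where
  "rep_plus_map C j =
     (rep_plus C (Dom C j),
      spre_ext C (rep_plus C (Dom C j)) (\<lambda>V n. map_option (Cmp C j)),
      rep_plus C (Cod C j))"

text \<open>The simplicial mapping space: its \<open>n\<close>-simplices are the pointed maps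
  \<open>A \<and> \<Delta>[n]\<^sub>+ \<rightarrow> B\<close>, written as maps \<open>A \<times> \<Delta>[n] \<rightarrow> B\<close> constant on \<open>* \<times> \<Delta>[n]\<close>.\<close>

definition map_space ::
  "('o, 'a) cat \<Rightarrow> ('o, 'a, 'v) spre \<Rightarrow> ('o, 'a, 'v) spre \<Rightarrow>
   ('o \<Rightarrow> nat \<Rightarrow> 'v \<times> (nat \<Rightarrow> nat) \<Rightarrow> 'v) sset" where
  "map_space C A B =
     \<lparr>cells = (\<lambda>n. {\<phi>.
        (\<forall>Y\<in>Ob C. sset_map (sset_prod (sec A Y) (simplex n)) (sec B Y) (\<phi> Y)) \<and>
        (\<forall>f\<in>Ar C. \<forall>k. \<forall>x\<in>cells (sec A (Cod C f)) k. \<forall>\<eta>\<in>Dmap k n.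
           \<phi> (Dom C f) k (rst A f k x, \<eta>) = rst B f k (\<phi> (Cod C f) k (x, \<eta>))) \<and>
        (\<forall>Y\<in>Ob C. \<forall>k. \<forall>\<eta>\<in>Dmap k n. \<phi> Y k (bpt A Y k, \<eta>) = bpt B Y k) \<and>
        (\<forall>Y k x \<eta>. \<not> (Y \<in> Ob C \<and> x \<in> cells (sec A Y) k \<and> \<eta> \<in> Dmap k n) \<longrightarrow>
           \<phi> Y k (x, \<eta>) = undefined)}),
      act = (\<lambda>m n \<theta> \<phi> Y k (x, \<eta>).
        if Y \<in> Ob C \<and> x \<in> cells (sec A Y) k \<and> \<eta> \<in> Dmap k m
        then \<phi> Y k (x, compose {..k} \<theta> \<eta>) else undefined)\<rparr>"

definition map_space_pre ::
  "('o, 'a) cat \<Rightarrow> ('o, 'a, 'v) smap_arr \<Rightarrow> nat \<Rightarrow>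
   ('o \<Rightarrow> nat \<Rightarrow> 'v \<times> (nat \<Rightarrow> nat) \<Rightarrow> 'v) \<Rightarrow> 'o \<Rightarrow> nat \<Rightarrow> 'v \<times> (nat \<Rightarrow> nat) \<Rightarrow> 'v" where
  "map_space_pre C = (\<lambda>(A, \<phi>, B) n \<psi> Y k (x, \<eta>).
     if Y \<in> Ob C \<and> x \<in> cells (sec A Y) k \<and> \<eta> \<in> Dmap k n
     then \<psi> Y k (\<phi> Y k x, \<eta>) else undefined)"

definition map_space_weq ::
  "('o, 'a) cat \<Rightarrow> ('o, 'a, 'v) smap_arr \<Rightarrow> ('o, 'a, 'v) spre \<Rightarrow> bool" where
  "map_space_weq C f Z \<longleftrightarrow>
     sset_weq (map_space C (snd (snd f)) Z) (map_space C (fst f) Z) (map_space_pre C f)"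


subsection \<open>Left Bousfield localization\<close>

text \<open>Model structures on pointed simplicial presheaves with the monomorphisms as cofibrations are
  given by their class \<open>W\<close> of weak equivalences; fibrations are the maps with the right lifting
  property against the trivial cofibrations. All objects are cofibrant and all these structures are
  simplicial, so the homotopy function complex into a fibrant object is the simplicial mapping
  space.\<close>

definition triv_cofs ::
  "'u itself \<Rightarrow> ('o, 'a) cat \<Rightarrow> ('o, 'a) parr set \<Rightarrow> ('o, 'a) parr set" where
  "triv_cofs u C W = spre_monos u C \<inter> W"

definition fibs ::
  "'u itself \<Rightarrow> ('o, 'a) cat \<Rightarrow> ('o, 'a) parr set \<Rightarrow> ('o, 'a) parr set" where
  "fibs u C W = {p \<in> Ar (sPre u C). \<forall>i\<in>triv_cofs u C W. has_lift (sPre u C) i p}"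

definition local_object ::
  "'u itself \<Rightarrow> ('o, 'a) cat \<Rightarrow> ('o, 'a) parr set \<Rightarrow> ('o, 'a) parr set \<Rightarrow> ('o, 'a) ppre \<Rightarrow> bool" where
  "local_object u C W S Z \<longleftrightarrow>
     Z \<in> Ob (sPre u C) \<and> to_pt C Z \<in> fibs u C W \<and> (\<forall>f\<in>S. map_space_weq C f Z)"

definition bousfield_weqs ::
  "'u itself \<Rightarrow> ('o, 'a) cat \<Rightarrow> ('o, 'a) parr set \<Rightarrow> ('o, 'a) parr set \<Rightarrow> ('o, 'a) parr set" where
  "bousfield_weqs u C W S =
     {f \<in> Ar (sPre u C). \<forall>Z. local_object u C W S Z \<longrightarrow> map_space_weq C f Z}"


section \<open>The Nisnevich site of smooth schemes\<close>

type_synonym 'u smobj = "'u sch \<times> 'u smor"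
type_synonym 'u smarr = "'u smobj \<times> 'u smor \<times> 'u smobj"

definition Sm_ob :: "'u sch \<Rightarrow> 'u smobj set" where
  "Sm_ob X = {(Y, p). small_scheme Y \<and> smooth_morphism Y X p \<and> finite_type_morphism Y X p}"

definition Sm :: "'u sch \<Rightarrow> ('u smobj, 'u smarr) cat" where
  "Sm X =
     \<lparr>Ob = Sm_ob X,
      Ar = {((V, p), h, (Y, q)) | V p h Y q.
              (V, p) \<in> Sm_ob X \<and> (Y, q) \<in> Sm_ob X \<and> lrmorphism V Y h \<and> rcomp V Y X q h = p},
      Dom = fst,
      Cod = (\<lambda>f. snd (snd f)),
      Idn = (\<lambda>(Y, p). ((Y, p), rident Y, (Y, p))),
      Cmp = (\<lambda>(Y', g, Z) (V, f, Y). (V, rcomp (fst V) (fst Y) (fst Z) g f, Z))\<rparr>"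

text \<open>Nisnevich neighbourhoods of \<open>y\<close> in \<open>Y\<close>: pairs of an etale \<open>e : V \<rightarrow> Y\<close> and a point \<open>v\<close> of \<open>V\<close>
  over \<open>y\<close> with trivial residue field extension. The corresponding stalks, for all \<open>Y\<close> in
  \<open>Sm\<^sub>X\<close> and \<open>y\<close> in \<open>Y\<close>, form a conservative family of points of the Nisnevich topology, and a map
  of simplicial presheaves is a local weak equivalence iff it is a weak equivalence on all of them.\<close>

definition nis_nbhds :: "'u sch \<Rightarrow> 'u smobj \<Rightarrow> 'u \<Rightarrow> ('u smarr \<times> 'u) set" where
  "nis_nbhds X Y y =
     {((V, h, Y'), v) | V h Y' v. (V, h, Y') \<in> Ar (Sm X) \<and> Y' = Y \<and>
        etale_morphism (fst V) (fst Y) h \<and> v \<in> topspace (spc (fst V)) \<and> pmap h v = y \<and>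
        trivial_residue_extension (fst V) (fst Y) h v}"

text \<open>The stalk is the colimit of the sections over all Nisnevich neighbourhoods.\<close>

definition nis_step ::
  "'u sch \<Rightarrow> ('u smobj, 'u smarr, 'v) spre \<Rightarrow> 'u smobj \<Rightarrow> 'u \<Rightarrow> nat \<Rightarrow>
   ('u smarr \<times> 'u) \<times> 'v \<Rightarrow> ('u smarr \<times> 'u) \<times> 'v \<Rightarrow> bool" where
  "nis_step X A Y y n = (\<lambda>((e, v), a) ((e', v'), a').
     (e, v) \<in> nis_nbhds X Y y \<and> (e', v') \<in> nis_nbhds X Y y \<and>
     a \<in> cells (sec A (Dom (Sm X) e)) n \<and>
     (\<exists>g\<in>homs (Sm X) (Dom (Sm X) e') (Dom (Sm X) e).
        Cmp (Sm X) e g = e' \<and> pmap (fst (snd g)) v' = v \<and> a' = rst A g n a))"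

definition nis_germ ::
  "'u sch \<Rightarrow> ('u smobj, 'u smarr, 'v) spre \<Rightarrow> 'u smobj \<Rightarrow> 'u \<Rightarrow> nat \<Rightarrow>
   ('u smarr \<times> 'u) \<times> 'v \<Rightarrow> (('u smarr \<times> 'u) \<times> 'v) set" where
  "nis_germ X A Y y n z = {z'. equivclp (nis_step X A Y y n) z z'}"

definition nis_stalk ::
  "'u sch \<Rightarrow> ('u smobj, 'u smarr, 'v) spre \<Rightarrow> 'u smobj \<Rightarrow> 'u \<Rightarrow>
   (('u smarr \<times> 'u) \<times> 'v) set sset" where
  "nis_stalk X A Y y =
     \<lparr>cells = (\<lambda>n. {nis_germ X A Y y n (N, a) | N a.
                      N \<in> nis_nbhds X Y y \<and> a \<in> cells (sec A (Dom (Sm X) (fst N))) n}),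
      act = (\<lambda>m n \<theta> c. \<Union>(N, a)\<in>c.
               nis_germ X A Y y m (N, act (sec A (Dom (Sm X) (fst N))) m n \<theta> a))\<rparr>"

definition nis_stalk_map ::
  "'u sch \<Rightarrow> ('u smobj, 'u smarr, 'v) smap_arr \<Rightarrow> 'u smobj \<Rightarrow> 'u \<Rightarrow> nat \<Rightarrow>
   (('u smarr \<times> 'u) \<times> 'v) set \<Rightarrow> (('u smarr \<times> 'u) \<times> 'v) set" where
  "nis_stalk_map X = (\<lambda>(A, \<phi>, B) Y y n c.
     \<Union>(N, a)\<in>c. nis_germ X B Y y n (N, \<phi> (Dom (Sm X) (fst N)) n a))"


section \<open>Motivic model structure\<close>

type_synonym 'u mob = "('u smobj, 'u smarr) ppre"
type_synonym 'u mar = "('u smobj, 'u smarr) parr"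

definition Mot :: "'u sch \<Rightarrow> ('u mob, 'u mar) cat" where
  "Mot X = sPre TYPE('u) (Sm X)"

definition nis_local_weqs :: "'u sch \<Rightarrow> 'u mar set" where
  "nis_local_weqs X =
     {f \<in> Ar (Mot X). \<forall>Y\<in>Ob (Sm X). \<forall>y\<in>topspace (spc (fst Y)).
        sset_weq (nis_stalk X (fst f) Y y) (nis_stalk X (snd (snd f)) Y y) (nis_stalk_map X f Y y)}"

text \<open>The motivic structure is the localization of the injective local one at all projections
  \<open>(\<bbbA>\<^sup>1\<^sub>Y)\<^sub>+ \<rightarrow> Y\<^sub>+\<close>. Localizing pointed simplicial presheaves in this way agrees with the structure
  whose weak equivalences are detected after forgetting base points.\<close>

definition affine_line_maps :: "'u sch \<Rightarrow> 'u mar set" where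
  "affine_line_maps X =
     {rep_plus_map (Sm X) (P, h, Y) | P h Y.
        (P, h, Y) \<in> Ar (Sm X) \<and> affine_line (fst Y) (fst P) h}"

definition motivic_weqs :: "'u sch \<Rightarrow> 'u mar set" where
  "motivic_weqs X = bousfield_weqs TYPE('u) (Sm X) (nis_local_weqs X) (affine_line_maps X)"

definition HMot :: "'u sch \<Rightarrow> ('u mob, 'u mob \<times> 'u mar zig list set \<times> 'u mob) cat" where
  "HMot X = localization (Mot X) (motivic_weqs X)"

definition Ho :: "'u sch \<Rightarrow> ('u mob, 'u mar, 'u mob, 'u mob \<times> 'u mar zig list set \<times> 'u mob) fnctr" where
  "Ho X = loc_functor (Mot X) (motivic_weqs X)"

text \<open>\<open>U\<close> is only determined up to isomorphism as an open subscheme of \<open>Y\<close>, so \<open>WB\<close> consists of the maps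
  coming from all open immersions \<open>j\<close>. The closed complement, with its reduced structure, enters
  through a closed immersion \<open>i\<close>.\<close>

definition WB :: "'u sch \<Rightarrow> nat \<Rightarrow> 'u mar set" where
  "WB X n =
     {rep_plus_map (Sm X) (U, j, (Y, p)) | U j Y p.
        (U, j, (Y, p)) \<in> Ar (Sm X) \<and> open_immersion (fst U) Y j \<and> irreducible_scheme Y \<and>
        (\<exists>Z i. reduced_scheme Z \<and> closed_immersion Z Y i \<and>
               pmap i ` topspace (spc Z) = topspace (spc Y) - pmap j ` topspace (spc (fst U)) \<and>
               (Z, rcomp Z Y X p i) \<in> Ob (Sm X)) \<and>
        enat (n + 1) \<le> codim Y (topspace (spc Y) - pmap j ` topspace (spc (fst U)))}"

definition WB_weqs :: "'u sch \<Rightarrow> nat \<Rightarrow> 'u mar set" where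
  "WB_weqs X n = bousfield_weqs TYPE('u) (Sm X) (motivic_weqs X) (WB X n)"

definition WB_triv_cofs :: "'u sch \<Rightarrow> nat \<Rightarrow> 'u mar set" where
  "WB_triv_cofs X n = triv_cofs TYPE('u) (Sm X) (WB_weqs X n)"

definition WB_fibs :: "'u sch \<Rightarrow> nat \<Rightarrow> 'u mar set" where
  "WB_fibs X n = fibs TYPE('u) (Sm X) (WB_weqs X n)"


section \<open>The tower\<close>

text \<open>\<open>F n\<close> is the factorization in \<open>WB\<^sub>n\<M>\<close>. The recursion is started at the auxiliary
  value \<open>\<tau>\<^sub>0 A = *\<close>, so that the factorization of \<open>A \<rightarrow> *\<close> in \<open>WB\<^sub>0\<M>\<close> is the step from \<open>0\<close> to \<open>1\<close>.\<close>

primrec tau_le :: "'u sch \<Rightarrow> (nat \<Rightarrow> 'u mar ffact) \<Rightarrow> nat \<Rightarrow> 'u mob \<Rightarrow> 'u mar" where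
  "tau_le X F 0 A = to_pt (Sm X) A"
| "tau_le X F (Suc n) A = fleft (F n) (tau_le X F n A)"

definition tau_ob :: "'u sch \<Rightarrow> (nat \<Rightarrow> 'u mar ffact) \<Rightarrow> nat \<Rightarrow> 'u mob \<Rightarrow> 'u mob" where
  "tau_ob X F n A = Cod (Mot X) (tau_le X F n A)"

primrec tau_ar :: "'u sch \<Rightarrow> (nat \<Rightarrow> 'u mar ffact) \<Rightarrow> nat \<Rightarrow> 'u mar \<Rightarrow> 'u mar" where
  "tau_ar X F 0 a = Idn (Mot X) pt_spre"
| "tau_ar X F (Suc n) a =
     fmid (F n) (tau_le X F n (Dom (Mot X) a)) (tau_le X F n (Cod (Mot X) a)) a (tau_ar X F n a)"

definition tau :: "'u sch \<Rightarrow> (nat \<Rightarrow> 'u mar ffact) \<Rightarrow> nat \<Rightarrow> ('u mob, 'u mar, 'u mob, 'u mar) fnctr" where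
  "tau X F n = (\<lambda>A\<in>Ob (Mot X). tau_ob X F n A, \<lambda>a\<in>Ar (Mot X). tau_ar X F n a)"

definition nu :: "'u sch \<Rightarrow> (nat \<Rightarrow> 'u mar ffact) \<Rightarrow> nat \<Rightarrow> 'u mob \<Rightarrow> 'u mar" where
  "nu X F n A = fright (F n) (tau_le X F n A)"

text \<open>The pullback of a map along the base point of its target.\<close>

definition fibre :: "('o, 'a, 'v) smap_arr \<Rightarrow> ('o, 'a, 'v) spre" where
  "fibre = (\<lambda>(E, \<phi>, B).
     E\<lparr>sec := (\<lambda>Y. (sec E Y)\<lparr>cells := (\<lambda>n. {x \<in> cells (sec E Y) n. \<phi> Y n x = bpt B Y n})\<rparr>)\<rparr>)"

definition s_tilde ::
  "'u sch \<Rightarrow> (nat \<Rightarrow> 'u mar ffact) \<Rightarrow> nat \<Rightarrow> ('u mob, 'u mar, 'u mob, 'u mar) fnctr" where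
  "s_tilde X F n =
     (\<lambda>A\<in>Ob (Mot X). fibre (nu X F n A),
      \<lambda>a\<in>Ar (Mot X).
        (fibre (nu X F n (Dom (Mot X) a)),
         spre_ext (Sm X) (fibre (nu X F n (Dom (Mot X) a))) (fst (snd (tau_ar X F (Suc n) a))),
         fibre (nu X F n (Cod (Mot X) a))))"

end

theory Submission
  imports Defs "HOL-Library.Countable"
begin

text \<open>
  A class of maps is detected by tests if its members are the maps \<open>A \<rightarrow> B\<close> that induce homotopy equivalences
  of certain Kan complexes of maps out of \<open>B\<close> and out of \<open>A\<close>. Local weak equivalences are detected by maps out
  of the stalks. If a class is detected by tests, then the mapping spaces into its fibrant objects are Kan
  complexes and turn its members into homotopy equivalences, so its left Bousfield localizations are
  detected by tests as well.

  Let two \<open>WB\<^sub>n\<close>-fibrations between \<open>WB\<^sub>n\<close>-fibrant objects be joined by a square of \<open>WB\<^sub>n\<close>-equivalences. Lifting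
  against the inclusions of the sources into the mapping cylinders gives a square in the other
  direction and a homotopy from the composite to the identity that restricts to the fibres. The same
  applied to the new square shows that both squares and the maps of fibres are homotopy equivalences, hence
  belong to every class detected by tests, in particular to the motivic weak equivalences. By induction
  along the tower, \<open>\<tau>\<^sub>n\<close> and \<open>s\<^sub>n\<close> preserve motivic weak equivalences, so they act on the zigzags that form the
  arrows of the homotopy category. Uniqueness holds because the image of \<open>\<M>\<close> and the inverses of weak
  equivalences generate it.
\<close>

section \<open>Simplicial sets\<close>

text \<open>No model category theorem is invoked: factorizations enter only through
  \<open>F\<close>, and everything else is lifting and horn filling. The decisive point is that a
  homotopy equivalence of presheaves is a weak equivalence for every class detected by tests. Two
  out of three alone would stop short: a motivic equivalence induces on the stages of the tower a
  priori only \<open>WB\<close> equivalences, and it is fibrancy that turns these into homotopy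
  equivalences, which do not remember the class used to construct them. Three obstacles shape the
  details. Presheaves take values in a fixed type, so tensors and mapping cylinders have to be coded
  back into it by an injection \<open>enc\<close>. Weak equivalences of simplicial sets are tested
  on Kan complexes over one type only, so the passage to all Kan complexes needs a fibrant
  replacement whose simplices can be injected into that type. Finally, germs of base points in a
  stalk may be distinct, so maps out of a stalk are prescribed on a subcomplex instead of at a
  point, and lifting has to be done relative to it.\<close>

abbreviation idD :: "nat => nat => nat" where "idD n \<equiv> (\<lambda>i\<in>{..n}. i)"
abbreviation cD :: "nat => nat => nat => nat" where "cD c m \<equiv> (\<lambda>i\<in>{..m}. c)"
abbreviation compD :: "nat => (nat => nat) => (nat => nat) => nat => nat" where
  "compD l \<mu> \<eta> \<equiv> compose {..l} \<mu> \<eta>"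

lemma Dmap_iff:
  "\<mu> \<in> Dmap m n \<longleftrightarrow>
     (\<forall>i\<le>m. \<mu> i \<le> n) \<and> (\<forall>i>m. \<mu> i = undefined) \<and> (\<forall>i j. i \<le> j \<longrightarrow> j \<le> m \<longrightarrow> \<mu> i \<le> \<mu> j)"
  by (auto simp: Dmap_def PiE_def Pi_def extensional_def mono_on_def not_le)

lemma DmapI:
  "(\<And>i. i \<le> m ==> \<mu> i \<le> n) ==> (\<And>i. i > m ==> \<mu> i = undefined) ==>
   (\<And>i j. i \<le> j ==> j \<le> m ==> \<mu> i \<le> \<mu> j) ==> \<mu> \<in> Dmap m n"
  by (auto simp: Dmap_iff)

lemma Dmap_le: "\<mu> \<in> Dmap m n ==> i \<le> m ==> \<mu> i \<le> n"
  by (auto simp: Dmap_iff)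

lemma Dmap_mono: "\<mu> \<in> Dmap m n ==> i \<le> j ==> j \<le> m ==> \<mu> i \<le> \<mu> j"
  by (auto simp: Dmap_iff)

lemma Dmap_eqI:
  "\<mu> \<in> Dmap m n ==> \<eta> \<in> Dmap m n' ==> (\<And>i. i \<le> m ==> \<mu> i = \<eta> i) ==> \<mu> = \<eta>"
  unfolding Dmap_iff by (rule ext) (metis not_le)

lemma id_Dmap [simp]: "idD n \<in> Dmap n n"
  by (auto simp: Dmap_iff)

lemma const_Dmap [simp]: "c \<le> n ==> cD c m \<in> Dmap m n"
  by (auto simp: Dmap_iff)

lemma comp_Dmap [simp, intro]: "\<mu> \<in> Dmap m n ==> \<eta> \<in> Dmap l m ==> compD l \<mu> \<eta> \<in> Dmap l n"
  by (auto simp: Dmap_iff compose_def)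

lemma comp_D_assoc: "\<zeta> \<in> Dmap k l ==> compD k (compD l \<mu> \<eta>) \<zeta> = compD k \<mu> (compD k \<eta> \<zeta>)"
  by (auto simp: Dmap_iff compose_def fun_eq_iff)

lemma comp_D_id_right [simp]: "\<mu> \<in> Dmap m n ==> compD m \<mu> (idD m) = \<mu>"
  by (auto simp: Dmap_iff compose_def fun_eq_iff)

lemma comp_D_id_left [simp]: "\<mu> \<in> Dmap m n ==> compD m (idD n) \<mu> = \<mu>"
  by (auto simp: Dmap_iff compose_def fun_eq_iff)

lemma comp_D_const [simp]: "\<mu> \<in> Dmap l m ==> compD l (cD c m) \<mu> = cD c l"
  by (auto simp: Dmap_iff compose_def fun_eq_iff)

lemma finite_Dmap [simp]: "finite (Dmap m n)"
  unfolding Dmap_def by (rule finite_subset[of _ "{..m} \<rightarrow>\<^sub>E {..n}"]) (auto intro: finite_PiE)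

lemma ss_act [intro, simp]: "is_sset K ==> \<mu> \<in> Dmap m n ==> x \<in> cells K n ==> act K m n \<mu> x \<in> cells K m"
  unfolding is_sset_def by blast

lemma ss_id [simp]: "is_sset K ==> x \<in> cells K n ==> act K n n (idD n) x = x"
  unfolding is_sset_def by blast

lemma ss_comp: "is_sset K ==> \<eta> \<in> Dmap l m ==> \<mu> \<in> Dmap m n ==> x \<in> cells K n ==>
   act K l m \<eta> (act K m n \<mu> x) = act K l n (compD l \<mu> \<eta>) x"
  unfolding is_sset_def by blast

lemma sm_in [intro, simp]: "sset_map K L f ==> x \<in> cells K n ==> f n x \<in> cells L n"
  unfolding sset_map_def by blast

lemma sm_nat: "sset_map K L f ==> \<mu> \<in> Dmap m n ==> x \<in> cells K n ==>
   f m (act K m n \<mu> x) = act L m n \<mu> (f n x)"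
  unfolding sset_map_def by blast

lemma smI:
  "(\<And>n x. x \<in> cells K n ==> f n x \<in> cells L n) ==>
   (\<And>m n \<mu> x. \<mu> \<in> Dmap m n ==> x \<in> cells K n ==> f m (act K m n \<mu> x) = act L m n \<mu> (f n x)) ==>
   sset_map K L f"
  unfolding sset_map_def by blast

lemma issI:
  "(\<And>m n \<mu> x. \<mu> \<in> Dmap m n ==> x \<in> cells K n ==> act K m n \<mu> x \<in> cells K m) ==>
   (\<And>n x. x \<in> cells K n ==> act K n n (idD n) x = x) ==>
   (\<And>l m n \<eta> \<mu> x. \<eta> \<in> Dmap l m ==> \<mu> \<in> Dmap m n ==> x \<in> cells K n ==>
      act K l m \<eta> (act K m n \<mu> x) = act K l n (compD l \<mu> \<eta>) x) ==> is_sset K"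
  unfolding is_sset_def by blast

lemma sm_comp: "sset_map K L f ==> sset_map L M g ==> sset_map K M (\<lambda>n x. g n (f n x))"
  unfolding sset_map_def by simp

lemma sm_id: "sset_map K K (\<lambda>n x. x)"
  unfolding sset_map_def by simp

lemma sm_cong:
  assumes "sset_map K L f" "\<And>n x. x \<in> cells K n ==> g n x = f n x" "is_sset K"
  shows "sset_map K L g"
  using assms unfolding sset_map_def by (metis ss_act)

lemma simplex_cells [simp]: "cells (simplex n) m = Dmap m n"
  and simplex_act [simp]: "act (simplex n) l m \<eta> \<mu> = compD l \<mu> \<eta>"
  by (simp_all add: simplex_def)

lemma is_sset_simplex [simp]: "is_sset (simplex n)"
  by (rule issI) (auto simp: comp_D_assoc)

lemma prod_cells [simp]: "cells (sset_prod K L) n = cells K n \<times> cells L n"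
  and prod_act [simp]: "act (sset_prod K L) m n \<mu> (x, y) = (act K m n \<mu> x, act L m n \<mu> y)"
  by (simp_all add: sset_prod_def)

lemma is_sset_prod [simp]: "is_sset K ==> is_sset L ==> is_sset (sset_prod K L)"
  by (rule issI) (auto simp: ss_comp)

text \<open>A subcomplex is kept as a family of cells inside a fixed \<open>X\<close>; then
  \<open>sub X U\<close> has the operators of \<open>X\<close>, and a map on \<open>X\<close>
  restricts to it without being changed.\<close>

definition subc :: "'a sset => (nat => 'a set) => bool" where
  "subc X U \<longleftrightarrow> (\<forall>n. U n \<subseteq> cells X n) \<and> (\<forall>m n. \<forall>\<mu>\<in>Dmap m n. \<forall>x\<in>U n. act X m n \<mu> x \<in> U m)"

abbreviation sub :: "'a sset => (nat => 'a set) => 'a sset" where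
  "sub X U \<equiv> X\<lparr>cells := U\<rparr>"

lemma subcI:
  "(\<And>n x. x \<in> U n ==> x \<in> cells X n) ==>
   (\<And>m n \<mu> x. \<mu> \<in> Dmap m n ==> x \<in> U n ==> act X m n \<mu> x \<in> U m) ==> subc X U"
  unfolding subc_def by blast

lemma subc_in: "subc X U ==> x \<in> U n ==> x \<in> cells X n"
  and subc_act: "subc X U ==> \<mu> \<in> Dmap m n ==> x \<in> U n ==> act X m n \<mu> x \<in> U m"
  unfolding subc_def by auto

lemma is_sset_sub [simp]: "is_sset X ==> subc X U ==> is_sset (sub X U)"
  by (rule issI) (auto simp: subc_act subc_in ss_comp dest: subc_in)

lemma sm_sub: "sset_map X Q f ==> subc X U ==> sset_map (sub X U) Q f"
  unfolding sset_map_def by (simp add: subc_in)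

lemma subc_empty [simp]: "subc X (\<lambda>_. {})"
  by (rule subcI) auto

text \<open>The boundary of \<Delta>[n], in the same form as the horns \<open>hn\<close> below, so
  that both can serve as attaching shapes in \<open>attach\<close>.\<close>

definition bd :: "nat => nat => (nat => nat) set" where
  "bd n m = {\<mu> \<in> Dmap m n. \<not> {..n} \<subseteq> \<mu> ` {..m}}"

definition hn :: "nat => nat => nat => (nat => nat) set" where
  "hn n k m = {\<mu> \<in> Dmap m n. \<not> {..n} - {k} \<subseteq> \<mu> ` {..m}}"

lemma horn_eq: "horn n k = sub (simplex n) (hn n k)"
  by (simp add: horn_def hn_def fun_eq_iff)

lemma compD_image: "\<eta> \<in> Dmap l m ==> compD l \<mu> \<eta> ` {..l} \<subseteq> \<mu> ` {..m}"
  by (auto simp: compose_def Dmap_iff)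

lemma subc_bd [simp]: "subc (simplex n) (bd n)"
proof (rule subcI)
  fix l m \<eta> \<mu> assume "\<eta> \<in> Dmap l m" "\<mu> \<in> bd n m"
  then show "act (simplex n) l m \<eta> \<mu> \<in> bd n l"
    using compD_image[of \<eta> l m \<mu>] by (simp add: bd_def) blast
qed (simp add: bd_def)

lemma subc_hn [simp]: "subc (simplex n) (hn n k)"
proof (rule subcI)
  fix l m \<eta> \<mu> assume "\<eta> \<in> Dmap l m" "\<mu> \<in> hn n k m"
  then show "act (simplex n) l m \<eta> \<mu> \<in> hn n k l"
    using compD_image[of \<eta> l m \<mu>] by (simp add: hn_def) blast
qed (simp add: hn_def)

subsection \<open>Extension along monomorphisms\<close>

text \<open>Graphs of simplicial maps defined on a subcomplex of \<open>X\<close>. As sets of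
  triples they are ordered by inclusion, and the union of a chain is again one, as Zorn's lemma
  requires.\<close>

definition parmap :: "'x sset => 'y sset => (nat \<times> 'x \<times> 'y) set => bool" where
  "parmap X N G \<longleftrightarrow> (\<forall>n x y. (n, x, y) \<in> G \<longrightarrow> x \<in> cells X n \<and> y \<in> cells N n) \<and>
     (\<forall>n x y y'. (n, x, y) \<in> G \<longrightarrow> (n, x, y') \<in> G \<longrightarrow> y = y') \<and>
     (\<forall>m n \<mu> x y. \<mu> \<in> Dmap m n \<longrightarrow> (n, x, y) \<in> G \<longrightarrow> (m, act X m n \<mu> x, act N m n \<mu> y) \<in> G)"

definition gdom :: "(nat \<times> 'x \<times> 'y) set => nat => 'x set" where
  "gdom G n = {x. \<exists>y. (n, x, y) \<in> G}"

lemma parmap_D: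
  "parmap X N G ==> (n, x, y) \<in> G ==> x \<in> cells X n"
  "parmap X N G ==> (n, x, y) \<in> G ==> y \<in> cells N n"
  "parmap X N G ==> (n, x, y) \<in> G ==> (n, x, y') \<in> G ==> y = y'"
  "parmap X N G ==> \<mu> \<in> Dmap m n ==> (n, x, y) \<in> G ==> (m, act X m n \<mu> x, act N m n \<mu> y) \<in> G"
  by (simp_all add: parmap_def)

lemma parmap_of_map:
  assumes "subc X U" "sset_map (sub X U) N a"
  shows "parmap X N {(n, x, a n x) | n x. x \<in> U n}"
  unfolding parmap_def using assms(1) sm_in[OF assms(2)] sm_nat[OF assms(2)]
  by (auto simp: subc_in subc_act)

lemma map_of_parmap:
  assumes "parmap X N G" "gdom G = cells X"
  shows "\<exists>c. sset_map X N c \<and> (\<forall>n x. x \<in> cells X n \<longrightarrow> (n, x, c n x) \<in> G)"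
proof -
  define c where "c = (\<lambda>n x. SOME y. (n, x, y) \<in> G)"
  have c: "(n, x, c n x) \<in> G" if "x \<in> cells X n" for n x
    using that assms(2) unfolding c_def gdom_def by (metis (mono_tags, lifting) mem_Collect_eq someI_ex)
  have "sset_map X N c"
  proof (rule smI)
    fix n x assume "x \<in> cells X n"
    then show "c n x \<in> cells N n" using c parmap_D(2)[OF assms(1)] by blast
  next
    fix m n \<mu> x assume t: "\<mu> \<in> Dmap m n" and x: "x \<in> cells X n"
    have 1: "(m, act X m n \<mu> x, act N m n \<mu> (c n x)) \<in> G"
      using parmap_D(4)[OF assms(1) t c[OF x]] .
    then have "act X m n \<mu> x \<in> cells X m" using parmap_D(1)[OF assms(1)] by blast
    then show "c m (act X m n \<mu> x) = act N m n \<mu> (c n x)" using 1 c parmap_D(3)[OF assms(1)] by blast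
  qed
  then show ?thesis using c by blast
qed

text \<open>One cell attachment: the simplex \<sigma> meets the domain of \<open>G\<close> exactly
  along \<Theta> and is free outside it by assumption \<open>2\<close>, so \<open>G\<close> extends
  as soon as its values on \<Theta> extend over \<Delta>[n]. The shape \<Theta> is a boundary in
  \<open>tfib_rlp\<close> and a horn in \<open>prism_step\<close>; in the former \<open>R\<close>
  carries the condition of lying over a prescribed map.\<close>

lemma attach:
  assumes X: "is_sset X" and N: "is_sset N" and G: "parmap X N G" and s: "\<sigma> \<in> cells X n"
    and \<Theta>: "\<And>m. \<Theta> m \<subseteq> Dmap m n"
    and 1: "\<And>m \<mu>. \<mu> \<in> Dmap m n ==> act X m n \<mu> \<sigma> \<in> gdom G m \<longleftrightarrow> \<mu> \<in> \<Theta> m"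
    and 2: "\<And>m \<mu> \<mu>'. \<mu> \<in> Dmap m n ==> \<mu>' \<in> Dmap m n ==> \<mu> \<notin> \<Theta> m ==> \<mu>' \<notin> \<Theta> m ==>
           act X m n \<mu> \<sigma> = act X m n \<mu>' \<sigma> ==> \<mu> = \<mu>'"
    and fill: "\<And>a. sset_map (sub (simplex n) \<Theta>) N a ==>
         (\<And>m \<mu>. \<mu> \<in> \<Theta> m ==> (m, act X m n \<mu> \<sigma>, a m \<mu>) \<in> G) ==>
         \<exists>g. sset_map (simplex n) N g \<and> (\<forall>m. \<forall>\<mu>\<in>\<Theta> m. g m \<mu> = a m \<mu>) \<and>
             (\<forall>m. \<forall>\<mu>\<in>Dmap m n. R m (act X m n \<mu> \<sigma>) (g m \<mu>))"
    and R: "\<And>m x y. (m, x, y) \<in> G ==> R m x y"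
  shows "\<exists>G'. parmap X N G' \<and> G \<subseteq> G' \<and> (\<forall>m x y. (m, x, y) \<in> G' \<longrightarrow> R m x y) \<and>
           (\<forall>m. gdom G' m = gdom G m \<union> {act X m n \<mu> \<sigma> | \<mu>. \<mu> \<in> Dmap m n})"
proof -
  define a where "a = (\<lambda>m \<mu>. SOME y. (m, act X m n \<mu> \<sigma>, y) \<in> G)"
  have a: "(m, act X m n \<mu> \<sigma>, a m \<mu>) \<in> G" if "\<mu> \<in> \<Theta> m" for m \<mu>
  proof -
    have "act X m n \<mu> \<sigma> \<in> gdom G m" using 1 \<Theta> that by blast
    then show ?thesis unfolding a_def gdom_def by (metis (mono_tags, lifting) mem_Collect_eq someI_ex)
  qed
  have "sset_map (sub (simplex n) \<Theta>) N a"
  proof (rule smI)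
    fix m \<mu> assume "\<mu> \<in> cells (sub (simplex n) \<Theta>) m"
    then have "\<mu> \<in> \<Theta> m" by simp
    from parmap_D(2)[OF G a[OF this]] show "a m \<mu> \<in> cells N m" .
  next
    fix l m \<eta> \<mu> assume e: "\<eta> \<in> Dmap l m" and "\<mu> \<in> cells (sub (simplex n) \<Theta>) m"
    then have t: "\<mu> \<in> \<Theta> m" by simp
    have tD: "\<mu> \<in> Dmap m n" using t \<Theta> by blast
    have g: "(l, act X l n (compD l \<mu> \<eta>) \<sigma>, act N l m \<eta> (a m \<mu>)) \<in> G"
      using parmap_D(4)[OF G e a[OF t]] ss_comp[OF X e tD s] by simp
    then have "compD l \<mu> \<eta> \<in> \<Theta> l" using 1[OF comp_Dmap[OF tD e]] unfolding gdom_def by blast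
    from a[OF this] g show "a l (act (sub (simplex n) \<Theta>) l m \<eta> \<mu>) = act N l m \<eta> (a m \<mu>)"
      using parmap_D(3)[OF G] by auto
  qed
  from fill[OF this a] obtain g where g: "sset_map (simplex n) N g"
    "\<And>m \<mu>. \<mu> \<in> \<Theta> m ==> g m \<mu> = a m \<mu>" "\<And>m \<mu>. \<mu> \<in> Dmap m n ==> R m (act X m n \<mu> \<sigma>) (g m \<mu>)" by blast
  define G' where "G' = G \<union> {(m, act X m n \<mu> \<sigma>, g m \<mu>) | m \<mu>. \<mu> \<in> Dmap m n}"
  \<comment> \<open>On the overlap the filler agrees with \<open>G\<close>, since both restrict to
    the attaching map \<open>a\<close>.\<close>
  have key: "y = g m \<mu>" if "(m, act X m n \<mu> \<sigma>, y) \<in> G" "\<mu> \<in> Dmap m n" for m \<mu> y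
  proof -
    have "\<mu> \<in> \<Theta> m" using 1[OF that(2)] that(1) unfolding gdom_def by blast
    then show ?thesis using g(2) a that parmap_D(3)[OF G] by metis
  qed
  have key2: "g m \<mu> = g m \<mu>'" if "act X m n \<mu> \<sigma> = act X m n \<mu>' \<sigma>" "\<mu> \<in> Dmap m n" "\<mu>' \<in> Dmap m n" for m \<mu> \<mu>'
  proof (cases "act X m n \<mu> \<sigma> \<in> gdom G m")
    case True
    then obtain y where y: "(m, act X m n \<mu> \<sigma>, y) \<in> G" unfolding gdom_def by blast
    then have "(m, act X m n \<mu>' \<sigma>, y) \<in> G" using that(1) by simp
    from key[OF this that(3)] key[OF y that(2)] show ?thesis by simp
  next
    case False
    then have "\<mu> \<notin> \<Theta> m" "\<mu>' \<notin> \<Theta> m" using 1[OF that(2)] 1[OF that(3)] that(1) by simp_all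
    from 2[OF that(2,3) this that(1)] show ?thesis by simp
  qed
  have "parmap X N G'"
    unfolding parmap_def
  proof (intro conjI allI impI)
    fix m x y assume "(m, x, y) \<in> G'"
    then show "x \<in> cells X m" "y \<in> cells N m"
      using parmap_D(1,2)[OF G] s X sm_in[OF g(1)] unfolding G'_def by auto
  next
    fix m x y y' assume "(m, x, y) \<in> G'" "(m, x, y') \<in> G'"
    then show "y = y'" using parmap_D(3)[OF G] key key2 unfolding G'_def by blast
  next
    fix l m \<eta> x y assume e: "\<eta> \<in> Dmap l m" and "(m, x, y) \<in> G'"
    then consider "(m, x, y) \<in> G" | \<mu> where "\<mu> \<in> Dmap m n" "x = act X m n \<mu> \<sigma>" "y = g m \<mu>"
      unfolding G'_def by blast
    then show "(l, act X l m \<eta> x, act N l m \<eta> y) \<in> G'"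
    proof cases
      case 1 then show ?thesis using parmap_D(4)[OF G e] unfolding G'_def by blast
    next
      case 2
      then have "act X l m \<eta> x = act X l n (compD l \<mu> \<eta>) \<sigma>" "act N l m \<eta> y = g l (compD l \<mu> \<eta>)"
        using ss_comp[OF X e _ s] sm_nat[OF g(1) e, of \<mu>] by auto
      then show ?thesis using 2 e unfolding G'_def by auto
    qed
  qed
  moreover have "G \<subseteq> G'" unfolding G'_def by blast
  moreover have "\<forall>m x y. (m, x, y) \<in> G' \<longrightarrow> R m x y" using R g(3) unfolding G'_def by blast
  moreover have "\<forall>m. gdom G' m = gdom G m \<union> {act X m n \<mu> \<sigma> | \<mu>. \<mu> \<in> Dmap m n}"
    unfolding G'_def gdom_def by auto
  ultimately show ?thesis by blast
qed

definition rlp :: "(nat => 'y => 'z) => 'y sset => 'z sset => 'x sset => (nat => 'x set) => bool" where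
  "rlp q N K X U \<longleftrightarrow> (\<forall>a b. sset_map (sub X U) N a \<and> sset_map X K b \<and> (\<forall>n. \<forall>x\<in>U n. q n (a n x) = b n x) \<longrightarrow>
     (\<exists>c. sset_map X N c \<and> (\<forall>n. \<forall>x\<in>U n. c n x = a n x) \<and> (\<forall>n. \<forall>x\<in>cells X n. q n (c n x) = b n x)))"

text \<open>Trivial fibrations are the source of most homotopy equivalences below
  (\<open>tfib_heq\<close>); boundary inclusions suffice as a test by
  \<open>tfib_rlp\<close>.\<close>

definition tfib :: "'y sset => 'z sset => (nat => 'y => 'z) => bool" where
  "tfib N K q \<longleftrightarrow> is_sset N \<and> is_sset K \<and> sset_map N K q \<and> (\<forall>n. rlp q N K (simplex n) (bd n))"

lemma rlpD:
  assumes "rlp q N K X U" "sset_map (sub X U) N a" "sset_map X K b" "\<And>n x. x \<in> U n ==> q n (a n x) = b n x"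
  obtains c where "sset_map X N c" "\<And>n x. x \<in> U n ==> c n x = a n x"
    "\<And>n x. x \<in> cells X n ==> q n (c n x) = b n x"
proof -
  have "\<exists>c. sset_map X N c \<and> (\<forall>n. \<forall>x\<in>U n. c n x = a n x) \<and> (\<forall>n. \<forall>x\<in>cells X n. q n (c n x) = b n x)"
    using assms(1)[unfolded rlp_def, THEN spec, THEN spec, of a b] assms(2-4) by simp
  then show ?thesis using that by blast
qed

section \<open>Factorizations and sections of monotone maps\<close>

lemma nonsurj_factor:
  assumes t: "\<mu> \<in> bd n m"
  obtains k \<delta> \<epsilon> where "k < n" "\<delta> \<in> Dmap k n" "\<epsilon> \<in> Dmap m k" "\<mu> = compD m \<delta> \<epsilon>"
proof -
  from t obtain v where v: "v \<le> n" "v \<notin> \<mu> ` {..m}" and th: "\<mu> \<in> Dmap m n" unfolding bd_def by blast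
  have "\<mu> 0 \<le> n" "\<mu> 0 \<noteq> v" using v th by (auto simp: Dmap_iff)
  then have n: "n > 0" using v by (cases n) auto
  \<comment> \<open>\<delta> is the coface that skips the missed vertex \<open>v\<close>, and
    \<epsilon> is \<mu> renumbered on the remaining \<open>n\<close> vertices.\<close>
  define \<delta> where "\<delta> = (\<lambda>i\<in>{..n-1}. if i < v then i else Suc i)"
  define \<epsilon> where "\<epsilon> = (\<lambda>i\<in>{..m}. if \<mu> i < v then \<mu> i else \<mu> i - 1)"
  have d: "\<delta> \<in> Dmap (n-1) n" unfolding \<delta>_def using n by (intro DmapI) (auto split: if_splits)
  have ne: "\<mu> i \<noteq> v" if "i \<le> m" for i using v that by auto
  have e: "\<epsilon> \<in> Dmap m (n-1)" unfolding \<epsilon>_def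
  proof (rule DmapI, goal_cases)
    case (1 i)
    then have "\<mu> i \<le> n" using th by (auto simp: Dmap_iff)
    then show ?case using 1 v n ne[of i] by auto
  next
    case (3 i j)
    then have "\<mu> i \<le> \<mu> j" using th by (auto simp: Dmap_iff)
    then show ?case using 3 ne[of i] ne[of j] by auto
  qed auto
  have "\<mu> i = compD m \<delta> \<epsilon> i" if "i \<le> m" for i
  proof -
    have le: "\<mu> i \<le> n" using th that by (auto simp: Dmap_iff)
    show ?thesis
    proof (cases "\<mu> i < v")
      case True
      then have "\<epsilon> i = \<mu> i" using that by (simp add: \<epsilon>_def)
      moreover have "\<mu> i \<le> n - 1" using True v by linarith
      ultimately show ?thesis using True that by (simp add: compose_def \<delta>_def)
    next
      case False
      then have "\<mu> i > v" using ne[OF that] by linarith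
      then have "\<epsilon> i = \<mu> i - 1" "\<not> \<mu> i - 1 < v" "\<mu> i - 1 \<le> n - 1" "Suc (\<mu> i - 1) = \<mu> i"
        using that le by (auto simp: \<epsilon>_def)
      then show ?thesis using that by (simp add: compose_def \<delta>_def)
    qed
  qed
  then have "\<mu> = compD m \<delta> \<epsilon>" using Dmap_eqI[OF th comp_Dmap[OF d e]] by blast
  then show ?thesis using that[OF _ d e] n by simp
qed

text \<open>The section takes least preimages, except that it is routed through the given
  \<open>i\<close>. This freedom separates two different surjections: \<open>tfib_rlp\<close>
  applies it at a vertex where they differ.\<close>

lemma surj_section:
  assumes t: "\<mu> \<in> Dmap m n" "{..n} \<subseteq> \<mu> ` {..m}" and i: "i \<le> m"
  obtains \<delta> where "\<delta> \<in> Dmap n m" "compD n \<mu> \<delta> = idD n" "\<delta> (\<mu> i) = i"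
proof -
  define L where "L = (\<lambda>v. LEAST j. \<mu> j = v \<and> j \<le> m)"
  have L: "\<mu> (L v) = v \<and> L v \<le> m" if "v \<le> n" for v
  proof -
    have "\<exists>j. \<mu> j = v \<and> j \<le> m" using t(2) that by (metis atMost_iff image_iff subset_iff)
    then show ?thesis unfolding L_def by (rule LeastI_ex)
  qed
  define \<delta> where "\<delta> = (\<lambda>v\<in>{..n}. if v = \<mu> i then i else L v)"
  have ti: "\<mu> i \<le> n" using t i by (auto simp: Dmap_iff)
  have th: "\<mu> (\<delta> v) = v \<and> \<delta> v \<le> m" if "v \<le> n" for v using L that i by (auto simp: \<delta>_def)
  have d: "\<delta> \<in> Dmap n m"
  proof (rule DmapI, goal_cases)
    case (1 i) then show ?case using th by blast
  next
    case (2 i) then show ?case by (simp add: \<delta>_def)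
  next
    case (3 v w)
    show ?case
    proof (rule ccontr)
      assume "\<not> \<delta> v \<le> \<delta> w"
      then have "\<mu> (\<delta> w) \<le> \<mu> (\<delta> v)" using Dmap_mono[OF t(1), of "\<delta> w" "\<delta> v"] th[of v] 3 by simp
      then have "v = w" using th[of v] th[of w] 3 by auto
      then show False using \<open>\<not> \<delta> v \<le> \<delta> w\<close> by simp
    qed
  qed
  have "compD n \<mu> \<delta> = idD n"
    by (rule Dmap_eqI[OF comp_Dmap[OF t(1) d] id_Dmap]) (use th in \<open>auto simp: compose_def\<close>)
  moreover have "\<delta> (\<mu> i) = i" using ti by (simp add: \<delta>_def)
  ultimately show ?thesis using that d by blast
qed

lemma surj_endo_id:
  assumes t: "\<epsilon> \<in> Dmap n n" "{..n} \<subseteq> \<epsilon> ` {..n}"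
  shows "\<epsilon> = idD n"
proof -
  have "\<epsilon> ` {..n} \<subseteq> {..n}" using t by (auto simp: Dmap_iff)
  then have "inj_on \<epsilon> {..n}" using t(2) by (simp add: finite_surj_inj)
  then have sm: "\<epsilon> i < \<epsilon> j" if "i < j" "j \<le> n" for i j
    using that t(1) unfolding inj_on_def Dmap_iff by (metis atMost_iff le_neq_implies_less less_imp_le less_irrefl order_trans)
  have up: "\<epsilon> i + d \<le> \<epsilon> (i + d)" if "i + d \<le> n" for i d
    using that by (induction d) (use sm in \<open>force simp: Suc_le_eq\<close>)+
  have "\<epsilon> i = i" if "i \<le> n" for i
  proof -
    have "i \<le> \<epsilon> i" using up[of 0 i] that by simp
    moreover have "\<epsilon> i + (n - i) \<le> n" using up[of i "n - i"] that t(1) by (auto simp: Dmap_iff intro: order_trans)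
    ultimately show ?thesis using that by linarith
  qed
  then show ?thesis by (intro Dmap_eqI[OF t(1) id_Dmap]) auto
qed

text \<open>Instead of an induction over skeleta, a maximal partial lift is chosen. A simplex of
  least dimension outside its domain has its boundary in the domain and can be attached along it,
  which contradicts maximality.\<close>

theorem tfib_rlp:
  assumes q: "tfib N K q" and X: "is_sset X" and U: "subc X U"
  shows "rlp q N K X U"
  unfolding rlp_def
proof (intro allI impI, elim conjE)
  fix a b assume a: "sset_map (sub X U) N a" and b: "sset_map X K b" and ab: "\<forall>n. \<forall>x\<in>U n. q n (a n x) = b n x"
  have N: "is_sset N" and K: "is_sset K" and qm: "sset_map N K q" using q by (auto simp: tfib_def)
  define G0 where "G0 = {(n, x, a n x) | n x. x \<in> U n}"
  define \<A> where "\<A> = {G. parmap X N G \<and> G0 \<subseteq> G \<and> (\<forall>n x y. (n, x, y) \<in> G \<longrightarrow> q n y = b n x)}"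
  have G0: "G0 \<in> \<A>" using parmap_of_map[OF U a] ab unfolding \<A>_def G0_def by auto
  have "\<exists>M\<in>\<A>. \<forall>G\<in>\<A>. M \<subseteq> G \<longrightarrow> G = M"
  proof (rule subset_Zorn_nonempty)
    show "\<A> \<noteq> {}" using G0 by blast
  next
    fix \<C> assume ne: "\<C> \<noteq> {}" and ch: "subset.chain \<A> \<C>"
    have sub: "\<And>G. G \<in> \<C> ==> G \<in> \<A>" using ch by (auto simp: subset.chain_def)
    have p: "\<And>G. G \<in> \<C> ==> parmap X N G" using sub by (auto simp: \<A>_def)
    have tot: "\<And>G H. G \<in> \<C> ==> H \<in> \<C> ==> G \<subseteq> H \<or> H \<subseteq> G"
      using ch unfolding subset.chain_def by blast
    have "parmap X N (\<Union>\<C>)"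
      unfolding parmap_def
    proof (intro conjI allI impI)
      fix n x y assume "(n, x, y) \<in> \<Union>\<C>"
      then show "x \<in> cells X n" "y \<in> cells N n" using parmap_D(1,2)[OF p] by blast+
    next
      fix n x y y' assume "(n, x, y) \<in> \<Union>\<C>" "(n, x, y') \<in> \<Union>\<C>"
      then obtain G H where "G \<in> \<C>" "H \<in> \<C>" "(n, x, y) \<in> G" "(n, x, y') \<in> H" by blast
      then show "y = y'" using tot[of G H] parmap_D(3)[OF p] by blast
    next
      fix m n \<mu> x y assume "\<mu> \<in> Dmap m n" "(n, x, y) \<in> \<Union>\<C>"
      then show "(m, act X m n \<mu> x, act N m n \<mu> y) \<in> \<Union>\<C>" using parmap_D(4)[OF p] by blast
    qed
    moreover have "G0 \<subseteq> \<Union>\<C>" using ne sub by (auto simp: \<A>_def)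
    moreover have "\<forall>n x y. (n, x, y) \<in> \<Union>\<C> \<longrightarrow> q n y = b n x" using sub by (auto simp: \<A>_def)
    ultimately show "\<Union>\<C> \<in> \<A>" by (simp add: \<A>_def)
  qed
  then obtain M where MA: "M \<in> \<A>" and max: "\<And>G. G \<in> \<A> ==> M \<subseteq> G ==> G = M" by blast
  have M: "parmap X N M" "G0 \<subseteq> M" "\<And>n x y. (n, x, y) \<in> M ==> q n y = b n x"
    using MA by (auto simp: \<A>_def)
  have dM: "gdom M n \<subseteq> cells X n" for n using parmap_D(1)[OF M(1)] by (auto simp: gdom_def)
  have cl: "act X m n \<mu> x \<in> gdom M m" if "\<mu> \<in> Dmap m n" "x \<in> gdom M n" for m n \<mu> x
    using parmap_D(4)[OF M(1) that(1)] that(2) unfolding gdom_def by blast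
  have "gdom M n = cells X n" for n
  proof (induction n rule: less_induct)
    case (less n)
    show ?case
    proof (rule ccontr)
      assume "gdom M n \<noteq> cells X n"
      then obtain x where x: "x \<in> cells X n" "x \<notin> gdom M n" using dM by blast
      have in1: "act X m n \<mu> x \<in> gdom M m" if th: "\<mu> \<in> bd n m" for m \<mu>
      proof -
        obtain k \<delta> \<epsilon> where k: "k < n" "\<delta> \<in> Dmap k n" "\<epsilon> \<in> Dmap m k" "\<mu> = compD m \<delta> \<epsilon>"
          using nonsurj_factor[OF th] by blast
        have "act X k n \<delta> x \<in> gdom M k" using less[OF k(1)] X k x by auto
        then have "act X m k \<epsilon> (act X k n \<delta> x) \<in> gdom M m" using cl k by blast
        then show ?thesis using ss_comp[OF X k(3) k(2) x(1)] k(4) by simp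
      qed
      \<comment> \<open>A section of a surjective \<mu> recovers \<open>x\<close> from its
        degeneracy, so no degeneracy of \<open>x\<close> can lie in the domain already.\<close>
      have notin: "\<mu> \<in> bd n m" if th: "\<mu> \<in> Dmap m n" "act X m n \<mu> x \<in> gdom M m" for m \<mu>
      proof (rule ccontr)
        assume "\<mu> \<notin> bd n m"
        then have "{..n} \<subseteq> \<mu> ` {..m}" using th by (auto simp: bd_def)
        then obtain \<delta> where "\<delta> \<in> Dmap n m" "compD n \<mu> \<delta> = idD n" using surj_section[OF th(1), of m] by auto
        then have "x = act X n m \<delta> (act X m n \<mu> x)" using ss_comp[OF X \<open>\<delta> \<in> Dmap n m\<close> th(1) x(1)] X x by simp
        then show False using cl[OF \<open>\<delta> \<in> Dmap n m\<close> th(2)] x by simp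
      qed
      have "\<exists>G'. parmap X N G' \<and> M \<subseteq> G' \<and> (\<forall>m x y. (m, x, y) \<in> G' \<longrightarrow> q m y = b m x) \<and>
           (\<forall>m. gdom G' m = gdom M m \<union> {act X m n \<mu> x | \<mu>. \<mu> \<in> Dmap m n})"
      proof (rule attach[OF X N M(1) x(1), of "bd n"])
        show "bd n m \<subseteq> Dmap m n" for m by (auto simp: bd_def)
        show "(act X m n \<mu> x \<in> gdom M m) = (\<mu> \<in> bd n m)" if "\<mu> \<in> Dmap m n" for m \<mu>
          using in1 notin that by blast
        show "q m y = b m x'" if "(m, x', y) \<in> M" for m x' y using M(3) that by blast
      next
        \<comment> \<open>Two surjections with the same value at \<open>x\<close> coincide:
          otherwise a section of \<mu> through a vertex where they differ shows that
          \<open>x\<close> is its own image under an endomorphism other than the identity. That one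
          factors through a proper face, so \<open>x\<close> would lie in the domain.\<close>
        fix m \<mu> \<mu>' assume th: "\<mu> \<in> Dmap m n" "\<mu>' \<in> Dmap m n" "\<mu> \<notin> bd n m" "\<mu>' \<notin> bd n m"
          and eq: "act X m n \<mu> x = act X m n \<mu>' x"
        show "\<mu> = \<mu>'"
        proof (rule Dmap_eqI[OF th(1,2)], rule ccontr)
          fix i assume i: "i \<le> m" "\<mu> i \<noteq> \<mu>' i"
          have "{..n} \<subseteq> \<mu> ` {..m}" using th by (auto simp: bd_def)
          then obtain \<delta> where d: "\<delta> \<in> Dmap n m" "compD n \<mu> \<delta> = idD n" "\<delta> (\<mu> i) = i"
            using surj_section[OF th(1) _ i(1)] by blast
          have x': "x = act X n m \<delta> (act X m n \<mu> x)" using ss_comp[OF X d(1) th(1) x(1)] X x d by simp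
          also have "\<dots> = act X n n (compD n \<mu>' \<delta>) x" using ss_comp[OF X d(1) th(2) x(1)] eq by simp
          finally have e: "x = act X n n (compD n \<mu>' \<delta>) x" .
          have ti: "\<mu> i \<le> n" using th i by (auto simp: Dmap_iff)
          have "compD n \<mu>' \<delta> (\<mu> i) = \<mu>' i" using ti d by (simp add: compose_def)
          then have "compD n \<mu>' \<delta> \<noteq> idD n" using i ti by auto
          then have "compD n \<mu>' \<delta> \<in> bd n n"
            using surj_endo_id[OF comp_Dmap[OF th(2) d(1)]] th d by (auto simp: bd_def)
          then show False using in1[of "compD n \<mu>' \<delta>" n] e x by simp
        qed
      next
        fix a' assume a': "sset_map (sub (simplex n) (bd n)) N a'"
          and aM: "\<And>m \<mu>. \<mu> \<in> bd n m ==> (m, act X m n \<mu> x, a' m \<mu>) \<in> M"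
        have r: "rlp q N K (simplex n) (bd n)" using q by (auto simp: tfib_def)
        have b': "sset_map (simplex n) K (\<lambda>m \<mu>. b m (act X m n \<mu> x))"
        proof (rule smI)
          fix m \<mu> assume "\<mu> \<in> cells (simplex n) m"
          then show "b m (act X m n \<mu> x) \<in> cells K m" using sm_in[OF b] X x by simp
        next
          fix l m \<eta> \<mu> assume e: "\<eta> \<in> Dmap l m" and "\<mu> \<in> cells (simplex n) m"
          then have t: "\<mu> \<in> Dmap m n" by simp
          show "b l (act X l n (act (simplex n) l m \<eta> \<mu>) x) = act K l m \<eta> (b m (act X m n \<mu> x))"
            using sm_nat[OF b e ss_act[OF X t x(1)]] ss_comp[OF X e t x(1)] by simp
        qed
        have "q m (a' m \<mu>) = b m (act X m n \<mu> x)" if "\<mu> \<in> bd n m" for m \<mu>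
          by (rule M(3)[OF aM[OF that]])
        from rlpD[OF r a' b' this] obtain g where "sset_map (simplex n) N g" "\<And>m \<mu>. \<mu> \<in> bd n m ==> g m \<mu> = a' m \<mu>"
          "\<And>m \<mu>. \<mu> \<in> cells (simplex n) m ==> q m (g m \<mu>) = b m (act X m n \<mu> x)" by blast
        then show "\<exists>g. sset_map (simplex n) N g \<and> (\<forall>m. \<forall>\<mu>\<in>bd n m. g m \<mu> = a' m \<mu>) \<and>
             (\<forall>m. \<forall>\<mu>\<in>Dmap m n. q m (g m \<mu>) = b m (act X m n \<mu> x))"
          by (intro exI[of _ g]) simp
      qed
      then obtain G' where G': "parmap X N G'" "M \<subseteq> G'" "\<forall>m x y. (m, x, y) \<in> G' \<longrightarrow> q m y = b m x"
        "\<And>m. gdom G' m = gdom M m \<union> {act X m n \<mu> x | \<mu>. \<mu> \<in> Dmap m n}" by blast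
      then have "G' \<in> \<A>" using M(2) by (auto simp: \<A>_def)
      then have "G' = M" using max G'(2) by blast
      moreover have "\<exists>\<mu>. x = act X n n \<mu> x \<and> \<mu> \<in> Dmap n n" by (intro exI[of _ "idD n"]) (use X x in simp)
      then have "x \<in> gdom G' n" unfolding G'(4) by blast
      ultimately show False using x(2) by simp
    qed
  qed
  then have "gdom M = cells X" by blast
  from map_of_parmap[OF M(1) this] obtain c where c: "sset_map X N c" "\<And>n x. x \<in> cells X n ==> (n, x, c n x) \<in> M" by blast
  have "c n x = a n x" if "x \<in> U n" for n x
  proof -
    have "(n, x, a n x) \<in> M" using that M(2) by (auto simp: G0_def)
    then show ?thesis using parmap_D(3)[OF M(1) c(2)[OF subc_in[OF U that]]] by simp
  qed
  then show "\<exists>c. sset_map X N c \<and> (\<forall>n. \<forall>x\<in>U n. c n x = a n x) \<and> (\<forall>n. \<forall>x\<in>cells X n. q n (c n x) = b n x)"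
    using c M(3) by blast
qed

section \<open>Function complexes\<close>

text \<open>A test is a diagram of objects \<open>tov i\<close> and arrows \<open>tav e\<close> of the site, together with simplicial sets \<open>tZ i\<close>
  and maps \<open>tr e\<close> between them, which may be pointed by \<open>tb i\<close>. A \<open>gf\<close> is a family of maps from the sections
  of a presheaf, times \<open>X\<close>, to the \<open>tZ i\<close> that is compatible with the arrows. Simplicial mapping spaces,
  function complexes of simplicial sets and maps out of Nisnevich stalks are all of the form \<open>TF\<close>.\<close>

record ('i, 'e, 'o, 'a, 'z) tst =
  tI :: "'i set"
  tE :: "'e set"
  tsrc :: "'e => 'i"
  ttgt :: "'e => 'i"
  tov :: "'i => 'o"
  tav :: "'e => 'a"
  tZ :: "'i => 'z sset"
  tr :: "'e => nat => 'z => 'z"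
  tb :: "'i => nat => 'z"
  tp :: bool

abbreviation tsec :: "('i, 'e, 'o, 'a, 'z) tst => ('o, 'a, 'v) spre => 'i => 'v sset" where
  "tsec t A i \<equiv> sec A (tov t i)"

definition gf :: "('i, 'e, 'o, 'a, 'z) tst => ('o, 'a, 'v) spre => 'x sset => ('i => nat => 'v \<times> 'x => 'z) => bool" where
  "gf t A X \<psi> \<longleftrightarrow>
     (\<forall>i\<in>tI t. sset_map (sset_prod (tsec t A i) X) (tZ t i) (\<psi> i)) \<and>
     (\<forall>e\<in>tE t. \<forall>k. \<forall>x\<in>cells (tsec t A (ttgt t e)) k. \<forall>\<xi>\<in>cells X k.
        \<psi> (tsrc t e) k (rst A (tav t e) k x, \<xi>) = tr t e k (\<psi> (ttgt t e) k (x, \<xi>))) \<and>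
     (tp t \<longrightarrow> (\<forall>i\<in>tI t. \<forall>k. \<forall>\<xi>\<in>cells X k. \<psi> i k (bpt A (tov t i) k, \<xi>) = tb t i k))"

definition TF :: "('i, 'e, 'o, 'a, 'z) tst => ('o, 'a, 'v) spre => ('i => nat => 'v \<times> (nat => nat) => 'z) sset" where
  "TF t A = \<lparr>
     cells = (\<lambda>n. {\<phi>. gf t A (simplex n) \<phi> \<and>
       (\<forall>i k x \<eta>. \<not> (i \<in> tI t \<and> x \<in> cells (tsec t A i) k \<and> \<eta> \<in> Dmap k n) \<longrightarrow> \<phi> i k (x, \<eta>) = undefined)}),
     act = (\<lambda>m n \<mu> \<phi> i k (x, \<eta>). if i \<in> tI t \<and> x \<in> cells (tsec t A i) k \<and> \<eta> \<in> Dmap k m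
        then \<phi> i k (x, compose {..k} \<mu> \<eta>) else undefined)\<rparr>"

definition wfA :: "('i, 'e, 'o, 'a, 'z) tst => ('o, 'a, 'v) spre => bool" where
  "wfA t A \<longleftrightarrow> (\<forall>i\<in>tI t. is_sset (tsec t A i)) \<and>
     (\<forall>e\<in>tE t. tsrc t e \<in> tI t \<and> ttgt t e \<in> tI t \<and> sset_map (tsec t A (ttgt t e)) (tsec t A (tsrc t e)) (rst A (tav t e))) \<and>
     (tp t \<longrightarrow> (\<forall>i\<in>tI t. \<forall>n. bpt A (tov t i) n \<in> cells (tsec t A i) n))"

lemma wfA_D:
  assumes "wfA t A"
  shows "i \<in> tI t ==> is_sset (tsec t A i)" "e \<in> tE t ==> tsrc t e \<in> tI t" "e \<in> tE t ==> ttgt t e \<in> tI t"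
    "e \<in> tE t ==> sset_map (tsec t A (ttgt t e)) (tsec t A (tsrc t e)) (rst A (tav t e))"
    "tp t ==> i \<in> tI t ==> bpt A (tov t i) n \<in> cells (tsec t A i) n"
  using assms by (simp_all add: wfA_def)

lemma gfI:
  assumes "\<And>i k x \<xi>. i \<in> tI t ==> x \<in> cells (tsec t A i) k ==> \<xi> \<in> cells X k ==> \<psi> i k (x, \<xi>) \<in> cells (tZ t i) k"
    and "\<And>i l k \<mu> x \<xi>. i \<in> tI t ==> \<mu> \<in> Dmap l k ==> x \<in> cells (tsec t A i) k ==> \<xi> \<in> cells X k ==>
       \<psi> i l (act (tsec t A i) l k \<mu> x, act X l k \<mu> \<xi>) = act (tZ t i) l k \<mu> (\<psi> i k (x, \<xi>))"
    and "\<And>e k x \<xi>. e \<in> tE t ==> x \<in> cells (tsec t A (ttgt t e)) k ==> \<xi> \<in> cells X k ==>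
       \<psi> (tsrc t e) k (rst A (tav t e) k x, \<xi>) = tr t e k (\<psi> (ttgt t e) k (x, \<xi>))"
    and "\<And>i k \<xi>. tp t ==> i \<in> tI t ==> \<xi> \<in> cells X k ==> \<psi> i k (bpt A (tov t i) k, \<xi>) = tb t i k"
  shows "gf t A X \<psi>"
  unfolding gf_def sset_map_def using assms by auto

lemma gfD:
  assumes "gf t A X \<psi>"
  shows "i \<in> tI t ==> x \<in> cells (tsec t A i) k ==> \<xi> \<in> cells X k ==> \<psi> i k (x, \<xi>) \<in> cells (tZ t i) k"
    and "i \<in> tI t ==> \<mu> \<in> Dmap l k ==> x \<in> cells (tsec t A i) k ==> \<xi> \<in> cells X k ==>
       \<psi> i l (act (tsec t A i) l k \<mu> x, act X l k \<mu> \<xi>) = act (tZ t i) l k \<mu> (\<psi> i k (x, \<xi>))"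
    and "e \<in> tE t ==> x \<in> cells (tsec t A (ttgt t e)) k ==> \<xi> \<in> cells X k ==>
       \<psi> (tsrc t e) k (rst A (tav t e) k x, \<xi>) = tr t e k (\<psi> (ttgt t e) k (x, \<xi>))"
    and "tp t ==> i \<in> tI t ==> \<xi> \<in> cells X k ==> \<psi> i k (bpt A (tov t i) k, \<xi>) = tb t i k"
proof -
  assume i: "i \<in> tI t" "x \<in> cells (tsec t A i) k" "\<xi> \<in> cells X k"
  have m: "sset_map (sset_prod (tsec t A i) X) (tZ t i) (\<psi> i)" using assms i by (simp add: gf_def)
  show "\<psi> i k (x, \<xi>) \<in> cells (tZ t i) k" using sm_in[OF m, of "(x, \<xi>)" k] i by simp
next
  assume i: "i \<in> tI t" "\<mu> \<in> Dmap l k" "x \<in> cells (tsec t A i) k" "\<xi> \<in> cells X k"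
  have m: "sset_map (sset_prod (tsec t A i) X) (tZ t i) (\<psi> i)" using assms i by (simp add: gf_def)
  show "\<psi> i l (act (tsec t A i) l k \<mu> x, act X l k \<mu> \<xi>) = act (tZ t i) l k \<mu> (\<psi> i k (x, \<xi>))"
    using sm_nat[OF m i(2), of "(x, \<xi>)"] i by simp
next
  show "e \<in> tE t ==> x \<in> cells (tsec t A (ttgt t e)) k ==> \<xi> \<in> cells X k ==>
       \<psi> (tsrc t e) k (rst A (tav t e) k x, \<xi>) = tr t e k (\<psi> (ttgt t e) k (x, \<xi>))"
    and "tp t ==> i \<in> tI t ==> \<xi> \<in> cells X k ==> \<psi> i k (bpt A (tov t i) k, \<xi>) = tb t i k"
    using assms by (simp_all add: gf_def)
qed

lemma gf_precomp:
  assumes "gf t A X \<psi>" "sset_map X' X u"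
  shows "gf t A X' (\<lambda>i k (x, \<xi>). \<psi> i k (x, u k \<xi>))"
  by (rule gfI) (use gfD[OF assms(1)] sm_in[OF assms(2)] sm_nat[OF assms(2)] in auto)

lemma TF_cells_iff:
  "\<phi> \<in> cells (TF t A) n \<longleftrightarrow> gf t A (simplex n) \<phi> \<and>
       (\<forall>i k x \<eta>. \<not> (i \<in> tI t \<and> x \<in> cells (tsec t A i) k \<and> \<eta> \<in> Dmap k n) \<longrightarrow> \<phi> i k (x, \<eta>) = undefined)"
  by (simp add: TF_def)

lemma TF_eqI:
  assumes "\<phi> \<in> cells (TF t A) n" "\<phi>' \<in> cells (TF t A) n"
    "\<And>i k x \<eta>. i \<in> tI t ==> x \<in> cells (tsec t A i) k ==> \<eta> \<in> Dmap k n ==> \<phi> i k (x, \<eta>) = \<phi>' i k (x, \<eta>)"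
  shows "\<phi> = \<phi>'"
proof (intro ext, clarify)
  fix i k x \<eta>
  show "\<phi> i k (x, \<eta>) = \<phi>' i k (x, \<eta>)"
    using assms(1,2)[unfolded TF_cells_iff] assms(3) by (cases "i \<in> tI t \<and> x \<in> cells (tsec t A i) k \<and> \<eta> \<in> Dmap k n") auto
qed

lemma TF_act: "i \<in> tI t ==> x \<in> cells (tsec t A i) k ==> \<eta> \<in> Dmap k m ==>
   act (TF t A) m n \<mu> \<phi> i k (x, \<eta>) = \<phi> i k (x, compD k \<mu> \<eta>)"
  by (simp add: TF_def)

lemma TF_act_cells:
  assumes A: "wfA t A" and th: "\<mu> \<in> Dmap m n" and \<phi>: "\<phi> \<in> cells (TF t A) n"
  shows "act (TF t A) m n \<mu> \<phi> \<in> cells (TF t A) m"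
proof -
  have g: "gf t A (simplex n) \<phi>" using \<phi> by (simp add: TF_cells_iff)
  have "gf t A (simplex m) (act (TF t A) m n \<mu> \<phi>)"
  proof (rule gfI)
    fix i k x \<xi> assume "i \<in> tI t" "x \<in> cells (tsec t A i) k" "\<xi> \<in> cells (simplex m) k"
    then show "act (TF t A) m n \<mu> \<phi> i k (x, \<xi>) \<in> cells (tZ t i) k"
      using gfD(1)[OF g] th by (simp add: TF_act)
  next
    fix i l k \<zeta> x \<xi> assume i: "i \<in> tI t" "\<zeta> \<in> Dmap l k" "x \<in> cells (tsec t A i) k" "\<xi> \<in> cells (simplex m) k"
    then have "act (tsec t A i) l k \<zeta> x \<in> cells (tsec t A i) l" using wfA_D(1)[OF A] by simp
    then show "act (TF t A) m n \<mu> \<phi> i l (act (tsec t A i) l k \<zeta> x, act (simplex m) l k \<zeta> \<xi>) =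
       act (tZ t i) l k \<zeta> (act (TF t A) m n \<mu> \<phi> i k (x, \<xi>))"
      using gfD(2)[OF g i(1,2,3), of "compD k \<mu> \<xi>"] i th by (simp add: TF_act comp_Dmap comp_D_assoc)
  next
    fix e k x \<xi> assume e: "e \<in> tE t" "x \<in> cells (tsec t A (ttgt t e)) k" "\<xi> \<in> cells (simplex m) k"
    have "rst A (tav t e) k x \<in> cells (tsec t A (tsrc t e)) k" using wfA_D(4)[OF A e(1)] e(2) by auto
    then show "act (TF t A) m n \<mu> \<phi> (tsrc t e) k (rst A (tav t e) k x, \<xi>) = tr t e k (act (TF t A) m n \<mu> \<phi> (ttgt t e) k (x, \<xi>))"
      using gfD(3)[OF g e(1,2), of "compD k \<mu> \<xi>"] e th wfA_D(2,3)[OF A e(1)] by (simp add: TF_act comp_Dmap)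
  next
    fix i k \<xi> assume "tp t" "i \<in> tI t" "\<xi> \<in> cells (simplex m) k"
    then show "act (TF t A) m n \<mu> \<phi> i k (bpt A (tov t i) k, \<xi>) = tb t i k"
      using gfD(4)[OF g] wfA_D(5)[OF A] th by (simp add: TF_act comp_Dmap)
  qed
  then show ?thesis unfolding TF_cells_iff by (auto simp: TF_def)
qed

lemma is_sset_TF [simp]:
  assumes A: "wfA t A"
  shows "is_sset (TF t A)"
proof (rule issI)
  fix n \<phi> assume p: "\<phi> \<in> cells (TF t A) n"
  show "act (TF t A) n n (idD n) \<phi> = \<phi>"
    by (rule TF_eqI[OF TF_act_cells[OF A id_Dmap p] p]) (simp add: TF_act)
next
  fix l m n \<eta> \<mu> \<phi> assume h: "\<eta> \<in> Dmap l m" "\<mu> \<in> Dmap m n" and p: "\<phi> \<in> cells (TF t A) n"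
  show "act (TF t A) l m \<eta> (act (TF t A) m n \<mu> \<phi>) = act (TF t A) l n (compD l \<mu> \<eta>) \<phi>"
    by (rule TF_eqI[OF TF_act_cells[OF A h(1) TF_act_cells[OF A h(2) p]] TF_act_cells[OF A _ p]])
      (use h in \<open>auto simp: TF_act comp_Dmap comp_D_assoc\<close>)
qed (rule TF_act_cells[OF A])

text \<open>The exponential law for \<open>TF\<close>: families on \<open>X\<close> correspond to
  simplicial maps from \<open>X\<close> into \<open>TF t A\<close>, with \<open>unc\<close> in the
  other direction.\<close>

definition cur :: "('i, 'e, 'o, 'a, 'z) tst => ('o, 'a, 'v) spre => 'x sset => ('i => nat => 'v \<times> 'x => 'z) =>
    nat => 'x => 'i => nat => 'v \<times> (nat => nat) => 'z" where
  "cur t A X \<psi> n \<xi> = (\<lambda>i k (x, \<eta>). if i \<in> tI t \<and> x \<in> cells (tsec t A i) k \<and> \<eta> \<in> Dmap k n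
      then \<psi> i k (x, act X k n \<eta> \<xi>) else undefined)"

text \<open>By naturality a map into \<open>TF\<close> is determined by its values at the identity
  simplex of each dimension, as in the Yoneda lemma.\<close>

definition unc where
  "unc \<phi> = (\<lambda>i k (x, \<xi>). \<phi> k \<xi> i k (x, idD k))"

lemma cur_map:
  assumes A: "wfA t A" and X: "is_sset X" and g: "gf t A X \<psi>"
  shows "sset_map X (TF t A) (cur t A X \<psi>)"
proof (rule smI)
  fix n \<xi> assume x: "\<xi> \<in> cells X n"
  have "gf t A (simplex n) (cur t A X \<psi> n \<xi>)"
  proof (rule gfI)
    fix i k y \<eta> assume "i \<in> tI t" "y \<in> cells (tsec t A i) k" "\<eta> \<in> cells (simplex n) k"
    then show "cur t A X \<psi> n \<xi> i k (y, \<eta>) \<in> cells (tZ t i) k"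
      using gfD(1)[OF g] X x by (simp add: cur_def)
  next
    fix i l k \<zeta> y \<eta> assume i: "i \<in> tI t" "\<zeta> \<in> Dmap l k" "y \<in> cells (tsec t A i) k" "\<eta> \<in> cells (simplex n) k"
    then have "act (tsec t A i) l k \<zeta> y \<in> cells (tsec t A i) l" using wfA_D(1)[OF A] by simp
    then show "cur t A X \<psi> n \<xi> i l (act (tsec t A i) l k \<zeta> y, act (simplex n) l k \<zeta> \<eta>) =
       act (tZ t i) l k \<zeta> (cur t A X \<psi> n \<xi> i k (y, \<eta>))"
      using gfD(2)[OF g i(1,2,3), of "act X k n \<eta> \<xi>"] i X x ss_comp[OF X i(2) _ x, of \<eta>] by (simp add: cur_def comp_Dmap)
  next
    fix e k y \<eta> assume e: "e \<in> tE t" "y \<in> cells (tsec t A (ttgt t e)) k" "\<eta> \<in> cells (simplex n) k"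
    have "rst A (tav t e) k y \<in> cells (tsec t A (tsrc t e)) k" using wfA_D(4)[OF A e(1)] e(2) by auto
    then show "cur t A X \<psi> n \<xi> (tsrc t e) k (rst A (tav t e) k y, \<eta>) = tr t e k (cur t A X \<psi> n \<xi> (ttgt t e) k (y, \<eta>))"
      using gfD(3)[OF g e(1,2), of "act X k n \<eta> \<xi>"] e X x wfA_D(2,3)[OF A e(1)] by (simp add: cur_def)
  next
    fix i k \<eta> assume "tp t" "i \<in> tI t" "\<eta> \<in> cells (simplex n) k"
    then show "cur t A X \<psi> n \<xi> i k (bpt A (tov t i) k, \<eta>) = tb t i k"
      using gfD(4)[OF g] wfA_D(5)[OF A] X x by (simp add: cur_def)
  qed
  then show "cur t A X \<psi> n \<xi> \<in> cells (TF t A) n" unfolding TF_cells_iff by (auto simp: cur_def)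
  fix m \<mu> assume th: "\<mu> \<in> Dmap m n"
  show "cur t A X \<psi> m (act X m n \<mu> \<xi>) = act (TF t A) m n \<mu> (cur t A X \<psi> n \<xi>)"
    using th x by (auto simp: cur_def TF_def fun_eq_iff ss_comp[OF X _ th x])
qed

lemma unc_gf:
  assumes A: "wfA t A" and X: "is_sset X" and \<phi>: "sset_map X (TF t A) \<phi>"
  shows "gf t A X (unc \<phi>)"
proof -
  have g: "gf t A (simplex n) (\<phi> n \<xi>)" if "\<xi> \<in> cells X n" for n \<xi>
    using sm_in[OF \<phi> that] by (simp add: TF_cells_iff)
  show ?thesis
  proof (rule gfI)
    fix i k x \<xi> assume "i \<in> tI t" "x \<in> cells (tsec t A i) k" "\<xi> \<in> cells X k"
    then show "unc \<phi> i k (x, \<xi>) \<in> cells (tZ t i) k" using gfD(1)[OF g] by (simp add: unc_def)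
  next
    fix i l k \<mu> x \<xi> assume i: "i \<in> tI t" "\<mu> \<in> Dmap l k" "x \<in> cells (tsec t A i) k" "\<xi> \<in> cells X k"
    have c: "act (tsec t A i) l k \<mu> x \<in> cells (tsec t A i) l" using i wfA_D(1)[OF A] by simp
    show "unc \<phi> i l (act (tsec t A i) l k \<mu> x, act X l k \<mu> \<xi>) = act (tZ t i) l k \<mu> (unc \<phi> i k (x, \<xi>))"
      using gfD(2)[OF g[OF i(4)] i(1,2,3), of "idD k"] i c sm_nat[OF \<phi> i(2,4)] by (simp add: unc_def TF_act)
  next
    fix e k x \<xi> assume e: "e \<in> tE t" "x \<in> cells (tsec t A (ttgt t e)) k" "\<xi> \<in> cells X k"
    then show "unc \<phi> (tsrc t e) k (rst A (tav t e) k x, \<xi>) = tr t e k (unc \<phi> (ttgt t e) k (x, \<xi>))"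
      using gfD(3)[OF g[OF e(3)] e(1,2)] by (simp add: unc_def)
  next
    fix i k \<xi> assume "tp t" "i \<in> tI t" "\<xi> \<in> cells X k"
    then show "unc \<phi> i k (bpt A (tov t i) k, \<xi>) = tb t i k" using gfD(4)[OF g] by (simp add: unc_def)
  qed
qed

lemma unc_cur: "is_sset X ==> i \<in> tI t ==> x \<in> cells (tsec t A i) k ==> \<xi> \<in> cells X k ==>
  unc (cur t A X \<psi>) i k (x, \<xi>) = \<psi> i k (x, \<xi>)"
  by (simp add: unc_def cur_def)

lemma TF_unc:
  assumes "sset_map X (TF t A) \<phi>" "\<xi> \<in> cells X n" "i \<in> tI t" "x \<in> cells (tsec t A i) k" "\<eta> \<in> Dmap k n"
  shows "\<phi> n \<xi> i k (x, \<eta>) = unc \<phi> i k (x, act X k n \<eta> \<xi>)"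
  using sm_nat[OF assms(1,5,2)] assms(3-5) by (simp add: unc_def TF_act)

text \<open>Nearly all later identities in function complexes are checked through this reduction to
  uncurried maps.\<close>

lemma TF_maps_eq:
  assumes "wfA t A" "sset_map X (TF t A) \<phi>" "sset_map X (TF t A) \<phi>'" "is_sset X" "\<xi> \<in> cells X n"
    and eq: "\<And>i k x \<zeta>. i \<in> tI t ==> x \<in> cells (tsec t A i) k ==> \<zeta> \<in> cells X k ==>
       unc \<phi> i k (x, \<zeta>) = unc \<phi>' i k (x, \<zeta>)"
  shows "\<phi> n \<xi> = \<phi>' n \<xi>"
  by (rule TF_eqI[OF sm_in[OF assms(2,5)] sm_in[OF assms(3,5)]])
    (use eq assms(4,5) in \<open>simp add: TF_unc[OF assms(2,5)] TF_unc[OF assms(3,5)]\<close>)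

lemma TF_maps_eq_on:
  assumes "wfA t A" "sset_map (sub X U) (TF t A) \<phi>" "sset_map (sub X U) (TF t A) \<phi>'" "is_sset X" "subc X U" "\<xi> \<in> U n"
    and eq: "\<And>i k x \<zeta>. i \<in> tI t ==> x \<in> cells (tsec t A i) k ==> \<zeta> \<in> U k ==>
       unc \<phi> i k (x, \<zeta>) = unc \<phi>' i k (x, \<zeta>)"
  shows "\<phi> n \<xi> = \<phi>' n \<xi>"
  by (rule TF_maps_eq[OF assms(1-3) is_sset_sub[OF assms(4,5)]]) (use assms(6) eq in auto)

definition wfm :: "('i, 'e, 'o, 'a, 'z) tst => ('o, 'a, 'v) spre => ('o => nat => 'v => 'w) => ('o, 'a, 'w) spre => bool" where
  "wfm t A f B \<longleftrightarrow>
     (\<forall>i\<in>tI t. sset_map (tsec t A i) (tsec t B i) (f (tov t i))) \<and>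
     (\<forall>e\<in>tE t. \<forall>k. \<forall>x\<in>cells (tsec t A (ttgt t e)) k.
        f (tov t (tsrc t e)) k (rst A (tav t e) k x) = rst B (tav t e) k (f (tov t (ttgt t e)) k x)) \<and>
     (tp t \<longrightarrow> (\<forall>i\<in>tI t. \<forall>k. f (tov t i) k (bpt A (tov t i) k) = bpt B (tov t i) k))"

definition Tpre :: "('i, 'e, 'o, 'a, 'z) tst => ('o, 'a, 'v) spre => ('o => nat => 'v => 'w) =>
    nat => ('i => nat => 'w \<times> (nat => nat) => 'z) => 'i => nat => 'v \<times> (nat => nat) => 'z" where
  "Tpre t A f n \<psi> = (\<lambda>i k (x, \<eta>). if i \<in> tI t \<and> x \<in> cells (tsec t A i) k \<and> \<eta> \<in> Dmap k n
      then \<psi> i k (f (tov t i) k x, \<eta>) else undefined)"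

lemma gf_pre:
  assumes A: "wfA t A" and f: "wfm t A f B" and g: "gf t B X \<psi>"
  shows "gf t A X (\<lambda>i k (x, \<xi>). \<psi> i k (f (tov t i) k x, \<xi>))"
proof -
  have m: "sset_map (tsec t A i) (tsec t B i) (f (tov t i))" if "i \<in> tI t" for i using f that by (simp add: wfm_def)
  show ?thesis
  proof (rule gfI)
    fix i k x \<xi> assume "i \<in> tI t" "x \<in> cells (tsec t A i) k" "\<xi> \<in> cells X k"
    then show "(case (x, \<xi>) of (x, \<xi>) => \<psi> i k (f (tov t i) k x, \<xi>)) \<in> cells (tZ t i) k"
      using gfD(1)[OF g] sm_in[OF m] by simp
  next
    fix i l k \<mu> x \<xi> assume i: "i \<in> tI t" "\<mu> \<in> Dmap l k" "x \<in> cells (tsec t A i) k" "\<xi> \<in> cells X k"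
    show "(case (act (tsec t A i) l k \<mu> x, act X l k \<mu> \<xi>) of (x, \<xi>) => \<psi> i l (f (tov t i) l x, \<xi>)) =
       act (tZ t i) l k \<mu> (case (x, \<xi>) of (x, \<xi>) => \<psi> i k (f (tov t i) k x, \<xi>))"
      using gfD(2)[OF g i(1,2) sm_in[OF m[OF i(1)] i(3)] i(4)] sm_nat[OF m[OF i(1)] i(2,3)] by simp
  next
    fix e k x \<xi> assume e: "e \<in> tE t" "x \<in> cells (tsec t A (ttgt t e)) k" "\<xi> \<in> cells X k"
    then show "(case (rst A (tav t e) k x, \<xi>) of (x, \<xi>) => \<psi> (tsrc t e) k (f (tov t (tsrc t e)) k x, \<xi>)) =
        tr t e k (case (x, \<xi>) of (x, \<xi>) => \<psi> (ttgt t e) k (f (tov t (ttgt t e)) k x, \<xi>))"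
      using gfD(3)[OF g e(1) sm_in[OF m[OF wfA_D(3)[OF A e(1)]] e(2)] e(3)] f by (simp add: wfm_def)
  next
    fix i k \<xi> assume "tp t" "i \<in> tI t" "\<xi> \<in> cells X k"
    then show "(case (bpt A (tov t i) k, \<xi>) of (x, \<xi>) => \<psi> i k (f (tov t i) k x, \<xi>)) = tb t i k"
      using gfD(4)[OF g] f by (simp add: wfm_def)
  qed
qed

lemma Tpre_map:
  assumes A: "wfA t A" and f: "wfm t A f B"
  shows "sset_map (TF t B) (TF t A) (Tpre t A f)"
proof (rule smI)
  fix n \<psi> assume p: "\<psi> \<in> cells (TF t B) n"
  then have g: "gf t B (simplex n) \<psi>" by (simp add: TF_cells_iff)
  have 1: "gf t A (simplex n) (\<lambda>i k (x, \<xi>). \<psi> i k (f (tov t i) k x, \<xi>))" by (rule gf_pre[OF A f g])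
  have "gf t A (simplex n) (Tpre t A f n \<psi>)"
    by (rule gfI) (use gfD[OF 1] wfA_D[OF A] wfA_D(4)[OF A, THEN sm_in] in \<open>auto simp: Tpre_def comp_Dmap\<close>)
  then show "Tpre t A f n \<psi> \<in> cells (TF t A) n" unfolding TF_cells_iff by (auto simp: Tpre_def)
next
  fix m n \<mu> \<psi> assume th: "\<mu> \<in> Dmap m n" and p: "\<psi> \<in> cells (TF t B) n"
  have m: "sset_map (tsec t A i) (tsec t B i) (f (tov t i))" if "i \<in> tI t" for i using f that by (simp add: wfm_def)
  show "Tpre t A f m (act (TF t B) m n \<mu> \<psi>) = act (TF t A) m n \<mu> (Tpre t A f n \<psi>)"
    using th m[THEN sm_in] by (auto simp: Tpre_def TF_def fun_eq_iff comp_Dmap)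
qed

lemma Tpre_unc: "i \<in> tI t ==> x \<in> cells (tsec t A i) k ==>
   unc (\<lambda>n \<xi>. Tpre t A f n (\<phi> n \<xi>)) i k (x, \<xi>) = unc \<phi> i k (f (tov t i) k x, \<xi>)"
  by (simp add: unc_def Tpre_def)

subsection \<open>Function complexes of simplicial sets\<close>

text \<open>The diagram with one object, no arrows and no base point: \<open>Fn S Q\<close> becomes
  the ordinary function complex and inherits the exponential law from \<open>TF\<close>. The field
  \<open>tb\<close> is arbitrary because \<open>tp\<close> is false.\<close>

definition ftest :: "'z sset => (unit, unit, unit, unit, 'z) tst" where
  "ftest Q = \<lparr>tI = UNIV, tE = {}, tsrc = id, ttgt = id, tov = id, tav = id, tZ = (\<lambda>_. Q),
     tr = (\<lambda>_ _ x. x), tb = undefined, tp = False\<rparr>"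

definition cst :: "'x sset => (unit, unit, 'x) spre" where
  "cst S = \<lparr>sec = (\<lambda>_. S), rst = (\<lambda>_ _ x. x), bpt = undefined\<rparr>"

abbreviation Fn where "Fn S Q \<equiv> TF (ftest Q) (cst S)"

lemma gf_ftest: "gf (ftest Q) (cst S) X \<psi> \<longleftrightarrow> sset_map (sset_prod S X) Q (\<psi> ())"
  by (simp add: gf_def ftest_def cst_def)

lemma wfA_ftest [simp]: "is_sset S ==> wfA (ftest Q) (cst S)"
  by (simp add: wfA_def ftest_def cst_def)

definition ucur where "ucur S Q X \<psi> = cur (ftest Q) (cst S) X (\<lambda>_. \<psi>)"
definition uunc where "uunc \<phi> = unc \<phi> ()"

lemma ucur_map: "is_sset S ==> is_sset X ==> sset_map (sset_prod S X) Q \<psi> ==> sset_map X (Fn S Q) (ucur S Q X \<psi>)"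
  unfolding ucur_def by (rule cur_map) (simp_all add: gf_ftest)

lemma uunc_map: "is_sset S ==> is_sset X ==> sset_map X (Fn S Q) \<phi> ==> sset_map (sset_prod S X) Q (uunc \<phi>)"
  unfolding uunc_def using unc_gf[of "ftest Q" "cst S" X \<phi>] by (simp add: gf_ftest)

lemma uunc_ucur: "is_sset X ==> x \<in> cells S k ==> \<xi> \<in> cells X k ==> uunc (ucur S Q X \<psi>) k (x, \<xi>) = \<psi> k (x, \<xi>)"
  unfolding uunc_def ucur_def by (subst unc_cur) (simp_all add: ftest_def cst_def)

lemma Fn_eq_on:
  assumes "is_sset S" "sset_map (sub X U) (Fn S Q) \<phi>" "sset_map (sub X U) (Fn S Q) \<phi>'" "is_sset X" "subc X U" "\<xi> \<in> U n"
    and eq: "\<And>k x \<zeta>. x \<in> cells S k ==> \<zeta> \<in> U k ==> uunc \<phi> k (x, \<zeta>) = uunc \<phi>' k (x, \<zeta>)"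
  shows "\<phi> n \<xi> = \<phi>' n \<xi>"
  by (rule TF_maps_eq_on[OF wfA_ftest[OF assms(1)] assms(2-6)]) (use eq in \<open>simp add: uunc_def cst_def ftest_def\<close>)

lemma Fn_eq:
  assumes "is_sset S" "sset_map X (Fn S Q) \<phi>" "sset_map X (Fn S Q) \<phi>'" "is_sset X" "\<xi> \<in> cells X n"
    and eq: "\<And>k x \<zeta>. x \<in> cells S k ==> \<zeta> \<in> cells X k ==> uunc \<phi> k (x, \<zeta>) = uunc \<phi>' k (x, \<zeta>)"
  shows "\<phi> n \<xi> = \<phi>' n \<xi>"
  by (rule TF_maps_eq[OF wfA_ftest[OF assms(1)] assms(2-5)]) (use eq in \<open>simp add: uunc_def cst_def ftest_def\<close>)

subsection \<open>Homotopy extension for Kan complexes\<close>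

text \<open>Simplification would otherwise turn \<open>1\<close> into a successor, and the terms
  \<open>simplex 1\<close> and \<open>cD 1 n\<close>, which occur in every homotopy, would no longer
  match.\<close>

declare One_nat_def [simp del]

section \<open>The prism \<Delta>[n] x \<Delta>[1] and its maximal simplices\<close>

definition pV :: "nat => nat => nat => ((nat => nat) \<times> (nat => nat)) set" where
  "pV n j m = {(\<alpha>, \<beta>). \<alpha> \<in> Dmap m n \<and> \<beta> \<in> Dmap m 1 \<and>
     (\<forall>r\<le>m. (\<beta> r = 0 \<longrightarrow> \<alpha> r \<le> j) \<and> (\<beta> r \<noteq> 0 \<longrightarrow> j \<le> \<alpha> r))}"

text \<open>The pair of \<open>pA n j\<close> and \<open>pB n j\<close> is the maximal simplex that
  runs through the vertices \<open>(0,0), ..., (j,0), (j,1), ..., (n,1)\<close>;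
  \<open>pV n j\<close> above is the subcomplex generated by it
  (\<open>p_act_range\<close>).\<close>

definition pA :: "nat => nat => nat => nat" where
  "pA n j = (\<lambda>r\<in>{..Suc n}. if r \<le> j then r else r - 1)"

definition pB :: "nat => nat => nat => nat" where
  "pB n j = (\<lambda>r\<in>{..Suc n}. if r \<le> j then 0 else 1)"

definition pbase :: "nat => nat => nat => ((nat => nat) \<times> (nat => nat)) set" where
  "pbase n e m = {(\<alpha>, \<beta>). \<alpha> \<in> Dmap m n \<and> \<beta> \<in> Dmap m 1 \<and> (\<alpha> \<in> bd n m \<or> \<beta> = cD e m)}"

lemma subc_pbase [simp]: "e \<le> 1 ==> subc (sset_prod (simplex n) (simplex 1)) (pbase n e)"
  by (rule subcI) (auto simp: pbase_def intro: subc_act[OF subc_bd, simplified])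

lemma pA_Dmap: "j \<le> n ==> pA n j \<in> Dmap (Suc n) n"
  by (rule DmapI) (auto simp: pA_def)

lemma pB_Dmap: "pB n j \<in> Dmap (Suc n) 1"
  by (rule DmapI) (auto simp: pB_def)

lemma p_act:
  assumes "\<mu> \<in> Dmap m (Suc n)" "r \<le> m"
  shows "compD m (pA n j) \<mu> r = (if \<mu> r \<le> j then \<mu> r else \<mu> r - 1)"
    "compD m (pB n j) \<mu> r = (if \<mu> r \<le> j then 0 else 1)"
  using Dmap_le[OF assms] assms(2) by (simp_all add: compose_def pA_def pB_def)

lemma p_act_inj:
  assumes "\<mu> \<in> Dmap m (Suc n)" "\<mu>' \<in> Dmap m (Suc n)"
    "compD m (pA n j) \<mu> = compD m (pA n j) \<mu>'" "compD m (pB n j) \<mu> = compD m (pB n j) \<mu>'"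
  shows "\<mu> = \<mu>'"
proof (rule Dmap_eqI[OF assms(1,2)])
  fix r assume r: "r \<le> m"
  have a: "(if \<mu> r \<le> j then \<mu> r else \<mu> r - 1) = (if \<mu>' r \<le> j then \<mu>' r else \<mu>' r - 1)"
    using fun_cong[OF assms(3), of r] p_act(1)[OF assms(1) r] p_act(1)[OF assms(2) r] by simp
  have b: "(if \<mu> r \<le> j then 0 else 1::nat) = (if \<mu>' r \<le> j then 0 else 1)"
    using fun_cong[OF assms(4), of r] p_act(2)[OF assms(1) r] p_act(2)[OF assms(2) r] by simp
  show "\<mu> r = \<mu>' r"
    using a b by (cases "\<mu> r \<le> j"; cases "\<mu>' r \<le> j") simp_all
qed

lemma p_act_range:
  assumes j: "j \<le> n"
  shows "{act (sset_prod (simplex n) (simplex 1)) m (Suc n) \<mu> (pA n j, pB n j) | \<mu>. \<mu> \<in> Dmap m (Suc n)} = pV n j m"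
proof (intro equalityI subsetI, goal_cases)
  case (1 x)
  then obtain \<mu> where t: "\<mu> \<in> Dmap m (Suc n)" "x = (compD m (pA n j) \<mu>, compD m (pB n j) \<mu>)" by auto
  then show ?case using p_act[OF t(1)] comp_Dmap[OF pA_Dmap[OF j] t(1)] comp_Dmap[OF pB_Dmap t(1)] by (auto simp: pV_def)
next
  case (2 x)
  then obtain \<alpha> \<beta> where x: "x = (\<alpha>, \<beta>)" and a: "\<alpha> \<in> Dmap m n" and b: "\<beta> \<in> Dmap m 1"
    and r: "\<And>r. r \<le> m ==> \<beta> r = 0 ==> \<alpha> r \<le> j" "\<And>r. r \<le> m ==> \<beta> r \<noteq> 0 ==> j \<le> \<alpha> r"
    by (auto simp: pV_def)
  \<comment> \<open>Shifting \<alpha> by one over the end \<open>1\<close> inverts the pair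
    \<open>pA\<close>, \<open>pB\<close>.\<close>
  define \<mu> where "\<mu> = (\<lambda>r\<in>{..m}. if \<beta> r = 0 then \<alpha> r else Suc (\<alpha> r))"
  have t: "\<mu> \<in> Dmap m (Suc n)"
  proof (rule DmapI, goal_cases)
    case (1 i) then show ?case using Dmap_le[OF a 1] by (simp add: \<mu>_def)
  next
    case (2 i) then show ?case by (simp add: \<mu>_def)
  next
    case (3 i k) then show ?case using Dmap_mono[OF a 3] Dmap_mono[OF b 3] by (auto simp: \<mu>_def)
  qed
  have "compD m (pA n j) \<mu> = \<alpha>"
  proof (rule Dmap_eqI[OF comp_Dmap[OF pA_Dmap[OF j] t] a])
    fix i assume i: "i \<le> m"
    show "compD m (pA n j) \<mu> i = \<alpha> i" unfolding p_act(1)[OF t i] using r[OF i] i by (auto simp: \<mu>_def)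
  qed
  moreover have "compD m (pB n j) \<mu> = \<beta>"
  proof (rule Dmap_eqI[OF comp_Dmap[OF pB_Dmap t] b])
    fix i assume i: "i \<le> m"
    show "compD m (pB n j) \<mu> i = \<beta> i" unfolding p_act(2)[OF t i] using r[OF i] i Dmap_le[OF b i] by (auto simp: \<mu>_def)
  qed
  ultimately show ?case using t x by auto
qed

text \<open>The index is the value of \<alpha> at the first vertex over the end \<open>1\<close>, or
  \<open>n\<close> if there is no such vertex.\<close>

lemma p_cover:
  assumes "\<alpha> \<in> Dmap m n" "\<beta> \<in> Dmap m 1"
  shows "\<exists>j\<le>n. (\<alpha>, \<beta>) \<in> pV n j m"
proof (cases "\<exists>r\<le>m. \<beta> r \<noteq> 0")
  case True
  define r0 where "r0 = (LEAST r. r \<le> m \<and> \<beta> r \<noteq> 0)"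
  have r0: "r0 \<le> m \<and> \<beta> r0 \<noteq> 0" unfolding r0_def by (rule LeastI_ex) (use True in blast)
  have "\<alpha> r \<le> \<alpha> r0" if "r \<le> m" "\<beta> r = 0" for r
  proof (rule Dmap_mono[OF assms(1)])
    show "r \<le> r0" using Dmap_mono[OF assms(2), of r0 r] that r0 by (cases "r0 \<le> r") auto
  qed (use r0 in simp)
  moreover have "\<alpha> r0 \<le> \<alpha> r" if "r \<le> m" "\<beta> r \<noteq> 0" for r
    by (rule Dmap_mono[OF assms(1) _ that(1)]) (use that in \<open>auto simp: r0_def intro: Least_le\<close>)
  ultimately show ?thesis using r0 assms Dmap_le[OF assms(1), of r0] by (intro exI[of _ "\<alpha> r0"]) (auto simp: pV_def)
next
  case False
  then show ?thesis using assms Dmap_le[OF assms(1)] by (intro exI[of _ n]) (auto simp: pV_def)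
qed

text \<open>When the maximal simplices are attached in decreasing order, starting from the end
  \<open>0\<close>, the one with index \<open>i\<close> finds all its faces present except the face
  opposite to vertex \<open>i\<close>. That face belongs to the simplex attached next, or to the end
  \<open>1\<close> if \<open>i = 0\<close>.\<close>

lemma p_horn0:
  assumes t: "\<mu> \<in> Dmap m (Suc n)" and i: "i \<le> n"
  shows "(compD m (pA n i) \<mu>, compD m (pB n i) \<mu>) \<in> pbase n 0 m \<union> (\<Union>j\<in>{Suc i..n}. pV n j m) \<longleftrightarrow>
     \<mu> \<in> hn (Suc n) i m"
proof -
  define \<alpha> \<beta> where "\<alpha> = compD m (pA n i) \<mu>" and "\<beta> = compD m (pB n i) \<mu>"
  have a: "\<alpha> \<in> Dmap m n" and b: "\<beta> \<in> Dmap m 1" unfolding \<alpha>_def \<beta>_def using pA_Dmap[OF i] pB_Dmap t by auto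
  have ar: "\<alpha> r = (if \<mu> r \<le> i then \<mu> r else \<mu> r - 1)" "\<beta> r = (if \<mu> r \<le> i then 0 else 1)" if "r \<le> m" for r
    using p_act[OF t that] by (simp_all add: \<alpha>_def \<beta>_def)
  show ?thesis unfolding \<alpha>_def[symmetric] \<beta>_def[symmetric]
  proof
    assume "\<mu> \<in> hn (Suc n) i m"
    then obtain v where v: "v \<le> Suc n" "v \<noteq> i" "\<And>r. r \<le> m ==> \<mu> r \<noteq> v" by (auto simp: hn_def)
    \<comment> \<open>The face opposite to \<open>Suc i\<close> is shared with the simplex attached
      just before, or is the end \<open>0\<close> if \<open>i = n\<close>; all faces opposite to
      other vertices project into the boundary of \<Delta>[n].\<close>
    consider "v < i" | "v = Suc i" "i < n" | "v = Suc i" "i = n" | "v > Suc i" using v i by linarith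
    then show "(\<alpha>, \<beta>) \<in> pbase n 0 m \<union> (\<Union>j\<in>{Suc i..n}. pV n j m)"
    proof cases
      case 1
      have "\<alpha> r \<noteq> v" if "r \<le> m" for r using ar(1)[OF that] v(3)[OF that] 1 by (auto split: if_splits)
      then have "v \<notin> \<alpha> ` {..m}" by auto
      moreover have "v \<le> n" using 1 i by simp
      ultimately have "\<alpha> \<in> bd n m" using a by (auto simp: bd_def)
      then show ?thesis using a b by (simp add: pbase_def)
    next
      case 2
      have "(\<alpha>, \<beta>) \<in> pV n (Suc i) m" using a b ar v(3) 2 by (fastforce simp: pV_def)
      then show ?thesis using 2 by (auto simp del: pV_def)
    next
      case 3
      have "\<mu> r \<le> i" if "r \<le> m" for r using Dmap_le[OF t that] v(3)[OF that] 3 by linarith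
      then have "\<beta> = cD 0 m" using ar(2) by (intro Dmap_eqI[OF b const_Dmap]) auto
      then show ?thesis using a b by (simp add: pbase_def)
    next
      case 4
      have "\<alpha> r \<noteq> v - 1" if "r \<le> m" for r using ar(1)[OF that] v(3)[OF that] 4 by (auto split: if_splits)
      then have "v - 1 \<notin> \<alpha> ` {..m}" by (metis atMost_iff imageE)
      moreover have "v - 1 \<le> n" using v by simp
      ultimately have "\<alpha> \<in> bd n m" using a by (auto simp: bd_def)
      then show ?thesis using a b by (simp add: pbase_def)
    qed
  next
    assume asm: "(\<alpha>, \<beta>) \<in> pbase n 0 m \<union> (\<Union>j\<in>{Suc i..n}. pV n j m)"
    show "\<mu> \<in> hn (Suc n) i m"
    proof (rule ccontr)
      assume "\<mu> \<notin> hn (Suc n) i m"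
      then have s: "{..Suc n} - {i} \<subseteq> \<mu> ` {..m}" using t by (simp add: hn_def)
      have ex: "\<exists>r\<le>m. \<mu> r = v" if "v \<le> Suc n" "v \<noteq> i" for v using s that by (auto simp: image_iff subset_iff)
      obtain r where r: "r \<le> m" "\<mu> r = Suc i" using ex[of "Suc i"] i by auto
      have 1: "\<beta> \<noteq> cD 0 m" using ar(2)[OF r(1)] r by auto
      have "\<exists>r\<le>m. \<alpha> r = v" if v: "v \<le> n" for v
      proof (cases "v < i")
        case True
        then obtain r where "r \<le> m" "\<mu> r = v" using ex[of v] v by auto
        then show ?thesis using ar(1) True by (intro exI[of _ r]) auto
      next
        case False
        then obtain r where "r \<le> m" "\<mu> r = Suc v" using ex[of "Suc v"] v by auto
        then show ?thesis using ar(1) False by (intro exI[of _ r]) auto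
      qed
      then have 2: "\<alpha> \<notin> bd n m" by (auto simp: bd_def image_iff)
      from asm 1 2 obtain j where "Suc i \<le> j" "(\<alpha>, \<beta>) \<in> pV n j m" by (auto simp: pbase_def)
      then show False using ar[OF r(1)] r by (auto simp: pV_def)
    qed
  qed
qed

text \<open>The mirror image of \<open>p_horn0\<close>: starting from the end \<open>1\<close> the
  order of attachment is increasing, and the missing face is the one opposite to vertex
  \<open>Suc i\<close>.\<close>

lemma p_horn1:
  assumes t: "\<mu> \<in> Dmap m (Suc n)" and i: "i \<le> n"
  shows "(compD m (pA n i) \<mu>, compD m (pB n i) \<mu>) \<in> pbase n 1 m \<union> (\<Union>j\<in>{..<i}. pV n j m) \<longleftrightarrow>
     \<mu> \<in> hn (Suc n) (Suc i) m"
proof -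
  define \<alpha> \<beta> where "\<alpha> = compD m (pA n i) \<mu>" and "\<beta> = compD m (pB n i) \<mu>"
  have a: "\<alpha> \<in> Dmap m n" and b: "\<beta> \<in> Dmap m 1" unfolding \<alpha>_def \<beta>_def using pA_Dmap[OF i] pB_Dmap t by auto
  have ar: "\<alpha> r = (if \<mu> r \<le> i then \<mu> r else \<mu> r - 1)" "\<beta> r = (if \<mu> r \<le> i then 0 else 1)" if "r \<le> m" for r
    using p_act[OF t that] by (simp_all add: \<alpha>_def \<beta>_def)
  show ?thesis unfolding \<alpha>_def[symmetric] \<beta>_def[symmetric]
  proof
    assume "\<mu> \<in> hn (Suc n) (Suc i) m"
    then obtain v where v: "v \<le> Suc n" "v \<noteq> Suc i" "\<And>r. r \<le> m ==> \<mu> r \<noteq> v" by (auto simp: hn_def)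
    consider "v < i" | "v = i" "0 < i" | "v = i" "i = 0" | "v > Suc i" using v i by linarith
    then show "(\<alpha>, \<beta>) \<in> pbase n 1 m \<union> (\<Union>j\<in>{..<i}. pV n j m)"
    proof cases
      case 1
      have "\<alpha> r \<noteq> v" if "r \<le> m" for r using ar(1)[OF that] v(3)[OF that] 1 by (auto split: if_splits)
      then have "v \<notin> \<alpha> ` {..m}" by auto
      moreover have "v \<le> n" using 1 i by simp
      ultimately have "\<alpha> \<in> bd n m" using a by (auto simp: bd_def)
      then show ?thesis using a b by (simp add: pbase_def)
    next
      case 2
      have "(\<alpha>, \<beta>) \<in> pV n (i - 1) m" using a b ar v(3) 2 by (fastforce simp: pV_def)
      moreover have "i - 1 \<in> {..<i}" using 2 by simp
      ultimately show ?thesis by blast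
    next
      case 3
      have "\<not> \<mu> r \<le> i" if "r \<le> m" for r using v(3)[OF that] 3 by linarith
      then have "\<beta> = cD 1 m" using ar(2) by (intro Dmap_eqI[OF b const_Dmap]) auto
      then show ?thesis using a b by (simp add: pbase_def)
    next
      case 4
      have "\<alpha> r \<noteq> v - 1" if "r \<le> m" for r using ar(1)[OF that] v(3)[OF that] 4 by (auto split: if_splits)
      then have "v - 1 \<notin> \<alpha> ` {..m}" by (metis atMost_iff imageE)
      moreover have "v - 1 \<le> n" using v by simp
      ultimately have "\<alpha> \<in> bd n m" using a by (auto simp: bd_def)
      then show ?thesis using a b by (simp add: pbase_def)
    qed
  next
    assume asm: "(\<alpha>, \<beta>) \<in> pbase n 1 m \<union> (\<Union>j\<in>{..<i}. pV n j m)"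
    show "\<mu> \<in> hn (Suc n) (Suc i) m"
    proof (rule ccontr)
      assume "\<mu> \<notin> hn (Suc n) (Suc i) m"
      then have s: "{..Suc n} - {Suc i} \<subseteq> \<mu> ` {..m}" using t by (simp add: hn_def)
      have ex: "\<exists>r\<le>m. \<mu> r = v" if "v \<le> Suc n" "v \<noteq> Suc i" for v using s that by (auto simp: image_iff subset_iff)
      obtain r where r: "r \<le> m" "\<mu> r = i" using ex[of i] i by auto
      have 1: "\<beta> \<noteq> cD 1 m" using ar(2)[OF r(1)] r by auto
      have "\<exists>r\<le>m. \<alpha> r = v" if v: "v \<le> n" for v
      proof (cases "v \<le> i")
        case True
        then obtain r where "r \<le> m" "\<mu> r = v" using ex[of v] v by auto
        then show ?thesis using ar(1) True by (intro exI[of _ r]) auto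
      next
        case False
        then obtain r where "r \<le> m" "\<mu> r = Suc v" using ex[of "Suc v"] v by auto
        then show ?thesis using ar(1) False by (intro exI[of _ r]) auto
      qed
      then have 2: "\<alpha> \<notin> bd n m" by (auto simp: bd_def image_iff)
      from asm 1 2 obtain j where "j < i" "(\<alpha>, \<beta>) \<in> pV n j m" by (auto simp: pbase_def)
      then show False using ar[OF r(1)] r by (auto simp: pV_def)
    qed
  qed
qed

lemma kanD: "kan_complex Z ==> is_sset Z"
  "kan_complex Z ==> 1 \<le> n ==> k \<le> n ==> sset_map (sub (simplex n) (hn n k)) Z f ==>
    \<exists>g. sset_map (simplex n) Z g \<and> (\<forall>m. \<forall>\<mu>\<in>hn n k m. g m \<mu> = f m \<mu>)"
  unfolding kan_complex_def horn_eq by simp_all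

lemma prism_step:
  assumes Q: "kan_complex Q" and i: "i \<le> n" and k: "k \<le> Suc n"
    and G: "parmap (sset_prod (simplex n) (simplex 1)) Q G"
    and 1: "\<And>m \<mu>. \<mu> \<in> Dmap m (Suc n) ==>
      (compD m (pA n i) \<mu>, compD m (pB n i) \<mu>) \<in> gdom G m \<longleftrightarrow> \<mu> \<in> hn (Suc n) k m"
  shows "\<exists>G'. parmap (sset_prod (simplex n) (simplex 1)) Q G' \<and> G \<subseteq> G' \<and> (\<forall>m. gdom G' m = gdom G m \<union> pV n i m)"
proof -
  let ?X = "sset_prod (simplex n) (simplex 1)"
  have "\<exists>G'. parmap ?X Q G' \<and> G \<subseteq> G' \<and> (\<forall>m x y. (m, x, y) \<in> G' \<longrightarrow> True) \<and>
     (\<forall>m. gdom G' m = gdom G m \<union> {act ?X m (Suc n) \<mu> (pA n i, pB n i) | \<mu>. \<mu> \<in> Dmap m (Suc n)})"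
  proof (rule attach[OF _ kanD(1)[OF Q] G, where \<Theta> = "hn (Suc n) k"])
    show "(pA n i, pB n i) \<in> cells ?X (Suc n)" using pA_Dmap[OF i] pB_Dmap by simp
    show "(act ?X m (Suc n) \<mu> (pA n i, pB n i) \<in> gdom G m) = (\<mu> \<in> hn (Suc n) k m)" if "\<mu> \<in> Dmap m (Suc n)" for m \<mu>
      using 1[OF that] by simp
    show "\<mu> = \<mu>'" if "\<mu> \<in> Dmap m (Suc n)" "\<mu>' \<in> Dmap m (Suc n)"
      "act ?X m (Suc n) \<mu> (pA n i, pB n i) = act ?X m (Suc n) \<mu>' (pA n i, pB n i)" for m \<mu> \<mu>'
      using p_act_inj[OF that(1,2)] that(3) by auto
    show "\<exists>g. sset_map (simplex (Suc n)) Q g \<and> (\<forall>m. \<forall>\<mu>\<in>hn (Suc n) k m. g m \<mu> = a m \<mu>) \<and>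
       (\<forall>m. \<forall>\<mu>\<in>Dmap m (Suc n). True)" if "sset_map (sub (simplex (Suc n)) (hn (Suc n) k)) Q a" for a
      using kanD(2)[OF Q _ k that] by auto
  qed (auto simp: hn_def)
  then show ?thesis unfolding p_act_range[OF i] by blast
qed

lemma prism:
  assumes Q: "kan_complex Q" and e: "e \<le> 1"
    and h: "sset_map (sub (sset_prod (simplex n) (simplex 1)) (pbase n e)) Q h"
  shows "\<exists>g. sset_map (sset_prod (simplex n) (simplex 1)) Q g \<and> (\<forall>m. \<forall>x\<in>pbase n e m. g m x = h m x)"
proof -
  let ?X = "sset_prod (simplex n) (simplex 1)"
  define G0 where "G0 = {(m, x, h m x) | m x. x \<in> pbase n e m}"
  have G0: "parmap ?X Q G0" unfolding G0_def by (rule parmap_of_map[OF subc_pbase[OF e] h])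
  have d0: "gdom G0 m = pbase n e m" for m by (auto simp: G0_def gdom_def)
  have "\<exists>G. parmap ?X Q G \<and> G0 \<subseteq> G \<and> (\<forall>m. gdom G m = pbase n e m \<union> (\<Union>j\<in>{..n}. pV n j m))"
  \<comment> \<open>The order of attachment depends on the given end: downwards from
    \<open>n\<close> for the end \<open>0\<close>, where \<open>d\<close> counts the simplices
    attached so far, and upwards from \<open>0\<close> for the end \<open>1\<close>.\<close>
  proof (cases "e = 0")
    case True
    have "\<exists>G. parmap ?X Q G \<and> G0 \<subseteq> G \<and> (\<forall>m. gdom G m = pbase n 0 m \<union> (\<Union>j\<in>{Suc n - d..n}. pV n j m))"
      if "d \<le> Suc n" for d
      using that
    proof (induction d)
      case 0
      show ?case using G0 d0 True by (intro exI[of _ G0]) auto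
    next
      case (Suc d)
      then obtain G where G: "parmap ?X Q G" "G0 \<subseteq> G"
        "\<And>m. gdom G m = pbase n 0 m \<union> (\<Union>j\<in>{Suc n - d..n}. pV n j m)" by auto
      have "n - d \<le> n \<and> Suc n - d = Suc (n - d) \<and> Suc n - Suc d = n - d" using Suc by auto
      then obtain i where i: "i \<le> n" "Suc n - d = Suc i" "Suc n - Suc d = i" by blast
      have iv: "{i..n} = insert i {Suc i..n}" using i by auto
      obtain G' where "parmap ?X Q G'" "G \<subseteq> G'" "\<And>m. gdom G' m = gdom G m \<union> pV n i m"
        using prism_step[OF Q i(1) _ G(1), of i] i p_horn0[OF _ i(1)] unfolding G(3) by (auto simp del: UN_iff Un_iff)
      moreover have "gdom G' m = pbase n 0 m \<union> (\<Union>j\<in>{Suc n - Suc d..n}. pV n j m)" for m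
        unfolding i(3) iv \<open>gdom G' m = gdom G m \<union> pV n i m\<close> G(3) i(2) by blast
      ultimately show ?case using G(2) by blast
    qed
    from this[of "Suc n"] show ?thesis using True by (simp add: atLeast0AtMost)
  next
    case False
    then have e1: "e = 1" using e by simp
    have "\<exists>G. parmap ?X Q G \<and> G0 \<subseteq> G \<and> (\<forall>m. gdom G m = pbase n 1 m \<union> (\<Union>j\<in>{..<i}. pV n j m))"
      if "i \<le> Suc n" for i
      using that
    proof (induction i)
      case 0
      show ?case using G0 d0 e1 by (intro exI[of _ G0]) auto
    next
      case (Suc i)
      then obtain G where G: "parmap ?X Q G" "G0 \<subseteq> G"
        "\<And>m. gdom G m = pbase n 1 m \<union> (\<Union>j\<in>{..<i}. pV n j m)" by auto
      have i: "i \<le> n" using Suc by simp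
      obtain G' where "parmap ?X Q G'" "G \<subseteq> G'" "\<And>m. gdom G' m = gdom G m \<union> pV n i m"
        using prism_step[OF Q i _ G(1), of "Suc i"] i p_horn1[OF _ i] unfolding G(3) by (auto simp del: UN_iff Un_iff)
      then show ?case using G by (intro exI[of _ G']) (auto simp: lessThan_Suc)
    qed
    from this[of "Suc n"] show ?thesis using e1 by (simp add: lessThan_Suc_atMost)
  qed
  then obtain G where G: "parmap ?X Q G" "G0 \<subseteq> G" "\<And>m. gdom G m = pbase n e m \<union> (\<Union>j\<in>{..n}. pV n j m)" by blast
  have "gdom G m = cells ?X m" for m
  proof
    show "gdom G m \<subseteq> cells ?X m" using parmap_D(1)[OF G(1)] by (auto simp: gdom_def)
    show "cells ?X m \<subseteq> gdom G m" unfolding G(3) using p_cover by fastforce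
  qed
  then have "gdom G = cells ?X" by blast
  from map_of_parmap[OF G(1) this] obtain c where c: "sset_map ?X Q c" "\<And>m x. x \<in> cells ?X m ==> (m, x, c m x) \<in> G" by blast
  have "c m x = h m x" if "x \<in> pbase n e m" for m x
  proof -
    have "(m, x, h m x) \<in> G" using that G(2) unfolding G0_def by blast
    moreover have "x \<in> cells ?X m" using that subc_in[OF subc_pbase[OF e]] by blast
    ultimately show ?thesis using parmap_D(3)[OF G(1) c(2)] by blast
  qed
  then show ?thesis using c(1) by blast
qed

abbreviation I1 :: "(nat => nat) sset" where "I1 \<equiv> simplex 1"

lemma prod_sub: "sset_prod (sub X U) Y = sub (sset_prod X Y) (\<lambda>n. U n \<times> cells Y n)"
  by (simp add: sset_prod_def)

lemma sm_prodI:
  assumes "\<And>n x y. x \<in> cells K n ==> y \<in> cells L n ==> f n (x, y) \<in> cells Q n"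
    and "\<And>m n \<mu> x y. \<mu> \<in> Dmap m n ==> x \<in> cells K n ==> y \<in> cells L n ==>
      f m (act K m n \<mu> x, act L m n \<mu> y) = act Q m n \<mu> (f n (x, y))"
  shows "sset_map (sset_prod K L) Q f"
  by (rule smI) (use assms in auto)

lemma sm_prod_in: "sset_map (sset_prod K L) Q f ==> x \<in> cells K n ==> y \<in> cells L n ==> f n (x, y) \<in> cells Q n"
  by (rule sm_in) auto

lemma sm_prod_nat: "sset_map (sset_prod K L) Q f ==> \<mu> \<in> Dmap m n ==> x \<in> cells K n ==> y \<in> cells L n ==>
   f m (act K m n \<mu> x, act L m n \<mu> y) = act Q m n \<mu> (f n (x, y))"
  using sm_nat[of "sset_prod K L" Q f \<mu> m n "(x, y)"] by simp

lemma sm_pair: "sset_map X K f ==> sset_map X L g ==> sset_map X (sset_prod K L) (\<lambda>n x. (f n x, g n x))"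
  by (rule smI) (auto simp: sm_nat)

lemma sm_fst: "sset_map (sset_prod K L) K (\<lambda>n. fst)"
  and sm_snd: "sset_map (sset_prod K L) L (\<lambda>n. snd)"
  by (rule smI; auto)+

lemma sm_const: "c \<le> 1 ==> sset_map X I1 (\<lambda>n x. cD c n)"
  by (rule smI) auto

lemma sm_swap: "sset_map (sset_prod K L) Q f ==> sset_map (sset_prod L K) Q (\<lambda>n (y, x). f n (x, y))"
  by (rule sm_prodI) (auto simp: sm_prod_in sm_prod_nat)

lemma cD_neq [simp]: "cD 0 n \<noteq> cD 1 n" "cD 1 n \<noteq> cD 0 n"
  by (auto simp: fun_eq_iff intro!: exI[of _ 0])

text \<open>Transposed, lifting against a boundary means extending a map from the boundary times the
  interval, together with one end, over the whole prism; this is \<open>prism\<close>.\<close>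

lemma tfib_path:
  assumes Q: "kan_complex Q" and e: "e \<le> 1"
  shows "tfib (Fn I1 Q) Q (\<lambda>k \<phi>. \<phi> () k (cD e k, idD k))"
  unfolding tfib_def
proof (intro conjI allI)
  have wf: "wfA (ftest Q) (cst I1)" by simp
  show "is_sset (Fn I1 Q)" "is_sset Q" using kanD(1)[OF Q] by simp_all
  have ident: "sset_map (Fn I1 Q) (Fn I1 Q) (\<lambda>n x. x)" by (rule sm_id)
  have u: "sset_map (sset_prod I1 (Fn I1 Q)) Q (uunc (\<lambda>n x. x))"
    by (rule uunc_map[OF _ _ ident]) simp_all
  show qm: "sset_map (Fn I1 Q) Q (\<lambda>k \<phi>. \<phi> () k (cD e k, idD k))"
    using sm_comp[OF sm_pair[OF sm_const[OF e] sm_id] u] by (simp add: uunc_def unc_def)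
  fix n
  show "rlp (\<lambda>k \<phi>. \<phi> () k (cD e k, idD k)) (Fn I1 Q) Q (simplex n) (bd n)"
    unfolding rlp_def
  proof (intro allI impI, elim conjE)
    fix a b assume a: "sset_map (sub (simplex n) (bd n)) (Fn I1 Q) a" and b: "sset_map (simplex n) Q b"
      and ab: "\<forall>m. \<forall>x\<in>bd n m. a m x () m (cD e m, idD m) = b m x"
    have ua: "sset_map (sset_prod I1 (sub (simplex n) (bd n))) Q (uunc a)"
      by (rule uunc_map[OF _ _ a]) simp_all
    have ab': "uunc a m (cD e m, x) = b m x" if "x \<in> bd n m" for m x
      using ab that by (simp add: uunc_def unc_def)
    define h where "h = (\<lambda>m (\<alpha>, \<beta>). if \<alpha> \<in> bd n m then uunc a m (\<beta>, \<alpha>) else b m \<alpha>)"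
    have bdD: "\<alpha> \<in> Dmap m n" if "\<alpha> \<in> bd n m" for \<alpha> m using that by (simp add: bd_def)
    have "sset_map (sub (sset_prod (simplex n) I1) (pbase n e)) Q h"
    proof (rule smI)
      fix m x assume "x \<in> cells (sub (sset_prod (simplex n) I1) (pbase n e)) m"
      then show "h m x \<in> cells Q m"
        using sm_prod_in[OF ua] sm_in[OF b] by (auto simp: h_def pbase_def)
    next
      fix l m \<eta> x assume e': "\<eta> \<in> Dmap l m" and "x \<in> cells (sub (sset_prod (simplex n) I1) (pbase n e)) m"
      then obtain \<alpha> \<beta> where x: "x = (\<alpha>, \<beta>)" "\<alpha> \<in> Dmap m n" "\<beta> \<in> Dmap m 1" "\<alpha> \<in> bd n m \<or> \<beta> = cD e m"
        by (auto simp: pbase_def)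
      show "h l (act (sub (sset_prod (simplex n) I1) (pbase n e)) l m \<eta> x) = act Q l m \<eta> (h m x)"
      proof (cases "\<alpha> \<in> bd n m")
        case True
        then have "compD l \<alpha> \<eta> \<in> bd n l" using subc_act[OF subc_bd e' True] by simp
        then show ?thesis using sm_prod_nat[OF ua e', of \<beta> \<alpha>] True x by (simp add: h_def)
      next
        case False
        then have "\<beta> = cD e m" using x by simp
        then show ?thesis using sm_nat[OF b e', of \<alpha>] False x e' ab' by (simp add: h_def)
      qed
    qed
    from prism[OF Q e this] obtain g where g: "sset_map (sset_prod (simplex n) I1) Q g"
      "\<And>m x. x \<in> pbase n e m ==> g m x = h m x" by blast
    define c where "c = ucur I1 Q (simplex n) (\<lambda>k (\<beta>, \<alpha>). g k (\<alpha>, \<beta>))"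
    have c: "sset_map (simplex n) (Fn I1 Q) c" unfolding c_def by (rule ucur_map) (simp_all add: sm_swap[OF g(1)])
    have uc: "uunc c k (\<beta>, \<alpha>) = g k (\<alpha>, \<beta>)" if "\<beta> \<in> Dmap k 1" "\<alpha> \<in> Dmap k n" for k \<alpha> \<beta>
      unfolding c_def using that by (subst uunc_ucur) simp_all
    have 1: "c m x = a m x" if "x \<in> bd n m" for m x
    proof (rule Fn_eq_on[OF _ sm_sub[OF c subc_bd] a _ subc_bd that])
      fix k \<beta> \<alpha> assume "\<beta> \<in> cells I1 k" "\<alpha> \<in> bd n k"
      then show "uunc c k (\<beta>, \<alpha>) = uunc a k (\<beta>, \<alpha>)" using uc bdD g(2)[of "(\<alpha>, \<beta>)" k] by (simp add: pbase_def h_def)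
    qed simp_all
    have 2: "c m x () m (cD e m, idD m) = b m x" if "x \<in> Dmap m n" for m x
    proof -
      have "c m x () m (cD e m, idD m) = uunc c m (cD e m, x)" by (simp add: uunc_def unc_def)
      also have "\<dots> = h m (x, cD e m)" using uc that e g(2)[of "(x, cD e m)" m] by (simp add: pbase_def)
      also have "\<dots> = b m x" using ab' by (simp add: h_def)
      finally show ?thesis .
    qed
    show "\<exists>c. sset_map (simplex n) (Fn I1 Q) c \<and> (\<forall>m. \<forall>x\<in>bd n m. c m x = a m x) \<and>
        (\<forall>m. \<forall>x\<in>cells (simplex n) m. c m x () m (cD e m, idD m) = b m x)"
      using c 1 2 by (intro exI[of _ c]) simp
  qed
qed

text \<open>Evaluation of paths at an end is a trivial fibration and therefore lifts against every
  inclusion; transposing back gives homotopy extension with no further induction over the cells of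
  \<open>X\<close>.\<close>

lemma hep:
  assumes Q: "kan_complex Q" and e: "e \<le> 1" and X: "is_sset X" and U: "subc X U"
    and f: "sset_map X Q f" and h: "sset_map (sset_prod (sub X U) I1) Q h"
    and hf: "\<And>n x. x \<in> U n ==> h n (x, cD e n) = f n x"
  obtains g where "sset_map (sset_prod X I1) Q g" "\<And>n x. x \<in> cells X n ==> g n (x, cD e n) = f n x"
    "\<And>n x t. x \<in> U n ==> t \<in> Dmap n 1 ==> g n (x, t) = h n (x, t)"
proof -
  define a where "a = ucur I1 Q (sub X U) (\<lambda>k (t, x). h k (x, t))"
  have a: "sset_map (sub X U) (Fn I1 Q) a"
    unfolding a_def by (rule ucur_map) (simp_all add: X U sm_swap[OF h])
  have ua: "uunc a k (t, x) = h k (x, t)" if "t \<in> Dmap k 1" "x \<in> U k" for k t x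
    unfolding a_def using that X U by (subst uunc_ucur) simp_all
  have cmp: "a n x () n (cD e n, idD n) = f n x" if "x \<in> U n" for n x
    using ua[of "cD e n" n x] that e hf by (simp add: uunc_def unc_def)
  obtain c where c: "sset_map X (Fn I1 Q) c" "\<And>n x. x \<in> U n ==> c n x = a n x"
    "\<And>n x. x \<in> cells X n ==> c n x () n (cD e n, idD n) = f n x"
    by (rule rlpD[OF tfib_rlp[OF tfib_path[OF Q e] X U] a f]) (use cmp in simp_all)
  have uc: "sset_map (sset_prod I1 X) Q (uunc c)" by (rule uunc_map[OF _ X c(1)]) simp
  show thesis
  proof (rule that[of "\<lambda>k (x, t). uunc c k (t, x)"])
    show "sset_map (sset_prod X I1) Q (\<lambda>k (x, t). uunc c k (t, x))" by (rule sm_swap[OF uc])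
    show "(case (x, cD e n) of (x, t) => uunc c n (t, x)) = f n x" if "x \<in> cells X n" for n x
      using c(3)[OF that] by (simp add: uunc_def unc_def)
    show "(case (x, t) of (x, t) => uunc c n (t, x)) = h n (x, t)" if "x \<in> U n" "t \<in> Dmap n 1" for n x t
      using ua[OF that(2,1)] c(2)[OF that(1)] by (simp add: uunc_def unc_def)
  qed
qed

text \<open>Homotopy extension for the subcomplex of \<open>sset_prod Y I1\<close> that consists of
  both ends and of the cylinder over \<open>V\<close>: a square with three given sides is filled
  compatibly with a given filling over \<open>V\<close>. Applications use the fourth side, at the
  end other than \<open>e\<close>.\<close>

lemma hep_sq:
  assumes Q: "kan_complex Q" and e: "e \<le> 1" and Y: "is_sset Y" and V: "subc Y V"
    and f: "sset_map (sset_prod Y I1) Q f"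
    and h0: "sset_map (sset_prod Y I1) Q h0" and h1: "sset_map (sset_prod Y I1) Q h1"
    and A: "sset_map (sset_prod (sset_prod (sub Y V) I1) I1) Q A"
    and c0: "\<And>n y. y \<in> cells Y n ==> h0 n (y, cD e n) = f n (y, cD 0 n)"
    and c1: "\<And>n y. y \<in> cells Y n ==> h1 n (y, cD e n) = f n (y, cD 1 n)"
    and cA: "\<And>n y u. y \<in> V n ==> u \<in> Dmap n 1 ==> A n ((y, u), cD e n) = f n (y, u)"
    and A0: "\<And>n y v. y \<in> V n ==> v \<in> Dmap n 1 ==> A n ((y, cD 0 n), v) = h0 n (y, v)"
    and A1: "\<And>n y v. y \<in> V n ==> v \<in> Dmap n 1 ==> A n ((y, cD 1 n), v) = h1 n (y, v)"
  obtains g where "sset_map (sset_prod (sset_prod Y I1) I1) Q g"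
    "\<And>n y u. y \<in> cells Y n ==> u \<in> Dmap n 1 ==> g n ((y, u), cD e n) = f n (y, u)"
    "\<And>n y v. y \<in> cells Y n ==> v \<in> Dmap n 1 ==> g n ((y, cD 0 n), v) = h0 n (y, v)"
    "\<And>n y v. y \<in> cells Y n ==> v \<in> Dmap n 1 ==> g n ((y, cD 1 n), v) = h1 n (y, v)"
    "\<And>n y u v. y \<in> V n ==> u \<in> Dmap n 1 ==> v \<in> Dmap n 1 ==> g n ((y, u), v) = A n ((y, u), v)"
proof -
  define U where "U = (\<lambda>n. {(y, u). y \<in> cells Y n \<and> u \<in> Dmap n 1 \<and> (u = cD 0 n \<or> u = cD 1 n \<or> y \<in> V n)})"
  have U: "subc (sset_prod Y I1) U"
    by (rule subcI) (auto simp: U_def Y subc_act[OF V])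
  define h where "h = (\<lambda>n ((y, u), v). if u = cD 0 n then h0 n (y, v) else if u = cD 1 n then h1 n (y, v) else A n ((y, u), v))"
  have h: "sset_map (sset_prod (sub (sset_prod Y I1) U) I1) Q h"
  proof (rule sm_prodI)
    fix n x v assume "x \<in> cells (sub (sset_prod Y I1) U) n" "v \<in> cells I1 n"
    then show "h n (x, v) \<in> cells Q n"
      using sm_prod_in[OF h0] sm_prod_in[OF h1] sm_prod_in[OF A] by (auto simp: h_def U_def)
  next
    fix m n \<mu> x v assume t: "\<mu> \<in> Dmap m n" and "x \<in> cells (sub (sset_prod Y I1) U) n" and "v \<in> cells I1 n"
    then obtain y u where x: "x = (y, u)" "y \<in> cells Y n" "u \<in> Dmap n 1" "u = cD 0 n \<or> u = cD 1 n \<or> y \<in> V n" "v \<in> Dmap n 1"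
      by (auto simp: U_def)
    have vt: "compD m v \<mu> \<in> Dmap m 1" "compD m u \<mu> \<in> Dmap m 1" using x t by auto
    consider "u = cD 0 n" | "u = cD 1 n" | "u \<noteq> cD 0 n" "u \<noteq> cD 1 n" "y \<in> V n" using x by blast
    then show "h m (act (sub (sset_prod Y I1) U) m n \<mu> x, act I1 m n \<mu> v) = act Q m n \<mu> (h n (x, v))"
    proof cases
      case 1
      then show ?thesis using sm_prod_nat[OF h0 t x(2), of v] x t by (simp add: h_def)
    next
      case 2
      then show ?thesis using sm_prod_nat[OF h1 t x(2), of v] x t by (simp add: h_def)
    next
      case 3
      have yV: "act Y m n \<mu> y \<in> V m" by (rule subc_act[OF V t 3(3)])
      have "A m ((act Y m n \<mu> y, compD m u \<mu>), compD m v \<mu>) = act Q m n \<mu> (A n ((y, u), v))"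
        using sm_prod_nat[OF A t, of "(y, u)" v] 3 x by simp
      then show ?thesis using 3 x A0[OF yV vt(1)] A1[OF yV vt(1)]
        by (cases "compD m u \<mu> = cD 0 m"; cases "compD m u \<mu> = cD 1 m") (simp_all add: h_def)
    qed
  qed
  have "h n (x, cD e n) = f n x" if "x \<in> U n" for n x
    using that c0 c1 cA by (auto simp: U_def h_def)
  from hep[OF Q e _ U f h this] obtain g where g: "sset_map (sset_prod (sset_prod Y I1) I1) Q g"
    "\<And>n x. x \<in> cells (sset_prod Y I1) n ==> g n (x, cD e n) = f n x"
    "\<And>n x t. x \<in> U n ==> t \<in> Dmap n 1 ==> g n (x, t) = h n (x, t)" using Y by auto
  show thesis
  proof (rule that[OF g(1)])
    show "g n ((y, u), cD e n) = f n (y, u)" if "y \<in> cells Y n" "u \<in> Dmap n 1" for n y u using g(2) that by simp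
    show "g n ((y, cD 0 n), v) = h0 n (y, v)" if "y \<in> cells Y n" "v \<in> Dmap n 1" for n y v
      using g(3)[of "(y, cD 0 n)" n v] that by (simp add: U_def h_def)
    show "g n ((y, cD 1 n), v) = h1 n (y, v)" if "y \<in> cells Y n" "v \<in> Dmap n 1" for n y v
      using g(3)[of "(y, cD 1 n)" n v] that by (simp add: U_def h_def)
    show "g n ((y, u), v) = A n ((y, u), v)" if "y \<in> V n" "u \<in> Dmap n 1" "v \<in> Dmap n 1" for n y u v
      using g(3)[of "(y, u)" n v] that subc_in[OF V] A0[OF that(1,3)] A1[OF that(1,3)] by (auto simp: U_def h_def)
  qed
qed

lemma hep_sq0:
  assumes Q: "kan_complex Q" and e: "e \<le> 1" and Y: "is_sset Y"
    and f: "sset_map (sset_prod Y I1) Q f"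
    and h0: "sset_map (sset_prod Y I1) Q h0" and h1: "sset_map (sset_prod Y I1) Q h1"
    and c0: "\<And>n y. y \<in> cells Y n ==> h0 n (y, cD e n) = f n (y, cD 0 n)"
    and c1: "\<And>n y. y \<in> cells Y n ==> h1 n (y, cD e n) = f n (y, cD 1 n)"
  obtains g where "sset_map (sset_prod (sset_prod Y I1) I1) Q g"
    "\<And>n y u. y \<in> cells Y n ==> u \<in> Dmap n 1 ==> g n ((y, u), cD e n) = f n (y, u)"
    "\<And>n y v. y \<in> cells Y n ==> v \<in> Dmap n 1 ==> g n ((y, cD 0 n), v) = h0 n (y, v)"
    "\<And>n y v. y \<in> cells Y n ==> v \<in> Dmap n 1 ==> g n ((y, cD 1 n), v) = h1 n (y, v)"
proof -
  have A: "sset_map (sset_prod (sset_prod (sub Y (\<lambda>_. {})) I1) I1) Q (\<lambda>_ _. undefined)"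
    by (rule sm_prodI) auto
  show thesis
    by (rule hep_sq[OF Q e Y subc_empty f h0 h1 A c0 c1]) (use that in auto)
qed

subsection \<open>Homotopy\<close>

definition htpy where
  "htpy K L f g h \<longleftrightarrow> sset_map (sset_prod K I1) L h \<and> (\<forall>n. \<forall>x\<in>cells K n. h n (x, cD 0 n) = f n x \<and> h n (x, cD 1 n) = g n x)"

lemma htpyD:
  assumes "htpy K L f g h"
  shows "sset_map (sset_prod K I1) L h" "x \<in> cells K n ==> h n (x, cD 0 n) = f n x" "x \<in> cells K n ==> h n (x, cD 1 n) = g n x"
  using assms unfolding htpy_def by blast+

lemma homI:
  "sset_map (sset_prod K I1) L h ==> (\<And>n x. x \<in> cells K n ==> h n (x, cD 0 n) = f n x) ==>
   (\<And>n x. x \<in> cells K n ==> h n (x, cD 1 n) = g n x) ==> sset_homotopic K L f g"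
  unfolding sset_homotopic_def by blast

lemma homE:
  assumes "sset_homotopic K L f g"
  obtains h where "htpy K L f g h"
  using assms unfolding sset_homotopic_def htpy_def by blast

lemma sm_end: "c \<le> 1 ==> sset_map (sset_prod K I1) L h ==> sset_map K L (\<lambda>n x. h n (x, cD c n))"
  using sm_comp[OF sm_pair[OF sm_id sm_const]] .

lemma hom_maps:
  assumes "sset_homotopic K L f g" "is_sset K"
  shows "sset_map K L f" "sset_map K L g"
proof -
  obtain h where "htpy K L f g h" by (rule homE[OF assms(1)])
  note h = htpyD[OF this]
  show "sset_map K L f" by (rule sm_cong[OF sm_end[OF _ h(1), of 0]]) (simp_all add: h assms)
  show "sset_map K L g" by (rule sm_cong[OF sm_end[OF _ h(1), of 1]]) (simp_all add: h assms)
qed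

lemma hom_refl: "sset_map K L f ==> sset_homotopic K L f f"
  by (rule homI[of _ _ "\<lambda>n x. f n (fst x)"]) (auto intro: sm_comp[OF sm_fst])

lemma hom_cong:
  "sset_homotopic K L f g ==> (\<And>n x. x \<in> cells K n ==> f' n x = f n x) ==>
   (\<And>n x. x \<in> cells K n ==> g' n x = g n x) ==> sset_homotopic K L f' g'"
  unfolding sset_homotopic_def by metis

lemma sm_prod_pre: "sset_map (sset_prod K I1) L h ==> sset_map K' K u ==>
    sset_map (sset_prod K' I1) L (\<lambda>n (x, t). h n (u n x, t))"
  by (rule sm_prodI) (auto simp: sm_prod_in sm_prod_nat[symmetric] sm_nat)

lemma hom_pre:
  assumes "sset_homotopic K L f g" "sset_map K' K u"
  shows "sset_homotopic K' L (\<lambda>n x. f n (u n x)) (\<lambda>n x. g n (u n x))"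
proof -
  obtain h where "htpy K L f g h" by (rule homE[OF assms(1)])
  note h = htpyD[OF this]
  show ?thesis by (rule homI[OF sm_prod_pre[OF h(1) assms(2)]]) (use h sm_in[OF assms(2)] in auto)
qed

lemma hom_post:
  assumes "sset_homotopic K L f g" "sset_map L L' u"
  shows "sset_homotopic K L' (\<lambda>n x. u n (f n x)) (\<lambda>n x. u n (g n x))"
proof -
  obtain h where "htpy K L f g h" by (rule homE[OF assms(1)])
  note h = htpyD[OF this]
  show ?thesis by (rule homI[OF sm_comp[OF h(1) assms(2)]]) (use h in auto)
qed

text \<open>A square with one side \<open>h\<close> and two constant sides has the inverse homotopy
  as its fourth side.\<close>

lemma hom_sym:
  assumes L: "kan_complex L" and K: "is_sset K" and h: "sset_homotopic K L f g"
  shows "sset_homotopic K L g f"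
proof -
  obtain h where "htpy K L f g h" by (rule homE[OF h])
  note h = htpyD[OF this]
  have f: "sset_map (sset_prod K I1) L (\<lambda>n x. h n (fst x, cD 0 n))"
    using sm_comp[OF sm_fst sm_end[OF _ h(1), of 0]] by simp
  obtain k where k: "sset_map (sset_prod (sset_prod K I1) I1) L k"
    "\<And>n y v. y \<in> cells K n ==> v \<in> Dmap n 1 ==> k n ((y, cD 0 n), v) = h n (y, v)"
    "\<And>n y v. y \<in> cells K n ==> v \<in> Dmap n 1 ==> k n ((y, cD 1 n), v) = h n (y, cD 0 n)"
    by (rule hep_sq0[OF L _ K f h(1) f, of 0]) simp_all
  show ?thesis by (rule homI[OF sm_end[OF _ k(1), of 1]]) (use h k in simp_all)
qed

text \<open>The composite is the fourth side of a square whose other sides are \<open>h\<close>,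
  \<open>h'\<close> and a constant homotopy.\<close>

lemma hom_trans:
  assumes L: "kan_complex L" and K: "is_sset K" and h: "sset_homotopic K L f g" "sset_homotopic K L g g'"
  shows "sset_homotopic K L f g'"
proof -
  obtain h where "htpy K L f g h" by (rule homE[OF assms(3)])
  note h = htpyD[OF this]
  obtain h' where "htpy K L g g' h'" by (rule homE[OF assms(4)])
  note h' = htpyD[OF this]
  have f: "sset_map (sset_prod K I1) L (\<lambda>n x. h n (fst x, cD 0 n))"
    using sm_comp[OF sm_fst sm_end[OF _ h(1), of 0]] by simp
  obtain k where k: "sset_map (sset_prod (sset_prod K I1) I1) L k"
    "\<And>n y v. y \<in> cells K n ==> v \<in> Dmap n 1 ==> k n ((y, cD 0 n), v) = h n (y, cD 0 n)"
    "\<And>n y v. y \<in> cells K n ==> v \<in> Dmap n 1 ==> k n ((y, cD 1 n), v) = h' n (y, v)"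
    by (rule hep_sq0[OF L _ K h(1) f h'(1), of 0]) (use h h' in simp_all)
  show ?thesis by (rule homI[OF sm_end[OF _ k(1), of 1]]) (use h h' k in simp_all)
qed

definition hinv where
  "hinv L K p s \<longleftrightarrow> sset_map L K p \<and> sset_map K L s \<and>
     sset_homotopic L L (\<lambda>n x. s n (p n x)) (\<lambda>n x. x) \<and> sset_homotopic K K (\<lambda>n x. p n (s n x)) (\<lambda>n x. x)"

definition heq :: "'a sset => 'b sset => (nat => 'a => 'b) => bool" where
  "heq L K p \<longleftrightarrow> (\<exists>s. hinv L K p s)"

lemma hinvD:
  assumes "hinv L K p s"
  shows "sset_map L K p" "sset_map K L s" "sset_homotopic L L (\<lambda>n x. s n (p n x)) (\<lambda>n x. x)"
    "sset_homotopic K K (\<lambda>n x. p n (s n x)) (\<lambda>n x. x)"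
  using assms unfolding hinv_def by blast+

lemma heqI:
  "sset_map L K p ==> sset_map K L s ==> sset_homotopic L L (\<lambda>n x. s n (p n x)) (\<lambda>n x. x) ==>
   sset_homotopic K K (\<lambda>n x. p n (s n x)) (\<lambda>n x. x) ==> heq L K p"
  unfolding heq_def hinv_def by blast

lemma heqE: "heq L K p ==> (\<And>s. hinv L K p s ==> thesis) ==> thesis"
  unfolding heq_def by blast

lemma heq_id: "heq L L (\<lambda>n x. x)"
  by (rule heqI[of _ _ _ "\<lambda>n x. x"]) (auto intro: hom_refl sm_id)

lemma heq_cong:
  assumes "heq L K p" "is_sset L" "\<And>n x. x \<in> cells L n ==> q n x = p n x"
  shows "heq L K q"
proof -
  obtain s where "hinv L K p s" by (rule heqE[OF assms(1)])
  note s = hinvD[OF this]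
  show ?thesis
    by (rule heqI[of _ _ _ s, OF sm_cong[OF s(1) assms(3,2)] s(2) hom_cong[OF s(3)] hom_cong[OF s(4)]])
      (use assms(3) sm_in[OF s(2)] in auto)
qed

lemma heq_comp:
  assumes k: "kan_complex L" "kan_complex K" "kan_complex M" and p: "heq L K p" "heq K M r"
  shows "heq L M (\<lambda>n x. r n (p n x))"
proof -
  obtain s where "hinv L K p s" by (rule heqE[OF p(1)])
  note s = hinvD[OF this]
  obtain u where "hinv K M r u" by (rule heqE[OF p(2)])
  note u = hinvD[OF this]
  note ks = kanD(1)[OF k(1)] kanD(1)[OF k(2)] kanD(1)[OF k(3)]
  show ?thesis
  proof (rule heqI[OF sm_comp[OF s(1) u(1)] sm_comp[OF u(2) s(2)]])
    show "sset_homotopic L L (\<lambda>n x. s n (u n (r n (p n x)))) (\<lambda>n x. x)"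
      by (rule hom_trans[OF k(1) ks(1) hom_post[OF hom_pre[OF u(3) s(1)] s(2)] s(3)])
    show "sset_homotopic M M (\<lambda>n x. r n (p n (s n (u n x)))) (\<lambda>n x. x)"
      by (rule hom_trans[OF k(3) ks(3) hom_post[OF hom_pre[OF s(4) u(2)] u(1)] u(4)])
  qed
qed

lemma heq_cancel_right:
  assumes k: "kan_complex L" "kan_complex K" "kan_complex M" and p: "heq L K p" "heq L M (\<lambda>n x. r n (p n x))"
    and r: "sset_map K M r"
  shows "heq K M r"
proof -
  obtain s where "hinv L K p s" by (rule heqE[OF p(1)])
  note s = hinvD[OF this]
  obtain u where "hinv L M (\<lambda>n x. r n (p n x)) u" by (rule heqE[OF p(2)])
  note u = hinvD(2-4)[OF this]
  note ks = kanD(1)[OF k(1)] kanD(1)[OF k(2)] kanD(1)[OF k(3)]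
  show ?thesis
  proof (rule heqI[OF r sm_comp[OF u(1) s(1)] _ u(3)])
    have a: "sset_homotopic K K (\<lambda>n x. p n (u n (r n (p n (s n x))))) (\<lambda>n x. p n (u n (r n x)))"
      using hom_post[OF s(4) sm_comp[OF sm_comp[OF r u(1)] s(1)]] .
    have b: "sset_homotopic K K (\<lambda>n x. p n (u n (r n (p n (s n x))))) (\<lambda>n x. p n (s n x))"
      using hom_post[OF hom_pre[OF u(2) s(2)] s(1)] .
    show "sset_homotopic K K (\<lambda>n x. p n (u n (r n x))) (\<lambda>n x. x)"
      by (rule hom_trans[OF k(2) ks(2) hom_sym[OF k(2) ks(2) a] hom_trans[OF k(2) ks(2) b s(4)]])
  qed
qed

lemma heq_cancel_left:
  assumes k: "kan_complex L" "kan_complex K" "kan_complex M" and p: "heq K M r" "heq L M (\<lambda>n x. r n (p n x))"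
    and pm: "sset_map L K p"
  shows "heq L K p"
proof -
  obtain s where "hinv K M r s" by (rule heqE[OF p(1)])
  note s = hinvD[OF this]
  obtain u where "hinv L M (\<lambda>n x. r n (p n x)) u" by (rule heqE[OF p(2)])
  note u = hinvD(2-4)[OF this]
  note ks = kanD(1)[OF k(1)] kanD(1)[OF k(2)] kanD(1)[OF k(3)]
  show ?thesis
  proof (rule heqI[OF pm sm_comp[OF s(1) u(1)] u(2)])
    have a: "sset_homotopic K K (\<lambda>n x. s n (r n (p n (u n (r n x))))) (\<lambda>n x. p n (u n (r n x)))"
      using hom_pre[OF s(3) sm_comp[OF sm_comp[OF s(1) u(1)] pm]] .
    have b: "sset_homotopic K K (\<lambda>n x. s n (r n (p n (u n (r n x))))) (\<lambda>n x. s n (r n x))"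
      using hom_post[OF hom_pre[OF u(3) s(1)] s(2)] .
    show "sset_homotopic K K (\<lambda>n x. p n (u n (r n x))) (\<lambda>n x. x)"
      by (rule hom_trans[OF k(2) ks(2) hom_sym[OF k(2) ks(2) a] hom_trans[OF k(2) ks(2) b s(3)]])
  qed
qed

section \<open>Lifting properties and homotopy equivalences\<close>

lemma tfib_heq:
  assumes q: "tfib L K p"
  shows "heq L K p"
proof -
  have L: "is_sset L" and K: "is_sset K" and p: "sset_map L K p" using q by (auto simp: tfib_def)
  have e: "sset_map (sub K (\<lambda>_. {})) L (\<lambda>_ _. undefined)" by (rule smI) auto
  obtain s where s: "sset_map K L s" "\<And>n x. x \<in> cells K n ==> p n (s n x) = x"
    by (rule rlpD[OF tfib_rlp[OF q K subc_empty] e sm_id]) (auto intro: that)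
  \<comment> \<open>Lifting over the cylinder of \<open>L\<close> relative to its two ends turns the
    section \<open>s\<close> into a homotopy inverse.\<close>
  define U where "U = (\<lambda>n. {(x, t). x \<in> cells L n \<and> (t = cD 0 n \<or> t = cD 1 n)})"
  have U: "subc (sset_prod L I1) U" by (rule subcI) (auto simp: U_def L)
  define a where "a = (\<lambda>n (x, t). if t = cD 0 n then s n (p n x) else x)"
  have a: "sset_map (sub (sset_prod L I1) U) L a"
    by (rule smI) (use sm_in[OF p] sm_in[OF s(1)] in \<open>auto simp: a_def U_def sm_nat[OF p] sm_nat[OF s(1)] L\<close>)
  obtain c where c: "sset_map (sset_prod L I1) L c" "\<And>n x. x \<in> U n ==> c n x = a n x"
    by (rule rlpD[OF tfib_rlp[OF q is_sset_prod[OF L is_sset_simplex] U] a sm_comp[OF sm_fst p]])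
      (use sm_in[OF p] s(2) in \<open>auto simp: a_def U_def intro: that\<close>)
  show ?thesis
  proof (rule heqI[OF p s(1)])
    show "sset_homotopic L L (\<lambda>n x. s n (p n x)) (\<lambda>n x. x)"
      by (rule homI[OF c(1)]) (use c(2) in \<open>auto simp: U_def a_def\<close>)
    show "sset_homotopic K K (\<lambda>n x. p n (s n x)) (\<lambda>n x. x)"
      by (rule hom_cong[OF hom_refl[OF sm_id]]) (simp_all add: s)
  qed
qed

text \<open>The naive lift, an inverse \<open>s\<close> applied to \<open>x0\<close>, cannot be
  joined to \<open>b\<close> over \<open>V\<close> directly, because the two homotopies
  \<open>G\<close> and \<open>E\<close> that belong to \<open>s\<close> need not be compatible with
  each other. The proof moves \<open>x0\<close> by a correcting path before applying
  \<open>s\<close>.\<close>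

lemma wrlp:
  assumes p: "heq L K p" and L: "kan_complex L" and K: "kan_complex K" and X: "is_sset X" and V: "subc X V"
    and x0: "sset_map X K x0" and b: "sset_map (sub X V) L b"
    and \<alpha>: "sset_map (sset_prod (sub X V) I1) K \<alpha>"
    and \<alpha>0: "\<And>n x. x \<in> V n ==> \<alpha> n (x, cD 0 n) = x0 n x"
    and \<alpha>1: "\<And>n x. x \<in> V n ==> \<alpha> n (x, cD 1 n) = p n (b n x)"
  obtains b' \<alpha>' where "sset_map X L b'" "\<And>n x. x \<in> V n ==> b' n x = b n x"
    "sset_map (sset_prod X I1) K \<alpha>'"
    "\<And>n x. x \<in> cells X n ==> \<alpha>' n (x, cD 0 n) = x0 n x"
    "\<And>n x. x \<in> cells X n ==> \<alpha>' n (x, cD 1 n) = p n (b' n x)"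
    "\<And>n x v. x \<in> V n ==> v \<in> Dmap n 1 ==> \<alpha>' n (x, v) = \<alpha> n (x, v)"
proof -
  note Ls = kanD(1)[OF L] and Ks = kanD(1)[OF K]
  let ?S = "sub X V"
  have S: "is_sset ?S" using X V by simp
  obtain s where "hinv L K p s" by (rule heqE[OF p])
  note s = hinvD[OF this]
  obtain G where "htpy L L (\<lambda>n x. s n (p n x)) (\<lambda>n x. x) G" by (rule homE[OF s(3)])
  note G = htpyD[OF this]
  obtain E where "htpy K K (\<lambda>n x. x) (\<lambda>n x. p n (s n x)) E" by (rule homE[OF hom_sym[OF K Ks s(4)]])
  note E = htpyD[OF this]
  note pin = sm_in[OF s(1)] and sin = sm_in[OF s(2)] and bin = sm_in[OF b, simplified]
  have g: "sset_map (sset_prod ?S I1) L (\<lambda>n (x, u). G n (b n x, u))" by (rule sm_prod_pre[OF G(1) b])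
  \<comment> \<open>Over \<open>V\<close> the path \<alpha>, the path \<open>E\<close> and the image
    of \<open>G\<close> under \<open>p\<close> are three sides of a square; its fourth side leads
    from \<open>p b\<close> to \<open>x0\<close> and is the correction.\<close>
  obtain A where A: "sset_map (sset_prod (sset_prod ?S I1) I1) K A"
    "\<And>n y u. y \<in> V n ==> u \<in> Dmap n 1 ==> A n ((y, u), cD 1 n) = p n (G n (b n y, u))"
    "\<And>n y v. y \<in> V n ==> v \<in> Dmap n 1 ==> A n ((y, cD 0 n), v) = E n (p n (b n y), v)"
    "\<And>n y v. y \<in> V n ==> v \<in> Dmap n 1 ==> A n ((y, cD 1 n), v) = \<alpha> n (y, v)"
    by (rule hep_sq0[OF K _ S sm_comp[OF g s(1)] sm_prod_pre[OF E(1) sm_comp[OF b s(1)]] \<alpha>, of 1])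
      (simp_all add: G E bin pin sin \<alpha>1)
  have mu0: "sset_map (sset_prod ?S I1) K (\<lambda>n x. A n (x, cD 0 n))" using sm_end[OF _ A(1), of 0] by simp
  \<comment> \<open>The correction is extended from \<open>x0\<close> to all of \<open>X\<close>.
    Its other end \<open>b0\<close> equals \<open>p b\<close> on \<open>V\<close>, so
    \<open>G\<close> can be extended to a homotopy that starts at \<open>s b0\<close>; the end of
    that homotopy is the lift.\<close>
  obtain \<nu> where \<nu>: "sset_map (sset_prod X I1) K \<nu>" "\<And>n x. x \<in> cells X n ==> \<nu> n (x, cD 1 n) = x0 n x"
    "\<And>n x t. x \<in> V n ==> t \<in> Dmap n 1 ==> \<nu> n (x, t) = A n ((x, t), cD 0 n)"
    by (rule hep[OF K _ X V x0 mu0, of 1]) (simp_all add: A(4) \<alpha>0)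
  define b0 where "b0 = (\<lambda>n x. \<nu> n (x, cD 0 n))"
  have b0: "sset_map X K b0" unfolding b0_def using sm_end[OF _ \<nu>(1), of 0] by simp
  note b0in = sm_in[OF b0]
  have b0x: "\<nu> n (x, cD 0 n) = b0 n x" for n x by (simp add: b0_def)
  have b0V: "b0 n x = p n (b n x)" if "x \<in> V n" for n x
    using that by (simp add: b0_def \<nu>(3) A(3) E(2) pin bin)
  obtain g' where g': "sset_map (sset_prod X I1) L g'" "\<And>n x. x \<in> cells X n ==> g' n (x, cD 0 n) = s n (b0 n x)"
    "\<And>n x t. x \<in> V n ==> t \<in> Dmap n 1 ==> g' n (x, t) = G n (b n x, t)"
    by (rule hep[OF L _ X V sm_comp[OF b0 s(2)] g, of 0]) (simp_all add: G(2) bin b0V)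
  have A': "sset_map (sset_prod (sset_prod ?S I1) I1) K (\<lambda>n ((y, v), u). A n ((y, u), v))"
    by (rule sm_prodI) (use sm_prod_in[OF A(1)] sm_prod_nat[OF A(1), where x="(y, u)" for y u] in auto)
  \<comment> \<open>In a square over \<open>X\<close> that extends \<open>A\<close>, with
    \<open>E\<close> at \<open>b0\<close> as one side, the opposite side is the required
    homotopy.\<close>
  obtain k where k: "sset_map (sset_prod (sset_prod X I1) I1) K k"
    "\<And>n y u. y \<in> cells X n ==> u \<in> Dmap n 1 ==> k n ((y, cD 0 n), u) = \<nu> n (y, u)"
    "\<And>n y u. y \<in> cells X n ==> u \<in> Dmap n 1 ==> k n ((y, cD 1 n), u) = p n (g' n (y, u))"
    "\<And>n y v u. y \<in> V n ==> v \<in> Dmap n 1 ==> u \<in> Dmap n 1 ==> k n ((y, v), u) = A n ((y, u), v)"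
    by (rule hep_sq[OF K _ X V sm_prod_pre[OF E(1) b0] \<nu>(1) sm_comp[OF g'(1) s(1)] A', of 0])
      (simp_all add: E b0in \<nu>(3) A g' b0V bin b0x)
  show thesis
  proof (rule that[of "\<lambda>n x. g' n (x, cD 1 n)" "\<lambda>n x. k n (x, cD 1 n)"])
    show "sset_map X L (\<lambda>n x. g' n (x, cD 1 n))" using sm_end[OF _ g'(1), of 1] by simp
    show "sset_map (sset_prod X I1) K (\<lambda>n x. k n (x, cD 1 n))" using sm_end[OF _ k(1), of 1] by simp
  qed (simp_all add: g' k \<nu> A G bin)
qed

text \<open>The weak lifting property of \<open>wrlp\<close> characterizes homotopy equivalences; the two instances
  of it that produce an inverse are these.\<close>

lemma heq_of_wrlp:
  assumes p: "sset_map L K p" and L: "kan_complex L" and K: "kan_complex K"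
    and w1: "\<exists>b' \<alpha>'. sset_map K L b' \<and> sset_map (sset_prod K I1) K \<alpha>' \<and>
      (\<forall>n. \<forall>x\<in>cells K n. \<alpha>' n (x, cD 0 n) = x \<and> \<alpha>' n (x, cD 1 n) = p n (b' n x))"
    and w2: "\<And>V x0 b \<alpha>. subc (sset_prod L I1) V ==> sset_map (sset_prod L I1) K x0 ==>
      sset_map (sub (sset_prod L I1) V) L b ==> sset_map (sset_prod (sub (sset_prod L I1) V) I1) K \<alpha> ==>
      (\<And>n x. x \<in> V n ==> \<alpha> n (x, cD 0 n) = x0 n x) ==>
      (\<And>n x. x \<in> V n ==> \<alpha> n (x, cD 1 n) = p n (b n x)) ==>
      \<exists>b'. sset_map (sset_prod L I1) L b' \<and> (\<forall>n. \<forall>x\<in>V n. b' n x = b n x)"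
  shows "heq L K p"
proof -
  note Ls = kanD(1)[OF L] and Ks = kanD(1)[OF K]
  from w1 obtain s \<beta> where s: "sset_map K L s" and \<beta>: "sset_map (sset_prod K I1) K \<beta>"
    "\<And>n x. x \<in> cells K n ==> \<beta> n (x, cD 0 n) = x" "\<And>n x. x \<in> cells K n ==> \<beta> n (x, cD 1 n) = p n (s n x)"
    by blast
  have ps: "sset_homotopic K K (\<lambda>n x. p n (s n x)) (\<lambda>n x. x)"
    by (rule hom_sym[OF K Ks homI[OF \<beta>]])
  obtain x0 where "htpy L K (\<lambda>n x. p n (s n (p n x))) p x0" by (rule homE[OF hom_pre[OF ps p]])
  note x0 = htpyD[OF this]
  define V where "V = (\<lambda>n. {(x, t). x \<in> cells L n \<and> (t = cD 0 n \<or> t = cD 1 n)})"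
  have V: "subc (sset_prod L I1) V" by (rule subcI) (auto simp: V_def Ls)
  define b where "b = (\<lambda>n (x, t). if t = cD 0 n then s n (p n x) else x)"
  have b: "sset_map (sub (sset_prod L I1) V) L b"
    by (rule smI) (use sm_in[OF p] sm_in[OF s(1)] in \<open>auto simp: b_def V_def sm_nat[OF p] sm_nat[OF s(1)] Ls\<close>)
  have \<alpha>: "sset_map (sset_prod (sub (sset_prod L I1) V) I1) K (\<lambda>n x. x0 n (fst x))"
    by (rule sm_comp[OF sm_fst sm_sub[OF x0(1) V]])
  have "\<exists>b'. sset_map (sset_prod L I1) L b' \<and> (\<forall>n. \<forall>x\<in>V n. b' n x = b n x)"
    by (rule w2[OF V x0(1) b \<alpha>]) (use x0(2,3) in \<open>auto simp: V_def b_def\<close>)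
  then obtain h where h: "sset_map (sset_prod L I1) L h" "\<And>n x. x \<in> V n ==> h n x = b n x" by blast
  show ?thesis
  proof (rule heqI[OF p s _ ps])
    show "sset_homotopic L L (\<lambda>n x. s n (p n x)) (\<lambda>n x. x)"
      by (rule homI[OF h(1)]) (auto simp: h(2) V_def b_def)
  qed
qed

subsection \<open>Horns times monomorphisms\<close>

text \<open>This provides the Kan property of function complexes, also with prescribed values on a
  subcomplex, and the inductive step for free Kan complexes. Cells of the product are never attached
  one by one: a homotopy of \<Delta>[n] into its horn lets \<open>hep\<close> do the
  extension.\<close>

lemma pph:
  assumes Q: "kan_complex Q" and n: "1 \<le> n" "k \<le> n" and X: "is_sset X" and V: "subc X V"
    and h: "sset_map (sub (sset_prod (simplex n) X) (\<lambda>m. {(\<mu>, \<xi>). \<mu> \<in> Dmap m n \<and> \<xi> \<in> cells X m \<and> (\<mu> \<in> hn n k m \<or> \<xi> \<in> V m)})) Q h"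
  obtains g where "sset_map (sset_prod (simplex n) X) Q g"
    "\<And>m \<mu> \<xi>. \<mu> \<in> hn n k m ==> \<xi> \<in> cells X m ==> g m (\<mu>, \<xi>) = h m (\<mu>, \<xi>)"
    "\<And>m \<mu> \<xi>. \<mu> \<in> Dmap m n ==> \<xi> \<in> V m ==> g m (\<mu>, \<xi>) = h m (\<mu>, \<xi>)"
proof -
  note conc = that
  let ?W = "sset_prod (simplex n) X"
  define U where "U = (\<lambda>m. {(\<mu>, \<xi>). \<mu> \<in> Dmap m n \<and> \<xi> \<in> cells X m \<and> (\<mu> \<in> hn n k m \<or> \<xi> \<in> V m)})"
  have hnD: "\<mu> \<in> Dmap m n" if "\<mu> \<in> hn n k m" for \<mu> m using that by (simp add: hn_def)
  have U: "subc ?W U"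
    by (rule subcI) (use subc_act[OF subc_hn, of _ _ _ _ n k] subc_act[OF V] X in \<open>auto simp: U_def\<close>)
  have h: "sset_map (sub ?W U) Q h" using h by (simp add: U_def)
  \<comment> \<open>The horn inclusion is a retract of its product with an end of the interval, via \<open>r\<close>.\<close>
  have main: thesis
    if e: "e \<le> 1" "e' \<le> 1"
      and r: "\<And>m \<mu> \<tau>. \<mu> \<in> Dmap m n ==> \<tau> \<in> Dmap m 1 ==> r m \<mu> \<tau> \<in> Dmap m n"
      and rn: "\<And>l m \<eta> \<mu> \<tau>. \<eta> \<in> Dmap l m ==> \<mu> \<in> Dmap m n ==> \<tau> \<in> Dmap m 1 ==>
          r l (compD l \<mu> \<eta>) (compD l \<tau> \<eta>) = compD l (r m \<mu> \<tau>) \<eta>"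
      and re: "\<And>m \<mu>. \<mu> \<in> Dmap m n ==> r m \<mu> (cD e m) \<in> hn n k m"
      and re': "\<And>m \<mu>. \<mu> \<in> Dmap m n ==> r m \<mu> (cD e' m) = \<mu>"
      and rh: "\<And>m \<mu> \<tau>. \<mu> \<in> hn n k m ==> \<tau> \<in> Dmap m 1 ==> r m \<mu> \<tau> \<in> hn n k m"
    for e e' and r :: "nat => (nat => nat) => (nat => nat) => nat => nat"
  proof -
    define hh where "hh = (\<lambda>m ((\<mu>, \<xi>), \<tau>). h m (r m \<mu> \<tau>, \<xi>))"
    have hh: "sset_map (sset_prod (sub ?W U) I1) Q hh"
    proof (rule sm_prodI)
      fix m x \<tau> assume "x \<in> cells (sub ?W U) m" "\<tau> \<in> cells I1 m"
      then show "hh m (x, \<tau>) \<in> cells Q m" using sm_in[OF h, simplified] r rh by (auto simp: hh_def U_def)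
    next
      fix l m \<eta> x \<tau> assume t: "\<eta> \<in> Dmap l m" and "x \<in> cells (sub ?W U) m" and "\<tau> \<in> cells I1 m"
      then obtain \<mu> \<xi> where x: "x = (\<mu>, \<xi>)" "(\<mu>, \<xi>) \<in> U m" "\<mu> \<in> Dmap m n" "\<tau> \<in> Dmap m 1" by (auto simp: U_def)
      then have "(r m \<mu> \<tau>, \<xi>) \<in> U m" using r rh by (auto simp: U_def)
      then show "hh l (act (sub ?W U) l m \<eta> x, act I1 l m \<eta> \<tau>) = act Q l m \<eta> (hh m (x, \<tau>))"
        using sm_nat[OF h t, of "(r m \<mu> \<tau>, \<xi>)"] x rn[OF t] by (simp add: hh_def)
    qed
    have f: "sset_map ?W Q (\<lambda>m (\<mu>, \<xi>). h m (r m \<mu> (cD e m), \<xi>))"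
    proof (rule sm_prodI)
      fix m \<mu> \<xi> assume "\<mu> \<in> cells (simplex n) m" "\<xi> \<in> cells X m"
      then have "(r m \<mu> (cD e m), \<xi>) \<in> U m" using re r e by (auto simp: U_def)
      then show "(case (\<mu>, \<xi>) of (\<mu>, \<xi>) => h m (r m \<mu> (cD e m), \<xi>)) \<in> cells Q m"
        using sm_in[OF h, of _ m] by simp
    next
      fix l m \<eta> \<mu> \<xi> assume t: "\<eta> \<in> Dmap l m" "\<mu> \<in> cells (simplex n) m" "\<xi> \<in> cells X m"
      then have "(r m \<mu> (cD e m), \<xi>) \<in> U m" using re r e by (auto simp: U_def)
      then show "(case (act (simplex n) l m \<eta> \<mu>, act X l m \<eta> \<xi>) of (\<mu>, \<xi>) => h l (r l \<mu> (cD e l), \<xi>)) =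
         act Q l m \<eta> (case (\<mu>, \<xi>) of (\<mu>, \<xi>) => h m (r m \<mu> (cD e m), \<xi>))"
        using sm_nat[OF h t(1), of "(r m \<mu> (cD e m), \<xi>)"] t rn[OF t(1), of \<mu> "cD e m"] e by simp
    qed
    obtain g where g: "sset_map (sset_prod ?W I1) Q g"
      "\<And>m x t. x \<in> U m ==> t \<in> Dmap m 1 ==> g m (x, t) = hh m (x, t)"
      by (rule hep[OF Q e(1) _ U f hh]) (use X in \<open>auto simp: hh_def intro: that\<close>)
    have ge: "g m ((\<mu>, \<xi>), cD e' m) = h m (\<mu>, \<xi>)" if "(\<mu>, \<xi>) \<in> U m" for m \<mu> \<xi>
      using g(2)[OF that, of "cD e' m"] e re' that by (simp add: hh_def U_def)
    show thesis
      by (rule conc[OF sm_end[OF e(2) g(1)]]) (use ge V hnD in \<open>auto simp: U_def subc_in\<close>)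
  qed
  show thesis
  proof (cases "k < n")
    case True
    show thesis
    \<comment> \<open>For \<open>k < n\<close> the vertices beyond \<open>k\<close> are pushed down
      to \<open>k\<close>. The result misses \<open>n\<close>, hence lies in the horn, and a simplex
      of the horn stays there because only the vertex \<open>k\<close> can be added to its image.
      The contracted map is at the end \<open>0\<close> since it lies below the identity.\<close>
    proof (rule main[of 0 1 "\<lambda>m \<mu> \<tau>. \<lambda>i\<in>{..m}. if \<tau> i = 0 then min (\<mu> i) k else \<mu> i"], goal_cases)
      case (3 m \<mu> \<tau>)
      show ?case
        by (rule DmapI) (use Dmap_le[OF 3(1)] Dmap_mono[OF 3(1)] Dmap_mono[OF 3(2)] in \<open>force simp: min_def\<close>)+
    next
      case (4 l m \<eta> \<mu> \<tau>)
      then show ?case by (auto simp: compose_def fun_eq_iff Dmap_iff)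
    next
      case (5 m \<mu>)
      have "(\<lambda>i\<in>{..m}. if cD 0 m i = 0 then min (\<mu> i) k else \<mu> i) \<in> Dmap m n"
        by (rule DmapI) (use Dmap_le[OF 5] Dmap_mono[OF 5] in \<open>force simp: min_def\<close>)+
      moreover have "n \<notin> (\<lambda>i\<in>{..m}. if cD 0 m i = 0 then min (\<mu> i) k else \<mu> i) ` {..m}" using True by auto
      ultimately show ?case using True by (force simp: hn_def)
    next
      case (6 m \<mu>)
      then show ?case by (auto simp: fun_eq_iff Dmap_iff)
    next
      case (7 m \<mu> \<tau>)
      have d: "\<mu> \<in> Dmap m n" by (rule hnD[OF 7(1)])
      have "(\<lambda>i\<in>{..m}. if \<tau> i = 0 then min (\<mu> i) k else \<mu> i) \<in> Dmap m n"
        by (rule DmapI) (use Dmap_le[OF d] Dmap_mono[OF d] Dmap_mono[OF 7(2)] in \<open>force simp: min_def\<close>)+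
      moreover have "(\<lambda>i\<in>{..m}. if \<tau> i = 0 then min (\<mu> i) k else \<mu> i) ` {..m} \<subseteq> insert k (\<mu> ` {..m})"
        by (auto simp: min_def)
      ultimately show ?case using 7(1) unfolding hn_def by blast
    qed simp_all
  next
    case False
    then have kn: "k = n" using n by simp
    show thesis
    \<comment> \<open>For \<open>k = n\<close> everything is pushed up to the vertex
      \<open>k\<close>; the result misses \<open>0\<close> because \<open>1 \<le> n\<close>. Now the
      identity is the lower map and sits at the end \<open>0\<close>.\<close>
    proof (rule main[of 1 0 "\<lambda>m \<mu> \<tau>. \<lambda>i\<in>{..m}. if \<tau> i = 0 then \<mu> i else k"], goal_cases)
      case (3 m \<mu> \<tau>)
      show ?case
        by (rule DmapI) (use Dmap_le[OF 3(1)] Dmap_mono[OF 3(1)] Dmap_mono[OF 3(2)] kn in force)+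
    next
      case (4 l m \<eta> \<mu> \<tau>)
      then show ?case by (auto simp: compose_def fun_eq_iff Dmap_iff)
    next
      case (5 m \<mu>)
      have "(\<lambda>i\<in>{..m}. if cD 1 m i = 0 then \<mu> i else k) \<in> Dmap m n"
        by (rule DmapI) (use kn in force)+
      moreover have "0 \<notin> (\<lambda>i\<in>{..m}. if cD 1 m i = 0 then \<mu> i else k) ` {..m}" using kn n by auto
      ultimately show ?case using kn n by (force simp: hn_def)
    next
      case (6 m \<mu>)
      then show ?case by (auto simp: fun_eq_iff Dmap_iff)
    next
      case (7 m \<mu> \<tau>)
      have d: "\<mu> \<in> Dmap m n" by (rule hnD[OF 7(1)])
      have "(\<lambda>i\<in>{..m}. if \<tau> i = 0 then \<mu> i else k) \<in> Dmap m n"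
        by (rule DmapI) (use Dmap_le[OF d] Dmap_mono[OF d] Dmap_mono[OF 7(2)] kn in force)+
      moreover have "(\<lambda>i\<in>{..m}. if \<tau> i = 0 then \<mu> i else k) ` {..m} \<subseteq> insert k (\<mu> ` {..m})"
        by auto
      ultimately show ?case using 7(1) unfolding hn_def by blast
    qed simp_all
  qed
qed

subsection \<open>Weak equivalences of Kan complexes\<close>

lemma heq_sset_weq:
  assumes p: "heq L K p" and L: "is_sset L" and K: "is_sset K"
  shows "sset_weq L K p"
  unfolding sset_weq_def
proof (intro conjI allI impI)
  obtain s where "hinv L K p s" by (rule heqE[OF p])
  note s = hinvD[OF this]
  show "is_sset L" "is_sset K" "sset_map L K p" using L K s by auto
  fix Z :: "'a sset" assume Z: "kan_complex Z"
  show "\<exists>h. sset_map K Z h \<and> sset_homotopic L Z (\<lambda>n x. h n (p n x)) g" if "sset_map L Z g" for g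
    using sm_comp[OF s(2) that] hom_post[OF s(3) that] by (intro exI[of _ "\<lambda>n x. g n (s n x)"]) simp
  fix h h' assume h: "sset_map K Z h \<and> sset_map K Z h' \<and> sset_homotopic L Z (\<lambda>n x. h n (p n x)) (\<lambda>n x. h' n (p n x))"
  have "sset_homotopic K Z (\<lambda>n x. h n (p n (s n x))) h" "sset_homotopic K Z (\<lambda>n x. h' n (p n (s n x))) h'"
    "sset_homotopic K Z (\<lambda>n x. h n (p n (s n x))) (\<lambda>n x. h' n (p n (s n x)))"
    using hom_post[OF s(4), of Z h] hom_post[OF s(4), of Z h'] h hom_pre[OF _ s(2)] by auto
  then show "sset_homotopic K Z h h'" using hom_trans[OF Z K] hom_sym[OF Z K] by blast
qed

text \<open>Testing against \<open>L\<close> yields a map back, and testing against \<open>K\<close>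
  the second homotopy; both are Kan complexes over the type that the definition quantifies
  over.\<close>

lemma sset_weq_heq:
  assumes w: "sset_weq L K p" and L: "kan_complex L" and K: "kan_complex K"
  shows "heq L K p"
proof -
  have p: "sset_map L K p" using w by (simp add: sset_weq_def)
  obtain s where s: "sset_map K L s" "sset_homotopic L L (\<lambda>n x. s n (p n x)) (\<lambda>n x. x)"
    using w L sm_id[of L] unfolding sset_weq_def by blast
  have "sset_homotopic L K (\<lambda>n x. p n (s n (p n x))) p" using hom_post[OF s(2) p] .
  then have "sset_homotopic K K (\<lambda>n x. p n (s n x)) (\<lambda>n x. x)"
    using w K sm_comp[OF s(1) p] sm_id[of K] unfolding sset_weq_def by blast
  then show ?thesis using heqI[OF p s] by blast
qed

section \<open>Small sets\<close>

lemma small_image: "small u A ==> small u (f ` A)"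
  unfolding small_def using card_of_image ordLeq_ordLess_trans by blast

lemma small_mono: "small u B ==> A \<subseteq> B ==> small u A"
  unfolding small_def using card_of_mono1 ordLeq_ordLess_trans by blast

lemma small_finite: "infinite (UNIV :: 'u set) ==> finite A ==> small (u :: 'u itself) A"
  unfolding small_def by (metis card_of_Well_order card_of_ordLeq_finite not_ordLeq_iff_ordLess)

lemma small_Un: "infinite (UNIV :: 'u set) ==> small (u :: 'u itself) A ==> small u B ==> small u (A \<union> B)"
  unfolding small_def by (rule card_of_Un_ordLess_infinite)

lemma small_times_finite:
  assumes "infinite (UNIV :: 'u set)" "small (u :: 'u itself) A" "finite B"
  shows "small u (A \<times> B)"
  using assms(3)
proof induction
  case empty
  show ?case using small_finite[OF assms(1), of "{}"] by simp
next
  case (insert b B)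
  have "A \<times> insert b B = (\<lambda>a. (a, b)) ` A \<union> A \<times> B" by auto
  then show ?case using small_Un[OF assms(1) small_image[OF assms(2)] insert(3), of "\<lambda>a. (a, b)"] by simp
qed

section \<open>Pointed simplicial presheaves\<close>

lemma psD:
  assumes "pointed_spre u C A"
  shows "Y \<in> Ob C ==> is_sset (sec A Y)"
    "Y \<in> Ob C ==> small u (cells (sec A Y) n)"
    "f \<in> Ar C ==> sset_map (sec A (Cod C f)) (sec A (Dom C f)) (rst A f)"
    "Y \<in> Ob C ==> x \<in> cells (sec A Y) n ==> rst A (Idn C Y) n x = x"
    "f \<in> Ar C ==> g \<in> Ar C ==> Cod C f = Dom C g ==> z \<in> cells (sec A (Cod C g)) n ==>
       rst A (Cmp C g f) n z = rst A f n (rst A g n z)"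
    "Y \<in> Ob C ==> bpt A Y n \<in> cells (sec A Y) n"
    "Y \<in> Ob C ==> \<mu> \<in> Dmap m n ==> act (sec A Y) m n \<mu> (bpt A Y n) = bpt A Y m"
    "f \<in> Ar C ==> rst A f n (bpt A (Cod C f) n) = bpt A (Dom C f) n"
  using assms by (simp_all add: pointed_spre_def)

lemma psI:
  assumes "\<And>Y. Y \<in> Ob C ==> is_sset (sec A Y)"
    "\<And>Y n. Y \<in> Ob C ==> small u (cells (sec A Y) n)"
    "\<And>f. f \<in> Ar C ==> sset_map (sec A (Cod C f)) (sec A (Dom C f)) (rst A f)"
    "\<And>Y n x. Y \<in> Ob C ==> x \<in> cells (sec A Y) n ==> rst A (Idn C Y) n x = x"
    "\<And>f g n x. f \<in> Ar C ==> g \<in> Ar C ==> Cod C f = Dom C g ==> x \<in> cells (sec A (Cod C g)) n ==>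
       rst A (Cmp C g f) n x = rst A f n (rst A g n x)"
    "\<And>Y n. Y \<in> Ob C ==> bpt A Y n \<in> cells (sec A Y) n"
    "\<And>Y m n \<mu>. Y \<in> Ob C ==> \<mu> \<in> Dmap m n ==> act (sec A Y) m n \<mu> (bpt A Y n) = bpt A Y m"
    "\<And>f n. f \<in> Ar C ==> rst A f n (bpt A (Cod C f) n) = bpt A (Dom C f) n"
  shows "pointed_spre u C A"
  using assms by (simp add: pointed_spre_def)

lemma sPre_simps [simp]:
  "Ob (sPre u C) = {A. pointed_spre u C A}" "Dom (sPre u C) = fst" "Cod (sPre u C) = (\<lambda>f. snd (snd f))"
  "Cmp (sPre u C) (B', \<psi>, D) (A, \<phi>, B) = (A, spre_ext C A (\<lambda>Y n x. \<psi> Y n (\<phi> Y n x)), D)"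
  "Idn (sPre u C) A = (A, spre_ext C A (\<lambda>Y n x. x), A)"
  by (simp_all add: sPre_def)

lemma Ar_sPre: "(A, \<phi>, B) \<in> Ar (sPre u C) \<longleftrightarrow> pointed_spre u C A \<and> pointed_spre u C B \<and> spre_map C A \<phi> B"
  by (simp add: sPre_def)

lemma smapD:
  assumes "spre_map C A \<phi> B"
  shows "Y \<in> Ob C ==> sset_map (sec A Y) (sec B Y) (\<phi> Y)"
    "f \<in> Ar C ==> x \<in> cells (sec A (Cod C f)) n ==> \<phi> (Dom C f) n (rst A f n x) = rst B f n (\<phi> (Cod C f) n x)"
    "Y \<in> Ob C ==> \<phi> Y n (bpt A Y n) = bpt B Y n"
    "\<not> (Y \<in> Ob C \<and> x \<in> cells (sec A Y) n) ==> \<phi> Y n x = undefined"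
  using assms by (simp_all add: spre_map_def)

lemma spre_ext_in [simp]: "Y \<in> Ob C ==> x \<in> cells (sec A Y) n ==> spre_ext C A \<phi> Y n x = \<phi> Y n x"
  by (simp add: spre_ext_def)

lemma spre_map_eqI:
  assumes "spre_map C A \<phi> B" "spre_map C A \<psi> B'" "\<And>Y n x. Y \<in> Ob C ==> x \<in> cells (sec A Y) n ==> \<phi> Y n x = \<psi> Y n x"
  shows "\<phi> = \<psi>"
  using smapD(4)[OF assms(1)] smapD(4)[OF assms(2)] assms(3) by (intro ext) metis

text \<open>The diagram is the whole site, so that \<open>TF\<close> becomes the simplicial mapping
  space into \<open>Z\<close> (\<open>TF_mt\<close>).\<close>

definition mt :: "('o, 'a) cat => ('o, 'a, 'z) spre => ('o, 'a, 'o, 'a, 'z) tst" where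
  "mt C Z = \<lparr>tI = Ob C, tE = Ar C, tsrc = Dom C, ttgt = Cod C, tov = (\<lambda>x. x), tav = (\<lambda>x. x),
     tZ = sec Z, tr = rst Z, tb = bpt Z, tp = True\<rparr>"

lemma mt_simps [simp]:
  "tI (mt C Z) = Ob C" "tE (mt C Z) = Ar C" "tsrc (mt C Z) = Dom C" "ttgt (mt C Z) = Cod C"
  "tov (mt C Z) x = x" "tav (mt C Z) a = a" "tZ (mt C Z) = sec Z" "tr (mt C Z) = rst Z" "tb (mt C Z) = bpt Z"
  "tp (mt C Z)"
  by (simp_all add: mt_def)

lemma TF_mt: "TF (mt C Z) A = map_space C A Z"
proof -
  have "gf (mt C Z) A (simplex n) \<phi> \<longleftrightarrow>
        (\<forall>Y\<in>Ob C. sset_map (sset_prod (sec A Y) (simplex n)) (sec Z Y) (\<phi> Y)) \<and>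
        (\<forall>f\<in>Ar C. \<forall>k. \<forall>x\<in>cells (sec A (Cod C f)) k. \<forall>\<eta>\<in>Dmap k n.
           \<phi> (Dom C f) k (rst A f k x, \<eta>) = rst Z f k (\<phi> (Cod C f) k (x, \<eta>))) \<and>
        (\<forall>Y\<in>Ob C. \<forall>k. \<forall>\<eta>\<in>Dmap k n. \<phi> Y k (bpt A Y k, \<eta>) = bpt Z Y k)" for n \<phi>
    by (simp add: gf_def)
  then show ?thesis unfolding TF_def map_space_def by simp
qed

lemma Tpre_mt: "Tpre (mt C Z) A \<phi> = map_space_pre C (A, \<phi>, B)"
  by (auto simp: Tpre_def map_space_pre_def fun_eq_iff)

definition wft :: "('o, 'a) cat => ('i, 'e, 'o, 'a, 'z) tst => bool" where
  "wft C t \<longleftrightarrow> tp t \<and> (\<forall>i\<in>tI t. tov t i \<in> Ob C) \<and>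
     (\<forall>e\<in>tE t. tsrc t e \<in> tI t \<and> ttgt t e \<in> tI t \<and> tav t e \<in> Ar C \<and>
        Dom C (tav t e) = tov t (tsrc t e) \<and> Cod C (tav t e) = tov t (ttgt t e)) \<and>
     (\<forall>i\<in>tI t. \<forall>n. tb t i n \<in> cells (tZ t i) n) \<and>
     (\<forall>i\<in>tI t. \<forall>m n. \<forall>\<mu>\<in>Dmap m n. act (tZ t i) m n \<mu> (tb t i n) = tb t i m) \<and>
     (\<forall>e\<in>tE t. \<forall>n. tr t e n (tb t (ttgt t e) n) = tb t (tsrc t e) n)"

lemma wftD:
  assumes "wft C t"
  shows "tp t" "i \<in> tI t ==> tov t i \<in> Ob C" "e \<in> tE t ==> tsrc t e \<in> tI t" "e \<in> tE t ==> ttgt t e \<in> tI t"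
    "e \<in> tE t ==> tav t e \<in> Ar C" "e \<in> tE t ==> Dom C (tav t e) = tov t (tsrc t e)"
    "e \<in> tE t ==> Cod C (tav t e) = tov t (ttgt t e)"
    "i \<in> tI t ==> tb t i n \<in> cells (tZ t i) n"
    "i \<in> tI t ==> \<mu> \<in> Dmap m n ==> act (tZ t i) m n \<mu> (tb t i n) = tb t i m"
    "e \<in> tE t ==> tr t e n (tb t (ttgt t e) n) = tb t (tsrc t e) n"
  using assms by (simp_all add: wft_def)

lemma wfA_ps: "wft C t ==> pointed_spre u C A ==> wfA t A"
  unfolding wfA_def using wftD psD by (metis (no_types, lifting))

lemma wfm_ar: "wft C t ==> spre_map C A \<phi> B ==> wfm t A \<phi> B"
  unfolding wfm_def
proof (intro conjI ballI allI impI)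
  assume t: "wft C t" and s: "spre_map C A \<phi> B"
  show "sset_map (tsec t A i) (tsec t B i) (\<phi> (tov t i))" if "i \<in> tI t" for i
    by (rule smapD(1)[OF s wftD(2)[OF t that]])
  show "\<phi> (tov t (tsrc t e)) k (rst A (tav t e) k x) = rst B (tav t e) k (\<phi> (tov t (ttgt t e)) k x)"
    if "e \<in> tE t" "x \<in> cells (tsec t A (ttgt t e)) k" for e k x
    using smapD(2)[OF s wftD(5)[OF t that(1)], of x k] wftD(6,7)[OF t that(1)] that(2) by simp
  show "\<phi> (tov t i) k (bpt A (tov t i) k) = bpt B (tov t i) k" if "i \<in> tI t" for i k
    by (rule smapD(3)[OF s wftD(2)[OF t that]])
qed

lemma wft_mt: 
  assumes "pointed_spre u C Z" "\<And>f. f \<in> Ar C ==> Dom C f \<in> Ob C" "\<And>f. f \<in> Ar C ==> Cod C f \<in> Ob C"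
  shows "wft C (mt C Z)"
  unfolding wft_def using psD(6-8)[OF assms(1)] assms(2,3) by simp

text \<open>The injection \<open>enc\<close> codes a value and an operator as one value, so that
  tensors with simplices and mapping cylinders are again presheaves over the type \<open>'v\<close>.
  Of the category axioms only sources and targets are recorded here.\<close>

locale site =
  fixes C :: "('o, 'a) cat" and u :: "'u itself" and enc :: "'v \<times> (nat => nat) => 'v"
  assumes inj_enc: "inj enc"
    and DomOb: "\<And>f. f \<in> Ar C ==> Dom C f \<in> Ob C" and CodOb: "\<And>f. f \<in> Ar C ==> Cod C f \<in> Ob C"
    and Dom_Idn: "\<And>Y. Y \<in> Ob C ==> Dom C (Idn C Y) = Y"
    and Dom_Cmp: "\<And>f g. f \<in> Ar C ==> g \<in> Ar C ==> Cod C f = Dom C g ==> Dom C (Cmp C g f) = Dom C f"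
    and infU: "infinite (UNIV :: 'u set)"
begin

abbreviation "PS \<equiv> pointed_spre u C"
abbreviation "M \<equiv> sPre u C"

definition "dec = inv_into UNIV enc"

lemma dec_enc [simp]: "dec (enc p) = p"
  unfolding dec_def using inj_enc by (simp add: inv_f_f)

lemma enc_eq [simp]: "enc p = enc q \<longleftrightarrow> p = q"
  using inj_enc by (auto dest: injD)

lemma wftmt: "PS Z ==> wft C (mt C Z)"
  by (rule wft_mt) (auto intro: DomOb CodOb)

text \<open>The family \<open>s\<close> consists of the degeneracies of a vertex of
  \<open>X\<close>; evaluating there turns a family of maps into an arrow. In applications
  \<open>X\<close> is a simplex and \<open>s\<close> is \<open>cD 0\<close>.\<close>

lemma gf_arr:
  assumes g: "gf (mt C Z) P X \<psi>" and P: "PS P" and Z: "PS Z" and s: "\<And>m. s m \<in> cells X m"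
    and sn: "\<And>l m \<eta>. \<eta> \<in> Dmap l m ==> act X l m \<eta> (s m) = s l"
  shows "(P, spre_ext C P (\<lambda>Y m y. \<psi> Y m (y, s m)), Z) \<in> Ar M"
proof -
  have "spre_map C P (spre_ext C P (\<lambda>Y m y. \<psi> Y m (y, s m))) Z"
    unfolding spre_map_def
  proof (intro conjI ballI allI impI)
    fix Y assume Y: "Y \<in> Ob C"
    show "sset_map (sec P Y) (sec Z Y) (spre_ext C P (\<lambda>Y m y. \<psi> Y m (y, s m)) Y)"
    proof (rule smI)
      fix n x assume "x \<in> cells (sec P Y) n"
      then show "spre_ext C P (\<lambda>Y m y. \<psi> Y m (y, s m)) Y n x \<in> cells (sec Z Y) n"
        using gfD(1)[OF g] Y s by simp
    next
      fix m n \<mu> x assume t: "\<mu> \<in> Dmap m n" "x \<in> cells (sec P Y) n"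
      then show "spre_ext C P (\<lambda>Y m y. \<psi> Y m (y, s m)) Y m (act (sec P Y) m n \<mu> x) =
         act (sec Z Y) m n \<mu> (spre_ext C P (\<lambda>Y m y. \<psi> Y m (y, s m)) Y n x)"
        using gfD(2)[OF g, of Y \<mu> m n x "s n"] Y s sn psD(1)[OF P Y] by simp
    qed
  next
    fix f n x assume f: "f \<in> Ar C" "x \<in> cells (sec P (Cod C f)) n"
    then show "spre_ext C P (\<lambda>Y m y. \<psi> Y m (y, s m)) (Dom C f) n (rst P f n x) =
       rst Z f n (spre_ext C P (\<lambda>Y m y. \<psi> Y m (y, s m)) (Cod C f) n x)"
      using gfD(3)[OF g, of f x n "s n"] s sm_in[OF psD(3)[OF P f(1)]] DomOb CodOb by simp
  next
    fix Y n assume "Y \<in> Ob C"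
    then show "spre_ext C P (\<lambda>Y m y. \<psi> Y m (y, s m)) Y n (bpt P Y n) = bpt Z Y n"
      using gfD(4)[OF g, of Y "s n" n] s psD(6)[OF P] by simp
  next
    fix Y n x assume "\<not> (Y \<in> Ob C \<and> x \<in> cells (sec P Y) n)"
    then show "spre_ext C P (\<lambda>Y m y. \<psi> Y m (y, s m)) Y n x = undefined" by (simp only: spre_ext_def if_False)
  qed
  then show ?thesis using P Z by (simp add: Ar_sPre)
qed

lemma arr_gf:
  assumes "(P, \<upsilon>, Z) \<in> Ar M"
  shows "gf (mt C Z) P X (\<lambda>Y m (y, \<xi>). \<upsilon> Y m y)"
proof -
  have s: "spre_map C P \<upsilon> Z" using assms by (simp add: Ar_sPre)
  show ?thesis
    by (rule gfI) (use smapD(2,3)[OF s] sm_in[OF smapD(1)[OF s]] sm_nat[OF smapD(1)[OF s]] in auto)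
qed

subsection \<open>Tensors with simplices\<close>

text \<open>The subpresheaf of \<open>A \<and> \<Delta>[n]\<^sub>+\<close> given by \<open>S\<close>, with \<open>(x, \<mu>)\<close> encoded as a single value and
  all pairs over the base point identified.\<close>

definition tc :: "('o, 'a, 'v) spre => 'o => nat => 'v \<times> (nat => nat) => 'v" where
  "tc A Y m = (\<lambda>(x, \<mu>). enc (if x = bpt A Y m then (x, \<lambda>_. 0) else (x, \<mu>)))"

definition Tens :: "('o, 'a, 'v) spre => ('o => nat => ('v \<times> (nat => nat)) set) => ('o, 'a, 'v) spre" where
  "Tens A S = \<lparr>
     sec = (\<lambda>Y. \<lparr>cells = (\<lambda>m. tc A Y m ` S Y m),
       act = (\<lambda>l m \<eta> y. case dec y of (x, \<mu>) => tc A Y l (act (sec A Y) l m \<eta> x, compD l \<mu> \<eta>))\<rparr>),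
     rst = (\<lambda>f m y. case dec y of (x, \<mu>) => tc A (Dom C f) m (rst A f m x, \<mu>)),
     bpt = (\<lambda>Y m. enc (bpt A Y m, \<lambda>_. 0))\<rparr>"

definition subT :: "('o, 'a, 'v) spre => nat => ('o => nat => ('v \<times> (nat => nat)) set) => bool" where
  "subT A n S \<longleftrightarrow> (\<forall>Y\<in>Ob C. \<forall>m. S Y m \<subseteq> cells (sec A Y) m \<times> Dmap m n \<and> {bpt A Y m} \<times> Dmap m n \<subseteq> S Y m) \<and>
     (\<forall>Y\<in>Ob C. \<forall>l m. \<forall>\<eta>\<in>Dmap l m. \<forall>x \<mu>. (x, \<mu>) \<in> S Y m \<longrightarrow> (act (sec A Y) l m \<eta> x, compD l \<mu> \<eta>) \<in> S Y l) \<and>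
     (\<forall>f\<in>Ar C. \<forall>m x \<mu>. (x, \<mu>) \<in> S (Cod C f) m \<longrightarrow> (rst A f m x, \<mu>) \<in> S (Dom C f) m)"

lemma subTD:
  assumes "subT A n S"
  shows "Y \<in> Ob C ==> (x, \<mu>) \<in> S Y m ==> x \<in> cells (sec A Y) m"
    "Y \<in> Ob C ==> (x, \<mu>) \<in> S Y m ==> \<mu> \<in> Dmap m n"
    "Y \<in> Ob C ==> \<mu> \<in> Dmap m n ==> (bpt A Y m, \<mu>) \<in> S Y m"
    "Y \<in> Ob C ==> \<eta> \<in> Dmap l m ==> (x, \<mu>) \<in> S Y m ==> (act (sec A Y) l m \<eta> x, compD l \<mu> \<eta>) \<in> S Y l"
    "f \<in> Ar C ==> (x, \<mu>) \<in> S (Cod C f) m ==> (rst A f m x, \<mu>) \<in> S (Dom C f) m"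
  using assms unfolding subT_def by (blast, blast, blast, simp, simp)

lemma tc_bpt [simp]: "tc A Y m (bpt A Y m, \<mu>) = enc (bpt A Y m, \<lambda>_. 0)"
  by (simp add: tc_def)

lemma Tens_simps [simp]:
  "cells (sec (Tens A S) Y) m = tc A Y m ` S Y m"
  "bpt (Tens A S) Y m = enc (bpt A Y m, \<lambda>_. 0)"
  by (simp_all add: Tens_def)

lemma Tens_act:
  assumes "PS A" "Y \<in> Ob C" "\<eta> \<in> Dmap l m"
  shows "act (sec (Tens A S) Y) l m \<eta> (tc A Y m (x, \<mu>)) = tc A Y l (act (sec A Y) l m \<eta> x, compD l \<mu> \<eta>)"
  using psD(7)[OF assms] by (auto simp: Tens_def tc_def)

lemma Tens_rst:
  assumes "PS A" "f \<in> Ar C"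
  shows "rst (Tens A S) f m (tc A (Cod C f) m (x, \<mu>)) = tc A (Dom C f) m (rst A f m x, \<mu>)"
  using psD(8)[OF assms] by (auto simp: Tens_def tc_def)

lemma PS_Tens:
  assumes A: "PS A" and S: "subT A n S"
  shows "PS (Tens A S)"
proof (rule psI)
  fix Y assume Y: "Y \<in> Ob C"
  note a = Tens_act[OF A Y, of _ _ _ S]
  show "is_sset (sec (Tens A S) Y)"
  proof (rule issI)
    fix l m \<eta> y assume e: "\<eta> \<in> Dmap l m" and "y \<in> cells (sec (Tens A S) Y) m"
    then obtain x \<mu> where y: "y = tc A Y m (x, \<mu>)" "(x, \<mu>) \<in> S Y m" by auto
    show "act (sec (Tens A S) Y) l m \<eta> y \<in> cells (sec (Tens A S) Y) l"
      using subTD(4)[OF S Y e y(2)] by (simp add: y(1) a[OF e])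
  next
    fix m y assume "y \<in> cells (sec (Tens A S) Y) m"
    then obtain x \<mu> where y: "y = tc A Y m (x, \<mu>)" "(x, \<mu>) \<in> S Y m" by auto
    show "act (sec (Tens A S) Y) m m (idD m) y = y"
      using subTD(1,2)[OF S Y y(2)] psD(1)[OF A Y] by (simp add: y(1) a[OF id_Dmap])
  next
    fix l m k \<eta> \<mu>' y assume e: "\<eta> \<in> Dmap l m" "\<mu>' \<in> Dmap m k" and "y \<in> cells (sec (Tens A S) Y) k"
    then obtain x \<mu> where y: "y = tc A Y k (x, \<mu>)" "(x, \<mu>) \<in> S Y k" by auto
    show "act (sec (Tens A S) Y) l m \<eta> (act (sec (Tens A S) Y) m k \<mu>' y) = act (sec (Tens A S) Y) l k (compD l \<mu>' \<eta>) y"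
      using subTD(1)[OF S Y y(2)] psD(1)[OF A Y] ss_comp[OF psD(1)[OF A Y] e]
      by (simp add: y(1) a[OF e(1)] a[OF e(2)] a[OF comp_Dmap[OF e(2,1)]] comp_D_assoc[OF e(1)])
  qed
  show "small u (cells (sec (Tens A S) Y) m)" for m
  proof (rule small_mono)
    show "small u (tc A Y m ` (cells (sec A Y) m \<times> Dmap m n))"
      by (intro small_image small_times_finite infU psD(2)[OF A Y]) simp
    show "cells (sec (Tens A S) Y) m \<subseteq> tc A Y m ` (cells (sec A Y) m \<times> Dmap m n)"
      using subTD(1,2)[OF S Y] by auto
  qed
  show "bpt (Tens A S) Y m \<in> cells (sec (Tens A S) Y) m" for m
    using tc_bpt[of A Y m "cD 0 m"] subTD(3)[OF S Y const_Dmap[of 0 n m]] by (auto intro!: image_eqI[of _ _ "(bpt A Y m, cD 0 m)"])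
  show "act (sec (Tens A S) Y) m k \<mu> (bpt (Tens A S) Y k) = bpt (Tens A S) Y m" if "\<mu> \<in> Dmap m k" for m k \<mu>
    using a[OF that, of "bpt A Y k" undefined] psD(7)[OF A Y that] by simp
  show "rst (Tens A S) (Idn C Y) m y = y" if "y \<in> cells (sec (Tens A S) Y) m" for m y
  proof -
    from that obtain x \<mu> where y: "y = tc A Y m (x, \<mu>)" "(x, \<mu>) \<in> S Y m" by auto
    have "dec y = (if x = bpt A Y m then (x, \<lambda>_. 0) else (x, \<mu>))" by (simp add: y(1) tc_def)
    then show ?thesis using psD(4)[OF A Y subTD(1)[OF S Y y(2)]] y(1) Dom_Idn[OF Y]
      by (cases "x = bpt A Y m") (simp_all add: Tens_def)
  qed
next
  fix f assume f: "f \<in> Ar C"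
  note a = Tens_act[OF A, of _ _ _ _ S] and Y = CodOb[OF f] DomOb[OF f]
  show "sset_map (sec (Tens A S) (Cod C f)) (sec (Tens A S) (Dom C f)) (rst (Tens A S) f)"
  proof (rule smI)
    fix m y assume "y \<in> cells (sec (Tens A S) (Cod C f)) m"
    then obtain x \<mu> where y: "y = tc A (Cod C f) m (x, \<mu>)" "(x, \<mu>) \<in> S (Cod C f) m" by auto
    show "rst (Tens A S) f m y \<in> cells (sec (Tens A S) (Dom C f)) m"
      using subTD(5)[OF S f y(2)] by (simp add: y(1) Tens_rst[OF A f])
  next
    fix l m \<eta> y assume e: "\<eta> \<in> Dmap l m" and "y \<in> cells (sec (Tens A S) (Cod C f)) m"
    then obtain x \<mu> where y: "y = tc A (Cod C f) m (x, \<mu>)" "(x, \<mu>) \<in> S (Cod C f) m" by auto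
    show "rst (Tens A S) f l (act (sec (Tens A S) (Cod C f)) l m \<eta> y) =
       act (sec (Tens A S) (Dom C f)) l m \<eta> (rst (Tens A S) f m y)"
      using sm_nat[OF psD(3)[OF A f] e subTD(1)[OF S Y(1) y(2)]]
      by (simp add: y(1) Tens_rst[OF A f] a[OF Y(1) e] a[OF Y(2) e])
  qed
  show "rst (Tens A S) f m (bpt (Tens A S) (Cod C f) m) = bpt (Tens A S) (Dom C f) m" for m
    using Tens_rst[OF A f, of S m "bpt A (Cod C f) m" undefined] psD(8)[OF A f] by simp
next
  fix f g m y assume f: "f \<in> Ar C" "g \<in> Ar C" "Cod C f = Dom C g" and "y \<in> cells (sec (Tens A S) (Cod C g)) m"
  then obtain x \<mu> where y: "y = tc A (Cod C g) m (x, \<mu>)" "(x, \<mu>) \<in> S (Cod C g) m" by auto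
  have x: "x \<in> cells (sec A (Cod C g)) m" by (rule subTD(1)[OF S CodOb[OF f(2)] y(2)])
  have d: "dec y = (if x = bpt A (Cod C g) m then (x, \<lambda>_. 0) else (x, \<mu>))" by (simp add: y(1) tc_def)
  have "rst (Tens A S) f m (rst (Tens A S) g m y) = tc A (Dom C f) m (rst A f m (rst A g m x), \<mu>)"
    using Tens_rst[OF A f(1), of S m "rst A g m x" \<mu>] by (simp add: y(1) Tens_rst[OF A f(2)] f(3))
  moreover have "rst (Tens A S) (Cmp C g f) m y = tc A (Dom C f) m (rst A f m (rst A g m x), \<mu>)"
    using psD(5)[OF A f x] Dom_Cmp[OF f] psD(8)[OF A f(1), of m] psD(8)[OF A f(2), of m] f(3)
    by (auto simp: Tens_def d)
  ultimately show "rst (Tens A S) (Cmp C g f) m y = rst (Tens A S) f m (rst (Tens A S) g m y)" by simp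
qed

lemma gf_TensD:
  assumes g: "gf t (Tens A S) X \<psi>" and t: "wft C t" and A: "PS A" and S: "subT A n S"
  shows "i \<in> tI t ==> (x, \<mu>) \<in> S (tov t i) k ==> \<xi> \<in> cells X k ==> \<psi> i k (tc A (tov t i) k (x, \<mu>), \<xi>) \<in> cells (tZ t i) k"
    and "i \<in> tI t ==> \<eta> \<in> Dmap l k ==> (x, \<mu>) \<in> S (tov t i) k ==> \<xi> \<in> cells X k ==>
      \<psi> i l (tc A (tov t i) l (act (sec A (tov t i)) l k \<eta> x, compD l \<mu> \<eta>), act X l k \<eta> \<xi>) =
      act (tZ t i) l k \<eta> (\<psi> i k (tc A (tov t i) k (x, \<mu>), \<xi>))"
    and "e \<in> tE t ==> (x, \<mu>) \<in> S (tov t (ttgt t e)) k ==> \<xi> \<in> cells X k ==>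
      \<psi> (tsrc t e) k (tc A (tov t (tsrc t e)) k (rst A (tav t e) k x, \<mu>), \<xi>) =
      tr t e k (\<psi> (ttgt t e) k (tc A (tov t (ttgt t e)) k (x, \<mu>), \<xi>))"
    and "i \<in> tI t ==> \<xi> \<in> cells X k ==> \<psi> i k (tc A (tov t i) k (bpt A (tov t i) k, \<mu>), \<xi>) = tb t i k"
proof -
  assume i: "i \<in> tI t" "(x, \<mu>) \<in> S (tov t i) k" "\<xi> \<in> cells X k"
  then show "\<psi> i k (tc A (tov t i) k (x, \<mu>), \<xi>) \<in> cells (tZ t i) k" by (intro gfD(1)[OF g]) auto
next
  assume i: "i \<in> tI t" "\<eta> \<in> Dmap l k" "(x, \<mu>) \<in> S (tov t i) k" "\<xi> \<in> cells X k"
  then show "\<psi> i l (tc A (tov t i) l (act (sec A (tov t i)) l k \<eta> x, compD l \<mu> \<eta>), act X l k \<eta> \<xi>) =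
      act (tZ t i) l k \<eta> (\<psi> i k (tc A (tov t i) k (x, \<mu>), \<xi>))"
    using gfD(2)[OF g i(1,2), of "tc A (tov t i) k (x, \<mu>)" \<xi>] Tens_act[OF A wftD(2)[OF t i(1)] i(2)] by auto
next
  assume e: "e \<in> tE t" "(x, \<mu>) \<in> S (tov t (ttgt t e)) k" "\<xi> \<in> cells X k"
  then show "\<psi> (tsrc t e) k (tc A (tov t (tsrc t e)) k (rst A (tav t e) k x, \<mu>), \<xi>) =
      tr t e k (\<psi> (ttgt t e) k (tc A (tov t (ttgt t e)) k (x, \<mu>), \<xi>))"
    using gfD(3)[OF g e(1), of "tc A (tov t (ttgt t e)) k (x, \<mu>)" k \<xi>] Tens_rst[OF A wftD(5)[OF t e(1)], of S k x \<mu>]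
      wftD(6,7)[OF t e(1)] by auto
next
  assume "i \<in> tI t" "\<xi> \<in> cells X k"
  then show "\<psi> i k (tc A (tov t i) k (bpt A (tov t i) k, \<mu>), \<xi>) = tb t i k"
    using gfD(4)[OF g wftD(1)[OF t]] by simp
qed

text \<open>Over base points the value is set to \<open>tb\<close>, so that it does not depend on
  which pair represents the collapsed simplices.\<close>

definition dtens :: "('i, 'e, 'o, 'a, 'z) tst => ('o, 'a, 'v) spre => ('i => nat => 'v \<times> (nat => nat) \<times> 'x => 'z) =>
    'i => nat => 'v \<times> 'x => 'z" where
  "dtens t A \<Psi> i k = (\<lambda>(y, \<xi>). case dec y of (x, \<mu>) => if x = bpt A (tov t i) k then tb t i k else \<Psi> i k (x, \<mu>, \<xi>))"

lemma dtens_tc: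
  "(x = bpt A (tov t i) k ==> \<Psi> i k (x, \<mu>, \<xi>) = tb t i k) ==>
    dtens t A \<Psi> i k (tc A (tov t i) k (x, \<mu>), \<xi>) = \<Psi> i k (x, \<mu>, \<xi>)"
  by (auto simp: dtens_def tc_def)

lemma gf_TensI:
  assumes t: "wft C t" and A: "PS A" and S: "subT A n S" and X: "is_sset X"
    and 1: "\<And>i k x \<mu> \<xi>. i \<in> tI t ==> (x, \<mu>) \<in> S (tov t i) k ==> \<xi> \<in> cells X k ==> \<Psi> i k (x, \<mu>, \<xi>) \<in> cells (tZ t i) k"
    and 2: "\<And>i l k \<eta> x \<mu> \<xi>. i \<in> tI t ==> \<eta> \<in> Dmap l k ==> (x, \<mu>) \<in> S (tov t i) k ==> \<xi> \<in> cells X k ==>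
      \<Psi> i l (act (sec A (tov t i)) l k \<eta> x, compD l \<mu> \<eta>, act X l k \<eta> \<xi>) = act (tZ t i) l k \<eta> (\<Psi> i k (x, \<mu>, \<xi>))"
    and 3: "\<And>e k x \<mu> \<xi>. e \<in> tE t ==> (x, \<mu>) \<in> S (tov t (ttgt t e)) k ==> \<xi> \<in> cells X k ==>
      \<Psi> (tsrc t e) k (rst A (tav t e) k x, \<mu>, \<xi>) = tr t e k (\<Psi> (ttgt t e) k (x, \<mu>, \<xi>))"
    and 4: "\<And>i k \<mu> \<xi>. i \<in> tI t ==> \<mu> \<in> Dmap k n ==> \<xi> \<in> cells X k ==> \<Psi> i k (bpt A (tov t i) k, \<mu>, \<xi>) = tb t i k"
  shows "gf t (Tens A S) X (dtens t A \<Psi>)"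
proof -
  have d: "dtens t A \<Psi> i k (tc A (tov t i) k (x, \<mu>), \<xi>) = \<Psi> i k (x, \<mu>, \<xi>)"
    if "i \<in> tI t" "(x, \<mu>) \<in> S (tov t i) k" "\<xi> \<in> cells X k" for i k x \<mu> \<xi>
    by (rule dtens_tc) (use 4[OF that(1) _ that(3)] subTD(2)[OF S wftD(2)[OF t that(1)] that(2)] in auto)
  show ?thesis
  proof (rule gfI)
    fix i k y \<xi> assume i: "i \<in> tI t" "y \<in> cells (sec (Tens A S) (tov t i)) k" "\<xi> \<in> cells X k"
    then obtain x \<mu> where y: "y = tc A (tov t i) k (x, \<mu>)" "(x, \<mu>) \<in> S (tov t i) k" by auto
    show "dtens t A \<Psi> i k (y, \<xi>) \<in> cells (tZ t i) k" using 1[OF i(1) y(2) i(3)] by (simp add: y(1) d[OF i(1) y(2) i(3)])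
  next
    fix i l k \<eta> y \<xi> assume i: "i \<in> tI t" "\<eta> \<in> Dmap l k" "y \<in> cells (sec (Tens A S) (tov t i)) k" "\<xi> \<in> cells X k"
    then obtain x \<mu> where y: "y = tc A (tov t i) k (x, \<mu>)" "(x, \<mu>) \<in> S (tov t i) k" by auto
    have Y: "tov t i \<in> Ob C" by (rule wftD(2)[OF t i(1)])
    show "dtens t A \<Psi> i l (act (sec (Tens A S) (tov t i)) l k \<eta> y, act X l k \<eta> \<xi>) =
       act (tZ t i) l k \<eta> (dtens t A \<Psi> i k (y, \<xi>))"
      using 2[OF i(1,2) y(2) i(4)] d[OF i(1) subTD(4)[OF S Y i(2) y(2)], of "act X l k \<eta> \<xi>"] X i
      by (simp add: y(1) d[OF i(1) y(2) i(4)] Tens_act[OF A Y i(2)])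
  next
    fix e k y \<xi> assume e: "e \<in> tE t" "y \<in> cells (sec (Tens A S) (tov t (ttgt t e))) k" "\<xi> \<in> cells X k"
    then obtain x \<mu> where y: "y = tc A (tov t (ttgt t e)) k (x, \<mu>)" "(x, \<mu>) \<in> S (tov t (ttgt t e)) k" by auto
    note w = wftD[OF t]
    have r: "(rst A (tav t e) k x, \<mu>) \<in> S (tov t (tsrc t e)) k"
      using subTD(5)[OF S w(5)[OF e(1)], of x \<mu> k] y(2) w(6,7)[OF e(1)] by simp
    have "rst (Tens A S) (tav t e) k y = tc A (tov t (tsrc t e)) k (rst A (tav t e) k x, \<mu>)"
      using Tens_rst[OF A w(5)[OF e(1)], of S k x \<mu>] w(6,7)[OF e(1)] y(1) by simp
    then show "dtens t A \<Psi> (tsrc t e) k (rst (Tens A S) (tav t e) k y, \<xi>) = tr t e k (dtens t A \<Psi> (ttgt t e) k (y, \<xi>))"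
      using 3[OF e(1) y(2) e(3)] d[OF w(3)[OF e(1)] r e(3)] d[OF w(4)[OF e(1)] y(2) e(3)] y(1) by simp
  next
    fix i k \<xi> show "dtens t A \<Psi> i k (bpt (Tens A S) (tov t i) k, \<xi>) = tb t i k" by (simp add: dtens_def)
  qed
qed

definition Tall :: "('o, 'a, 'v) spre => nat => 'o => nat => ('v \<times> (nat => nat)) set" where
  "Tall A n Y m = cells (sec A Y) m \<times> Dmap m n"

lemma subT_Tall: "PS A ==> subT A n (Tall A n)"
  unfolding subT_def Tall_def using psD(1,6)[of u C A] sm_in[OF psD(3)[of u C A]]
  by (auto simp: DomOb CodOb)

text \<open>With \<open>gf_dtens\<close> this is the tensor adjunction: a factor \<Delta>[n] moves
  from the presheaf to the parameter complex.\<close>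

lemma gf_Tall:
  assumes g: "gf t (Tens A (Tall A n)) X \<psi>" and t: "wft C t" and A: "PS A"
  shows "gf t A (sset_prod (simplex n) X) (\<lambda>i k (x, \<mu>, \<xi>). \<psi> i k (tc A (tov t i) k (x, \<mu>), \<xi>))"
  by (rule gfI) (use gf_TensD[OF g t A subT_Tall[OF A]] in \<open>auto simp: Tall_def simp del: tc_bpt\<close>)

lemma gf_dtens:
  assumes g: "gf t A (sset_prod (simplex n) X) \<Psi>" and t: "wft C t" and A: "PS A" and X: "is_sset X"
  shows "gf t (Tens A (Tall A n)) X (dtens t A \<Psi>)"
proof (rule gf_TensI[OF t A subT_Tall[OF A] X], goal_cases)
  case (1 i k x \<mu> \<xi>) then show ?case using gfD(1)[OF g] by (simp add: Tall_def)
next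
  case (2 i l k \<eta> x \<mu> \<xi>) then show ?case using gfD(2)[OF g 2(1,2), of x "(\<mu>, \<xi>)"] by (simp add: Tall_def)
next
  case (3 e k x \<mu> \<xi>) then show ?case using gfD(3)[OF g 3(1), of x k "(\<mu>, \<xi>)"] by (simp add: Tall_def)
next
  case (4 i k \<mu> \<xi>) then show ?case using gfD(4)[OF g wftD(1)[OF t] 4(1), of "(\<mu>, \<xi>)" k] by simp
qed

lemma dtens_gf:
  assumes g: "gf t A (sset_prod (simplex n) X) \<Psi>" and t: "wft C t"
    and i: "i \<in> tI t" "\<mu> \<in> Dmap k n" "\<xi> \<in> cells X k"
  shows "dtens t A \<Psi> i k (tc A (tov t i) k (x, \<mu>), \<xi>) = \<Psi> i k (x, \<mu>, \<xi>)"
  by (rule dtens_tc) (use gfD(4)[OF g wftD(1)[OF t] i(1), of "(\<mu>, \<xi>)" k] i in simp)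

lemma wfm_incl:
  assumes "PS P" "PS Q" "\<And>Y n. Y \<in> Ob C ==> cells (sec P Y) n \<subseteq> cells (sec Q Y) n"
    "\<And>Y m n \<mu> x. Y \<in> Ob C ==> act (sec P Y) m n \<mu> x = act (sec Q Y) m n \<mu> x"
    "\<And>f n x. f \<in> Ar C ==> rst P f n x = rst Q f n x" "\<And>Y n. Y \<in> Ob C ==> bpt P Y n = bpt Q Y n"
  shows "spre_map C P (spre_ext C P (\<lambda>Y n y. y)) Q"
  unfolding spre_map_def
proof (intro conjI ballI allI impI)
  fix Y assume Y: "Y \<in> Ob C"
  show "sset_map (sec P Y) (sec Q Y) (spre_ext C P (\<lambda>Y n y. y) Y)"
  proof (rule smI)
    fix n x assume "x \<in> cells (sec P Y) n"
    then show "spre_ext C P (\<lambda>Y n y. y) Y n x \<in> cells (sec Q Y) n" using Y assms(3) by auto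
  next
    fix m n \<mu> x assume "\<mu> \<in> Dmap m n" "x \<in> cells (sec P Y) n"
    then show "spre_ext C P (\<lambda>Y n y. y) Y m (act (sec P Y) m n \<mu> x) =
        act (sec Q Y) m n \<mu> (spre_ext C P (\<lambda>Y n y. y) Y n x)"
      using ss_act[OF psD(1)[OF assms(1) Y], of \<mu> m n x] Y assms(4) by simp
  qed
next
  fix f n x assume f: "f \<in> Ar C" "x \<in> cells (sec P (Cod C f)) n"
  then show "spre_ext C P (\<lambda>Y n y. y) (Dom C f) n (rst P f n x) = rst Q f n (spre_ext C P (\<lambda>Y n y. y) (Cod C f) n x)"
    using sm_in[OF psD(3)[OF assms(1) f(1)] f(2)] assms(5) DomOb CodOb by simp
next
  fix Y n assume "Y \<in> Ob C"
  then show "spre_ext C P (\<lambda>Y n y. y) Y n (bpt P Y n) = bpt Q Y n" using psD(6)[OF assms(1)] assms(6) by simp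
qed (auto simp: spre_ext_def)

definition tincl :: "('o, 'a, 'v) spre => nat => ('o => nat => ('v \<times> (nat => nat)) set) => ('o, 'a, 'v) smap_arr" where
  "tincl A n S = (Tens A S, spre_ext C (Tens A S) (\<lambda>Y n y. y), Tens A (Tall A n))"

lemma tincl_mono:
  assumes A: "PS A" and S: "subT A n S"
  shows "tincl A n S \<in> spre_monos u C"
proof -
  have "spre_map C (Tens A S) (spre_ext C (Tens A S) (\<lambda>Y n y. y)) (Tens A (Tall A n))"
    by (rule wfm_incl[OF PS_Tens[OF A S] PS_Tens[OF A subT_Tall[OF A]]])
      (use subTD(1,2)[OF S] in \<open>auto simp: Tens_def Tall_def\<close>)
  then show ?thesis
    using PS_Tens[OF A S] PS_Tens[OF A subT_Tall[OF A]]
    by (auto simp: spre_monos_def tincl_def Ar_sPre inj_on_def)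
qed

subsection \<open>Mapping cylinders\<close>

text \<open>The reduced mapping cylinder of \<open>\<phi> : A \<rightarrow> B\<close>, with the end \<open>1\<close> of \<open>A \<and> \<Delta>[1]\<^sub>+\<close> glued to \<open>B\<close>.
  The tag \<open>\<lambda>_. 2\<close>, which is not a simplex of \<open>\<Delta>[1]\<close>, marks the elements of \<open>B\<close>.\<close>

definition cB :: "'v => 'v" where "cB b = enc (b, \<lambda>_. 2)"

definition cA :: "('o, 'a, 'v) spre => ('o => nat => 'v => 'v) => 'o => nat => 'v \<times> (nat => nat) => 'v" where
  "cA A \<phi> Y m = (\<lambda>(a, t). if a = bpt A Y m \<or> t = cD 1 m then cB (\<phi> Y m a) else enc (a, t))"

definition Cyl :: "('o, 'a, 'v) smap_arr => ('o, 'a, 'v) spre" where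
  "Cyl = (\<lambda>(A, \<phi>, B). \<lparr>
     sec = (\<lambda>Y. \<lparr>cells = (\<lambda>m. cB ` cells (sec B Y) m \<union> cA A \<phi> Y m ` (cells (sec A Y) m \<times> Dmap m 1)),
       act = (\<lambda>l m \<eta> y. case dec y of (x, t) => if t = (\<lambda>_. 2) then cB (act (sec B Y) l m \<eta> x)
         else cA A \<phi> Y l (act (sec A Y) l m \<eta> x, compD l t \<eta>))\<rparr>),
     rst = (\<lambda>f m y. case dec y of (x, t) => if t = (\<lambda>_. 2) then cB (rst B f m x) else cA A \<phi> (Dom C f) m (rst A f m x, t)),
     bpt = (\<lambda>Y m. cB (bpt B Y m))\<rparr>)"

lemma cB_eq [simp]: "cB b = cB b' \<longleftrightarrow> b = b'"
  by (simp add: cB_def)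

lemma dec_cB [simp]: "dec (cB b) = (b, \<lambda>_. 2)"
  by (simp add: cB_def)

lemma tag2: "t \<in> Dmap m 1 ==> t \<noteq> (\<lambda>_. 2)"
  by (auto simp: Dmap_iff)

lemma Cyl_simps [simp]:
  "cells (sec (Cyl (A, \<phi>, B)) Y) m = cB ` cells (sec B Y) m \<union> cA A \<phi> Y m ` (cells (sec A Y) m \<times> Dmap m 1)"
  "bpt (Cyl (A, \<phi>, B)) Y m = cB (bpt B Y m)"
  "act (sec (Cyl (A, \<phi>, B)) Y) l m \<eta> (cB b) = cB (act (sec B Y) l m \<eta> b)"
  "rst (Cyl (A, \<phi>, B)) f m (cB b) = cB (rst B f m b)"
  by (simp_all add: Cyl_def)

lemma Cyl_cellE:
  assumes "y \<in> cells (sec (Cyl (A, \<phi>, B)) Y) m"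
  obtains b where "y = cB b" "b \<in> cells (sec B Y) m"
    | a t where "y = cA A \<phi> Y m (a, t)" "a \<in> cells (sec A Y) m" "t \<in> Dmap m 1"
  using assms by auto

lemma cA_cD1 [simp]: "cA A \<phi> Y m (a, cD 1 m) = cB (\<phi> Y m a)"
  by (simp add: cA_def)

lemma Cyl_act:
  assumes f: "(A, \<phi>, B) \<in> Ar M" and Y: "Y \<in> Ob C" and e: "\<eta> \<in> Dmap l m" and a: "a \<in> cells (sec A Y) m" and t: "t \<in> Dmap m 1"
  shows "act (sec (Cyl (A, \<phi>, B)) Y) l m \<eta> (cA A \<phi> Y m (a, t)) = cA A \<phi> Y l (act (sec A Y) l m \<eta> a, compD l t \<eta>)"
proof -
  have A: "PS A" and p: "spre_map C A \<phi> B" using f by (auto simp: Ar_sPre)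
  have n: "\<phi> Y l (act (sec A Y) l m \<eta> a) = act (sec B Y) l m \<eta> (\<phi> Y m a)" by (rule sm_nat[OF smapD(1)[OF p Y] e a])
  show ?thesis
  proof (cases "a = bpt A Y m \<or> t = cD 1 m")
    case True
    then have "act (sec A Y) l m \<eta> a = bpt A Y l \<or> compD l t \<eta> = cD 1 l" using psD(7)[OF A Y e] e by auto
    then show ?thesis using True n by (simp add: cA_def)
  next
    case False
    then have "cA A \<phi> Y m (a, t) = enc (a, t)" by (simp add: cA_def)
    then show ?thesis using tag2[OF t] by (simp add: Cyl_def)
  qed
qed

lemma Cyl_rst:
  assumes f: "(A, \<phi>, B) \<in> Ar M" and g: "g \<in> Ar C" and a: "a \<in> cells (sec A (Cod C g)) m" and t: "t \<in> Dmap m 1"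
  shows "rst (Cyl (A, \<phi>, B)) g m (cA A \<phi> (Cod C g) m (a, t)) = cA A \<phi> (Dom C g) m (rst A g m a, t)"
proof -
  have A: "PS A" and p: "spre_map C A \<phi> B" using f by (auto simp: Ar_sPre)
  have n: "\<phi> (Dom C g) m (rst A g m a) = rst B g m (\<phi> (Cod C g) m a)" by (rule smapD(2)[OF p g a])
  show ?thesis
  proof (cases "a = bpt A (Cod C g) m \<or> t = cD 1 m")
    case True
    then have "rst A g m a = bpt A (Dom C g) m \<or> t = cD 1 m" using psD(8)[OF A g] by auto
    then show ?thesis using True n by (auto simp: cA_def)
  next
    case False
    then have "cA A \<phi> (Cod C g) m (a, t) = enc (a, t)" by (simp add: cA_def)
    then show ?thesis using tag2[OF t] by (simp add: Cyl_def)
  qed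
qed

lemma cB_in: "b \<in> cells (sec B Y) m ==> cB b \<in> cells (sec (Cyl (A, \<phi>, B)) Y) m"
  and cA_in: "a \<in> cells (sec A Y) m ==> t \<in> Dmap m 1 ==> cA A \<phi> Y m (a, t) \<in> cells (sec (Cyl (A, \<phi>, B)) Y) m"
  by auto

lemma PS_Cyl:
  assumes f: "(A, \<phi>, B) \<in> Ar M"
  shows "PS (Cyl (A, \<phi>, B))"
proof (rule psI)
  have A: "PS A" and B: "PS B" and p: "spre_map C A \<phi> B" using f by (auto simp: Ar_sPre)
  let ?Z = "Cyl (A, \<phi>, B)"
  {
    fix Y assume Y: "Y \<in> Ob C"
    note a = Cyl_act[OF f Y]
    note As = psD(1)[OF A Y] and Bs = psD(1)[OF B Y]
    show "is_sset (sec ?Z Y)"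
    proof (rule issI)
      fix l m \<eta> y assume e: "\<eta> \<in> Dmap l m" and y: "y \<in> cells (sec ?Z Y) m"
      show "act (sec ?Z Y) l m \<eta> y \<in> cells (sec ?Z Y) l"
        using y
      proof (cases rule: Cyl_cellE)
        case (1 b)
        have "cB (act (sec B Y) l m \<eta> b) \<in> cells (sec ?Z Y) l" by (rule cB_in[OF ss_act[OF Bs e 1(2)]])
        then show ?thesis unfolding 1(1) Cyl_simps(3) .
      next
        case (2 x t)
        show ?thesis unfolding 2(1) a[OF e 2(2,3)] by (rule cA_in[OF ss_act[OF As e 2(2)] comp_Dmap[OF 2(3) e]])
      qed
    next
      fix m y assume y: "y \<in> cells (sec ?Z Y) m"
      show "act (sec ?Z Y) m m (idD m) y = y"
        using y by (cases rule: Cyl_cellE) (simp_all add: Bs As a)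
    next
      fix l m k \<eta> \<mu>' y assume e: "\<eta> \<in> Dmap l m" "\<mu>' \<in> Dmap m k" and y: "y \<in> cells (sec ?Z Y) k"
      show "act (sec ?Z Y) l m \<eta> (act (sec ?Z Y) m k \<mu>' y) = act (sec ?Z Y) l k (compD l \<mu>' \<eta>) y"
        using y
      proof (cases rule: Cyl_cellE)
        case (1 b) then show ?thesis by (simp add: ss_comp[OF Bs e])
      next
        case (2 x t)
        then show ?thesis
          by (simp add: a[OF e(2)] a[OF e(1)] a[OF comp_Dmap[OF e(2,1)]] As e comp_Dmap ss_comp[OF As e] comp_D_assoc[OF e(1)])
      qed
    qed
    show "small u (cells (sec ?Z Y) m)" for m
      unfolding Cyl_simps(1) by (intro small_Un infU small_image small_times_finite psD(2)[OF A Y] psD(2)[OF B Y]) simp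
    show "bpt ?Z Y m \<in> cells (sec ?Z Y) m" for m using psD(6)[OF B Y] by simp
    show "act (sec ?Z Y) m k \<mu> (bpt ?Z Y k) = bpt ?Z Y m" if "\<mu> \<in> Dmap m k" for m k \<mu>
      using psD(7)[OF B Y that] by simp
    show "rst ?Z (Idn C Y) m y = y" if "y \<in> cells (sec ?Z Y) m" for m y
      using that
    proof (cases rule: Cyl_cellE)
      case (1 b) then show ?thesis by (simp add: psD(4)[OF B Y])
    next
      case (2 a t)
      then show ?thesis using psD(4)[OF A Y 2(2)] psD(4)[OF B Y sm_in[OF smapD(1)[OF p Y] 2(2)]] tag2[OF 2(3)] Dom_Idn[OF Y]
        by (cases "a = bpt A Y m \<or> t = cD 1 m") (auto simp: cA_def Cyl_def)
    qed
  }
  {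
    fix g assume g: "g \<in> Ar C"
    note a = Cyl_act[OF f] and Y = CodOb[OF g] DomOb[OF g]
    show "sset_map (sec ?Z (Cod C g)) (sec ?Z (Dom C g)) (rst ?Z g)"
    proof (rule smI)
      fix m y assume y: "y \<in> cells (sec ?Z (Cod C g)) m"
      show "rst ?Z g m y \<in> cells (sec ?Z (Dom C g)) m"
        using y
      proof (cases rule: Cyl_cellE)
        case (1 b)
        show ?thesis unfolding 1(1) Cyl_simps(4) by (rule cB_in[OF sm_in[OF psD(3)[OF B g] 1(2)]])
      next
        case (2 x t)
        show ?thesis unfolding 2(1) Cyl_rst[OF f g 2(2,3)] by (rule cA_in[OF sm_in[OF psD(3)[OF A g] 2(2)] 2(3)])
      qed
    next
      fix l m \<eta> y assume e: "\<eta> \<in> Dmap l m" and y: "y \<in> cells (sec ?Z (Cod C g)) m"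
      show "rst ?Z g l (act (sec ?Z (Cod C g)) l m \<eta> y) = act (sec ?Z (Dom C g)) l m \<eta> (rst ?Z g m y)"
        using y
      proof (cases rule: Cyl_cellE)
        case (1 b) then show ?thesis by (simp add: sm_nat[OF psD(3)[OF B g] e])
      next
        case (2 x t)
        have "act (sec A (Cod C g)) l m \<eta> x \<in> cells (sec A (Cod C g)) l" "rst A g m x \<in> cells (sec A (Dom C g)) m"
          using psD(1)[OF A Y(1)] e 2 sm_in[OF psD(3)[OF A g]] by auto
        then show ?thesis using 2 e
          by (simp add: a[OF Y(1)] a[OF Y(2)] Cyl_rst[OF f g] sm_nat[OF psD(3)[OF A g] e] comp_Dmap)
      qed
    qed
    show "rst ?Z g m (bpt ?Z (Cod C g) m) = bpt ?Z (Dom C g) m" for m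
      using psD(8)[OF B g] by simp
  }
  fix g h m y assume g: "g \<in> Ar C" "h \<in> Ar C" "Cod C g = Dom C h" and y: "y \<in> cells (sec ?Z (Cod C h)) m"
  show "rst ?Z (Cmp C h g) m y = rst ?Z g m (rst ?Z h m y)"
    using y
  proof (cases rule: Cyl_cellE)
    case (1 b) then show ?thesis using psD(5)[OF B g] by simp
  next
    case (2 a t)
    have r: "rst A h m a \<in> cells (sec A (Cod C g)) m" using sm_in[OF psD(3)[OF A g(2)] 2(2)] g(3) by simp
    have 1: "rst ?Z g m (rst ?Z h m y) = cA A \<phi> (Dom C g) m (rst A g m (rst A h m a), t)"
      using Cyl_rst[OF f g(2) 2(2,3)] Cyl_rst[OF f g(1) r 2(3)] g(3) 2(1) by simp
    show ?thesis
    proof (cases "a = bpt A (Cod C h) m \<or> t = cD 1 m")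
      case True
      then have y': "y = cB (\<phi> (Cod C h) m a)" using 2(1) by (simp add: cA_def)
      show ?thesis
        using psD(5)[OF B g sm_in[OF smapD(1)[OF p CodOb[OF g(2)]] 2(2)]] y' by simp
    next
      case False
      then have "y = enc (a, t)" using 2(1) by (simp add: cA_def)
      then have "rst ?Z (Cmp C h g) m y = cA A \<phi> (Dom C g) m (rst A g m (rst A h m a), t)"
        using tag2[OF 2(3)] psD(5)[OF A g 2(2)] Dom_Cmp[OF g] by (simp add: Cyl_def)
      then show ?thesis using 1 by simp
    qed
  qed
qed

definition iB :: "('o, 'a, 'v) smap_arr => 'o => nat => 'v => 'v" where
  "iB = (\<lambda>(A, \<phi>, B). spre_ext C B (\<lambda>Y m. cB))"

definition iA :: "('o, 'a, 'v) smap_arr => 'o => nat => 'v => 'v" where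
  "iA = (\<lambda>(A, \<phi>, B). spre_ext C A (\<lambda>Y m a. cA A \<phi> Y m (a, cD 0 m)))"

lemma iB_map:
  assumes f: "(A, \<phi>, B) \<in> Ar M"
  shows "spre_map C B (iB (A, \<phi>, B)) (Cyl (A, \<phi>, B))"
  unfolding spre_map_def
proof (intro conjI ballI allI impI)
  have B: "PS B" using f by (auto simp: Ar_sPre)
  show "sset_map (sec B Y) (sec (Cyl (A, \<phi>, B)) Y) (iB (A, \<phi>, B) Y)" if Y: "Y \<in> Ob C" for Y
  proof (rule smI)
    show "iB (A, \<phi>, B) Y n x \<in> cells (sec (Cyl (A, \<phi>, B)) Y) n" if "x \<in> cells (sec B Y) n" for n x
      using that Y by (simp add: iB_def)
    show "iB (A, \<phi>, B) Y m (act (sec B Y) m n \<mu> x) = act (sec (Cyl (A, \<phi>, B)) Y) m n \<mu> (iB (A, \<phi>, B) Y n x)"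
      if "\<mu> \<in> Dmap m n" "x \<in> cells (sec B Y) n" for m n \<mu> x
      using that Y psD(1)[OF B Y] by (simp add: iB_def)
  qed
  show "iB (A, \<phi>, B) (Dom C g) n (rst B g n x) = rst (Cyl (A, \<phi>, B)) g n (iB (A, \<phi>, B) (Cod C g) n x)"
    if "g \<in> Ar C" "x \<in> cells (sec B (Cod C g)) n" for g n x
    using that DomOb CodOb sm_in[OF psD(3)[OF B]] by (simp add: iB_def)
  show "iB (A, \<phi>, B) Y n (bpt B Y n) = bpt (Cyl (A, \<phi>, B)) Y n" if "Y \<in> Ob C" for Y n
    using that psD(6)[OF B] by (simp add: iB_def)
qed (auto simp: iB_def spre_ext_def)

lemma iA_map:
  assumes f: "(A, \<phi>, B) \<in> Ar M"
  shows "spre_map C A (iA (A, \<phi>, B)) (Cyl (A, \<phi>, B))"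
  unfolding spre_map_def
proof (intro conjI ballI allI impI)
  have A: "PS A" and p: "spre_map C A \<phi> B" using f by (auto simp: Ar_sPre)
  show "sset_map (sec A Y) (sec (Cyl (A, \<phi>, B)) Y) (iA (A, \<phi>, B) Y)" if Y: "Y \<in> Ob C" for Y
  proof (rule smI)
    show "iA (A, \<phi>, B) Y n x \<in> cells (sec (Cyl (A, \<phi>, B)) Y) n" if "x \<in> cells (sec A Y) n" for n x
      using cA_in[OF that, of "cD 0 n"] that Y by (simp add: iA_def)
    show "iA (A, \<phi>, B) Y m (act (sec A Y) m n \<mu> x) = act (sec (Cyl (A, \<phi>, B)) Y) m n \<mu> (iA (A, \<phi>, B) Y n x)"
      if "\<mu> \<in> Dmap m n" "x \<in> cells (sec A Y) n" for m n \<mu> x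
      using that Y psD(1)[OF A Y] Cyl_act[OF f Y that, of "cD 0 n"] by (simp add: iA_def)
  qed
  show "iA (A, \<phi>, B) (Dom C g) n (rst A g n x) = rst (Cyl (A, \<phi>, B)) g n (iA (A, \<phi>, B) (Cod C g) n x)"
    if "g \<in> Ar C" "x \<in> cells (sec A (Cod C g)) n" for g n x
    using that DomOb CodOb sm_in[OF psD(3)[OF A]] Cyl_rst[OF f that, of "cD 0 n"] by (simp add: iA_def)
  show "iA (A, \<phi>, B) Y n (bpt A Y n) = bpt (Cyl (A, \<phi>, B)) Y n" if "Y \<in> Ob C" for Y n
    using that psD(6)[OF A] smapD(3)[OF p] by (simp add: iA_def cA_def)
qed (auto simp: iA_def spre_ext_def)

lemma iA_inj:
  assumes "Y \<in> Ob C"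
  shows "inj_on (iA (A, \<phi>, B) Y n) (cells (sec A Y) n)"
proof (rule inj_onI)
  fix x y assume xy: "x \<in> cells (sec A Y) n" "y \<in> cells (sec A Y) n" "iA (A, \<phi>, B) Y n x = iA (A, \<phi>, B) Y n y"
  have "cD 0 n \<noteq> (\<lambda>_. 2)" by (rule tag2[of _ n]) simp
  then show "x = y" using xy assms by (auto simp: iA_def cA_def cB_def split: if_splits)
qed

lemma gf_CylD:
  assumes g: "gf t (Cyl (A, \<phi>, B)) X \<psi>" and t: "wft C t" and f: "(A, \<phi>, B) \<in> Ar M"
  shows "gf t A (sset_prod X I1) (\<lambda>i k (a, \<xi>, \<tau>). \<psi> i k (cA A \<phi> (tov t i) k (a, \<tau>), \<xi>))"
proof (rule gfI, goal_cases)
  case (1 i k x \<xi>)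
  obtain \<zeta> \<tau> where \<xi>: "\<xi> = (\<zeta>, \<tau>)" "\<zeta> \<in> cells X k" "\<tau> \<in> Dmap k 1" using 1(3) by auto
  show ?case using gfD(1)[OF g 1(1) cA_in[OF 1(2) \<xi>(3)] \<xi>(2)] by (simp add: \<xi>(1))
next
  case (2 i l k \<mu> x \<xi>)
  obtain \<zeta> \<tau> where \<xi>: "\<xi> = (\<zeta>, \<tau>)" "\<zeta> \<in> cells X k" "\<tau> \<in> Dmap k 1" using 2(4) by auto
  show ?case using gfD(2)[OF g 2(1,2) cA_in[OF 2(3) \<xi>(3)] \<xi>(2)] Cyl_act[OF f wftD(2)[OF t 2(1)] 2(2,3) \<xi>(3)]
    by (simp add: \<xi>(1))
next
  case (3 e k x \<xi>)
  obtain \<zeta> \<tau> where \<xi>: "\<xi> = (\<zeta>, \<tau>)" "\<zeta> \<in> cells X k" "\<tau> \<in> Dmap k 1" using 3(3) by auto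
  note w = wftD[OF t]
  have x: "x \<in> cells (sec A (Cod C (tav t e))) k" using 3(2) w(7)[OF 3(1)] by simp
  show ?case using gfD(3)[OF g 3(1) cA_in[OF 3(2) \<xi>(3)] \<xi>(2)] Cyl_rst[OF f w(5)[OF 3(1)] x \<xi>(3)] w(6,7)[OF 3(1)]
    by (simp add: \<xi>(1))
next
  case (4 i k \<xi>)
  obtain \<zeta> \<tau> where \<xi>: "\<xi> = (\<zeta>, \<tau>)" "\<zeta> \<in> cells X k" "\<tau> \<in> Dmap k 1" using 4(3) by auto
  have p: "spre_map C A \<phi> B" using f by (simp add: Ar_sPre)
  show ?case using gfD(4)[OF g 4(1,2) \<xi>(2)] smapD(3)[OF p wftD(2)[OF t 4(2)]] by (simp add: \<xi>(1) cA_def)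
qed

definition dcyl where
  "dcyl \<beta> \<eta> i k = (\<lambda>(y, \<xi>). case dec y of (x, \<tau>) => if \<tau> = (\<lambda>_. 2) then \<beta> i k (x, \<xi>) else \<eta> i k (x, \<xi>, \<tau>))"

lemma dcyl_cB [simp]: "dcyl \<beta> \<eta> i k (cB b, \<xi>) = \<beta> i k (b, \<xi>)"
  by (simp add: dcyl_def)

lemma dcyl_cA:
  assumes t: "wft C t" and f: "(A, \<phi>, B) \<in> Ar M" and b: "gf t B X \<beta>" and h: "gf t A (sset_prod X I1) \<eta>"
    and c: "\<And>i k a \<xi>. i \<in> tI t ==> a \<in> cells (sec A (tov t i)) k ==> \<xi> \<in> cells X k ==>
       \<eta> i k (a, \<xi>, cD 1 k) = \<beta> i k (\<phi> (tov t i) k a, \<xi>)"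
    and a: "i \<in> tI t" "a \<in> cells (sec A (tov t i)) k" "\<xi> \<in> cells X k" "\<tau> \<in> Dmap k 1"
  shows "dcyl \<beta> \<eta> i k (cA A \<phi> (tov t i) k (a, \<tau>), \<xi>) = \<eta> i k (a, \<xi>, \<tau>)"
proof -
  have p: "spre_map C A \<phi> B" using f by (simp add: Ar_sPre)
  have "\<eta> i k (bpt A (tov t i) k, \<xi>, \<tau>) = tb t i k" using gfD(4)[OF h wftD(1)[OF t] a(1), of "(\<xi>, \<tau>)" k] a by simp
  moreover have "\<beta> i k (\<phi> (tov t i) k (bpt A (tov t i) k), \<xi>) = tb t i k"
    using gfD(4)[OF b wftD(1)[OF t] a(1,3)] smapD(3)[OF p wftD(2)[OF t a(1)]] by simp
  ultimately show ?thesis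
    using c[OF a(1-3)] tag2[OF a(4)]
    by (cases "a = bpt A (tov t i) k"; cases "\<tau> = cD 1 k") (auto simp: cA_def dcyl_def)
qed

lemma gf_dcyl:
  assumes t: "wft C t" and f: "(A, \<phi>, B) \<in> Ar M" and X: "is_sset X"
    and b: "gf t B X \<beta>" and h: "gf t A (sset_prod X I1) \<eta>"
    and c: "\<And>i k a \<xi>. i \<in> tI t ==> a \<in> cells (sec A (tov t i)) k ==> \<xi> \<in> cells X k ==>
       \<eta> i k (a, \<xi>, cD 1 k) = \<beta> i k (\<phi> (tov t i) k a, \<xi>)"
  shows "gf t (Cyl (A, \<phi>, B)) X (dcyl \<beta> \<eta>)"
proof (rule gfI)
  have d: "dcyl \<beta> \<eta> i k (cA A \<phi> (tov t i) k (a, \<tau>), \<xi>) = \<eta> i k (a, \<xi>, \<tau>)"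
    if "i \<in> tI t" "a \<in> cells (sec A (tov t i)) k" "\<xi> \<in> cells X k" "\<tau> \<in> Dmap k 1" for i k a \<xi> \<tau>
    by (rule dcyl_cA[OF t f b h]) (use c that in auto)
  have A: "PS A" using f by (simp add: Ar_sPre)
  {
    fix i k y \<xi> assume i: "i \<in> tI t" "y \<in> cells (sec (Cyl (A, \<phi>, B)) (tov t i)) k" "\<xi> \<in> cells X k"
    show "dcyl \<beta> \<eta> i k (y, \<xi>) \<in> cells (tZ t i) k"
      using i(2)
    proof (cases rule: Cyl_cellE)
      case (1 b') then show ?thesis using gfD(1)[OF b i(1) _ i(3)] by simp
    next
      case (2 a \<tau>)
      show ?thesis using gfD(1)[OF h i(1) 2(2), of "(\<xi>, \<tau>)"] 2 i by (simp add: 2(1) d[OF i(1) 2(2) i(3) 2(3)])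
    qed
  next
    fix i l k \<mu> y \<xi> assume i: "i \<in> tI t" "\<mu> \<in> Dmap l k" "y \<in> cells (sec (Cyl (A, \<phi>, B)) (tov t i)) k" "\<xi> \<in> cells X k"
    have Y: "tov t i \<in> Ob C" by (rule wftD(2)[OF t i(1)])
    show "dcyl \<beta> \<eta> i l (act (sec (Cyl (A, \<phi>, B)) (tov t i)) l k \<mu> y, act X l k \<mu> \<xi>) = act (tZ t i) l k \<mu> (dcyl \<beta> \<eta> i k (y, \<xi>))"
      using i(3)
    proof (cases rule: Cyl_cellE)
      case (1 b') then show ?thesis using gfD(2)[OF b i(1,2) _ i(4)] by simp
    next
      case (2 a \<tau>)
      show ?thesis
        using gfD(2)[OF h i(1,2) 2(2), of "(\<xi>, \<tau>)"] 2(3) i(4)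
          d[OF i(1) ss_act[OF psD(1)[OF A Y] i(2) 2(2)] ss_act[OF X i(2,4)] comp_Dmap[OF 2(3) i(2)]]
        by (simp add: 2(1) d[OF i(1) 2(2) i(4) 2(3)] Cyl_act[OF f Y i(2) 2(2,3)])
    qed
  next
    fix e k y \<xi> assume e: "e \<in> tE t" "y \<in> cells (sec (Cyl (A, \<phi>, B)) (tov t (ttgt t e))) k" "\<xi> \<in> cells X k"
    note w = wftD[OF t]
    show "dcyl \<beta> \<eta> (tsrc t e) k (rst (Cyl (A, \<phi>, B)) (tav t e) k y, \<xi>) = tr t e k (dcyl \<beta> \<eta> (ttgt t e) k (y, \<xi>))"
      using e(2)
    proof (cases rule: Cyl_cellE)
      case (1 b') then show ?thesis using gfD(3)[OF b e(1) _ e(3)] by simp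
    next
      case (2 a \<tau>)
      have a: "a \<in> cells (sec A (Cod C (tav t e))) k" using 2(2) w(7)[OF e(1)] by simp
      have r: "rst A (tav t e) k a \<in> cells (sec A (tov t (tsrc t e))) k"
        using sm_in[OF psD(3)[OF A w(5)[OF e(1)]] a] w(6)[OF e(1)] by simp
      have "rst (Cyl (A, \<phi>, B)) (tav t e) k y = cA A \<phi> (tov t (tsrc t e)) k (rst A (tav t e) k a, \<tau>)"
        using Cyl_rst[OF f w(5)[OF e(1)] a 2(3)] w(6,7)[OF e(1)] 2(1) by simp
      then show ?thesis
        using gfD(3)[OF h e(1) 2(2), of "(\<xi>, \<tau>)"] 2(3) e(3) d[OF w(3)[OF e(1)] r e(3) 2(3)] d[OF w(4)[OF e(1)] 2(2) e(3) 2(3)]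
        by (simp add: 2(1))
    qed
  next
    fix i k \<xi> assume "tp t" "i \<in> tI t" "\<xi> \<in> cells X k"
    then show "dcyl \<beta> \<eta> i k (bpt (Cyl (A, \<phi>, B)) (tov t i) k, \<xi>) = tb t i k" using gfD(4)[OF b] by simp
  }
qed

text \<open>Maps into the function complex of a cylinder are pairs of a map into that of \<open>B\<close> and a homotopy
  in that of \<open>A\<close>; \<open>hC\<close> extracts the latter.\<close>

definition hC where
  "hC t f X a = cur t (fst f) (sset_prod X I1)
     (\<lambda>i k (x, \<xi>, \<tau>). unc a i k (cA (fst f) (fst (snd f)) (tov t i) k (x, \<tau>), \<xi>))"

context
  fixes t :: "('i, 'e, 'o, 'a, 'z) tst" and A B :: "('o, 'a, 'v) spre" and \<phi> :: "'o => nat => 'v => 'v"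
  assumes t: "wft C t" and f: "(A, \<phi>, B) \<in> Ar M"
begin

lemma cylA: "PS A" and cylB: "PS B" and cyl\<phi>: "spre_map C A \<phi> B"
  using f by (auto simp: Ar_sPre)

lemma cyl_wf: "wfA t A" "wfA t B" "wfA t (Cyl (A, \<phi>, B))"
  by (rule wfA_ps[OF t cylA] wfA_ps[OF t cylB] wfA_ps[OF t PS_Cyl[OF f]])+

lemma cyl_wfm: "wfm t A \<phi> B" "wfm t A (iA (A, \<phi>, B)) (Cyl (A, \<phi>, B))" "wfm t B (iB (A, \<phi>, B)) (Cyl (A, \<phi>, B))"
  by (rule wfm_ar[OF t cyl\<phi>] wfm_ar[OF t iA_map[OF f]] wfm_ar[OF t iB_map[OF f]])+

lemma hC_map:
  assumes X: "is_sset X" and a: "sset_map X (TF t (Cyl (A, \<phi>, B))) a"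
  shows "sset_map (sset_prod X I1) (TF t A) (hC t (A, \<phi>, B) X a)"
  unfolding hC_def using cur_map[OF cyl_wf(1) _ gf_CylD[OF unc_gf[OF cyl_wf(3) X a] t f]] X by simp

lemma hC_unc:
  assumes X: "is_sset X" "\<xi> \<in> cells X k" "\<tau> \<in> Dmap k 1" "i \<in> tI t" "x \<in> cells (sec A (tov t i)) k"
  shows "unc (hC t (A, \<phi>, B) X a) i k (x, \<xi>, \<tau>) = unc a i k (cA A \<phi> (tov t i) k (x, \<tau>), \<xi>)"
  unfolding hC_def using X by (subst unc_cur) simp_all

lemma hC_0:
  assumes X: "is_sset X" and a: "sset_map X (TF t (Cyl (A, \<phi>, B))) a" and x: "\<xi> \<in> cells X n"
  shows "hC t (A, \<phi>, B) X a n (\<xi>, cD 0 n) = Tpre t A (iA (A, \<phi>, B)) n (a n \<xi>)"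
proof (rule TF_maps_eq[OF cyl_wf(1) sm_end[OF _ hC_map[OF X a]] sm_comp[OF a Tpre_map[OF cyl_wf(1) cyl_wfm(2)]] X x])
  fix i k y \<zeta> assume i: "i \<in> tI t" "y \<in> cells (sec A (tov t i)) k" "\<zeta> \<in> cells X k"
  have "unc (\<lambda>n x. hC t (A, \<phi>, B) X a n (x, cD 0 n)) i k (y, \<zeta>) = unc (hC t (A, \<phi>, B) X a) i k (y, \<zeta>, cD 0 k)"
    by (simp add: unc_def)
  then show "unc (\<lambda>n x. hC t (A, \<phi>, B) X a n (x, cD 0 n)) i k (y, \<zeta>) = unc (\<lambda>n x. Tpre t A (iA (A, \<phi>, B)) n (a n x)) i k (y, \<zeta>)"
    using i wftD(2)[OF t i(1)] by (simp add: Tpre_unc hC_unc X iA_def)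
qed simp

lemma hC_1:
  assumes X: "is_sset X" and a: "sset_map X (TF t (Cyl (A, \<phi>, B))) a" and x: "\<xi> \<in> cells X n"
  shows "hC t (A, \<phi>, B) X a n (\<xi>, cD 1 n) = Tpre t A \<phi> n (Tpre t B (iB (A, \<phi>, B)) n (a n \<xi>))"
proof (rule TF_maps_eq[OF cyl_wf(1) sm_end[OF _ hC_map[OF X a]]
      sm_comp[OF sm_comp[OF a Tpre_map[OF cyl_wf(2) cyl_wfm(3)]] Tpre_map[OF cyl_wf(1) cyl_wfm(1)]] X x])
  fix i k y \<zeta> assume i: "i \<in> tI t" "y \<in> cells (sec A (tov t i)) k" "\<zeta> \<in> cells X k"
  have Y: "tov t i \<in> Ob C" by (rule wftD(2)[OF t i(1)])
  have p: "\<phi> (tov t i) k y \<in> cells (sec B (tov t i)) k" by (rule sm_in[OF smapD(1)[OF cyl\<phi> Y] i(2)])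
  have "unc (\<lambda>n x. hC t (A, \<phi>, B) X a n (x, cD 1 n)) i k (y, \<zeta>) = unc (hC t (A, \<phi>, B) X a) i k (y, \<zeta>, cD 1 k)"
    by (simp add: unc_def)
  then show "unc (\<lambda>n x. hC t (A, \<phi>, B) X a n (x, cD 1 n)) i k (y, \<zeta>) =
      unc (\<lambda>n x. Tpre t A \<phi> n (Tpre t B (iB (A, \<phi>, B)) n (a n x))) i k (y, \<zeta>)"
    using i Y p by (simp add: Tpre_unc hC_unc X iB_def)
qed simp

lemma cyl_join:
  assumes X: "is_sset X" and b: "sset_map X (TF t B) b" and g: "sset_map (sset_prod X I1) (TF t A) g"
    and c: "\<And>n \<xi>. \<xi> \<in> cells X n ==> g n (\<xi>, cD 1 n) = Tpre t A \<phi> n (b n \<xi>)"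
  obtains d where "sset_map X (TF t (Cyl (A, \<phi>, B))) d"
    "\<And>n \<xi>. \<xi> \<in> cells X n ==> Tpre t B (iB (A, \<phi>, B)) n (d n \<xi>) = b n \<xi>"
    "\<And>n \<xi> \<tau>. \<xi> \<in> cells X n ==> \<tau> \<in> Dmap n 1 ==> hC t (A, \<phi>, B) X d n (\<xi>, \<tau>) = g n (\<xi>, \<tau>)"
proof -
  note ub = unc_gf[OF cyl_wf(2) X b]
  have ug: "gf t A (sset_prod X I1) (unc g)" by (rule unc_gf[OF cyl_wf(1) _ g]) (simp add: X)
  have c': "unc g i k (a, \<xi>, cD 1 k) = unc b i k (\<phi> (tov t i) k a, \<xi>)"
    if "i \<in> tI t" "a \<in> cells (sec A (tov t i)) k" "\<xi> \<in> cells X k" for i k a \<xi>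
    using c[OF that(3)] that by (simp add: unc_def Tpre_def)
  have gd: "gf t (Cyl (A, \<phi>, B)) X (dcyl (unc b) (unc g))"
    by (rule gf_dcyl[OF t f X ub ug]) (rule c')
  have dA: "dcyl (unc b) (unc g) i k (cA A \<phi> (tov t i) k (a, \<tau>), \<xi>) = unc g i k (a, \<xi>, \<tau>)"
    if "i \<in> tI t" "a \<in> cells (sec A (tov t i)) k" "\<xi> \<in> cells X k" "\<tau> \<in> Dmap k 1" for i k a \<xi> \<tau>
    by (rule dcyl_cA[OF t f ub ug]) (use c' that in auto)
  define d where "d = cur t (Cyl (A, \<phi>, B)) X (dcyl (unc b) (unc g))"
  have d: "sset_map X (TF t (Cyl (A, \<phi>, B))) d" unfolding d_def by (rule cur_map[OF cyl_wf(3) X gd])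
  have ud: "unc d i k (y, \<xi>) = dcyl (unc b) (unc g) i k (y, \<xi>)"
    if "i \<in> tI t" "y \<in> cells (sec (Cyl (A, \<phi>, B)) (tov t i)) k" "\<xi> \<in> cells X k" for i k y \<xi>
    unfolding d_def by (rule unc_cur[OF X that])
  show thesis
  proof (rule that[OF d])
    fix n \<xi> assume x: "\<xi> \<in> cells X n"
    show "Tpre t B (iB (A, \<phi>, B)) n (d n \<xi>) = b n \<xi>"
    proof (rule TF_maps_eq[OF cyl_wf(2) sm_comp[OF d Tpre_map[OF cyl_wf(2) cyl_wfm(3)]] b X x])
      fix i k y \<zeta> assume i: "i \<in> tI t" "y \<in> cells (sec B (tov t i)) k" "\<zeta> \<in> cells X k"
      then show "unc (\<lambda>n x. Tpre t B (iB (A, \<phi>, B)) n (d n x)) i k (y, \<zeta>) = unc b i k (y, \<zeta>)"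
        using wftD(2)[OF t i(1)] ud[OF i(1) cB_in[OF i(2)] i(3)] by (simp add: Tpre_unc iB_def)
    qed
    fix \<tau> assume \<tau>: "\<tau> \<in> Dmap n 1"
    show "hC t (A, \<phi>, B) X d n (\<xi>, \<tau>) = g n (\<xi>, \<tau>)"
    proof (rule TF_maps_eq[OF cyl_wf(1) hC_map[OF X d] g])
      fix i k y \<zeta> assume i: "i \<in> tI t" "y \<in> cells (sec A (tov t i)) k" "\<zeta> \<in> cells (sset_prod X I1) k"
      obtain \<xi>' \<tau>' where z: "\<zeta> = (\<xi>', \<tau>')" "\<xi>' \<in> cells X k" "\<tau>' \<in> Dmap k 1" using i(3) by auto
      show "unc (hC t (A, \<phi>, B) X d) i k (y, \<zeta>) = unc g i k (y, \<zeta>)"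
        using ud[OF i(1) cA_in[OF i(2) z(3)] z(2)] dA[OF i(1,2) z(2,3)] by (simp add: z(1) hC_unc[OF X z(2,3) i(1,2)])
    qed (use X x \<tau> in auto)
  qed
qed

lemma cyl_ext:
  assumes X: "is_sset X" and d: "sset_map X (TF t (Cyl (A, \<phi>, B))) d" and a: "sset_map X (TF t (Cyl (A, \<phi>, B))) a"
    and b: "\<And>n \<xi>. \<xi> \<in> cells X n ==> Tpre t B (iB (A, \<phi>, B)) n (d n \<xi>) = Tpre t B (iB (A, \<phi>, B)) n (a n \<xi>)"
    and h: "\<And>n \<xi> \<tau>. \<xi> \<in> cells X n ==> \<tau> \<in> Dmap n 1 ==> hC t (A, \<phi>, B) X d n (\<xi>, \<tau>) = hC t (A, \<phi>, B) X a n (\<xi>, \<tau>)"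
    and x: "\<xi> \<in> cells X n"
  shows "d n \<xi> = a n \<xi>"
proof (rule TF_maps_eq[OF cyl_wf(3) d a X x])
  fix i k y \<zeta> assume i: "i \<in> tI t" "y \<in> cells (sec (Cyl (A, \<phi>, B)) (tov t i)) k" "\<zeta> \<in> cells X k"
  have Y: "tov t i \<in> Ob C" by (rule wftD(2)[OF t i(1)])
  show "unc d i k (y, \<zeta>) = unc a i k (y, \<zeta>)"
    using i(2)
  proof (cases rule: Cyl_cellE)
    case (1 b')
    have "unc (\<lambda>n x. Tpre t B (iB (A, \<phi>, B)) n (d n x)) i k (b', \<zeta>) = unc (\<lambda>n x. Tpre t B (iB (A, \<phi>, B)) n (a n x)) i k (b', \<zeta>)"
      using b[OF i(3)] by (simp add: unc_def)
    then show ?thesis using 1 i Y by (simp add: Tpre_unc iB_def)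
  next
    case (2 a' \<tau>)
    have "unc (hC t (A, \<phi>, B) X d) i k (a', \<zeta>, \<tau>) = unc (hC t (A, \<phi>, B) X a) i k (a', \<zeta>, \<tau>)"
      using h[OF i(3) 2(3)] by (simp add: unc_def)
    then show ?thesis unfolding 2(1) hC_unc[OF X i(3) 2(3) i(1) 2(2)] .
  qed
qed

lemma hC_sub: "hC t (A, \<phi>, B) (sub X V) a = hC t (A, \<phi>, B) X a"
  unfolding hC_def prod_sub by (intro ext) (auto simp: cur_def fun_eq_iff)

text \<open>A lift amounts to extending a homotopy in \<open>TF t A\<close> from its end
  \<open>1\<close>, which is already determined by the map into \<open>TF t B\<close>; so
  \<open>hep\<close> suffices.\<close>

lemma tfib_iB:
  assumes k: "kan_complex (TF t A)"
  shows "tfib (TF t (Cyl (A, \<phi>, B))) (TF t B) (Tpre t B (iB (A, \<phi>, B)))"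
  unfolding tfib_def
proof (intro conjI allI)
  show "is_sset (TF t (Cyl (A, \<phi>, B)))" "is_sset (TF t B)" using cyl_wf by auto
  show pm: "sset_map (TF t (Cyl (A, \<phi>, B))) (TF t B) (Tpre t B (iB (A, \<phi>, B)))" by (rule Tpre_map[OF cyl_wf(2) cyl_wfm(3)])
  fix n
  let ?X = "simplex n" and ?V = "bd n"
  have XV: "is_sset (sub ?X ?V)" by simp
  show "rlp (Tpre t B (iB (A, \<phi>, B))) (TF t (Cyl (A, \<phi>, B))) (TF t B) (simplex n) (bd n)"
    unfolding rlp_def
  proof (intro allI impI, elim conjE)
    fix a b assume a: "sset_map (sub ?X ?V) (TF t (Cyl (A, \<phi>, B))) a" and b: "sset_map ?X (TF t B) b"
      and ab: "\<forall>m. \<forall>x\<in>?V m. Tpre t B (iB (A, \<phi>, B)) m (a m x) = b m x"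
    note h = hC_map[OF XV a]
    obtain g where g: "sset_map (sset_prod ?X I1) (TF t A) g"
      "\<And>m x. x \<in> cells ?X m ==> g m (x, cD 1 m) = Tpre t A \<phi> m (b m x)"
      "\<And>m x \<tau>. x \<in> ?V m ==> \<tau> \<in> Dmap m 1 ==> g m (x, \<tau>) = hC t (A, \<phi>, B) (sub ?X ?V) a m (x, \<tau>)"
      by (rule hep[OF k _ is_sset_simplex subc_bd sm_comp[OF b Tpre_map[OF cyl_wf(1) cyl_wfm(1)]] h, of 1])
        (use hC_1[OF XV a] ab in auto)
    obtain d where d: "sset_map ?X (TF t (Cyl (A, \<phi>, B))) d"
      "\<And>m x. x \<in> cells ?X m ==> Tpre t B (iB (A, \<phi>, B)) m (d m x) = b m x"
      "\<And>m x \<tau>. x \<in> cells ?X m ==> \<tau> \<in> Dmap m 1 ==> hC t (A, \<phi>, B) ?X d m (x, \<tau>) = g m (x, \<tau>)"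
      by (rule cyl_join[OF is_sset_simplex b g(1)]) (auto intro: that g(2))
    have "d m x = a m x" if "x \<in> ?V m" for m x
      by (rule cyl_ext[OF XV sm_sub[OF d(1) subc_bd] a])
        (use that ab d g in \<open>auto simp: hC_sub subc_in[OF subc_bd, simplified]\<close>)
    then show "\<exists>c. sset_map ?X (TF t (Cyl (A, \<phi>, B))) c \<and> (\<forall>m. \<forall>x\<in>?V m. c m x = a m x) \<and>
        (\<forall>m. \<forall>x\<in>cells ?X m. Tpre t B (iB (A, \<phi>, B)) m (c m x) = b m x)" using d by blast
  qed
qed

text \<open>Lifting along \<open>iA\<close> asks for a map into \<open>TF t B\<close> and a homotopy
  in \<open>TF t A\<close> from the given map to its image, which is exactly the weak lifting
  property \<open>wrlp\<close>. Replacing \<phi> by the inclusion into its cylinder thus turns a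
  homotopy equivalence into a trivial fibration.\<close>

lemma tfib_iA:
  assumes k: "kan_complex (TF t A)" "kan_complex (TF t B)" and e: "heq (TF t B) (TF t A) (Tpre t A \<phi>)"
  shows "tfib (TF t (Cyl (A, \<phi>, B))) (TF t A) (Tpre t A (iA (A, \<phi>, B)))"
  unfolding tfib_def
proof (intro conjI allI)
  show "is_sset (TF t (Cyl (A, \<phi>, B)))" "is_sset (TF t A)" using cyl_wf by auto
  show pm: "sset_map (TF t (Cyl (A, \<phi>, B))) (TF t A) (Tpre t A (iA (A, \<phi>, B)))" by (rule Tpre_map[OF cyl_wf(1) cyl_wfm(2)])
  fix n
  let ?X = "simplex n" and ?V = "bd n"
  have XV: "is_sset (sub ?X ?V)" by simp
  show "rlp (Tpre t A (iA (A, \<phi>, B))) (TF t (Cyl (A, \<phi>, B))) (TF t A) (simplex n) (bd n)"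
    unfolding rlp_def
  proof (intro allI impI, elim conjE)
    fix a b assume a: "sset_map (sub ?X ?V) (TF t (Cyl (A, \<phi>, B))) a" and b: "sset_map ?X (TF t A) b"
      and ab: "\<forall>m. \<forall>x\<in>?V m. Tpre t A (iA (A, \<phi>, B)) m (a m x) = b m x"
    note h = hC_map[OF XV a]
    obtain b' g where b': "sset_map ?X (TF t B) b'" "\<And>m x. x \<in> ?V m ==> b' m x = Tpre t B (iB (A, \<phi>, B)) m (a m x)"
      and g: "sset_map (sset_prod ?X I1) (TF t A) g"
      "\<And>m x. x \<in> cells ?X m ==> g m (x, cD 0 m) = b m x"
      "\<And>m x. x \<in> cells ?X m ==> g m (x, cD 1 m) = Tpre t A \<phi> m (b' m x)"
      "\<And>m x \<tau>. x \<in> ?V m ==> \<tau> \<in> Dmap m 1 ==> g m (x, \<tau>) = hC t (A, \<phi>, B) (sub ?X ?V) a m (x, \<tau>)"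
      by (rule wrlp[OF e k(2,1) is_sset_simplex subc_bd b sm_comp[OF a Tpre_map[OF cyl_wf(2) cyl_wfm(3)]] h])
        (use hC_1[OF XV a] hC_0[OF XV a] ab in auto)
    obtain d where d: "sset_map ?X (TF t (Cyl (A, \<phi>, B))) d"
      "\<And>m x. x \<in> cells ?X m ==> Tpre t B (iB (A, \<phi>, B)) m (d m x) = b' m x"
      "\<And>m x \<tau>. x \<in> cells ?X m ==> \<tau> \<in> Dmap m 1 ==> hC t (A, \<phi>, B) ?X d m (x, \<tau>) = g m (x, \<tau>)"
      by (rule cyl_join[OF is_sset_simplex b'(1) g(1)]) (auto intro: that g(3))
    have 1: "d m x = a m x" if "x \<in> ?V m" for m x
      by (rule cyl_ext[OF XV sm_sub[OF d(1) subc_bd] a])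
        (use that ab d g b' in \<open>auto simp: hC_sub subc_in[OF subc_bd, simplified]\<close>)
    have 2: "Tpre t A (iA (A, \<phi>, B)) m (d m x) = b m x" if "x \<in> cells ?X m" for m x
      using hC_0[OF is_sset_simplex d(1) that] d(3)[OF that, of "cD 0 m"] g(2)[OF that] by simp
    show "\<exists>c. sset_map ?X (TF t (Cyl (A, \<phi>, B))) c \<and> (\<forall>m. \<forall>x\<in>?V m. c m x = a m x) \<and>
        (\<forall>m. \<forall>x\<in>cells ?X m. Tpre t A (iA (A, \<phi>, B)) m (c m x) = b m x)" using d 1 2 by blast
  qed
qed

end

subsection \<open>Pushout-product inclusions\<close>

text \<open>The pushout product of \<open>j\<close> with the inclusion of \<Theta> into \<Delta>[n],
  before base points are collapsed.\<close>

definition pps :: "('o, 'a, 'v) spre => ('o => nat => 'v => 'v) => ('o, 'a, 'v) spre => nat => (nat => (nat => nat) set) =>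
    'o => nat => ('v \<times> (nat => nat)) set" where
  "pps A j B n \<Theta> Y m = {(x, \<mu>). x \<in> cells (sec B Y) m \<and> \<mu> \<in> Dmap m n \<and> (x \<in> j Y m ` cells (sec A Y) m \<or> \<mu> \<in> \<Theta> m)}"

lemma subT_pps:
  assumes A: "PS A" and B: "PS B" and j: "spre_map C A j B" and th: "subc (simplex n) \<Theta>"
  shows "subT B n (pps A j B n \<Theta>)"
  unfolding subT_def
proof (intro conjI ballI allI impI subsetI)
  fix Y m x assume Y: "Y \<in> Ob C" and x: "x \<in> {bpt B Y m} \<times> Dmap m n"
  have "bpt B Y m \<in> j Y m ` cells (sec A Y) m" using smapD(3)[OF j Y] psD(6)[OF A Y] by (metis imageI)
  then show "x \<in> pps A j B n \<Theta> Y m" using x psD(6)[OF B Y] by (auto simp: pps_def)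
next
  fix Y l m \<eta> x \<mu> assume Y: "Y \<in> Ob C" and e: "\<eta> \<in> Dmap l m" and x: "(x, \<mu>) \<in> pps A j B n \<Theta> Y m"
  have "act (sec B Y) l m \<eta> x \<in> j Y l ` cells (sec A Y) l" if xj: "x \<in> j Y m ` cells (sec A Y) m"
  proof -
    obtain a where a: "x = j Y m a" "a \<in> cells (sec A Y) m" using xj by blast
    have "act (sec B Y) l m \<eta> x = j Y l (act (sec A Y) l m \<eta> a)" unfolding a(1) by (rule sm_nat[OF smapD(1)[OF j Y] e a(2), symmetric])
    then show ?thesis using ss_act[OF psD(1)[OF A Y] e a(2)] by blast
  qed
  then show "(act (sec B Y) l m \<eta> x, compD l \<mu> \<eta>) \<in> pps A j B n \<Theta> Y l"
    using x e psD(1)[OF B Y] subc_act[OF th e, of \<mu>] by (auto simp: pps_def)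
next
  fix f m x \<mu> assume f: "f \<in> Ar C" and x: "(x, \<mu>) \<in> pps A j B n \<Theta> (Cod C f) m"
  have "rst B f m x \<in> j (Dom C f) m ` cells (sec A (Dom C f)) m" if xj: "x \<in> j (Cod C f) m ` cells (sec A (Cod C f)) m"
  proof -
    obtain a where a: "x = j (Cod C f) m a" "a \<in> cells (sec A (Cod C f)) m" using xj by blast
    have "rst B f m x = j (Dom C f) m (rst A f m a)" unfolding a(1) by (rule smapD(2)[OF j f a(2), symmetric])
    then show ?thesis using sm_in[OF psD(3)[OF A f] a(2)] by blast
  qed
  then show "(rst B f m x, \<mu>) \<in> pps A j B n \<Theta> (Dom C f) m"
    using x sm_in[OF psD(3)[OF B f]] by (auto simp: pps_def)
qed (auto simp: pps_def)

text \<open>By the tensor adjunction, lifting for the restriction along a pushout product is lifting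
  for the restriction along \<open>j\<close>, with \<Delta>[n] moved to the side of simplicial sets.
  There \<Theta> and the boundary of the lifting problem combine into the subcomplex of assumption
  \<open>r\<close>.\<close>

lemma tfib_pps:
  assumes t: "wft C t" and A: "PS A" and B: "PS B" and j: "spre_map C A j B" and th: "subc (simplex n) \<Theta>"
    and r: "\<And>(X :: (nat => nat) sset) V. is_sset X ==> subc X V ==>
      rlp (Tpre t A j) (TF t B) (TF t A) (sset_prod (simplex n) X)
        (\<lambda>m. {(\<mu>, \<xi>). \<mu> \<in> Dmap m n \<and> \<xi> \<in> cells X m \<and> (\<mu> \<in> \<Theta> m \<or> \<xi> \<in> V m)})"
  shows "tfib (TF t (Tens B (Tall B n))) (TF t (Tens B (pps A j B n \<Theta>)))
     (Tpre t (Tens B (pps A j B n \<Theta>)) (fst (snd (tincl B n (pps A j B n \<Theta>)))))"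
proof -
  let ?S = "pps A j B n \<Theta>"
  let ?\<iota> = "fst (snd (tincl B n ?S))"
  have S: "subT B n ?S" by (rule subT_pps[OF A B j th])
  have Sa: "subT B n (Tall B n)" by (rule subT_Tall[OF B])
  note PT = PS_Tens[OF B Sa] and PTS = PS_Tens[OF B S]
  have w: "wfA t (Tens B (Tall B n))" "wfA t (Tens B ?S)" "wfA t A" "wfA t B"
    using wfA_ps[OF t] PT PTS A B by auto
  have im: "spre_map C (Tens B ?S) ?\<iota> (Tens B (Tall B n))"
    using tincl_mono[OF B S] by (simp add: spre_monos_def tincl_def Ar_sPre)
  have iw: "wfm t (Tens B ?S) ?\<iota> (Tens B (Tall B n))" by (rule wfm_ar[OF t im])
  have jw: "wfm t A j B" by (rule wfm_ar[OF t j])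
  have i\<iota>: "?\<iota> Y m (tc B Y m (x, \<mu>)) = tc B Y m (x, \<mu>)" if "Y \<in> Ob C" "(x, \<mu>) \<in> ?S Y m" for Y m x \<mu>
    using that by (simp add: tincl_def image_eqI[of _ _ "(x, \<mu>)"])
  show ?thesis
    unfolding tfib_def
  proof (intro conjI allI)
    show "is_sset (TF t (Tens B (Tall B n)))" "is_sset (TF t (Tens B ?S))" using w by auto
    show "sset_map (TF t (Tens B (Tall B n))) (TF t (Tens B ?S)) (Tpre t (Tens B ?S) ?\<iota>)" by (rule Tpre_map[OF w(2) iw])
    fix N
    define X where "X = simplex N"
    define V where "V = bd N"
    have X: "is_sset X" and V: "subc X V" and XV: "is_sset (sub X V)" by (auto simp: X_def V_def)
    show "rlp (Tpre t (Tens B ?S) ?\<iota>) (TF t (Tens B (Tall B n))) (TF t (Tens B ?S)) (simplex N) (bd N)"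
      unfolding rlp_def X_def[symmetric] V_def[symmetric]
    proof (intro allI impI, elim conjE)
      fix a' b' assume a': "sset_map (sub X V) (TF t (Tens B (Tall B n))) a'" and b': "sset_map X (TF t (Tens B ?S)) b'"
        and ab: "\<forall>m. \<forall>x\<in>V m. Tpre t (Tens B ?S) ?\<iota> m (a' m x) = b' m x"
      note \<alpha> = gf_TensD[OF unc_gf[OF w(1) XV a'] t B Sa] and \<beta> = gf_TensD[OF unc_gf[OF w(2) X b'] t B S]
      have cmp: "unc a' i k (tc B (tov t i) k (x, \<mu>), \<xi>) = unc b' i k (tc B (tov t i) k (x, \<mu>), \<xi>)"
        if "i \<in> tI t" "(x, \<mu>) \<in> ?S (tov t i) k" "\<xi> \<in> V k" for i k x \<mu> \<xi>
      proof -
        have "unc (\<lambda>m x. Tpre t (Tens B ?S) ?\<iota> m (a' m x)) i k (tc B (tov t i) k (x, \<mu>), \<xi>) = unc b' i k (tc B (tov t i) k (x, \<mu>), \<xi>)"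
          using ab that(3) by (simp add: unc_def)
        moreover have "tc B (tov t i) k (x, \<mu>) \<in> cells (sec (Tens B ?S) (tov t i)) k" using that(2) by auto
        ultimately show ?thesis using that i\<iota>[OF wftD(2)[OF t that(1)] that(2)] by (simp add: Tpre_unc)
      qed
      let ?W = "sset_prod (simplex n) X"
      define U where "U = (\<lambda>m. {(\<mu>, \<xi>). \<mu> \<in> Dmap m n \<and> \<xi> \<in> cells X m \<and> (\<mu> \<in> \<Theta> m \<or> \<xi> \<in> V m)})"
      have W: "is_sset ?W" using X by simp
      have U: "subc ?W U"
        by (rule subcI) (use X subc_act[OF th] subc_act[OF V] in \<open>auto simp: U_def\<close>)
      \<comment> \<open>The partial lift: \<open>a'\<close> prescribes it over \<open>V\<close> and
        \<open>b'\<close> over \<Theta>; on the overlap they agree by \<open>cmp\<close>.\<close>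
      define \<Psi>a where "\<Psi>a = (\<lambda>i k (x, \<mu>, \<xi>). if \<xi> \<in> V k then unc a' i k (tc B (tov t i) k (x, \<mu>), \<xi>)
          else unc b' i k (tc B (tov t i) k (x, \<mu>), \<xi>))"
      have inS: "(x, \<mu>) \<in> ?S Y k" if "x \<in> cells (sec B Y) k" "(\<mu>, \<xi>) \<in> U k" "\<xi> \<notin> V k" for x \<mu> \<xi> Y k
        using that by (auto simp: U_def pps_def)
      have inA: "(x, \<mu>) \<in> Tall B n Y k" if "x \<in> cells (sec B Y) k" "(\<mu>, \<xi>) \<in> U k" for x \<mu> \<xi> Y k
        using that by (auto simp: U_def Tall_def)
      have ga: "gf t B (sub ?W U) \<Psi>a"
      proof (rule gfI)
        fix i k x \<zeta> assume i: "i \<in> tI t" "x \<in> cells (sec B (tov t i)) k" "\<zeta> \<in> cells (sub ?W U) k"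
        obtain \<mu> \<xi> where z: "\<zeta> = (\<mu>, \<xi>)" "(\<mu>, \<xi>) \<in> U k" "\<xi> \<in> cells X k" using i(3) by (auto simp: U_def)
        show "\<Psi>a i k (x, \<zeta>) \<in> cells (tZ t i) k"
          using \<alpha>(1)[OF i(1) inA[OF i(2) z(2)], of \<xi>] \<beta>(1)[OF i(1) inS[OF i(2) z(2)] z(3)] by (simp add: \<Psi>a_def z(1))
      next
        fix i l k \<eta> x \<zeta> assume i: "i \<in> tI t" "\<eta> \<in> Dmap l k" "x \<in> cells (sec B (tov t i)) k" "\<zeta> \<in> cells (sub ?W U) k"
        obtain \<mu> \<xi> where z: "\<zeta> = (\<mu>, \<xi>)" "(\<mu>, \<xi>) \<in> U k" "\<xi> \<in> cells X k" using i(4) by (auto simp: U_def)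
        have Y: "tov t i \<in> Ob C" by (rule wftD(2)[OF t i(1)])
        show "\<Psi>a i l (act (sec B (tov t i)) l k \<eta> x, act (sub ?W U) l k \<eta> \<zeta>) = act (tZ t i) l k \<eta> (\<Psi>a i k (x, \<zeta>))"
        proof (cases "\<xi> \<in> V k")
          case True
          then show ?thesis using \<alpha>(2)[OF i(1,2) inA[OF i(3) z(2)], of \<xi>] subc_act[OF V i(2) True] by (simp add: \<Psi>a_def z(1))
        next
          case False
          note s = inS[OF i(3) z(2) False]
          show ?thesis
            using \<beta>(2)[OF i(1,2) s z(3)] cmp[OF i(1) subTD(4)[OF S Y i(2) s], of "act X l k \<eta> \<xi>"] False by (simp add: \<Psi>a_def z(1))
        qed
      next
        fix e k x \<zeta> assume e: "e \<in> tE t" "x \<in> cells (sec B (tov t (ttgt t e))) k" "\<zeta> \<in> cells (sub ?W U) k"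
        obtain \<mu> \<xi> where z: "\<zeta> = (\<mu>, \<xi>)" "(\<mu>, \<xi>) \<in> U k" "\<xi> \<in> cells X k" using e(3) by (auto simp: U_def)
        show "\<Psi>a (tsrc t e) k (rst B (tav t e) k x, \<zeta>) = tr t e k (\<Psi>a (ttgt t e) k (x, \<zeta>))"
          using \<alpha>(3)[OF e(1) inA[OF e(2) z(2)], of \<xi>] \<beta>(3)[OF e(1) inS[OF e(2) z(2)] z(3)] by (simp add: \<Psi>a_def z(1))
      next
        fix i k \<zeta> assume i: "i \<in> tI t" "\<zeta> \<in> cells (sub ?W U) k"
        obtain \<mu> \<xi> where z: "\<zeta> = (\<mu>, \<xi>)" "(\<mu>, \<xi>) \<in> U k" "\<xi> \<in> cells X k" using i(2) by (auto simp: U_def)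
        show "\<Psi>a i k (bpt B (tov t i) k, \<zeta>) = tb t i k"
          using \<alpha>(4)[OF i(1), of \<xi> k \<mu>] \<beta>(4)[OF i(1), of \<xi> k \<mu>] z by (simp add: \<Psi>a_def)
      qed
      \<comment> \<open>The map to be lifted is the part of \<open>b'\<close> over the image of
        \<open>j\<close>.\<close>
      define \<Psi>b where "\<Psi>b = (\<lambda>i k (y, \<mu>, \<xi>). unc b' i k (tc B (tov t i) k (j (tov t i) k y, \<mu>), \<xi>))"
      have jS: "(j Y k y, \<mu>) \<in> ?S Y k" if "Y \<in> Ob C" "y \<in> cells (sec A Y) k" "\<mu> \<in> Dmap k n" for Y k y \<mu>
        using that sm_in[OF smapD(1)[OF j]] by (auto simp: pps_def)
      have gb: "gf t A ?W \<Psi>b"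
      proof (rule gfI)
        fix i k y \<zeta> assume i: "i \<in> tI t" "y \<in> cells (sec A (tov t i)) k" "\<zeta> \<in> cells ?W k"
        then show "\<Psi>b i k (y, \<zeta>) \<in> cells (tZ t i) k" using \<beta>(1)[OF i(1) jS[OF wftD(2)[OF t i(1)] i(2)]] by (auto simp: \<Psi>b_def)
      next
        fix i l k \<eta> y \<zeta> assume i: "i \<in> tI t" "\<eta> \<in> Dmap l k" "y \<in> cells (sec A (tov t i)) k" "\<zeta> \<in> cells ?W k"
        then show "\<Psi>b i l (act (sec A (tov t i)) l k \<eta> y, act ?W l k \<eta> \<zeta>) = act (tZ t i) l k \<eta> (\<Psi>b i k (y, \<zeta>))"
          using \<beta>(2)[OF i(1,2) jS[OF wftD(2)[OF t i(1)] i(3)]] sm_nat[OF smapD(1)[OF j wftD(2)[OF t i(1)]] i(2,3)] by (auto simp: \<Psi>b_def)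
      next
        fix e k y \<zeta> assume e: "e \<in> tE t" "y \<in> cells (sec A (tov t (ttgt t e))) k" "\<zeta> \<in> cells ?W k"
        note wf = wftD[OF t]
        show "\<Psi>b (tsrc t e) k (rst A (tav t e) k y, \<zeta>) = tr t e k (\<Psi>b (ttgt t e) k (y, \<zeta>))"
          using \<beta>(3)[OF e(1) jS[OF wf(2)[OF wf(4)[OF e(1)]] e(2)]] smapD(2)[OF j wf(5)[OF e(1)], of y k] e wf(6,7)[OF e(1)]
          by (auto simp: \<Psi>b_def)
      next
        fix i k \<zeta> assume i: "i \<in> tI t" "\<zeta> \<in> cells ?W k"
        obtain \<mu> \<xi> where z: "\<zeta> = (\<mu>, \<xi>)" "\<xi> \<in> cells X k" using i(2) by auto
        show "\<Psi>b i k (bpt A (tov t i) k, \<zeta>) = tb t i k"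
          using \<beta>(4)[OF i(1) z(2), of \<mu>] smapD(3)[OF j wftD(2)[OF t i(1)]] by (simp add: \<Psi>b_def z(1))
      qed
      define a where "a = cur t B (sub ?W U) \<Psi>a"
      define b where "b = cur t A ?W \<Psi>b"
      have a: "sset_map (sub ?W U) (TF t B) a" unfolding a_def by (rule cur_map[OF w(4) _ ga]) (simp add: W U)
      have b: "sset_map ?W (TF t A) b" unfolding b_def by (rule cur_map[OF w(3) W gb])
      have ua: "unc a i k (x, \<zeta>) = \<Psi>a i k (x, \<zeta>)" if "i \<in> tI t" "x \<in> cells (sec B (tov t i)) k" "\<zeta> \<in> U k" for i k x \<zeta>
        unfolding a_def using that W U by (subst unc_cur) simp_all
      have ub: "unc b i k (x, \<zeta>) = \<Psi>b i k (x, \<zeta>)" if "i \<in> tI t" "x \<in> cells (sec A (tov t i)) k" "\<zeta> \<in> cells ?W k" for i k x \<zeta>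
        unfolding b_def by (rule unc_cur[OF W that])
      have compat: "Tpre t A j m (a m \<zeta>) = b m \<zeta>" if z: "\<zeta> \<in> U m" for m \<zeta>
      proof (rule TF_maps_eq_on[OF w(3) sm_comp[OF a Tpre_map[OF w(3) jw]] sm_sub[OF b U] W U z])
        fix i k y \<zeta>' assume i: "i \<in> tI t" "y \<in> cells (sec A (tov t i)) k" "\<zeta>' \<in> U k"
        obtain \<mu> \<xi> where z: "\<zeta>' = (\<mu>, \<xi>)" "\<mu> \<in> Dmap k n" "\<xi> \<in> cells X k" using i(3) by (auto simp: U_def)
        have Y: "tov t i \<in> Ob C" by (rule wftD(2)[OF t i(1)])
        have jy: "j (tov t i) k y \<in> cells (sec B (tov t i)) k" by (rule sm_in[OF smapD(1)[OF j Y] i(2)])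
        have "\<zeta>' \<in> cells ?W k" using z by simp
        then show "unc (\<lambda>m x. Tpre t A j m (a m x)) i k (y, \<zeta>') = unc b i k (y, \<zeta>')"
          using ua[OF i(1) jy i(3)] ub[OF i(1,2)] cmp[OF i(1) jS[OF Y i(2) z(2)], of \<xi>] i
          by (simp add: Tpre_unc \<Psi>a_def \<Psi>b_def z(1))
      qed
      obtain c where c: "sset_map ?W (TF t B) c" "\<And>m x. x \<in> U m ==> c m x = a m x"
        "\<And>m x. x \<in> cells ?W m ==> Tpre t A j m (c m x) = b m x"
        by (rule rlpD[OF r[OF X V, folded U_def] a b]) (blast intro: that compat)+
      have gc: "gf t B ?W (unc c)" by (rule unc_gf[OF w(4) W c(1)])
      define d where "d = cur t (Tens B (Tall B n)) X (dtens t B (unc c))"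
      have d: "sset_map X (TF t (Tens B (Tall B n))) d"
        unfolding d_def by (rule cur_map[OF w(1) X gf_dtens[OF gc t B X]])
      have ud: "unc d i k (tc B (tov t i) k (x, \<mu>), \<xi>) = unc c i k (x, \<mu>, \<xi>)"
        if "i \<in> tI t" "x \<in> cells (sec B (tov t i)) k" "\<mu> \<in> Dmap k n" "\<xi> \<in> cells X k" for i k x \<mu> \<xi>
      proof -
        have "tc B (tov t i) k (x, \<mu>) \<in> cells (sec (Tens B (Tall B n)) (tov t i)) k" using that by (auto simp: Tall_def)
        then show ?thesis unfolding d_def using that dtens_gf[OF gc t that(1,3,4), of x] by (subst unc_cur) (simp_all add: X)
      qed
      have uca: "unc c i k (x, \<zeta>) = \<Psi>a i k (x, \<zeta>)" if "i \<in> tI t" "x \<in> cells (sec B (tov t i)) k" "\<zeta> \<in> U k" for i k x \<zeta>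
        using ua[OF that] c(2)[OF that(3)] by (simp add: unc_def)
      have ucb: "unc c i k (j (tov t i) k y, \<mu>, \<xi>) = unc b' i k (tc B (tov t i) k (j (tov t i) k y, \<mu>), \<xi>)"
        if "i \<in> tI t" "y \<in> cells (sec A (tov t i)) k" "\<mu> \<in> Dmap k n" "\<xi> \<in> cells X k" for i k y \<mu> \<xi>
      proof -
        have "unc (\<lambda>m x. Tpre t A j m (c m x)) i k (y, \<mu>, \<xi>) = unc b i k (y, \<mu>, \<xi>)"
          using c(3)[of "(\<mu>, \<xi>)" k] that by (simp add: unc_def)
        then show ?thesis using that ub[OF that(1,2), of "(\<mu>, \<xi>)"] by (simp add: Tpre_unc \<Psi>b_def)
      qed
      have 1: "d m x = a' m x" if "x \<in> V m" for m x
      proof (rule TF_maps_eq_on[OF w(1) sm_sub[OF d V] a' X V that])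
        fix i k y \<xi> assume i: "i \<in> tI t" "y \<in> cells (sec (Tens B (Tall B n)) (tov t i)) k" "\<xi> \<in> V k"
        obtain x \<mu> where y: "y = tc B (tov t i) k (x, \<mu>)" "x \<in> cells (sec B (tov t i)) k" "\<mu> \<in> Dmap k n"
          using i(2) by (auto simp: Tall_def)
        have "\<xi> \<in> cells X k" by (rule subc_in[OF V i(3)])
        then show "unc d i k (y, \<xi>) = unc a' i k (y, \<xi>)"
          using ud[OF i(1) y(2,3)] uca[OF i(1) y(2), of "(\<mu>, \<xi>)"] i(3) y(3) by (simp add: y(1) \<Psi>a_def U_def)
      qed
      have 2: "Tpre t (Tens B ?S) ?\<iota> m (d m x) = b' m x" if "x \<in> cells X m" for m x
      proof (rule TF_maps_eq[OF w(2) sm_comp[OF d Tpre_map[OF w(2) iw]] b' X that])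
        fix i k y \<xi> assume i: "i \<in> tI t" "y \<in> cells (sec (Tens B ?S) (tov t i)) k" "\<xi> \<in> cells X k"
        obtain x \<mu> where y: "y = tc B (tov t i) k (x, \<mu>)" "(x, \<mu>) \<in> ?S (tov t i) k" using i(2) by auto
        have Y: "tov t i \<in> Ob C" by (rule wftD(2)[OF t i(1)])
        note x = subTD(1,2)[OF S Y y(2)]
        have "unc c i k (x, \<mu>, \<xi>) = unc b' i k (y, \<xi>)"
        proof (cases "\<mu> \<in> \<Theta> k")
          case True
          then have "(\<mu>, \<xi>) \<in> U k" using x i(3) by (simp add: U_def)
          then show ?thesis using uca[OF i(1) x(1), of "(\<mu>, \<xi>)"] cmp[OF i(1) y(2), of \<xi>] by (simp add: \<Psi>a_def y(1))
        next
          case False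
          then obtain y' where y': "x = j (tov t i) k y'" "y' \<in> cells (sec A (tov t i)) k" using y(2) by (auto simp: pps_def)
          show ?thesis using ucb[OF i(1) y'(2) x(2) i(3)] by (simp add: y(1) y'(1))
        qed
        then show "unc (\<lambda>m x. Tpre t (Tens B ?S) ?\<iota> m (d m x)) i k (y, \<xi>) = unc b' i k (y, \<xi>)"
          using ud[OF i(1) x i(3)] i i\<iota>[OF Y y(2)] by (simp add: Tpre_unc y(1))
      qed
      show "\<exists>c. sset_map X (TF t (Tens B (Tall B n))) c \<and> (\<forall>m. \<forall>x\<in>V m. c m x = a' m x) \<and>
          (\<forall>m. \<forall>x\<in>cells X m. Tpre t (Tens B ?S) ?\<iota> m (c m x) = b' m x)"
        using d 1 2 by blast
    qed
  qed
qed

subsection \<open>Weak equivalences detected by tests\<close>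

definition Wt :: "('i, 'e, 'o, 'a, 'z) tst set => ('o, 'a, 'v) smap_arr set" where
  "Wt T = {f \<in> Ar M. \<forall>t\<in>T. heq (TF t (snd (snd f))) (TF t (fst f)) (Tpre t (fst f) (fst (snd f)))}"

text \<open>The Kan condition is imposed for all presheaves, because reversing and composing
  homotopies, hence two out of three, needs it at every object that occurs.\<close>

definition good :: "('i, 'e, 'o, 'a, 'z) tst set => bool" where
  "good T \<longleftrightarrow> (\<forall>t\<in>T. wft C t \<and> (\<forall>A :: ('o, 'a, 'v) spre. PS A \<longrightarrow> kan_complex (TF t A)))"

lemma Wt_iff: "(A, \<phi>, B) \<in> Wt T \<longleftrightarrow> (A, \<phi>, B) \<in> Ar M \<and> (\<forall>t\<in>T. heq (TF t B) (TF t A) (Tpre t A \<phi>))"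
  by (simp add: Wt_def)

lemma ArD: "(A, \<phi>, B) \<in> Ar M ==> PS A" "(A, \<phi>, B) \<in> Ar M ==> PS B" "(A, \<phi>, B) \<in> Ar M ==> spre_map C A \<phi> B"
  by (simp_all add: Ar_sPre)

lemma comp_map:
  assumes "spre_map C A \<phi> B" "spre_map C B \<psi> D" "PS A"
  shows "spre_map C A (spre_ext C A (\<lambda>Y n x. \<psi> Y n (\<phi> Y n x))) D"
  unfolding spre_map_def
proof (intro conjI ballI allI impI)
  show "sset_map (sec A Y) (sec D Y) (spre_ext C A (\<lambda>Y n x. \<psi> Y n (\<phi> Y n x)) Y)" if Y: "Y \<in> Ob C" for Y
    by (rule sm_cong[OF sm_comp[OF smapD(1)[OF assms(1) Y] smapD(1)[OF assms(2) Y]]])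
      (use Y psD(1)[OF assms(3) Y] in simp_all)
  show "spre_ext C A (\<lambda>Y n x. \<psi> Y n (\<phi> Y n x)) (Dom C f) n (rst A f n x) =
      rst D f n (spre_ext C A (\<lambda>Y n x. \<psi> Y n (\<phi> Y n x)) (Cod C f) n x)"
    if f: "f \<in> Ar C" "x \<in> cells (sec A (Cod C f)) n" for f n x
    using f smapD(2)[OF assms(1) f] smapD(2)[OF assms(2) f(1) sm_in[OF smapD(1)[OF assms(1) CodOb[OF f(1)]] f(2)]]
      sm_in[OF psD(3)[OF assms(3) f(1)] f(2)] DomOb CodOb by simp
  show "spre_ext C A (\<lambda>Y n x. \<psi> Y n (\<phi> Y n x)) Y n (bpt A Y n) = bpt D Y n" if Y: "Y \<in> Ob C" for Y n
    using smapD(3)[OF assms(1) Y] smapD(3)[OF assms(2) Y] psD(6)[OF assms(3) Y] Y by simp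
qed (auto simp: spre_ext_def)

lemma comp_Ar: "(A, \<phi>, B) \<in> Ar M ==> (B, \<psi>, D) \<in> Ar M ==> (A, spre_ext C A (\<lambda>Y n x. \<psi> Y n (\<phi> Y n x)), D) \<in> Ar M"
  using comp_map[of A \<phi> B \<psi> D] by (simp add: Ar_sPre)

lemma id_Ar: "PS A ==> (A, spre_ext C A (\<lambda>Y n x. x), A) \<in> Ar M"
  using wfm_incl[of A A] by (simp add: Ar_sPre)

lemma Tpre_comp:
  assumes "wft C t" "(A, \<phi>, B) \<in> Ar M"
  shows "Tpre t A \<phi> n (Tpre t B \<psi> n x) = Tpre t A (spre_ext C A (\<lambda>Y n x. \<psi> Y n (\<phi> Y n x))) n x"
  using wftD(2)[OF assms(1)] sm_in[OF smapD(1)[OF ArD(3)[OF assms(2)]]]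
  by (auto simp: Tpre_def fun_eq_iff)

lemma Tpre_id:
  assumes "wft C t" "x \<in> cells (TF t A) n"
  shows "Tpre t A (spre_ext C A (\<lambda>Y n x. x)) n x = x"
  using wftD(2)[OF assms(1)] assms(2)[unfolded TF_cells_iff] by (auto simp: Tpre_def fun_eq_iff)

context
  fixes T :: "('i, 'e, 'o, 'a, 'z) tst set"
  assumes T: "good T"
begin

lemma goodD:
  fixes A :: "('o, 'a, 'v) spre"
  shows "t \<in> T ==> wft C t" "t \<in> T ==> PS A ==> kan_complex (TF t A)"
  using T by (auto simp: good_def)

text \<open>Tests are contravariant, so cancelling on the left here is cancelling on the right for
  homotopy equivalences, and conversely.\<close>

lemma Wt_comp:
  assumes f: "(A, \<phi>, B) \<in> Ar M" and g: "(B, \<psi>, D) \<in> Ar M" and gf: "(A, \<chi>, D) = Cmp M (B, \<psi>, D) (A, \<phi>, B)"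
  shows "(A, \<phi>, B) \<in> Wt T ==> (B, \<psi>, D) \<in> Wt T ==> (A, \<chi>, D) \<in> Wt T"
    and "(B, \<psi>, D) \<in> Wt T ==> (A, \<chi>, D) \<in> Wt T ==> (A, \<phi>, B) \<in> Wt T"
    and "(A, \<phi>, B) \<in> Wt T ==> (A, \<chi>, D) \<in> Wt T ==> (B, \<psi>, D) \<in> Wt T"
proof -
  have \<chi>: "\<chi> = spre_ext C A (\<lambda>Y n x. \<psi> Y n (\<phi> Y n x))" using gf by simp
  have c: "(A, \<chi>, D) \<in> Ar M" using comp_Ar[OF f g] by (simp add: \<chi>)
  have eq: "Tpre t A \<chi> = (\<lambda>n x. Tpre t A \<phi> n (Tpre t B \<psi> n x))" if "t \<in> T" for t
    by (intro ext) (simp only: \<chi> Tpre_comp[OF goodD(1)[OF that] f])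
  note k = goodD(2)[OF _ ArD(1)[OF f]] goodD(2)[OF _ ArD(2)[OF f]] goodD(2)[OF _ ArD(2)[OF g]]
  have m: "sset_map (TF t Q) (TF t P) (Tpre t P \<upsilon>)" if "t \<in> T" "(P, \<upsilon>, Q) \<in> Ar M" for t P Q \<upsilon>
    using Tpre_map[OF wfA_ps[OF goodD(1)[OF that(1)] ArD(1)[OF that(2)]] wfm_ar[OF goodD(1)[OF that(1)] ArD(3)[OF that(2)]]] .
  show "(A, \<chi>, D) \<in> Wt T" if "(A, \<phi>, B) \<in> Wt T" "(B, \<psi>, D) \<in> Wt T"
    unfolding Wt_iff
  proof (intro conjI ballI)
    fix t assume t: "t \<in> T"
    show "heq (TF t D) (TF t A) (Tpre t A \<chi>)"
      using heq_comp[OF k(3)[OF t] k(2)[OF t] k(1)[OF t], of "Tpre t B \<psi>" "Tpre t A \<phi>"] that t eq[OF t] by (simp add: Wt_iff)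
  qed (rule c)
  show "(A, \<phi>, B) \<in> Wt T" if "(B, \<psi>, D) \<in> Wt T" "(A, \<chi>, D) \<in> Wt T"
    unfolding Wt_iff
  proof (intro conjI ballI)
    fix t assume t: "t \<in> T"
    show "heq (TF t B) (TF t A) (Tpre t A \<phi>)"
      by (rule heq_cancel_right[OF k(3)[OF t] k(2)[OF t] k(1)[OF t], of "Tpre t B \<psi>"])
        (use that t m[OF t f] in \<open>simp_all add: Wt_iff eq[OF t, symmetric]\<close>)
  qed (rule f)
  show "(B, \<psi>, D) \<in> Wt T" if "(A, \<phi>, B) \<in> Wt T" "(A, \<chi>, D) \<in> Wt T"
    unfolding Wt_iff
  proof (intro conjI ballI)
    fix t assume t: "t \<in> T"
    show "heq (TF t D) (TF t B) (Tpre t B \<psi>)"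
      by (rule heq_cancel_left[OF k(3)[OF t] k(2)[OF t] k(1)[OF t], of "Tpre t A \<phi>"])
        (use that t m[OF t g] in \<open>simp_all add: Wt_iff eq[OF t, symmetric]\<close>)
  qed (rule g)
qed

lemma Wt_tfib:
  assumes "(A, \<phi>, B) \<in> Ar M" "\<And>t. t \<in> T ==> tfib (TF t B) (TF t A) (Tpre t A \<phi>)"
  shows "(A, \<phi>, B) \<in> Wt T"
  using assms tfib_heq by (auto simp: Wt_iff)

lemma Wt_id: "PS A ==> (A, spre_ext C A (\<lambda>Y n x. x), A) \<in> Wt T"
  unfolding Wt_iff
proof (intro conjI ballI)
  assume A: "PS A"
  show "(A, spre_ext C A (\<lambda>Y n x. x), A) \<in> Ar M" by (rule id_Ar[OF A])
  show "heq (TF t A) (TF t A) (Tpre t A (spre_ext C A (\<lambda>Y n x. x)))" if "t \<in> T" for t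
    by (rule heq_cong[OF heq_id]) (use Tpre_id[OF goodD(1)[OF that]] wfA_ps[OF goodD(1)[OF that] A] in auto)
qed

end

lemma iB_Ar: "(A, \<phi>, B) \<in> Ar M ==> (B, iB (A, \<phi>, B), Cyl (A, \<phi>, B)) \<in> Ar M"
  and iA_Ar: "(A, \<phi>, B) \<in> Ar M ==> (A, iA (A, \<phi>, B), Cyl (A, \<phi>, B)) \<in> Ar M"
  using PS_Cyl iB_map iA_map ArD by (simp_all add: Ar_sPre)

lemma iA_mono: "(A, \<phi>, B) \<in> Ar M ==> (A, iA (A, \<phi>, B), Cyl (A, \<phi>, B)) \<in> spre_monos u C"
  using iA_Ar iA_inj by (simp add: spre_monos_def)

text \<open>The pushout property of the cylinder for arrows is its version for tests with the
  one-point complex \<open>simplex 0\<close> as parameter.\<close>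

lemma cyl_arr:
  assumes f: "(A, \<phi>, B) \<in> Ar M" and b: "(B, b, Z) \<in> Ar M" and h: "gf (mt C Z) A I1 h"
    and c: "\<And>Y m a. Y \<in> Ob C ==> a \<in> cells (sec A Y) m ==> h Y m (a, cD 1 m) = b Y m (\<phi> Y m a)"
  obtains k where "(Cyl (A, \<phi>, B), k, Z) \<in> Ar M"
    "\<And>Y m x. Y \<in> Ob C ==> x \<in> cells (sec B Y) m ==> k Y m (cB x) = b Y m x"
    "\<And>Y m a t. Y \<in> Ob C ==> a \<in> cells (sec A Y) m ==> t \<in> Dmap m 1 ==> k Y m (cA A \<phi> Y m (a, t)) = h Y m (a, t)"
proof -
  have Z: "PS Z" by (rule ArD(2)[OF b])
  note w = wftmt[OF Z]
  have gb: "gf (mt C Z) B (simplex 0) (\<lambda>Y m (x, \<xi>). b Y m x)" by (rule arr_gf[OF b])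
  have gh: "gf (mt C Z) A (sset_prod (simplex 0) I1) (\<lambda>Y m (a, \<xi>). h Y m (a, snd \<xi>))"
    using gf_precomp[OF h sm_snd[of "simplex 0" I1]] by simp
  have g: "gf (mt C Z) (Cyl (A, \<phi>, B)) (simplex 0) (dcyl (\<lambda>Y m (x, \<xi>). b Y m x) (\<lambda>Y m (a, \<xi>). h Y m (a, snd \<xi>)))"
    by (rule gf_dcyl[OF w f _ gb gh]) (use c in auto)
  have k: "(Cyl (A, \<phi>, B), spre_ext C (Cyl (A, \<phi>, B))
      (\<lambda>Y m y. dcyl (\<lambda>Y m (x, \<xi>). b Y m x) (\<lambda>Y m (a, \<xi>). h Y m (a, snd \<xi>)) Y m (y, cD 0 m)), Z) \<in> Ar M"
    by (rule gf_arr[OF g PS_Cyl[OF f] Z]) simp_all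
  show thesis
  proof (rule that[OF k], goal_cases)
    case (1 Y m x) then show ?case using cB_in by simp
  next
    case (2 Y m a t)
    have "dcyl (\<lambda>Y m (x, \<xi>). b Y m x) (\<lambda>Y m (a, \<xi>). h Y m (a, snd \<xi>)) (Y) m (cA A \<phi> (tov (mt C Z) Y) m (a, t), cD 0 m) = h Y m (a, t)"
      by (subst dcyl_cA[OF w f gb gh]) (use c 2 in auto)
    then show ?case using cA_in[OF 2(2,3)] 2(1) by simp
  qed
qed

lemma cyl_proj:
  assumes f: "(A, \<phi>, B) \<in> Ar M"
  obtains r where "(Cyl (A, \<phi>, B), r, B) \<in> Ar M"
    "Cmp M (Cyl (A, \<phi>, B), r, B) (B, iB (A, \<phi>, B), Cyl (A, \<phi>, B)) = Idn M B"
    "Cmp M (Cyl (A, \<phi>, B), r, B) (A, iA (A, \<phi>, B), Cyl (A, \<phi>, B)) = (A, \<phi>, B)"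
proof -
  have B: "PS B" by (rule ArD(2)[OF f])
  obtain r where r: "(Cyl (A, \<phi>, B), r, B) \<in> Ar M"
    "\<And>Y m x. Y \<in> Ob C ==> x \<in> cells (sec B Y) m ==> r Y m (cB x) = x"
    "\<And>Y m a t. Y \<in> Ob C ==> a \<in> cells (sec A Y) m ==> t \<in> Dmap m 1 ==> r Y m (cA A \<phi> Y m (a, t)) = \<phi> Y m a"
  proof (rule cyl_arr[OF f id_Ar[OF B] arr_gf[OF f]])
    show "(case (a, cD 1 m) of (y, \<xi>) => \<phi> Y m y) = spre_ext C B (\<lambda>Y n x. x) Y m (\<phi> Y m a)"
      if "Y \<in> Ob C" "a \<in> cells (sec A Y) m" for Y m a
      using that sm_in[OF smapD(1)[OF ArD(3)[OF f] that(1)] that(2)] by simp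
  qed (rule that, auto)
  show thesis
  proof (rule that[OF r(1)])
    show "Cmp M (Cyl (A, \<phi>, B), r, B) (B, iB (A, \<phi>, B), Cyl (A, \<phi>, B)) = Idn M B"
      using r(2) by (auto simp: iB_def spre_ext_def fun_eq_iff)
    have "spre_ext C A (\<lambda>Y n x. r Y n (iA (A, \<phi>, B) Y n x)) = \<phi>"
      by (rule spre_map_eqI[OF comp_map[OF ArD(3)[OF iA_Ar[OF f]] ArD(3)[OF r(1)] ArD(1)[OF f]] ArD(3)[OF f]])
        (use r(3) in \<open>simp add: iA_def\<close>)
    then show "Cmp M (Cyl (A, \<phi>, B), r, B) (A, iA (A, \<phi>, B), Cyl (A, \<phi>, B)) = (A, \<phi>, B)" by simp
  qed
qed

context
  fixes T :: "('i, 'e, 'o, 'a, 'z) tst set"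
  assumes T: "good T"
begin

lemma Wt_iB: "(A, \<phi>, B) \<in> Ar M ==> (B, iB (A, \<phi>, B), Cyl (A, \<phi>, B)) \<in> Wt T"
  by (rule Wt_tfib[OF T iB_Ar tfib_iB]) (auto intro: goodD[OF T] dest: ArD)

lemma Wt_iA_tfib:
  assumes "(A, \<phi>, B) \<in> Wt T" "t \<in> T"
  shows "tfib (TF t (Cyl (A, \<phi>, B))) (TF t A) (Tpre t A (iA (A, \<phi>, B)))"
  using assms by (intro tfib_iA) (auto intro: goodD[OF T] dest: ArD simp: Wt_iff)

lemma Wt_iA: "(A, \<phi>, B) \<in> Wt T ==> (A, iA (A, \<phi>, B), Cyl (A, \<phi>, B)) \<in> Wt T"
  by (rule Wt_tfib[OF T iA_Ar Wt_iA_tfib]) (auto simp: Wt_iff)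

end

subsection \<open>Fibrant objects\<close>

text \<open>Fibrancy in terms of elements: a square over the terminal presheaf commutes by itself,
  so lifting is extension of arrows into \<open>Z\<close>.\<close>

definition exto :: "('o, 'a, 'v) smap_arr set => ('o, 'a, 'v) spre => bool" where
  "exto W Z \<longleftrightarrow> PS Z \<and> (\<forall>P \<iota> Q \<upsilon>. (P, \<iota>, Q) \<in> spre_monos u C \<inter> W \<longrightarrow> (P, \<upsilon>, Z) \<in> Ar M \<longrightarrow>
     (\<exists>\<omega>. (Q, \<omega>, Z) \<in> Ar M \<and> (\<forall>Y\<in>Ob C. \<forall>n. \<forall>x\<in>cells (sec P Y) n. \<omega> Y n (\<iota> Y n x) = \<upsilon> Y n x)))"

text \<open>Compatible data on the two parts of a pushout product define an arrow out of it.
  Fibrancy extends this arrow along \<open>tincl\<close>, and the tensor adjunction turns the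
  extension into a family on \<open>B\<close>.\<close>

lemma exto_pps:
  assumes Z: "exto W Z" and A: "PS A" and B: "PS B" and j: "spre_map C A j B"
    and inj: "\<And>Y n. Y \<in> Ob C ==> inj_on (j Y n) (cells (sec A Y) n)"
    and th: "subc (simplex n) \<Theta>" and i: "tincl B n (pps A j B n \<Theta>) \<in> W"
    and g1: "gf (mt C Z) A (simplex n) \<Psi>1" and g2: "gf (mt C Z) B (sub (simplex n) \<Theta>) \<Psi>2"
    and c: "\<And>Y m a \<mu>. Y \<in> Ob C ==> a \<in> cells (sec A Y) m ==> \<mu> \<in> \<Theta> m ==> \<Psi>2 Y m (j Y m a, \<mu>) = \<Psi>1 Y m (a, \<mu>)"
  obtains \<Psi> where "gf (mt C Z) B (simplex n) \<Psi>"
    "\<And>Y m x \<mu>. Y \<in> Ob C ==> x \<in> cells (sec B Y) m ==> \<mu> \<in> \<Theta> m ==> \<Psi> Y m (x, \<mu>) = \<Psi>2 Y m (x, \<mu>)"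
    "\<And>Y m a \<mu>. Y \<in> Ob C ==> a \<in> cells (sec A Y) m ==> \<mu> \<in> Dmap m n ==> \<Psi> Y m (j Y m a, \<mu>) = \<Psi>1 Y m (a, \<mu>)"
proof -
  have PZ: "PS Z" using Z by (simp add: exto_def)
  note w = wftmt[OF PZ]
  let ?S = "pps A j B n \<Theta>"
  have S: "subT B n ?S" by (rule subT_pps[OF A B j th])
  have thD: "\<mu> \<in> Dmap m n" if "\<mu> \<in> \<Theta> m" for m \<mu> using subc_in[OF th that] by simp
  \<comment> \<open>Off \<Theta> the elements of the pushout product come from \<open>A\<close>, and
    \<open>ji\<close> is evaluated only there.\<close>
  define ji where "ji = (\<lambda>Y m. the_inv_into (cells (sec A Y) m) (j Y m))"
  have ji: "ji Y m (j Y m a) = a" if "Y \<in> Ob C" "a \<in> cells (sec A Y) m" for Y m a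
    unfolding ji_def using inj[OF that(1)] that(2) by (rule the_inv_into_f_f)
  define \<Psi>0 where "\<Psi>0 = (\<lambda>Y m (x, \<mu>, \<xi> :: nat => nat). if \<mu> \<in> \<Theta> m then \<Psi>2 Y m (x, \<mu>) else \<Psi>1 Y m (ji Y m x, \<mu>))"
  have P2: "\<Psi>0 Y m (x, \<mu>, \<xi>) = \<Psi>2 Y m (x, \<mu>)" if "\<mu> \<in> \<Theta> m" for Y m x \<mu> \<xi>
    using that by (simp add: \<Psi>0_def)
  have P1: "\<Psi>0 Y m (j Y m a, \<mu>, \<xi>) = \<Psi>1 Y m (a, \<mu>)" if "Y \<in> Ob C" "a \<in> cells (sec A Y) m" for Y m a \<mu> \<xi>
    using that c ji by (simp add: \<Psi>0_def)
  have P0: "\<Psi>0 Y m (bpt B Y m, \<mu>, \<xi>) = bpt Z Y m" if "Y \<in> Ob C" "\<mu> \<in> Dmap m n" for Y m \<mu> \<xi>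
    using P1[OF that(1) psD(6)[OF A that(1)], of m \<mu> \<xi>] smapD(3)[OF j that(1)] gfD(4)[OF g1 _ , of Y \<mu> m] that by simp
  have cs: "(\<exists>a. x = j Y m a \<and> a \<in> cells (sec A Y) m) \<or> \<mu> \<in> \<Theta> m" "x \<in> cells (sec B Y) m" "\<mu> \<in> Dmap m n"
    if "(x, \<mu>) \<in> ?S Y m" for x \<mu> Y m using that by (auto simp: pps_def)
  have g0: "gf (mt C Z) (Tens B ?S) (simplex 0) (dtens (mt C Z) B \<Psi>0)"
  proof (rule gf_TensI[OF w B S is_sset_simplex])
    fix Y k x \<mu> and \<xi> :: "nat => nat" assume Y: "Y \<in> tI (mt C Z)" and x: "(x, \<mu>) \<in> ?S (tov (mt C Z) Y) k"
    show "\<Psi>0 Y k (x, \<mu>, \<xi>) \<in> cells (tZ (mt C Z) Y) k"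
      using cs[OF x] Y P1[of Y _ k \<mu> \<xi>] P2[of \<mu> k Y x \<xi>] gfD(1)[OF g1, of Y _ k \<mu>] gfD(1)[OF g2, of Y x k \<mu>] by auto
  next
    fix Y l k \<eta> x \<mu> and \<xi> :: "nat => nat" assume Y: "Y \<in> tI (mt C Z)" and e: "\<eta> \<in> Dmap l k" and x: "(x, \<mu>) \<in> ?S (tov (mt C Z) Y) k"
    have Y': "Y \<in> Ob C" and x': "(x, \<mu>) \<in> ?S Y k" using Y x by simp_all
    have "\<Psi>0 Y l (act (sec B Y) l k \<eta> x, compD l \<mu> \<eta>, act (simplex 0) l k \<eta> \<xi>) = act (sec Z Y) l k \<eta> (\<Psi>0 Y k (x, \<mu>, \<xi>))"
    proof (cases "\<mu> \<in> \<Theta> k")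
      case True
      then have "compD l \<mu> \<eta> \<in> \<Theta> l" using subc_act[OF th e True] by simp
      then show ?thesis using gfD(2)[OF g2, of Y \<eta> l k x \<mu>] True Y' e cs(2)[OF x'] by (simp add: P2)
    next
      case False
      then obtain a where a: "x = j Y k a" "a \<in> cells (sec A Y) k" using cs(1)[OF x'] by blast
      have aa: "act (sec A Y) l k \<eta> a \<in> cells (sec A Y) l" by (rule ss_act[OF psD(1)[OF A Y'] e a(2)])
      have "act (sec B Y) l k \<eta> x = j Y l (act (sec A Y) l k \<eta> a)"
        unfolding a(1) by (rule sm_nat[OF smapD(1)[OF j Y'] e a(2), symmetric])
      then show ?thesis using gfD(2)[OF g1, of Y \<eta> l k a \<mu>] Y' e a cs(3)[OF x'] by (simp add: P1[OF Y' aa] P1[OF Y' a(2)])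
    qed
    then show "\<Psi>0 Y l (act (sec B (tov (mt C Z) Y)) l k \<eta> x, compD l \<mu> \<eta>, act (simplex 0) l k \<eta> \<xi>) =
       act (tZ (mt C Z) Y) l k \<eta> (\<Psi>0 Y k (x, \<mu>, \<xi>))" by simp
  next
    fix f k x \<mu> and \<xi> :: "nat => nat" assume f: "f \<in> tE (mt C Z)" and x: "(x, \<mu>) \<in> ?S (tov (mt C Z) (ttgt (mt C Z) f)) k"
    have f': "f \<in> Ar C" and x': "(x, \<mu>) \<in> ?S (Cod C f) k" using f x by simp_all
    have "\<Psi>0 (Dom C f) k (rst B f k x, \<mu>, \<xi>) = rst Z f k (\<Psi>0 (Cod C f) k (x, \<mu>, \<xi>))"
    proof (cases "\<mu> \<in> \<Theta> k")
      case True
      then show ?thesis using gfD(3)[OF g2, of f x k \<mu>] f' cs(2)[OF x'] by (simp add: P2)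
    next
      case False
      then obtain a where a: "x = j (Cod C f) k a" "a \<in> cells (sec A (Cod C f)) k" using cs(1)[OF x'] by blast
      have aa: "rst A f k a \<in> cells (sec A (Dom C f)) k" by (rule sm_in[OF psD(3)[OF A f'] a(2)])
      have "rst B f k x = j (Dom C f) k (rst A f k a)" unfolding a(1) by (rule smapD(2)[OF j f' a(2), symmetric])
      then show ?thesis using gfD(3)[OF g1, of f a k \<mu>] f' a cs(3)[OF x']
        by (simp add: P1[OF DomOb[OF f'] aa] P1[OF CodOb[OF f'] a(2)])
    qed
    then show "\<Psi>0 (tsrc (mt C Z) f) k (rst B (tav (mt C Z) f) k x, \<mu>, \<xi>) = tr (mt C Z) f k (\<Psi>0 (ttgt (mt C Z) f) k (x, \<mu>, \<xi>))" by simp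
  qed (use P0 in simp)
  have "(Tens B ?S, spre_ext C (Tens B ?S) (\<lambda>Y m y. dtens (mt C Z) B \<Psi>0 Y m (y, cD 0 m)), Z) \<in> Ar M"
    by (rule gf_arr[OF g0 PS_Tens[OF B S] PZ]) simp_all
  moreover have "tincl B n ?S \<in> spre_monos u C \<inter> W" using tincl_mono[OF B S] i by simp
  ultimately obtain \<omega> where \<omega>: "(Tens B (Tall B n), \<omega>, Z) \<in> Ar M"
    and \<omega>2: "\<And>Y m y. Y \<in> Ob C ==> y \<in> cells (sec (Tens B ?S) Y) m ==> \<omega> Y m (spre_ext C (Tens B ?S) (\<lambda>Y n y. y) Y m y) =
      spre_ext C (Tens B ?S) (\<lambda>Y m y. dtens (mt C Z) B \<Psi>0 Y m (y, cD 0 m)) Y m y"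
    using Z unfolding exto_def tincl_def by blast
  have \<omega>3: "\<omega> Y m (tc B Y m (x, \<mu>)) = \<Psi>0 Y m (x, \<mu>, cD 0 m)" if "Y \<in> Ob C" "(x, \<mu>) \<in> ?S Y m" for Y m x \<mu>
  proof -
    have y: "tc B Y m (x, \<mu>) \<in> cells (sec (Tens B ?S) Y) m" using that(2) by auto
    have "dtens (mt C Z) B \<Psi>0 Y m (tc B (tov (mt C Z) Y) m (x, \<mu>), cD 0 m) = \<Psi>0 Y m (x, \<mu>, cD 0 m)"
      by (rule dtens_tc) (use P0[OF that(1)] cs(3)[OF that(2)] in simp)
    then show ?thesis using \<omega>2[OF that(1) y] y that(1) by simp
  qed
  have "gf (mt C Z) B (sset_prod (simplex n) (simplex 0)) (\<lambda>Y m (x, \<mu>, \<xi>). \<omega> Y m (tc B Y m (x, \<mu>)))"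
    using gf_Tall[OF arr_gf[OF \<omega>] w B] by simp
  then have "gf (mt C Z) B (simplex n) (\<lambda>Y m (x, \<mu>). \<omega> Y m (tc B Y m (x, \<mu>)))"
    using gf_precomp[of "mt C Z" B "sset_prod (simplex n) (simplex 0)" _ "simplex n" "\<lambda>m \<mu>. (\<mu>, cD 0 m)"]
      sm_pair[OF sm_id, of "simplex n" "simplex 0" "\<lambda>m \<mu>. cD 0 m"] by (force simp: sset_map_def)
  then show thesis
  proof (rule that)
    fix Y m x \<mu> assume Y: "Y \<in> Ob C" "x \<in> cells (sec B Y) m" "\<mu> \<in> \<Theta> m"
    then show "(case (x, \<mu>) of (x, \<mu>) => \<omega> Y m (tc B Y m (x, \<mu>))) = \<Psi>2 Y m (x, \<mu>)"
      using \<omega>3[OF Y(1), of x \<mu> m] thD[OF Y(3)] P2 by (simp add: pps_def)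
  next
    fix Y m a \<mu> assume Y: "Y \<in> Ob C" "a \<in> cells (sec A Y) m" "\<mu> \<in> Dmap m n"
    then show "(case (j Y m a, \<mu>) of (x, \<mu>) => \<omega> Y m (tc B Y m (x, \<mu>))) = \<Psi>1 Y m (a, \<mu>)"
      using \<omega>3[OF Y(1), of "j Y m a" \<mu> m] P1[OF Y(1,2)] sm_in[OF smapD(1)[OF j Y(1)] Y(2)] by (simp add: pps_def)
  qed
qed

text \<open>A zero presheaf over the arbitrary value type \<open>'v\<close>, for which
  \<open>pt_spre\<close> cannot be used. Writing it as a tensor makes \<open>PS_Tens\<close>
  applicable, and the tensor of \<open>A\<close> with a horn becomes the pushout product along
  \<open>j0\<close>.\<close>

definition pt0 :: "('o, 'a, 'v) spre => ('o, 'a, 'v) spre" where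
  "pt0 A = Tens A (\<lambda>Y m. {bpt A Y m} \<times> Dmap m 0)"

definition j0 :: "('o, 'a, 'v) spre => 'o => nat => 'v => 'v" where
  "j0 A = spre_ext C (pt0 A) (\<lambda>Y m y. bpt A Y m)"

lemma pt0_cells: "y \<in> cells (sec (pt0 A) Y) m ==> y = bpt (pt0 A) Y m"
  by (auto simp: pt0_def)

lemma PS_pt0: "PS A ==> PS (pt0 A)"
  unfolding pt0_def by (rule PS_Tens[of _ 0]) (auto simp: subT_def psD)

lemma j0_map: "PS A ==> spre_map C (pt0 A) (j0 A) A"
proof -
  assume A: "PS A"
  note P = PS_pt0[OF A]
  show ?thesis
    unfolding spre_map_def
  proof (intro conjI ballI allI impI)
    show "sset_map (sec (pt0 A) Y) (sec A Y) (j0 A Y)" if Y: "Y \<in> Ob C" for Y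
      by (rule smI) (use Y psD(6,7)[OF A Y] psD(1)[OF P Y] in \<open>auto simp: j0_def\<close>)
    show "j0 A (Dom C f) n (rst (pt0 A) f n x) = rst A f n (j0 A (Cod C f) n x)"
      if "f \<in> Ar C" "x \<in> cells (sec (pt0 A) (Cod C f)) n" for f n x
      using that DomOb CodOb sm_in[OF psD(3)[OF P]] psD(8)[OF A] by (simp add: j0_def)
    show "j0 A Y n (bpt (pt0 A) Y n) = bpt A Y n" if "Y \<in> Ob C" for Y n
      using that psD(6)[OF P] by (simp add: j0_def)
  qed (auto simp: j0_def spre_ext_def)
qed

context
  fixes T :: "('i, 'e, 'o, 'a, 'z) tst set"
  assumes T: "good T"
begin

lemma tincl_Wt:
  assumes A: "PS A" and B: "PS B" and j: "spre_map C A j B" and th: "subc (simplex n) \<Theta>"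
    and r: "\<And>t (X :: (nat => nat) sset) V. t \<in> T ==> is_sset X ==> subc X V ==>
      rlp (Tpre t A j) (TF t B) (TF t A) (sset_prod (simplex n) X)
        (\<lambda>m. {(\<mu>, \<xi>). \<mu> \<in> Dmap m n \<and> \<xi> \<in> cells X m \<and> (\<mu> \<in> \<Theta> m \<or> \<xi> \<in> V m)})"
  shows "tincl B n (pps A j B n \<Theta>) \<in> Wt T"
proof -
  have "(Tens B (pps A j B n \<Theta>), fst (snd (tincl B n (pps A j B n \<Theta>))), Tens B (Tall B n)) \<in> Wt T"
  proof (rule Wt_tfib[OF T])
    show "(Tens B (pps A j B n \<Theta>), fst (snd (tincl B n (pps A j B n \<Theta>))), Tens B (Tall B n)) \<in> Ar M"
      using tincl_mono[OF B subT_pps[OF A B j th]] by (simp add: spre_monos_def tincl_def)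
    fix t assume t: "t \<in> T"
    show "tfib (TF t (Tens B (Tall B n))) (TF t (Tens B (pps A j B n \<Theta>)))
          (Tpre t (Tens B (pps A j B n \<Theta>)) (fst (snd (tincl B n (pps A j B n \<Theta>)))))"
      by (rule tfib_pps[OF goodD(1)[OF T t] A B j th r[OF t]])
  qed
  then show ?thesis by (simp add: tincl_def)
qed

lemma TF_pt0:
  assumes "t \<in> T" "x \<in> cells (TF t (pt0 A)) n" "y \<in> cells (TF t (pt0 A)) n"
  shows "x = y"
proof (rule TF_eqI[OF assms(2,3)])
  fix i k y' \<eta> assume i: "i \<in> tI t" "y' \<in> cells (sec (pt0 A) (tov t i)) k" "\<eta> \<in> Dmap k n"
  have g: "gf t (pt0 A) (simplex n) x" "gf t (pt0 A) (simplex n) y" using assms by (auto simp: TF_cells_iff)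
  show "x i k (y', \<eta>) = y i k (y', \<eta>)"
    using gfD(4)[OF g(1) wftD(1)[OF goodD(1)[OF T assms(1)]] i(1)] gfD(4)[OF g(2) wftD(1)[OF goodD(1)[OF T assms(1)]] i(1)]
      pt0_cells[OF i(2)] i(3) by simp
qed

text \<open>A function complex out of \<open>pt0 A\<close> has at most one simplex in each
  dimension, so the condition of lying over a given map is automatic; what remains is extension from
  a horn combined with a monomorphism, which is \<open>pph\<close>.\<close>

lemma horn_tincl_Wt:
  assumes A: "PS A" and n: "1 \<le> n" "k \<le> n"
  shows "tincl A n (pps (pt0 A) (j0 A) A n (hn n k)) \<in> Wt T"
proof (rule tincl_Wt[OF PS_pt0[OF A] A j0_map[OF A] subc_hn])
  fix t and X :: "(nat => nat) sset" and V assume t: "t \<in> T" and X: "is_sset X" and V: "subc X V"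
  let ?U = "\<lambda>m. {(\<mu>, \<xi>). \<mu> \<in> Dmap m n \<and> \<xi> \<in> cells X m \<and> (\<mu> \<in> hn n k m \<or> \<xi> \<in> V m)}"
  note tw = goodD(1)[OF T t]
  have w: "wfA t (pt0 A)" by (rule wfA_ps[OF tw PS_pt0[OF A]])
  show "rlp (Tpre t (pt0 A) (j0 A)) (TF t A) (TF t (pt0 A)) (sset_prod (simplex n) X) ?U"
    unfolding rlp_def
  proof (intro allI impI, elim conjE)
    fix a b assume a: "sset_map (sub (sset_prod (simplex n) X) ?U) (TF t A) a"
      and b: "sset_map (sset_prod (simplex n) X) (TF t (pt0 A)) b"
    obtain c where c: "sset_map (sset_prod (simplex n) X) (TF t A) c"
      "\<And>m \<mu> \<xi>. \<mu> \<in> hn n k m ==> \<xi> \<in> cells X m ==> c m (\<mu>, \<xi>) = a m (\<mu>, \<xi>)"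
      "\<And>m \<mu> \<xi>. \<mu> \<in> Dmap m n ==> \<xi> \<in> V m ==> c m (\<mu>, \<xi>) = a m (\<mu>, \<xi>)"
      by (rule pph[OF goodD(2)[OF T t A] n X V a]) (rule that)
    have "Tpre t (pt0 A) (j0 A) m (c m x) = b m x" if "x \<in> cells (sset_prod (simplex n) X) m" for m x
      by (rule TF_pt0[OF t sm_in[OF Tpre_map[OF w wfm_ar[OF tw j0_map[OF A]]] sm_in[OF c(1) that]] sm_in[OF b that]])
    then show "\<exists>c. sset_map (sset_prod (simplex n) X) (TF t A) c \<and> (\<forall>m. \<forall>x\<in>?U m. c m x = a m x) \<and>
       (\<forall>m. \<forall>x\<in>cells (sset_prod (simplex n) X) m. Tpre t (pt0 A) (j0 A) m (c m x) = b m x)"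
      using c by (intro exI[of _ c]) auto
  qed
qed

text \<open>A horn in the mapping space is an arrow out of the tensor of \<open>A\<close> with the
  horn. Its inclusion into the tensor with \<Delta>[n] is a trivial cofibration by
  \<open>horn_tincl_Wt\<close>, so fibrancy of \<open>Z\<close> gives the filler.\<close>

theorem map_space_kan:
  fixes A :: "('o, 'a, 'v) spre"
  assumes Z: "exto (Wt T) Z" and A: "PS A"
  shows "kan_complex (TF (mt C Z) A)"
  unfolding kan_complex_def horn_eq
proof (intro conjI allI impI)
  have PZ: "PS Z" using Z by (simp add: exto_def)
  note w = wftmt[OF PZ] and wA = wfA_ps[OF wftmt[OF PZ] A]
  show "is_sset (TF (mt C Z) A)" using wA by simp
  fix n k :: nat and \<phi> assume n: "1 \<le> n" "k \<le> n" and p: "sset_map (sub (simplex n) (hn n k)) (TF (mt C Z) A) \<phi>"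
  have g2: "gf (mt C Z) A (sub (simplex n) (hn n k)) (unc \<phi>)" by (rule unc_gf[OF wA _ p]) simp
  \<comment> \<open>On the zero presheaf the only possible family is the one at the base point of
    \<open>Z\<close>.\<close>
  have g1: "gf (mt C Z) (pt0 A) (simplex n) (\<lambda>Y m _. bpt Z Y m)"
    by (rule gfI) (use psD(6-8)[OF PZ] DomOb CodOb in auto)
  obtain \<Psi> where \<Psi>: "gf (mt C Z) A (simplex n) \<Psi>"
    "\<And>Y m x \<mu>. Y \<in> Ob C ==> x \<in> cells (sec A Y) m ==> \<mu> \<in> hn n k m ==> \<Psi> Y m (x, \<mu>) = unc \<phi> Y m (x, \<mu>)"
  proof (rule exto_pps[OF Z PS_pt0[OF A] A j0_map[OF A] _ subc_hn horn_tincl_Wt[OF A n] g1 g2])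
    show "inj_on (j0 A Y n) (cells (sec (pt0 A) Y) n)" for Y n
      using pt0_cells by (metis inj_onI)
    show "unc \<phi> Y m (j0 A Y m a, \<mu>) = bpt Z Y m" if "Y \<in> Ob C" "a \<in> cells (sec (pt0 A) Y) m" "\<mu> \<in> hn n k m" for Y m a \<mu>
      using gfD(4)[OF g2, of Y \<mu> m] that by (simp add: j0_def)
  qed (rule that)
  have c: "sset_map (simplex n) (TF (mt C Z) A) (cur (mt C Z) A (simplex n) \<Psi>)" by (rule cur_map[OF wA _ \<Psi>(1)]) simp
  have "cur (mt C Z) A (simplex n) \<Psi> m x = \<phi> m x" if "x \<in> hn n k m" for m x
  proof (rule TF_maps_eq_on[OF wA sm_sub[OF c subc_hn] p is_sset_simplex subc_hn that])
    fix Y l y \<zeta> assume i: "Y \<in> tI (mt C Z)" "y \<in> cells (tsec (mt C Z) A Y) l" "\<zeta> \<in> hn n k l"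
    have z: "\<zeta> \<in> cells (simplex n) l" by (rule subc_in[OF subc_hn i(3)])
    show "unc (cur (mt C Z) A (simplex n) \<Psi>) Y l (y, \<zeta>) = unc \<phi> Y l (y, \<zeta>)"
      using unc_cur[OF is_sset_simplex i(1,2) z, of \<Psi>] \<Psi>(2) i by simp
  qed
  then show "\<exists>g. sset_map (simplex n) (TF (mt C Z) A) g \<and> (\<forall>m. \<forall>\<mu>\<in>cells (sub (simplex n) (hn n k)) m. g m \<mu> = \<phi> m \<mu>)"
    using c by (intro exI[of _ "cur (mt C Z) A (simplex n) \<Psi>"]) simp
qed

text \<open>The pushout products of \<open>iA\<close> with boundaries are trivial cofibrations, so
  restriction along \<open>iA\<close> is a trivial fibration of mapping spaces. The map \<phi> is
  the projection \<open>r\<close> of the cylinder after \<open>iA\<close>, and \<open>r\<close> is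
  treated by comparison with \<open>iB\<close>.\<close>

theorem map_space_heq:
  assumes Z: "exto (Wt T) Z" and f: "(A, \<phi>, B) \<in> Wt T"
  shows "heq (TF (mt C Z) B) (TF (mt C Z) A) (Tpre (mt C Z) A \<phi>)"
proof -
  have PZ: "PS Z" using Z by (simp add: exto_def)
  have far: "(A, \<phi>, B) \<in> Ar M" using f by (simp add: Wt_iff)
  note A = ArD(1)[OF far] and B = ArD(2)[OF far] and K = PS_Cyl[OF far]
  let ?K = "Cyl (A, \<phi>, B)" and ?m = "mt C Z"
  note w = wftmt[OF PZ]
  note wA = wfA_ps[OF w A] and wB = wfA_ps[OF w B] and wK = wfA_ps[OF w K]
  note jm = iA_map[OF far]
  note kan = map_space_kan[OF Z]
  have Tj: "sset_map (TF ?m ?K) (TF ?m A) (Tpre ?m A (iA (A, \<phi>, B)))" by (rule Tpre_map[OF wA wfm_ar[OF w jm]])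
  have "tfib (TF ?m ?K) (TF ?m A) (Tpre ?m A (iA (A, \<phi>, B)))"
    unfolding tfib_def
  proof (intro conjI allI)
    show "is_sset (TF ?m ?K)" "is_sset (TF ?m A)" using wA wK by auto
    show "sset_map (TF ?m ?K) (TF ?m A) (Tpre ?m A (iA (A, \<phi>, B)))" by (rule Tj)
    fix n
    have incl: "tincl ?K n (pps A (iA (A, \<phi>, B)) ?K n (bd n)) \<in> Wt T"
    proof (rule tincl_Wt[OF A K jm subc_bd])
      fix t and X :: "(nat => nat) sset" and V assume t: "t \<in> T" and X: "is_sset X" and V: "subc X V"
      show "rlp (Tpre t A (iA (A, \<phi>, B))) (TF t ?K) (TF t A) (sset_prod (simplex n) X)
          (\<lambda>m. {(\<mu>, \<xi>). \<mu> \<in> Dmap m n \<and> \<xi> \<in> cells X m \<and> (\<mu> \<in> bd n m \<or> \<xi> \<in> V m)})"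
      proof (rule tfib_rlp[OF Wt_iA_tfib[OF T f t]])
        show "subc (sset_prod (simplex n) X) (\<lambda>m. {(\<mu>, \<xi>). \<mu> \<in> Dmap m n \<and> \<xi> \<in> cells X m \<and> (\<mu> \<in> bd n m \<or> \<xi> \<in> V m)})"
          by (rule subcI) (use X subc_act[OF subc_bd] subc_act[OF V] in auto)
      qed (simp add: X)
    qed
    show "rlp (Tpre ?m A (iA (A, \<phi>, B))) (TF ?m ?K) (TF ?m A) (simplex n) (bd n)"
      unfolding rlp_def
    proof (intro allI impI, elim conjE)
      fix a b assume a: "sset_map (sub (simplex n) (bd n)) (TF ?m ?K) a" and b: "sset_map (simplex n) (TF ?m A) b"
        and ab: "\<forall>m. \<forall>x\<in>bd n m. Tpre ?m A (iA (A, \<phi>, B)) m (a m x) = b m x"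
      have g2: "gf ?m ?K (sub (simplex n) (bd n)) (unc a)" by (rule unc_gf[OF wK _ a]) simp
      have g1: "gf ?m A (simplex n) (unc b)" by (rule unc_gf[OF wA _ b]) simp
      obtain \<Psi> where \<Psi>: "gf ?m ?K (simplex n) \<Psi>"
        "\<And>Y m x \<mu>. Y \<in> Ob C ==> x \<in> cells (sec ?K Y) m ==> \<mu> \<in> bd n m ==> \<Psi> Y m (x, \<mu>) = unc a Y m (x, \<mu>)"
        "\<And>Y m x \<mu>. Y \<in> Ob C ==> x \<in> cells (sec A Y) m ==> \<mu> \<in> Dmap m n ==> \<Psi> Y m (iA (A, \<phi>, B) Y m x, \<mu>) = unc b Y m (x, \<mu>)"
      proof (rule exto_pps[OF Z A K jm _ subc_bd incl g1 g2])
        show "inj_on (iA (A, \<phi>, B) Y n) (cells (sec A Y) n)" if "Y \<in> Ob C" for Y n by (rule iA_inj[OF that])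
        show "unc a Y m (iA (A, \<phi>, B) Y m y, \<mu>) = unc b Y m (y, \<mu>)" if "Y \<in> Ob C" "y \<in> cells (sec A Y) m" "\<mu> \<in> bd n m" for Y m y \<mu>
        proof -
          have "unc (\<lambda>m x. Tpre ?m A (iA (A, \<phi>, B)) m (a m x)) Y m (y, \<mu>) = unc b Y m (y, \<mu>)"
            using ab that(3) by (simp add: unc_def)
          then show ?thesis using that by (simp add: Tpre_unc)
        qed
      qed (rule that)
      have c: "sset_map (simplex n) (TF ?m ?K) (cur ?m ?K (simplex n) \<Psi>)" by (rule cur_map[OF wK _ \<Psi>(1)]) simp
      have 1: "cur ?m ?K (simplex n) \<Psi> m x = a m x" if "x \<in> bd n m" for m x
      proof (rule TF_maps_eq_on[OF wK sm_sub[OF c subc_bd] a is_sset_simplex subc_bd that])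
        fix Y l y \<zeta> assume i: "Y \<in> tI ?m" "y \<in> cells (tsec ?m ?K Y) l" "\<zeta> \<in> bd n l"
        have z: "\<zeta> \<in> cells (simplex n) l" by (rule subc_in[OF subc_bd i(3)])
        show "unc (cur ?m ?K (simplex n) \<Psi>) Y l (y, \<zeta>) = unc a Y l (y, \<zeta>)"
          using unc_cur[OF is_sset_simplex i(1,2) z, of \<Psi>] \<Psi>(2)[of Y y l \<zeta>] i by (simp del: Cyl_simps)
      qed
      have 2: "Tpre ?m A (iA (A, \<phi>, B)) m (cur ?m ?K (simplex n) \<Psi> m x) = b m x" if "x \<in> cells (simplex n) m" for m x
      proof (rule TF_maps_eq[OF wA sm_comp[OF c Tj] b is_sset_simplex that])
        fix Y l y \<zeta> assume i: "Y \<in> tI ?m" "y \<in> cells (tsec ?m A Y) l" "\<zeta> \<in> cells (simplex n) l"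
        have y: "iA (A, \<phi>, B) (tov ?m Y) l y \<in> cells (tsec ?m ?K Y) l"
          using sm_in[OF smapD(1)[OF jm], of Y y l] i by (simp del: Cyl_simps)
        show "unc (\<lambda>m x. Tpre ?m A (iA (A, \<phi>, B)) m (cur ?m ?K (simplex n) \<Psi> m x)) Y l (y, \<zeta>) = unc b Y l (y, \<zeta>)"
          unfolding Tpre_unc[OF i(1,2)] using unc_cur[OF is_sset_simplex i(1) y i(3), of \<Psi>] \<Psi>(3)[of Y y l \<zeta>] i by simp
      qed
      show "\<exists>c. sset_map (simplex n) (TF ?m ?K) c \<and> (\<forall>m. \<forall>x\<in>bd n m. c m x = a m x) \<and>
          (\<forall>m. \<forall>x\<in>cells (simplex n) m. Tpre ?m A (iA (A, \<phi>, B)) m (c m x) = b m x)"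
        using c 1 2 by blast
    qed
  qed
  then have hA: "heq (TF ?m ?K) (TF ?m A) (Tpre ?m A (iA (A, \<phi>, B)))" by (rule tfib_heq)
  have hB: "heq (TF ?m ?K) (TF ?m B) (Tpre ?m B (iB (A, \<phi>, B)))" by (rule tfib_heq[OF tfib_iB[OF w far kan[OF A]]])
  obtain r where r: "(?K, r, B) \<in> Ar M" "Cmp M (?K, r, B) (B, iB (A, \<phi>, B), ?K) = Idn M B"
    "Cmp M (?K, r, B) (A, iA (A, \<phi>, B), ?K) = (A, \<phi>, B)" by (rule cyl_proj[OF far]) (rule that)
  have rm: "sset_map (TF ?m B) (TF ?m ?K) (Tpre ?m ?K r)" by (rule Tpre_map[OF wK wfm_ar[OF w ArD(3)[OF r(1)]]])
  have id: "Tpre ?m B (iB (A, \<phi>, B)) n (Tpre ?m ?K r n x) = x" if "x \<in> cells (TF ?m B) n" for n x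
    using Tpre_comp[OF w iB_Ar[OF far], of n r x] r(2) Tpre_id[OF w that] by simp
  \<comment> \<open>\<open>r\<close> retracts the cylinder onto \<open>B\<close>, and restriction
    along \<open>iB\<close> is already an equivalence, so restriction along \<open>r\<close> is one
    by cancellation.\<close>
  have hr: "heq (TF ?m B) (TF ?m ?K) (Tpre ?m ?K r)"
    by (rule heq_cancel_left[OF kan[OF B] kan[OF K] kan[OF B] hB heq_cong[OF heq_id _ id] rm]) (use wB in auto)
  have "heq (TF ?m B) (TF ?m A) (\<lambda>n x. Tpre ?m A (iA (A, \<phi>, B)) n (Tpre ?m ?K r n x))"
    by (rule heq_comp[OF kan[OF B] kan[OF K] kan[OF A] hr hA])
  moreover have "Tpre ?m A (iA (A, \<phi>, B)) n (Tpre ?m ?K r n x) = Tpre ?m A \<phi> n x" for n x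
    using Tpre_comp[OF w iA_Ar[OF far], of n r x] r(3) by simp
  ultimately show ?thesis by simp
qed

end

end

subsection \<open>Fibrant replacement\<close>

lemma fn_kan:
  assumes Q: "kan_complex Q" and S: "is_sset S"
  shows "kan_complex (Fn S Q)"
  unfolding kan_complex_def horn_eq
proof (intro conjI allI impI)
  show "is_sset (Fn S Q)" using S by simp
  fix n k :: nat and f assume n: "1 \<le> n" "k \<le> n" and f: "sset_map (sub (simplex n) (hn n k)) (Fn S Q) f"
  have u: "sset_map (sset_prod S (sub (simplex n) (hn n k))) Q (uunc f)" by (rule uunc_map[OF S _ f]) simp
  have h: "sset_map (sub (sset_prod (simplex n) S)
      (\<lambda>m. {(\<mu>, \<xi>). \<mu> \<in> Dmap m n \<and> \<xi> \<in> cells S m \<and> (\<mu> \<in> hn n k m \<or> \<xi> \<in> {})})) Q (\<lambda>m (\<mu>, x). uunc f m (x, \<mu>))"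
    using sm_prod_in[OF u] sm_prod_nat[OF u] by (intro smI) auto
  obtain g where g: "sset_map (sset_prod (simplex n) S) Q g"
    "\<And>m \<mu> \<xi>. \<mu> \<in> hn n k m ==> \<xi> \<in> cells S m ==> g m (\<mu>, \<xi>) = (\<lambda>m (\<mu>, x). uunc f m (x, \<mu>)) m (\<mu>, \<xi>)"
    by (rule pph[OF Q n S subc_empty h]) (rule that)
  define c where "c = ucur S Q (simplex n) (\<lambda>m (x, \<mu>). g m (\<mu>, x))"
  have c: "sset_map (simplex n) (Fn S Q) c" unfolding c_def by (rule ucur_map[OF S _ sm_swap[OF g(1)]]) simp
  have "c m x = f m x" if "x \<in> hn n k m" for m x
  proof (rule Fn_eq_on[OF S sm_sub[OF c subc_hn] f is_sset_simplex subc_hn that])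
    fix l y \<zeta> assume y: "y \<in> cells S l" "\<zeta> \<in> hn n k l"
    have "\<zeta> \<in> cells (simplex n) l" by (rule subc_in[OF subc_hn y(2)])
    then show "uunc c l (y, \<zeta>) = uunc f l (y, \<zeta>)" using g(2)[OF y(2,1)] y(1) by (simp add: c_def uunc_ucur)
  qed
  then show "\<exists>g. sset_map (simplex n) (Fn S Q) g \<and> (\<forall>m. \<forall>\<mu>\<in>cells (sub (simplex n) (hn n k)) m. g m \<mu> = f m \<mu>)"
    using c by (intro exI[of _ c]) simp
qed

text \<open>Operators are coded by numbers so that the recursive argument of the datatype
  \<open>kt\<close> is a function on \<open>nat\<close>. The coded list has length
  \<open>m + 1\<close>, hence the code determines the dimension as well.\<close>

definition cd :: "nat => (nat => nat) => nat" where
  "cd m \<mu> = to_nat (map \<mu> [0..<Suc m])"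

lemma cd_inj:
  assumes "\<mu> \<in> Dmap m n" "\<mu>' \<in> Dmap m' n'" "cd m \<mu> = cd m' \<mu>'"
  shows "m = m' \<and> \<mu> = \<mu>'"
proof -
  have e: "map \<mu> [0..<Suc m] = map \<mu>' [0..<Suc m']" using assms(3) unfolding cd_def by simp
  have "length (map \<mu> [0..<Suc m]) = length (map \<mu>' [0..<Suc m'])" unfolding e by simp
  then have m: "m = m'" by simp
  have "\<mu> i = \<mu>' i" if "i \<le> m" for i
  proof -
    have "map \<mu> [0..<Suc m] ! i = map \<mu>' [0..<Suc m'] ! i" unfolding e by simp
    then show ?thesis using that m by (simp del: upt_Suc)
  qed
  then show ?thesis using m Dmap_eqI[OF assms(1)] assms(2) by blast
qed

text \<open>The free Kan complex on \<open>S\<close>: \<open>KF N k h \<mu>\<close> is the restriction along \<open>\<mu>\<close> of a formal filler of the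
  \<open>k\<close>-horn \<open>h\<close> in dimension \<open>N\<close>.\<close>

datatype 'a kt = KB 'a | KF nat nat "nat => 'a kt" "nat => nat"

definition kface :: "nat => nat => (nat => 'a kt) => nat => (nat => nat) => 'a kt" where
  "kface N k h m \<mu> = (if \<mu> \<in> hn N k m then h (cd m \<mu>) else KF N k h \<mu>)"

definition kact :: "'a sset => nat => nat => (nat => nat) => 'a kt => 'a kt" where
  "kact S m n \<eta> y = (case y of KB x => KB (act S m n \<eta> x) | KF N k h \<mu> => kface N k h m (compD m \<mu> \<eta>))"

text \<open>The last two premises of \<open>KF\<close> say that \<open>h\<close>, read through
  \<open>cd\<close>, is a simplicial map defined on the horn.\<close>

inductive kcell :: "'a sset => nat => 'a kt => bool" for S where
  KB: "x \<in> cells S n ==> kcell S n (KB x)"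
| KF: "1 \<le> N ==> k \<le> N ==> \<mu> \<in> Dmap n N ==> \<mu> \<notin> hn N k n ==>
    (\<And>m \<mu>'. \<mu>' \<in> hn N k m ==> kcell S m (h (cd m \<mu>'))) ==>
    (\<And>l m \<eta> \<mu>'. \<eta> \<in> Dmap l m ==> \<mu>' \<in> hn N k m ==> kact S l m \<eta> (h (cd m \<mu>')) = h (cd l (compD l \<mu>' \<eta>))) ==>
    kcell S n (KF N k h \<mu>)"

definition KS :: "'a sset => 'a kt sset" where
  "KS S = \<lparr>cells = (\<lambda>n. {y. kcell S n y}), act = kact S\<rparr>"

lemma KS_simps [simp]: "cells (KS S) n = {y. kcell S n y}" "act (KS S) = kact S"
  by (simp_all add: KS_def)

lemma kact_KB [simp]: "kact S m n \<eta> (KB x) = KB (act S m n \<eta> x)"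
  and kact_KF [simp]: "kact S m n \<eta> (KF N k h \<mu>) = kface N k h m (compD m \<mu> \<eta>)"
  by (simp_all add: kact_def)

lemma kcell_face:
  assumes "kcell S n (KF N k h \<mu>)" "\<mu>' \<in> Dmap m N"
  shows "kcell S m (kface N k h m \<mu>')"
  using assms(1) by cases (use assms(2) in \<open>auto simp: kface_def intro: kcell.intros\<close>)

lemma kact_face:
  assumes h: "\<And>l m \<eta> \<mu>'. \<eta> \<in> Dmap l m ==> \<mu>' \<in> hn N k m ==> kact S l m \<eta> (h (cd m \<mu>')) = h (cd l (compD l \<mu>' \<eta>))"
    and "\<mu> \<in> Dmap m N" "\<eta> \<in> Dmap l m"
  shows "kact S l m \<eta> (kface N k h m \<mu>) = kface N k h l (compD l \<mu> \<eta>)"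
  using assms(2,3) h[OF assms(3), of \<mu>] subc_act[OF subc_hn assms(3), of \<mu> N k] by (auto simp: kface_def)

lemma is_sset_KS [simp]:
  assumes S: "is_sset S"
  shows "is_sset (KS S)"
proof (rule issI)
  fix m n \<mu> y assume t: "\<mu> \<in> Dmap m n" and "y \<in> cells (KS S) n"
  then have "kcell S n y" by simp
  then show "act (KS S) m n \<mu> y \<in> cells (KS S) m"
  proof cases
    case (KB x) then show ?thesis using S t by (auto intro: kcell.KB)
  next
    case (KF N k \<zeta> h)
    then show ?thesis using kcell_face[of S n N k h \<zeta> "compD m \<zeta> \<mu>" m] t \<open>kcell S n y\<close> by auto
  qed
next
  fix n y assume "y \<in> cells (KS S) n"
  then have "kcell S n y" by simp
  then show "act (KS S) n n (idD n) y = y"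
    by cases (use S in \<open>auto simp: kface_def\<close>)
next
  fix l m n \<eta> \<mu> y assume e: "\<eta> \<in> Dmap l m" "\<mu> \<in> Dmap m n" and "y \<in> cells (KS S) n"
  then have "kcell S n y" by simp
  then show "act (KS S) l m \<eta> (act (KS S) m n \<mu> y) = act (KS S) l n (compD l \<mu> \<eta>) y"
  proof cases
    case (KB x) then show ?thesis using ss_comp[OF S e] by simp
  next
    case (KF N k \<zeta> h)
    then show ?thesis using kact_face[of N k S h "compD m \<zeta> \<mu>" m \<eta> l] e by (simp add: comp_Dmap comp_D_assoc)
  qed
qed

lemma KB_map: "sset_map S (KS S) (\<lambda>n. KB)"
  by (rule smI) (auto intro: kcell.KB)

lemma kan_KS:
  assumes S: "is_sset S"
  shows "kan_complex (KS S)"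
  unfolding kan_complex_def horn_eq
proof (intro conjI allI impI)
  show "is_sset (KS S)" using S by simp
  fix n k :: nat and f assume n: "1 \<le> n" "k \<le> n" and f: "sset_map (sub (simplex n) (hn n k)) (KS S) f"
  \<comment> \<open>The horn \<open>f\<close> in coded form; by \<open>cd_inj\<close> the choice has
    only one candidate at codes of simplices of the horn.\<close>
  define h where "h = (\<lambda>c. case (SOME (m, \<mu>). \<mu> \<in> hn n k m \<and> cd m \<mu> = c) of (m, \<mu>) => f m \<mu>)"
  have h: "h (cd m \<mu>) = f m \<mu>" if t: "\<mu> \<in> hn n k m" for m \<mu>
  proof -
    have "(SOME (m', \<mu>'). \<mu>' \<in> hn n k m' \<and> cd m' \<mu>' = cd m \<mu>) = (m, \<mu>)"
    proof (rule some_equality)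
      fix p assume "case p of (m', \<mu>') => \<mu>' \<in> hn n k m' \<and> cd m' \<mu>' = cd m \<mu>"
      then show "p = (m, \<mu>)" using cd_inj[of "snd p" "fst p" n \<mu> m n] t by (auto simp: hn_def split: prod.splits)
    qed (use t in simp)
    then show ?thesis by (simp add: h_def)
  qed
  have fin: "kcell S m (f m \<mu>)" if "\<mu> \<in> hn n k m" for m \<mu> using sm_in[OF f, of \<mu> m] that by simp
  have fnat: "f l (compD l \<mu> \<eta>) = kact S l m \<eta> (f m \<mu>)" if "\<eta> \<in> Dmap l m" "\<mu> \<in> hn n k m" for l m \<eta> \<mu>
    using sm_nat[OF f that(1), of \<mu>] that(2) by simp
  have hnat: "kact S l m \<eta> (h (cd m \<mu>)) = h (cd l (compD l \<mu> \<eta>))" if "\<eta> \<in> Dmap l m" "\<mu> \<in> hn n k m" for l m \<eta> \<mu>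
    using that subc_act[OF subc_hn that] fnat by (simp add: h)
  have "sset_map (simplex n) (KS S) (\<lambda>m \<mu>. kface n k h m \<mu>)"
  proof (rule smI)
    fix m \<mu> assume "\<mu> \<in> cells (simplex n) m"
    then show "kface n k h m \<mu> \<in> cells (KS S) m"
      using fin h hnat n by (auto simp: kface_def intro: kcell.KF)
  next
    fix l m \<eta> \<mu> assume "\<eta> \<in> Dmap l m" "\<mu> \<in> cells (simplex n) m"
    then show "kface n k h l (act (simplex n) l m \<eta> \<mu>) = act (KS S) l m \<eta> (kface n k h m \<mu>)"
      using kact_face[of n k S h \<mu> m \<eta> l] hnat by simp
  qed
  then show "\<exists>g. sset_map (simplex n) (KS S) g \<and> (\<forall>m. \<forall>\<mu>\<in>cells (sub (simplex n) (hn n k)) m. g m \<mu> = f m \<mu>)"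
    using h by (intro exI[of _ "\<lambda>m \<mu>. kface n k h m \<mu>"]) (simp add: kface_def)
qed

section \<open>Extension of maps over the free Kan complex\<close>

definition kfill where
  "kfill Q X V \<psi> N k h gh = (SOME g. sset_map (sset_prod (simplex N) X) Q g \<and>
     (\<forall>m. \<forall>\<mu>\<in>hn N k m. \<forall>\<xi>\<in>cells X m. g m (\<mu>, \<xi>) = gh (cd m \<mu>) m \<xi>) \<and>
     (\<forall>m. \<forall>\<mu>\<in>Dmap m N. \<forall>\<xi>\<in>V m. g m (\<mu>, \<xi>) = \<psi> m (kface N k h m \<mu>, \<xi>)))"

text \<open>A filler is chosen once for the data \<open>N\<close>, \<open>k\<close>,
  \<open>h\<close> and evaluated at \<mu> only afterwards, so all restrictions of one formal filler
  receive compatible values.\<close>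

primrec kext :: "'q sset => 'x sset => (nat => 'x set) => (nat => 'a kt \<times> 'x => 'q) => 'a kt => nat => 'x => 'q" where
  "kext Q X V \<psi> (KB x) = (\<lambda>n \<xi>. \<psi> n (KB x, \<xi>))"
| "kext Q X V \<psi> (KF N k h \<mu>) = (\<lambda>n \<xi>. kfill Q X V \<psi> N k h (\<lambda>c. kext Q X V \<psi> (h c)) n (\<mu>, \<xi>))"

text \<open>Induction over the terms that form \<open>KS S\<close>, with \<open>pph\<close> for each
  formal filler. The relative form with \<open>V\<close> also gives uniqueness of extensions up to
  homotopy, by taking the ends of an interval as \<open>V\<close>.\<close>

theorem KS_extend:
  assumes S: "is_sset S" and Q: "kan_complex Q" and X: "is_sset X" and V: "subc X V"
    and \<psi>: "sset_map (sub (sset_prod (KS S) X) (\<lambda>n. {(y, \<xi>). kcell S n y \<and> \<xi> \<in> cells X n \<and> ((\<exists>x. y = KB x) \<or> \<xi> \<in> V n)})) Q \<psi>"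
  obtains \<Psi> where "sset_map (sset_prod (KS S) X) Q \<Psi>"
    "\<And>n x \<xi>. x \<in> cells S n ==> \<xi> \<in> cells X n ==> \<Psi> n (KB x, \<xi>) = \<psi> n (KB x, \<xi>)"
    "\<And>n y \<xi>. kcell S n y ==> \<xi> \<in> V n ==> \<Psi> n (y, \<xi>) = \<psi> n (y, \<xi>)"
proof -
  define G where "G = kext Q X V \<psi>"
  have \<psi>in: "\<psi> n (y, \<xi>) \<in> cells Q n" if "kcell S n y" "\<xi> \<in> cells X n" "(\<exists>x. y = KB x) \<or> \<xi> \<in> V n" for n y \<xi>
    using sm_in[OF \<psi>, of "(y, \<xi>)" n] that by simp
  have \<psi>nat: "\<psi> m (kact S m n \<eta> y, act X m n \<eta> \<xi>) = act Q m n \<eta> (\<psi> n (y, \<xi>))"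
    if "\<eta> \<in> Dmap m n" "kcell S n y" "\<xi> \<in> cells X n" "(\<exists>x. y = KB x) \<or> \<xi> \<in> V n" for m n \<eta> y \<xi>
    using sm_nat[OF \<psi> that(1), of "(y, \<xi>)"] that by simp
  have main: "(\<forall>\<xi>\<in>cells X n. G y n \<xi> \<in> cells Q n) \<and>
      (\<forall>m \<eta> \<xi>. \<eta> \<in> Dmap m n \<longrightarrow> \<xi> \<in> cells X n \<longrightarrow> G (kact S m n \<eta> y) m (act X m n \<eta> \<xi>) = act Q m n \<eta> (G y n \<xi>)) \<and>
      (\<forall>\<xi>\<in>V n. G y n \<xi> = \<psi> n (y, \<xi>))" if "kcell S n y" for n y
    using that
  proof induction
    case (KB x n)
    then have k: "kcell S n (KB x)" by (rule kcell.KB)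
    show ?case using \<psi>in[OF k] \<psi>nat[OF _ k] by (simp add: G_def)
  next
    case (KF N k \<mu> n h)
    have ih1: "G (h (cd m \<mu>')) m \<xi> \<in> cells Q m" if "\<mu>' \<in> hn N k m" "\<xi> \<in> cells X m" for m \<mu>' \<xi>
      using KF.IH(1)[OF that(1)] that(2) by blast
    have ih2: "G (h (cd l (compD l \<mu>' \<eta>))) l (act X l m \<eta> \<xi>) = act Q l m \<eta> (G (h (cd m \<mu>')) m \<xi>)"
      if "\<eta> \<in> Dmap l m" "\<mu>' \<in> hn N k m" "\<xi> \<in> cells X m" for l m \<eta> \<mu>' \<xi>
      using KF.IH(1)[OF that(2)] KF.hyps(6)[OF that(1,2)] that by metis
    have ih3: "G (h (cd m \<mu>')) m \<xi> = \<psi> m (h (cd m \<mu>'), \<xi>)" if "\<mu>' \<in> hn N k m" "\<xi> \<in> V m" for m \<mu>' \<xi>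
      using KF.IH(1)[OF that(1)] that(2) by blast
    have kc: "kcell S n (KF N k h \<mu>)" by (rule kcell.KF[OF KF.hyps(1-4)]) (use KF.IH KF.hyps in auto)
    have kf: "kcell S m (kface N k h m \<mu>')" if "\<mu>' \<in> Dmap m N" for m \<mu>' by (rule kcell_face[OF kc that])
    have ka: "kact S l m \<eta> (kface N k h m \<mu>') = kface N k h l (compD l \<mu>' \<eta>)" if "\<mu>' \<in> Dmap m N" "\<eta> \<in> Dmap l m" for l m \<eta> \<mu>'
      by (rule kact_face[OF _ that]) (rule KF.hyps(6))
    have fh: "kface N k h m \<mu>' = h (cd m \<mu>')" if "\<mu>' \<in> hn N k m" for m \<mu>' using that by (simp add: kface_def)
    \<comment> \<open>Over \<open>V\<close> the values are prescribed by \<psi>; over the horn they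
      are known by the induction hypothesis.\<close>
    define hm where "hm = (\<lambda>m (\<mu>', \<xi>). if \<xi> \<in> V m then \<psi> m (kface N k h m \<mu>', \<xi>) else G (h (cd m \<mu>')) m \<xi>)"
    have hm: "sset_map (sub (sset_prod (simplex N) X) (\<lambda>m. {(\<mu>, \<xi>). \<mu> \<in> Dmap m N \<and> \<xi> \<in> cells X m \<and> (\<mu> \<in> hn N k m \<or> \<xi> \<in> V m)})) Q hm"
    proof (rule smI, goal_cases)
      case (1 m x)
      then show ?case using \<psi>in[OF kf] ih1 by (auto simp: hm_def)
    next
      case (2 l m \<eta> x)
      then obtain \<mu>' \<xi> where x: "x = (\<mu>', \<xi>)" "\<mu>' \<in> Dmap m N" "\<xi> \<in> cells X m" "\<mu>' \<in> hn N k m \<or> \<xi> \<in> V m" by auto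
      show ?case
      proof (cases "\<xi> \<in> V m")
        case True
        then show ?thesis using subc_act[OF V 2(1) True] \<psi>nat[OF 2(1) kf[OF x(2)] x(3)] x by (simp add: hm_def ka[OF x(2) 2(1)])
      next
        case False
        then have t: "\<mu>' \<in> hn N k m" using x by simp
        then have t': "compD l \<mu>' \<eta> \<in> hn N k l" using subc_act[OF subc_hn 2(1) t] by simp
        show ?thesis using False x ih2[OF 2(1) t x(3)] ih3[OF t', of "act X l m \<eta> \<xi>"] by (simp add: hm_def fh[OF t'])
      qed
    qed
    have ex: "\<exists>g. sset_map (sset_prod (simplex N) X) Q g \<and>
     (\<forall>m. \<forall>\<mu>\<in>hn N k m. \<forall>\<xi>\<in>cells X m. g m (\<mu>, \<xi>) = G (h (cd m \<mu>)) m \<xi>) \<and>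
     (\<forall>m. \<forall>\<mu>\<in>Dmap m N. \<forall>\<xi>\<in>V m. g m (\<mu>, \<xi>) = \<psi> m (kface N k h m \<mu>, \<xi>))"
    proof (rule pph[OF Q KF.hyps(1,2) X V hm])
      fix g assume g: "sset_map (sset_prod (simplex N) X) Q g"
        "\<And>m \<mu> \<xi>. \<mu> \<in> hn N k m ==> \<xi> \<in> cells X m ==> g m (\<mu>, \<xi>) = hm m (\<mu>, \<xi>)"
        "\<And>m \<mu> \<xi>. \<mu> \<in> Dmap m N ==> \<xi> \<in> V m ==> g m (\<mu>, \<xi>) = hm m (\<mu>, \<xi>)"
      show ?thesis
        by (rule exI[of _ g]) (use g ih3 fh in \<open>simp add: hm_def\<close>)
    qed
    define g where "g = kfill Q X V \<psi> N k h (\<lambda>c. G (h c))"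
    have g: "sset_map (sset_prod (simplex N) X) Q g"
      "\<And>m \<mu> \<xi>. \<mu> \<in> hn N k m ==> \<xi> \<in> cells X m ==> g m (\<mu>, \<xi>) = G (h (cd m \<mu>)) m \<xi>"
      "\<And>m \<mu> \<xi>. \<mu> \<in> Dmap m N ==> \<xi> \<in> V m ==> g m (\<mu>, \<xi>) = \<psi> m (kface N k h m \<mu>, \<xi>)"
      using someI_ex[OF ex] unfolding g_def kfill_def by blast+
    have Gf: "G (KF N k h \<mu>') m \<xi> = g m (\<mu>', \<xi>)" for \<mu>' m \<xi> by (simp add: G_def g_def)
    have Gk: "G (kface N k h m \<mu>') m \<xi> = g m (\<mu>', \<xi>)" if "\<mu>' \<in> Dmap m N" "\<xi> \<in> cells X m" for \<mu>' m \<xi>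
      using that g(2) by (simp add: kface_def Gf)
    show ?case
    proof (intro conjI allI ballI impI)
      show "G (KF N k h \<mu>) n \<xi> \<in> cells Q n" if "\<xi> \<in> cells X n" for \<xi>
        unfolding Gf by (rule sm_prod_in[OF g(1)]) (use that KF.hyps in auto)
      show "G (kact S m n \<eta> (KF N k h \<mu>)) m (act X m n \<eta> \<xi>) = act Q m n \<eta> (G (KF N k h \<mu>) n \<xi>)"
        if e: "\<eta> \<in> Dmap m n" "\<xi> \<in> cells X n" for m \<eta> \<xi>
        using sm_prod_nat[OF g(1) e(1), of \<mu> \<xi>] e KF.hyps(3) X by (simp add: Gf Gk comp_Dmap)
      show "G (KF N k h \<mu>) n \<xi> = \<psi> n (KF N k h \<mu>, \<xi>)" if "\<xi> \<in> V n" for \<xi>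
        using g(3)[OF KF.hyps(3) that] KF.hyps(4) by (simp add: Gf kface_def)
    qed
  qed
  show thesis
  proof (rule that[of "\<lambda>n (y, \<xi>). G y n \<xi>"])
    show "sset_map (sset_prod (KS S) X) Q (\<lambda>n (y, \<xi>). G y n \<xi>)"
      by (rule sm_prodI) (use main in auto)
    show "(case (KB x, \<xi>) of (y, \<xi>) => G y n \<xi>) = \<psi> n (KB x, \<xi>)" for n x \<xi> by (simp add: G_def)
    show "(case (y, \<xi>) of (y, \<xi>) => G y n \<xi>) = \<psi> n (y, \<xi>)" if "kcell S n y" "\<xi> \<in> V n" for n y \<xi>
      using main[OF that(1)] that(2) by simp
  qed
qed

lemma KS_extend0:
  assumes S: "is_sset S" and Q: "kan_complex Q" and X: "is_sset X" and \<psi>: "sset_map (sset_prod S X) Q \<psi>"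
  obtains \<Psi> where "sset_map (sset_prod (KS S) X) Q \<Psi>"
    "\<And>n x \<xi>. x \<in> cells S n ==> \<xi> \<in> cells X n ==> \<Psi> n (KB x, \<xi>) = \<psi> n (x, \<xi>)"
proof -
  define \<psi>' where "\<psi>' = (\<lambda>n (y, \<xi>). case y of KB x => \<psi> n (x, \<xi>) | _ => undefined)"
  have KBc: "x \<in> cells S n" if "kcell S n (KB x)" for n x using that by cases auto
  have m: "sset_map (sub (sset_prod (KS S) X) (\<lambda>n. {(y, \<xi>). kcell S n y \<and> \<xi> \<in> cells X n \<and> ((\<exists>x. y = KB x) \<or> \<xi> \<in> {})})) Q \<psi>'"
    by (rule smI) (use sm_prod_in[OF \<psi>] sm_prod_nat[OF \<psi>] KBc in \<open>auto simp: \<psi>'_def\<close>)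
  show thesis
    by (rule KS_extend[OF S Q X subc_empty m]) (rule that, auto simp: \<psi>'_def)
qed

text \<open>The test complex is copied along \<open>E\<close> into the type over which the
  definition of \<open>sset_weq\<close> quantifies.\<close>

lemma sset_weq_test:
  fixes S :: "'a sset" and E :: "'b => 'a"
  assumes w: "sset_weq S T f" and E: "inj E" and Z: "kan_complex (Z :: 'b sset)"
  shows "sset_map S Z g ==> \<exists>h. sset_map T Z h \<and> sset_homotopic S Z (\<lambda>n x. h n (f n x)) g"
    and "sset_map T Z h ==> sset_map T Z h' ==> sset_homotopic S Z (\<lambda>n x. h n (f n x)) (\<lambda>n x. h' n (f n x)) ==>
      sset_homotopic T Z h h'"
proof -
  note Zs = kanD(1)[OF Z]
  define I where "I = inv_into UNIV E"
  have IE: "I (E z) = z" for z using E by (simp add: I_def)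
  define Z' where "Z' = \<lparr>cells = (\<lambda>n. E ` cells Z n), act = (\<lambda>m n \<mu> z. E (act Z m n \<mu> (I z)))\<rparr>"
  have Zc: "cells Z' n = E ` cells Z n" "act Z' m n \<mu> (E z) = E (act Z m n \<mu> z)" for m n \<mu> z
    by (simp_all add: Z'_def IE)
  have Ss: "is_sset Z'"
    by (rule issI) (use Zs in \<open>auto simp: Zc ss_comp\<close>)
  have up: "sset_map Z Z' (\<lambda>n. E)" by (rule smI) (auto simp: Zc)
  have dn: "sset_map Z' Z (\<lambda>n. I)" by (rule smI) (auto simp: Zc IE)
  have K: "kan_complex Z'"
    unfolding kan_complex_def horn_eq
  proof (intro conjI allI impI)
    fix n k :: nat and \<phi> assume n: "1 \<le> n" "k \<le> n" and p: "sset_map (sub (simplex n) (hn n k)) Z' \<phi>"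
    obtain g where g: "sset_map (simplex n) Z g" "\<And>m \<mu>. \<mu> \<in> hn n k m ==> g m \<mu> = I (\<phi> m \<mu>)"
      using kanD(2)[OF Z n sm_comp[OF p dn]] by blast
    have "E (I (\<phi> m \<mu>)) = \<phi> m \<mu>" if "\<mu> \<in> hn n k m" for m \<mu>
      using sm_in[OF p, of \<mu> m] that by (auto simp: Zc IE)
    then show "\<exists>g. sset_map (simplex n) Z' g \<and> (\<forall>m. \<forall>\<mu>\<in>cells (sub (simplex n) (hn n k)) m. g m \<mu> = \<phi> m \<mu>)"
      using sm_comp[OF g(1) up] g(2) by (intro exI[of _ "\<lambda>n x. E (g n x)"]) simp
  qed (rule Ss)
  show "\<exists>h. sset_map T Z h \<and> sset_homotopic S Z (\<lambda>n x. h n (f n x)) g" if g: "sset_map S Z g"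
  proof -
    obtain h where h: "sset_map T Z' h" "sset_homotopic S Z' (\<lambda>n x. h n (f n x)) (\<lambda>n x. E (g n x))"
      using w K sm_comp[OF g up] unfolding sset_weq_def by blast
    show ?thesis using sm_comp[OF h(1) dn] hom_post[OF h(2) dn] by (intro exI[of _ "\<lambda>n x. I (h n x)"]) (simp add: IE)
  qed
  show "sset_homotopic T Z h h'" if h: "sset_map T Z h" "sset_map T Z h'"
     "sset_homotopic S Z (\<lambda>n x. h n (f n x)) (\<lambda>n x. h' n (f n x))"
  proof -
    have "sset_homotopic T Z' (\<lambda>n x. E (h n x)) (\<lambda>n x. E (h' n x))"
      using w K sm_comp[OF h(1) up] sm_comp[OF h(2) up] hom_post[OF h(3) up] unfolding sset_weq_def by blast
    then show ?thesis using hom_post[OF _ dn] by (fastforce simp: IE)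
  qed
qed

section \<open>Weak equivalences and function complexes\<close>

lemma wfm_ftest: "sset_map S T f ==> wfm (ftest Q) (cst S) (\<lambda>_. f) (cst T)"
  by (simp add: wfm_def ftest_def cst_def)

definition Fpre where "Fpre S Q f = Tpre (ftest Q) (cst S) (\<lambda>_. f)"

lemma Fpre_map: "is_sset S ==> sset_map S T f ==> sset_map (Fn T Q) (Fn S Q) (Fpre S Q f)"
  unfolding Fpre_def by (rule Tpre_map[OF wfA_ftest wfm_ftest])

lemma Fpre_uunc: "x \<in> cells S k ==> uunc (\<lambda>n \<xi>. Fpre S Q f n (\<phi> n \<xi>)) k (x, \<xi>) = uunc \<phi> k (f k x, \<xi>)"
  unfolding uunc_def Fpre_def by (subst Tpre_unc) (simp_all add: ftest_def cst_def)

lemma Fn_homI: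
  assumes S: "is_sset S" and K: "is_sset K" and \<phi>: "sset_map K (Fn S Q) \<phi>" and \<psi>: "sset_map K (Fn S Q) \<psi>"
    and h: "sset_map (sset_prod S (sset_prod K I1)) Q h"
    and e: "\<And>n x k. x \<in> cells S n ==> k \<in> cells K n ==> h n (x, k, cD 0 n) = uunc \<phi> n (x, k)"
      "\<And>n x k. x \<in> cells S n ==> k \<in> cells K n ==> h n (x, k, cD 1 n) = uunc \<psi> n (x, k)"
  shows "sset_homotopic K (Fn S Q) \<phi> \<psi>"
proof -
  have KI: "is_sset (sset_prod K I1)" using K by simp
  define H where "H = ucur S Q (sset_prod K I1) h"
  have H: "sset_map (sset_prod K I1) (Fn S Q) H" unfolding H_def by (rule ucur_map[OF S KI h])
  have uH: "uunc (\<lambda>n x. H n (x, cD c n)) n (x, k) = h n (x, k, cD c n)"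
    if "x \<in> cells S n" "k \<in> cells K n" "c \<le> 1" for n x k c
    using uunc_ucur[OF KI that(1), of "(k, cD c n)" Q h] that(2,3) by (simp add: H_def uunc_def unc_def)
  show ?thesis
  proof (rule homI[OF H])
    fix n k assume k: "k \<in> cells K n"
    show "H n (k, cD 0 n) = \<phi> n k" by (rule Fn_eq[OF S sm_end[OF _ H] \<phi> K k]) (simp_all add: uH e)
    show "H n (k, cD 1 n) = \<psi> n k" by (rule Fn_eq[OF S sm_end[OF _ H] \<psi> K k]) (simp_all add: uH e)
  qed
qed

text \<open>The definition of \<open>sset_weq\<close> speaks about homotopy classes of maps only.
  Tested on the free Kan complexes, it yields a homotopy inverse \<open>r\<close> of
  \<open>f\<close> with values in \<open>KS S\<close>. Since maps into \<open>Q\<close> extend over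
  free Kan complexes, \<open>r\<close> induces an inverse on the whole function complexes, for a
  \<open>Q\<close> over any type.\<close>

theorem sset_weq_heq_Fn:
  fixes S T :: "'a sset" and E :: "'a kt => 'a"
  assumes w: "sset_weq S T f" and E: "inj E" and Q: "kan_complex Q"
  shows "heq (Fn T Q) (Fn S Q) (Fpre S Q f)"
proof -
  have S: "is_sset S" and T: "is_sset T" and f: "sset_map S T f" using w by (auto simp: sset_weq_def)
  note Ks = kan_KS[OF S] and Kt = kan_KS[OF T]
  let ?K = "Fn S Q" and ?L = "Fn T Q"
  have K: "is_sset ?K" and L: "is_sset ?L" using S T by simp_all
  note kK = fn_kan[OF Q S] and kL = fn_kan[OF Q T]
  note fin = sm_in[OF f]
  obtain r where r: "sset_map T (KS S) r" "sset_homotopic S (KS S) (\<lambda>n x. r n (f n x)) (\<lambda>n. KB)"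
    using sset_weq_test(1)[OF w E Ks KB_map] by blast
  note rin = sm_in[OF r(1)]
  obtain \<rho> where "htpy S (KS S) (\<lambda>n x. r n (f n x)) (\<lambda>n x. KB x) \<rho>" by (rule homE[OF r(2)])
  note \<rho> = htpyD[OF this]
  obtain j where j: "sset_map (KS S) (KS T) j" "\<And>n x. x \<in> cells S n ==> j n (KB x) = KB (f n x)"
  proof -
    have "sset_map (sset_prod S (simplex 0)) (KS T) (\<lambda>n x. KB (f n (fst x)))"
      by (rule sm_comp[OF sm_comp[OF sm_fst f] KB_map])
    then obtain \<Psi> where P: "sset_map (sset_prod (KS S) (simplex 0)) (KS T) \<Psi>"
      "\<And>n x \<xi>. x \<in> cells S n ==> \<xi> \<in> cells (simplex 0) n ==> \<Psi> n (KB x, \<xi>) = KB (f n (fst (x, \<xi>)))"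
      by (rule KS_extend0[OF S Kt is_sset_simplex]) (rule that)
    have c: "sset_map (KS S) (simplex 0) (\<lambda>n x. cD 0 n)" by (rule smI) auto
    show thesis by (rule that[OF sm_comp[OF sm_pair[OF sm_id c] P(1)]]) (use P(2) in simp)
  qed
  note jin = sm_in[OF j(1)]
  have "sset_homotopic S (KS T) (\<lambda>n x. j n (r n (f n x))) (\<lambda>n x. KB (f n x))"
    by (rule hom_cong[OF hom_post[OF r(2) j(1)]]) (simp_all add: j(2))
  then have "sset_homotopic T (KS T) (\<lambda>n x. j n (r n x)) (\<lambda>n. KB)"
    by (rule sset_weq_test(2)[OF w E Kt sm_comp[OF r(1) j(1)] KB_map])
  then obtain \<kappa> where "htpy T (KS T) (\<lambda>n x. j n (r n x)) (\<lambda>n x. KB x) \<kappa>" by (rule homE)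
  note \<kappa> = htpyD[OF this]
  have evS: "sset_map (sset_prod S ?K) Q (uunc (\<lambda>n x. x))" by (rule uunc_map[OF S K sm_id])
  have evT: "sset_map (sset_prod T ?L) Q (uunc (\<lambda>n x. x))" by (rule uunc_map[OF T L sm_id])
  obtain eS where eS: "sset_map (sset_prod (KS S) ?K) Q eS"
    "\<And>n x \<xi>. x \<in> cells S n ==> \<xi> \<in> cells ?K n ==> eS n (KB x, \<xi>) = uunc (\<lambda>n x. x) n (x, \<xi>)"
    by (rule KS_extend0[OF S Q K evS]) (rule that)
  obtain eT where eT: "sset_map (sset_prod (KS T) ?L) Q eT"
    "\<And>n x \<xi>. x \<in> cells T n ==> \<xi> \<in> cells ?L n ==> eT n (KB x, \<xi>) = uunc (\<lambda>n x. x) n (x, \<xi>)"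
    by (rule KS_extend0[OF T Q L evT]) (rule that)
  have pre: "sset_map (sset_prod A X) Q (\<lambda>n (a, \<xi>). e n (u n a, v n \<xi>))"
    if "sset_map (sset_prod A' X') Q e" "sset_map A A' u" "sset_map X X' v"
    for A :: "'c sset" and X :: "'d sset" and A' :: "'e sset" and X' :: "'g sset" and e u v
    by (rule sm_prodI) (use sm_prod_in[OF that(1)] sm_prod_nat[OF that(1)] sm_in[OF that(2)] sm_in[OF that(3)]
        sm_nat[OF that(2)] sm_nat[OF that(3)] in auto)
  \<comment> \<open>Precomposition with \<open>r\<close>: a map on \<open>S\<close> is extended over
    \<open>KS S\<close> by \<open>eS\<close> and then pulled back.\<close>
  define s where "s = ucur T Q ?K (\<lambda>n (y, k). eS n (r n y, k))"
  have s: "sset_map ?K ?L s" unfolding s_def by (rule ucur_map[OF T K pre[OF eS(1) r(1) sm_id]])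
  note sin = sm_in[OF s]
  have us: "uunc s n (y, k) = eS n (r n y, k)" if "y \<in> cells T n" "k \<in> cells ?K n" for n y k
    unfolding s_def by (subst uunc_ucur[OF K that]) simp
  define p where "p = Fpre S Q f"
  have p: "sset_map ?L ?K p" unfolding p_def by (rule Fpre_map[OF S f])
  note pin = sm_in[OF p]
  have uc: "uunc (\<lambda>n x. \<phi> n (v n x)) n (y, \<xi>) = uunc \<phi> n (y, v n \<xi>)" for \<phi> v n y \<xi>
    by (simp add: uunc_def unc_def)
  have ps: "sset_homotopic ?K ?K (\<lambda>n x. p n (s n x)) (\<lambda>n x. x)"
  proof -
    have h: "sset_map (sset_prod S (sset_prod ?K I1)) Q (\<lambda>n (x, k, \<tau>). eS n (\<rho> n (x, \<tau>), k))"
      by (rule sm_prodI) (use sm_prod_in[OF eS(1)] sm_prod_nat[OF eS(1)] sm_prod_in[OF \<rho>(1)] sm_prod_nat[OF \<rho>(1)] in auto)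
    show ?thesis
      by (rule Fn_homI[OF S K sm_comp[OF s p] sm_id h])
        (use us[OF fin] in \<open>simp_all add: uc[of p s] p_def Fpre_uunc \<rho> eS\<close>)
  qed
  have sp: "sset_homotopic ?L ?L (\<lambda>n x. s n (p n x)) (\<lambda>n x. x)"
  proof -
    \<comment> \<open>\<open>eT\<close> after \<open>j\<close> and \<open>eS\<close> after
      \<open>p\<close> extend the same map from \<open>S\<close> to \<open>KS S\<close>. Extending
      relative to the two ends of an interval produces a homotopy between them.\<close>
    define V where "V = (\<lambda>n. {(l, \<tau>). l \<in> cells ?L n \<and> (\<tau> = cD 0 n \<or> \<tau> = cD 1 n)})"
    have V: "subc (sset_prod ?L I1) V" by (rule subcI) (auto simp: V_def L)
    define \<psi> where "\<psi> = (\<lambda>n (y, l, \<tau>). if \<tau> = cD 1 n then eT n (j n y, l) else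
        if \<tau> = cD 0 n then eS n (y, p n l) else (case y of KB x => uunc (\<lambda>n x. x) n (f n x, l) | _ => undefined))"
    have KBc: "x \<in> cells S n" if "kcell S n (KB x)" for n x using that by cases auto
    have e1: "eS n (KB x, p n l) = uunc (\<lambda>n x. x) n (f n x, l)" if "x \<in> cells S n" "l \<in> cells ?L n" for n x l
    proof -
      have "eS n (KB x, p n l) = uunc (\<lambda>n x. x) n (x, p n l)" by (rule eS(2)[OF that(1) pin[OF that(2)]])
      also have "\<dots> = uunc (\<lambda>n \<xi>. p n \<xi>) n (x, l)" using uc[of "\<lambda>n x. x" p n x l] by simp
      also have "\<dots> = uunc (\<lambda>n x. x) n (f n x, l)" unfolding p_def using Fpre_uunc[OF that(1), of Q f "\<lambda>n x. x" l] by simp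
      finally show ?thesis .
    qed
    have e2: "eT n (j n (KB x), l) = uunc (\<lambda>n x. x) n (f n x, l)" if "x \<in> cells S n" "l \<in> cells ?L n" for n x l
      using eT(2)[OF fin[OF that(1)] that(2)] j(2)[OF that(1)] by simp
    have ends: "sset_map (sset_prod (KS S) ?L) Q (\<lambda>n (y, l). eT n (j n y, l))" "sset_map (sset_prod (KS S) ?L) Q (\<lambda>n (y, l). eS n (y, p n l))"
      by (rule pre[OF eT(1) j(1) sm_id] pre[OF eS(1) sm_id p])+
    have mid: "sset_map (sset_prod S ?L) Q (\<lambda>n (x, l). uunc (\<lambda>n x. x) n (f n x, l))" by (rule pre[OF evT f sm_id])
    have \<psi>: "sset_map (sub (sset_prod (KS S) (sset_prod ?L I1)) (\<lambda>n. {(y, \<xi>). kcell S n y \<and> \<xi> \<in> cells (sset_prod ?L I1) n \<and> ((\<exists>x. y = KB x) \<or> \<xi> \<in> V n)})) Q \<psi>"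
    proof (rule smI, goal_cases)
      case (1 n z)
      then obtain y l \<tau> where z: "z = (y, l, \<tau>)" "kcell S n y" "l \<in> cells ?L n" "\<tau> \<in> Dmap n 1" "(\<exists>x. y = KB x) \<or> \<tau> = cD 0 n \<or> \<tau> = cD 1 n"
        by (auto simp: V_def)
      then show ?case using sm_prod_in[OF ends(1), of y n l] sm_prod_in[OF ends(2), of y n l] sm_prod_in[OF mid, of _ n l] KBc
        by (auto simp: \<psi>_def)
    next
      case (2 m n \<mu> z)
      then obtain y l \<tau> where z: "z = (y, l, \<tau>)" "kcell S n y" "l \<in> cells ?L n" "\<tau> \<in> Dmap n 1" "(\<exists>x. y = KB x) \<or> \<tau> = cD 0 n \<or> \<tau> = cD 1 n"
        by (auto simp: V_def)
      have n1: "eT m (j m (kact S m n \<mu> y), act ?L m n \<mu> l) = act Q m n \<mu> (eT n (j n y, l))"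
        and n2: "eS m (kact S m n \<mu> y, p m (act ?L m n \<mu> l)) = act Q m n \<mu> (eS n (y, p n l))"
        using sm_prod_nat[OF ends(1) 2(1), of y l] sm_prod_nat[OF ends(2) 2(1), of y l] z by auto
      show ?case
      proof (cases "\<tau> = cD 0 n \<or> \<tau> = cD 1 n")
        case True
        then show ?thesis using n1 n2 2(1) z by (auto simp: \<psi>_def)
      next
        case False
        then obtain x where y: "y = KB x" using z by blast
        have x: "x \<in> cells S n" using KBc z(2) y by simp
        have xa: "act S m n \<mu> x \<in> cells S m" "act ?L m n \<mu> l \<in> cells ?L m" using S L x z(3) 2(1) by auto
        have n3: "uunc (\<lambda>n x. x) m (f m (act S m n \<mu> x), act ?L m n \<mu> l) = act Q m n \<mu> (uunc (\<lambda>n x. x) n (f n x, l))"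
          using sm_prod_nat[OF mid 2(1) x z(3)] by simp
        show ?thesis using False n3 e1[OF xa] e2[OF xa] by (simp add: \<psi>_def z(1) y)
      qed
    qed
    have Li: "is_sset (sset_prod ?L I1)" using L by simp
    obtain D where D: "sset_map (sset_prod (KS S) (sset_prod ?L I1)) Q D"
      "\<And>n y \<xi>. kcell S n y ==> \<xi> \<in> V n ==> D n (y, \<xi>) = \<psi> n (y, \<xi>)"
      by (rule KS_extend[OF S Q Li V \<psi>]) (rule that)
    \<comment> \<open>\<open>u\<close> is the intermediate map: \<open>h1\<close> is the homotopy
      between the two extensions, pulled back along \<open>r\<close>, and \<open>h2\<close> comes
      from the homotopy \<kappa> between \<open>j r\<close> and the inclusion of
      \<open>T\<close>.\<close>
    define u where "u = ucur T Q ?L (\<lambda>n (y, l). eT n (j n (r n y), l))"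
    have u: "sset_map ?L ?L u" unfolding u_def by (rule ucur_map[OF T L pre[OF eT(1) sm_comp[OF r(1) j(1)] sm_id]])
    have uu: "uunc u n (y, l) = eT n (j n (r n y), l)" if "y \<in> cells T n" "l \<in> cells ?L n" for n y l
      unfolding u_def by (subst uunc_ucur[OF L that]) simp
    have h1: "sset_homotopic ?L ?L (\<lambda>n x. s n (p n x)) u"
    proof (rule Fn_homI[OF T L sm_comp[OF p s] u pre[OF D(1) r(1) sm_id]])
      fix k x \<zeta> assume x: "x \<in> cells T k" "\<zeta> \<in> cells ?L k"
      have d: "D k (r k x, \<zeta>, \<tau>) = \<psi> k (r k x, \<zeta>, \<tau>)" if "\<tau> = cD 0 k \<or> \<tau> = cD 1 k" for \<tau>
        using D(2)[of k "r k x" "(\<zeta>, \<tau>)"] rin[OF x(1)] x(2) that by (simp add: V_def)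
      show "(case (x, \<zeta>, cD 0 k) of (a, \<xi>) => D k (r k a, \<xi>)) = uunc (\<lambda>n x. s n (p n x)) k (x, \<zeta>)"
        using us[OF x(1) pin[OF x(2)]] uc[of s p k x \<zeta>] by (simp add: d \<psi>_def)
      show "(case (x, \<zeta>, cD 1 k) of (a, \<xi>) => D k (r k a, \<xi>)) = uunc u k (x, \<zeta>)"
        using uu[OF x] by (simp add: d \<psi>_def)
    qed
    have h: "sset_map (sset_prod T (sset_prod ?L I1)) Q (\<lambda>n (x, k, \<tau>). eT n (\<kappa> n (x, \<tau>), k))"
      by (rule sm_prodI) (use sm_prod_in[OF eT(1)] sm_prod_nat[OF eT(1)] sm_prod_in[OF \<kappa>(1)] sm_prod_nat[OF \<kappa>(1)] in auto)
    have h2: "sset_homotopic ?L ?L u (\<lambda>n x. x)"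
      by (rule Fn_homI[OF T L u sm_id h]) (simp_all add: uu \<kappa> eT)
    show ?thesis by (rule hom_trans[OF kL L h1 h2])
  qed
  have "heq ?L ?K p" by (rule heqI[OF p s]) (use sp ps in simp_all)
  then show ?thesis by (simp add: p_def)
qed

subsection \<open>Function complexes relative to a subcomplex\<close>

text \<open>Composing a path with the minimum of two coordinates gives a square in which two sides
  are the path and two are constant (\<open>minD_ends\<close>).\<close>

definition minD :: "nat => (nat => nat) => (nat => nat) => nat => nat" where
  "minD m v w = (\<lambda>i\<in>{..m}. min (v i) (w i))"

lemma minD_Dmap: "v \<in> Dmap m n ==> w \<in> Dmap m n ==> minD m v w \<in> Dmap m n"
proof (rule DmapI)
  fix i j assume v: "v \<in> Dmap m n" and w: "w \<in> Dmap m n" and i: "i \<le> j" "j \<le> m"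
  then show "minD m v w i \<le> minD m v w j"
    using Dmap_mono[OF v i] Dmap_mono[OF w i] by (simp add: minD_def min.coboundedI1 min.coboundedI2 min.mono)
qed (auto simp: minD_def Dmap_iff intro: min.coboundedI1)

lemma minD_comp: "\<mu> \<in> Dmap l m ==> minD l (compD l v \<mu>) (compD l w \<mu>) = compD l (minD m v w) \<mu>"
  by (auto simp: minD_def compose_def fun_eq_iff Dmap_iff)

lemma minD_ends:
  assumes "v \<in> Dmap m 1"
  shows "minD m v (cD 1 m) = v" "minD m (cD 1 m) v = v" "minD m v (cD 0 m) = cD 0 m" "minD m (cD 0 m) v = cD 0 m"
  using assms by (auto simp: minD_def fun_eq_iff Dmap_iff)

text \<open>The subcomplexes \<open>DS\<close> and \<open>DT\<close>, which \<open>f\<close> identifies, play the role of base points: the maps to \<open>Q\<close>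
  considered below are prescribed on them.\<close>

locale relmap =
  fixes S :: "'s sset" and T :: "'t sset" and f and DS DT and Q :: "'q sset"
  assumes S: "is_sset S" and T: "is_sset T" and f: "sset_map S T f" and DS: "subc S DS" and DT: "subc T DT"
    and bij: "\<And>n. bij_betw (f n) (DS n) (DT n)" and Q: "kan_complex Q"
begin

definition "g n = the_inv_into (DS n) (f n)"

lemma g_in: "y \<in> DT n ==> g n y \<in> DS n" and fg: "y \<in> DT n ==> f n (g n y) = y"
  and gf: "x \<in> DS n ==> g n (f n x) = x" and f_in: "x \<in> DS n ==> f n x \<in> DT n"
  unfolding g_def using bij[of n] by (auto simp: bij_betw_def the_inv_into_into f_the_inv_into_f the_inv_into_f_f)

lemma g_nat: "\<mu> \<in> Dmap m n ==> y \<in> DT n ==> g m (act T m n \<mu> y) = act S m n \<mu> (g n y)"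
proof -
  assume t: "\<mu> \<in> Dmap m n" and y: "y \<in> DT n"
  have "f m (act S m n \<mu> (g n y)) = act T m n \<mu> y"
    using sm_nat[OF f t subc_in[OF DS g_in[OF y]]] fg[OF y] by simp
  then show ?thesis using gf[OF subc_act[OF DS t g_in[OF y]]] by simp
qed

text \<open>The lift and the homotopy supplied by \<open>wrlp\<close> need not have the prescribed
  values on \<open>DT\<close> and \<open>DS\<close>. The path traced by the homotopy over the base
  points moves the lift back to \<open>d\<close>, while it is kept fixed over \<open>V\<close>; a
  square that shrinks this path over \<open>DS\<close> then corrects the homotopy.\<close>

lemma wrlp_rel:
  assumes h: "heq (Fn T Q) (Fn S Q) (Fpre S Q f)" and X: "is_sset X" and V: "subc X V"
    and d: "\<And>n y. y \<in> DT n ==> d n y \<in> cells Q n"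
    and x0: "sset_map (sset_prod S X) Q x0" "\<And>n x \<xi>. x \<in> DS n ==> \<xi> \<in> cells X n ==> x0 n (x, \<xi>) = d n (f n x)"
    and b: "sset_map (sset_prod T (sub X V)) Q b" "\<And>n y \<xi>. y \<in> DT n ==> \<xi> \<in> V n ==> b n (y, \<xi>) = d n y"
    and \<alpha>: "sset_map (sset_prod S (sset_prod (sub X V) I1)) Q \<alpha>"
      "\<And>n x \<xi> \<tau>. x \<in> DS n ==> \<xi> \<in> V n ==> \<tau> \<in> Dmap n 1 ==> \<alpha> n (x, \<xi>, \<tau>) = d n (f n x)"
      "\<And>n x \<xi>. x \<in> cells S n ==> \<xi> \<in> V n ==> \<alpha> n (x, \<xi>, cD 0 n) = x0 n (x, \<xi>)"
      "\<And>n x \<xi>. x \<in> cells S n ==> \<xi> \<in> V n ==> \<alpha> n (x, \<xi>, cD 1 n) = b n (f n x, \<xi>)"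
  obtains b' \<alpha>' where "sset_map (sset_prod T X) Q b'" "\<And>n y \<xi>. y \<in> cells T n ==> \<xi> \<in> V n ==> b' n (y, \<xi>) = b n (y, \<xi>)"
    "\<And>n y \<xi>. y \<in> DT n ==> \<xi> \<in> cells X n ==> b' n (y, \<xi>) = d n y"
    "sset_map (sset_prod S (sset_prod X I1)) Q \<alpha>'"
    "\<And>n x \<xi>. x \<in> cells S n ==> \<xi> \<in> cells X n ==> \<alpha>' n (x, \<xi>, cD 0 n) = x0 n (x, \<xi>)"
    "\<And>n x \<xi>. x \<in> cells S n ==> \<xi> \<in> cells X n ==> \<alpha>' n (x, \<xi>, cD 1 n) = b' n (f n x, \<xi>)"
    "\<And>n x \<xi> \<tau>. x \<in> DS n ==> \<xi> \<in> cells X n ==> \<tau> \<in> Dmap n 1 ==> \<alpha>' n (x, \<xi>, \<tau>) = d n (f n x)"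
proof -
  let ?L = "Fn T Q" and ?K = "Fn S Q"
  have XV: "is_sset (sub X V)" and XVI: "is_sset (sset_prod (sub X V) I1)" and XI: "is_sset (sset_prod X I1)" using X V by simp_all
  have L: "is_sset ?L" and K: "is_sset ?K" using S T by simp_all
  note fin = sm_in[OF f]
  define x0c where "x0c = ucur S Q X x0"
  define bc where "bc = ucur T Q (sub X V) b"
  define \<alpha>c where "\<alpha>c = ucur S Q (sset_prod (sub X V) I1) \<alpha>"
  have x0c: "sset_map X ?K x0c" unfolding x0c_def by (rule ucur_map[OF S X x0(1)])
  have bc: "sset_map (sub X V) ?L bc" unfolding bc_def by (rule ucur_map[OF T XV b(1)])
  have \<alpha>c: "sset_map (sset_prod (sub X V) I1) ?K \<alpha>c" unfolding \<alpha>c_def by (rule ucur_map[OF S XVI \<alpha>(1)])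
  have ux0: "uunc x0c n (x, \<xi>) = x0 n (x, \<xi>)" if "x \<in> cells S n" "\<xi> \<in> cells X n" for n x \<xi>
    unfolding x0c_def by (rule uunc_ucur[OF X that])
  have ub: "uunc bc n (y, \<xi>) = b n (y, \<xi>)" if "y \<in> cells T n" "\<xi> \<in> V n" for n y \<xi>
    unfolding bc_def by (rule uunc_ucur[OF XV]) (use that in simp_all)
  have u\<alpha>: "uunc \<alpha>c n (x, \<xi>, \<tau>) = \<alpha> n (x, \<xi>, \<tau>)" if "x \<in> cells S n" "\<xi> \<in> V n" "\<tau> \<in> Dmap n 1" for n x \<xi> \<tau>
    unfolding \<alpha>c_def by (rule uunc_ucur[OF XVI]) (use that in simp_all)
  have uc: "uunc (\<lambda>n x. \<phi> n (v n x)) n (y, \<xi>) = uunc \<phi> n (y, v n \<xi>)" for \<phi> v n y \<xi>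
    by (simp add: uunc_def unc_def)
  have pm: "sset_map ?L ?K (Fpre S Q f)" by (rule Fpre_map[OF S f])
  have c0: "\<alpha>c n (\<xi>, cD 0 n) = x0c n \<xi>" if "\<xi> \<in> V n" for n \<xi>
  proof (rule Fn_eq[OF S sm_end[OF _ \<alpha>c, of 0] sm_sub[OF x0c V] XV])
    fix k x \<zeta> assume x: "x \<in> cells S k" "\<zeta> \<in> cells (sub X V) k"
    then have "\<zeta> \<in> V k" by simp
    then show "uunc (\<lambda>n x. \<alpha>c n (x, cD 0 n)) k (x, \<zeta>) = uunc x0c k (x, \<zeta>)"
      using uc[of \<alpha>c "\<lambda>n x. (x, cD 0 n)" k x \<zeta>] u\<alpha>[OF x(1), of \<zeta> "cD 0 k"] \<alpha>(3)[OF x(1)] ux0[OF x(1)] subc_in[OF V] by simp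
  qed (use that in simp_all)
  have c1: "\<alpha>c n (\<xi>, cD 1 n) = Fpre S Q f n (bc n \<xi>)" if "\<xi> \<in> V n" for n \<xi>
  proof (rule Fn_eq[OF S sm_end[OF _ \<alpha>c, of 1] sm_comp[OF bc pm] XV])
    fix k x \<zeta> assume x: "x \<in> cells S k" "\<zeta> \<in> cells (sub X V) k"
    then have "\<zeta> \<in> V k" by simp
    then show "uunc (\<lambda>n x. \<alpha>c n (x, cD 1 n)) k (x, \<zeta>) = uunc (\<lambda>n x. Fpre S Q f n (bc n x)) k (x, \<zeta>)"
      using uc[of \<alpha>c "\<lambda>n x. (x, cD 1 n)" k x \<zeta>] u\<alpha>[OF x(1), of \<zeta> "cD 1 k"] \<alpha>(4)[OF x(1)] ub[OF fin[OF x(1)]] Fpre_uunc[OF x(1), of Q f bc \<zeta>] by simp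
  qed (use that in simp_all)
  obtain b1 \<alpha>1 where b1: "sset_map X ?L b1" "\<And>n x. x \<in> V n ==> b1 n x = bc n x"
    and \<alpha>1: "sset_map (sset_prod X I1) ?K \<alpha>1" "\<And>n x. x \<in> cells X n ==> \<alpha>1 n (x, cD 0 n) = x0c n x"
    "\<And>n x. x \<in> cells X n ==> \<alpha>1 n (x, cD 1 n) = Fpre S Q f n (b1 n x)"
    "\<And>n x v. x \<in> V n ==> v \<in> Dmap n 1 ==> \<alpha>1 n (x, v) = \<alpha>c n (x, v)"
    by (rule wrlp[OF h fn_kan[OF Q T] fn_kan[OF Q S] X V x0c bc \<alpha>c]) (auto intro: that c0 c1)
  define b' where "b' = uunc b1"
  define \<alpha>' where "\<alpha>' = uunc \<alpha>1"
  have b': "sset_map (sset_prod T X) Q b'" unfolding b'_def by (rule uunc_map[OF T X b1(1)])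
  have \<alpha>': "sset_map (sset_prod S (sset_prod X I1)) Q \<alpha>'" unfolding \<alpha>'_def by (rule uunc_map[OF S XI \<alpha>1(1)])
  have b'V: "b' n (y, \<xi>) = b n (y, \<xi>)" if "y \<in> cells T n" "\<xi> \<in> V n" for n y \<xi>
    using ub[OF that] b1(2)[OF that(2)] by (simp add: b'_def uunc_def unc_def)
  have \<alpha>'V: "\<alpha>' n (x, \<xi>, \<tau>) = \<alpha> n (x, \<xi>, \<tau>)" if "x \<in> cells S n" "\<xi> \<in> V n" "\<tau> \<in> Dmap n 1" for n x \<xi> \<tau>
    using u\<alpha>[OF that] \<alpha>1(4)[OF that(2,3)] by (simp add: \<alpha>'_def uunc_def unc_def)
  have \<alpha>'0: "\<alpha>' n (x, \<xi>, cD 0 n) = x0 n (x, \<xi>)" if "x \<in> cells S n" "\<xi> \<in> cells X n" for n x \<xi>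
    using ux0[OF that] \<alpha>1(2)[OF that(2)] by (simp add: \<alpha>'_def uunc_def unc_def)
  have \<alpha>'1: "\<alpha>' n (x, \<xi>, cD 1 n) = b' n (f n x, \<xi>)" if "x \<in> cells S n" "\<xi> \<in> cells X n" for n x \<xi>
  proof -
    have "\<alpha>' n (x, \<xi>, cD 1 n) = uunc (\<lambda>n x. Fpre S Q f n (b1 n x)) n (x, \<xi>)"
      using \<alpha>1(3)[OF that(2)] by (simp add: \<alpha>'_def uunc_def unc_def)
    then show ?thesis using Fpre_uunc[OF that(1), of Q f b1 \<xi>] by (simp add: b'_def)
  qed
  define U where "U = (\<lambda>n. {(y, \<xi>). y \<in> cells T n \<and> \<xi> \<in> cells X n \<and> (y \<in> DT n \<or> \<xi> \<in> V n)})"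
  have U: "subc (sset_prod T X) U"
    by (rule subcI) (use T X subc_act[OF DT] subc_act[OF V] in \<open>auto simp: U_def\<close>)
  \<comment> \<open>Over \<open>DT\<close> this is the path of \<alpha>', whose end \<open>1\<close>
    is \<open>b'\<close>; over \<open>V\<close> it is constant. The two agree on the overlap by
    \<open>ov\<close>.\<close>
  define h1 where "h1 = (\<lambda>n ((y, \<xi>), w). if y \<in> DT n then \<alpha>' n (g n y, \<xi>, w) else b n (y, \<xi>))"
  have gin: "g n y \<in> cells S n" if "y \<in> DT n" for n y using subc_in[OF DS g_in[OF that]] .
  have ov: "\<alpha>' n (g n y, \<xi>, w) = b n (y, \<xi>)" if "y \<in> DT n" "\<xi> \<in> V n" "w \<in> Dmap n 1" for n y \<xi> w
    using \<alpha>'V[OF gin[OF that(1)] that(2,3)] \<alpha>(2)[OF g_in[OF that(1)] that(2,3)] b(2)[OF that(1,2)] fg[OF that(1)] by simp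
  have h1: "sset_map (sset_prod (sub (sset_prod T X) U) I1) Q h1"
  proof (rule sm_prodI)
    fix n x w assume "x \<in> cells (sub (sset_prod T X) U) n" "w \<in> cells I1 n"
    then show "h1 n (x, w) \<in> cells Q n"
      using sm_prod_in[OF \<alpha>' gin] sm_prod_in[OF b(1)] by (auto simp: h1_def U_def)
  next
    fix m n \<mu> x w assume t: "\<mu> \<in> Dmap m n" and x: "x \<in> cells (sub (sset_prod T X) U) n" "w \<in> cells I1 n"
    obtain y \<xi> where z: "x = (y, \<xi>)" "y \<in> cells T n" "\<xi> \<in> cells X n" "y \<in> DT n \<or> \<xi> \<in> V n" using x(1) by (auto simp: U_def)
    show "h1 m (act (sub (sset_prod T X) U) m n \<mu> x, act I1 m n \<mu> w) = act Q m n \<mu> (h1 n (x, w))"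
    proof (cases "y \<in> DT n")
      case True
      then show ?thesis
        using sm_prod_nat[OF \<alpha>' t gin[OF True], of "(\<xi>, w)"] subc_act[OF DT t True] g_nat[OF t True] x z by (simp add: h1_def)
    next
      case False
      then have v: "\<xi> \<in> V n" using z by simp
      show ?thesis
        using sm_prod_nat[OF b(1) t z(2), of \<xi>] ov[of "act T m n \<mu> y" m "act X m n \<mu> \<xi>" "compD m w \<mu>"] subc_act[OF V t v] v False x t
        by (simp add: h1_def z(1) comp_Dmap)
    qed
  qed
  have h1e: "h1 n (x, cD 1 n) = b' n x" if xU: "x \<in> U n" for n x
  proof -
    obtain y \<xi> where z: "x = (y, \<xi>)" "y \<in> cells T n" "\<xi> \<in> cells X n" "y \<in> DT n \<or> \<xi> \<in> V n" using xU by (auto simp: U_def)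
    then show ?thesis
      using \<alpha>'1[OF gin z(3), of y] fg[of y n] b'V[OF z(2)] by (auto simp: h1_def)
  qed
  have TX: "is_sset (sset_prod T X)" using T X by simp
  obtain Mh where Mh: "sset_map (sset_prod (sset_prod T X) I1) Q Mh"
    "\<And>n x. x \<in> cells (sset_prod T X) n ==> Mh n (x, cD 1 n) = b' n x"
    "\<And>n x t. x \<in> U n ==> t \<in> Dmap n 1 ==> Mh n (x, t) = h1 n (x, t)"
    by (rule hep[OF Q _ TX U b' h1, of 1]) (simp_all add: h1e)
  have MD: "Mh n ((y, \<xi>), w) = \<alpha>' n (g n y, \<xi>, w)" if "y \<in> DT n" "\<xi> \<in> cells X n" "w \<in> Dmap n 1" for n y \<xi> w
    using Mh(3)[of "(y, \<xi>)" n w] that subc_in[OF DT] by (simp add: U_def h1_def)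
  have MV: "Mh n ((y, \<xi>), w) = b n (y, \<xi>)" if "y \<in> cells T n" "\<xi> \<in> V n" "w \<in> Dmap n 1" for n y \<xi> w
    using Mh(3)[of "(y, \<xi>)" n w] that subc_in[OF V] ov by (auto simp: U_def h1_def)
  define b2 where "b2 = (\<lambda>n x. Mh n (x, cD 0 n))"
  have b2: "sset_map (sset_prod T X) Q b2" unfolding b2_def using sm_end[OF _ Mh(1), of 0] by simp
  define V' where "V' = (\<lambda>n. {(x, \<xi>). x \<in> DS n \<and> \<xi> \<in> cells X n})"
  have V': "subc (sset_prod S X) V'"
    by (rule subcI) (use X subc_act[OF DS] subc_in[OF DS] in \<open>auto simp: V'_def\<close>)
  have SX: "is_sset (sset_prod S X)" using S X by simp
  have f1: "sset_map (sset_prod (sset_prod S X) I1) Q (\<lambda>n ((x, \<xi>), v). \<alpha>' n (x, \<xi>, v))"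
    by (rule sm_prodI) (use sm_prod_in[OF \<alpha>'] sm_prod_nat[OF \<alpha>', where y = "(\<xi>, v)" for \<xi> v] in auto)
  have f2: "sset_map (sset_prod (sset_prod S X) I1) Q (\<lambda>n (z, w). x0 n z)"
    using sm_comp[OF sm_fst[of "sset_prod S X" I1] x0(1)] by (simp add: case_prod_unfold)
  have f3: "sset_map (sset_prod (sset_prod S X) I1) Q (\<lambda>n ((x, \<xi>), w). Mh n ((f n x, \<xi>), w))"
    by (rule sm_prodI) (use sm_prod_in[OF Mh(1)] sm_prod_nat[OF Mh(1), where x = "(y, \<xi>)" for y \<xi>] fin sm_nat[OF f] in auto)
  \<comment> \<open>The filling over \<open>DS\<close> uses \<open>minD\<close>, so that its side at
    the end \<open>0\<close> is constant in \<open>v\<close>, with value \<open>x0\<close>, which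
    there is the prescribed one.\<close>
  have f4: "sset_map (sset_prod (sset_prod (sub (sset_prod S X) V') I1) I1) Q (\<lambda>n (((x, \<xi>), v), w). \<alpha>' n (x, \<xi>, minD n v w))"
    by (rule sm_prodI)
      (use sm_prod_in[OF \<alpha>'] sm_prod_nat[OF \<alpha>', where y = "(\<xi>, v)" for \<xi> v] subc_in[OF DS] in
        \<open>auto simp: V'_def minD_Dmap minD_comp\<close>)
  obtain k where k: "sset_map (sset_prod (sset_prod (sset_prod S X) I1) I1) Q k"
    "\<And>n y v. y \<in> cells (sset_prod S X) n ==> v \<in> Dmap n 1 ==> k n ((y, cD 0 n), v) = (\<lambda>n (z, w). x0 n z) n (y, v)"
    "\<And>n y v. y \<in> cells (sset_prod S X) n ==> v \<in> Dmap n 1 ==> k n ((y, cD 1 n), v) = (\<lambda>n ((x, \<xi>), w). Mh n ((f n x, \<xi>), w)) n (y, v)"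
    "\<And>n y u v. y \<in> V' n ==> u \<in> Dmap n 1 ==> v \<in> Dmap n 1 ==> k n ((y, u), v) = (\<lambda>n (((x, \<xi>), v), w). \<alpha>' n (x, \<xi>, minD n v w)) n ((y, u), v)"
  proof (rule hep_sq[OF Q _ SX V' f1 f2 f3 f4, of 1], goal_cases)
    case (2 n y) then show ?case by (auto simp: \<alpha>'0)
  next
    case (3 n y) then show ?case using Mh(2) fin by (auto simp: \<alpha>'1)
  next
    case (4 n y u) then show ?case by (auto simp: V'_def minD_ends)
  next
    case (5 n y v) then show ?case using subc_in[OF DS] by (auto simp: V'_def minD_ends \<alpha>'0)
  next
    case (6 n y v) then show ?case using f_in gf MD by (auto simp: V'_def minD_ends)
  next
    case (7 g) then show ?case by (intro that) auto
  qed simp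
  show thesis
  proof (rule that[of b2 "\<lambda>n (x, \<xi>, v). k n (((x, \<xi>), v), cD 0 n)"])
    show "sset_map (sset_prod T X) Q b2" by (rule b2)
    show "b2 n (y, \<xi>) = b n (y, \<xi>)" if "y \<in> cells T n" "\<xi> \<in> V n" for n y \<xi>
      using MV[OF that, of "cD 0 n"] by (simp add: b2_def)
    show "b2 n (y, \<xi>) = d n y" if "y \<in> DT n" "\<xi> \<in> cells X n" for n y \<xi>
      using MD[OF that, of "cD 0 n"] \<alpha>'0[OF gin[OF that(1)] that(2)] x0(2)[OF g_in[OF that(1)] that(2)] fg[OF that(1)] by (simp add: b2_def)
    show "sset_map (sset_prod S (sset_prod X I1)) Q (\<lambda>n (x, \<xi>, v). k n (((x, \<xi>), v), cD 0 n))"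
    proof -
      have e: "sset_map (sset_prod (sset_prod S X) I1) Q (\<lambda>n z. k n (z, cD 0 n))" using sm_end[OF _ k(1), of 0] by simp
      show ?thesis
        by (rule sm_prodI) (use sm_prod_in[OF e] sm_prod_nat[OF e, where x = "(x, \<xi>)" for x \<xi>] in auto)
    qed
    show "(case (x, \<xi>, cD 0 n) of (x, \<xi>, v) => k n (((x, \<xi>), v), cD 0 n)) = x0 n (x, \<xi>)"
      if "x \<in> cells S n" "\<xi> \<in> cells X n" for n x \<xi> using k(2)[of "(x, \<xi>)" n "cD 0 n"] that by simp
    show "(case (x, \<xi>, cD 1 n) of (x, \<xi>, v) => k n (((x, \<xi>), v), cD 0 n)) = b2 n (f n x, \<xi>)"
      if "x \<in> cells S n" "\<xi> \<in> cells X n" for n x \<xi> using k(3)[of "(x, \<xi>)" n "cD 0 n"] that by (simp add: b2_def)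
    show "(case (x, \<xi>, \<tau>) of (x, \<xi>, v) => k n (((x, \<xi>), v), cD 0 n)) = d n (f n x)"
      if "x \<in> DS n" "\<xi> \<in> cells X n" "\<tau> \<in> Dmap n 1" for n x \<xi> \<tau>
      using k(4)[of "(x, \<xi>)" n \<tau> "cD 0 n"] that subc_in[OF DS] x0(2)[OF that(1,2)]
      by (simp add: V'_def minD_ends \<alpha>'0)
  qed
qed

text \<open>The maps \<open>h\<close> and \<open>h'\<close> may differ on base points. The homotopy
  over \<open>S\<close>, restricted to \<open>DS\<close> and carried over to \<open>DT\<close>,
  moves \<open>h\<close> to a map \<open>h''\<close> that agrees with \<open>h'\<close> there; the
  comparison of \<open>h''\<close> with \<open>h'\<close> can then be made stationary over
  \<open>DS\<close> by filling a square.\<close>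

lemma inj_rel:
  assumes h: "sset_map T Q h" "sset_map T Q h'" and G: "sset_homotopic S Q (\<lambda>n x. h n (f n x)) (\<lambda>n x. h' n (f n x))"
  obtains h'' K where "sset_homotopic T Q h h''" "sset_map T Q h''" "\<And>n y. y \<in> DT n ==> h'' n y = h' n y"
    "sset_map (sset_prod S I1) Q K" "\<And>n x. x \<in> cells S n ==> K n (x, cD 0 n) = h'' n (f n x)"
    "\<And>n x. x \<in> cells S n ==> K n (x, cD 1 n) = h' n (f n x)"
    "\<And>n x \<tau>. x \<in> DS n ==> \<tau> \<in> Dmap n 1 ==> K n (x, \<tau>) = h' n (f n x)"
proof -
  note fin = sm_in[OF f]
  have gin: "g n y \<in> cells S n" if "y \<in> DT n" for n y using subc_in[OF DS g_in[OF that]] .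
  obtain G where "htpy S Q (\<lambda>n x. h n (f n x)) (\<lambda>n x. h' n (f n x)) G" by (rule homE[OF G])
  note G = htpyD[OF this]
  have gm: "sset_map (sub T DT) S g" by (rule smI) (use gin g_nat in auto)
  obtain Mh where Mh: "sset_map (sset_prod T I1) Q Mh" "\<And>n x. x \<in> cells T n ==> Mh n (x, cD 0 n) = h n x"
    "\<And>n x t. x \<in> DT n ==> t \<in> Dmap n 1 ==> Mh n (x, t) = (\<lambda>n (x, t). G n (g n x, t)) n (x, t)"
    by (rule hep[OF Q _ T DT h(1) sm_prod_pre[OF G(1) gm], of 0]) (simp_all add: G(2) gin fg)
  define h'' where "h'' = (\<lambda>n x. Mh n (x, cD 1 n))"
  have h'': "sset_map T Q h''" unfolding h''_def using sm_end[OF _ Mh(1), of 1] by simp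
  have f1: "sset_map (sset_prod S I1) Q (\<lambda>n x. h n (f n (fst x)))" by (rule sm_comp[OF sm_comp[OF sm_fst f] h(1)])
  have f4: "sset_map (sset_prod (sset_prod (sub S DS) I1) I1) Q (\<lambda>n ((x, v), w). G n (x, w))"
    by (rule sm_prodI) (use sm_prod_in[OF G(1)] sm_prod_nat[OF G(1)] subc_in[OF DS] in auto)
  obtain k where k: "sset_map (sset_prod (sset_prod S I1) I1) Q k"
    "\<And>n y v. y \<in> cells S n ==> v \<in> Dmap n 1 ==> k n ((y, cD 0 n), v) = Mh n (f n y, v)"
    "\<And>n y v. y \<in> cells S n ==> v \<in> Dmap n 1 ==> k n ((y, cD 1 n), v) = G n (y, v)"
    "\<And>n y u v. y \<in> DS n ==> u \<in> Dmap n 1 ==> v \<in> Dmap n 1 ==> k n ((y, u), v) = G n (y, v)"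
    by (rule hep_sq[OF Q _ S DS f1 sm_prod_pre[OF Mh(1) f] G(1) f4, of 0])
      (use subc_in[OF DS] f_in in \<open>auto simp: Mh(2,3) G gf fin intro: that\<close>)
  show thesis
  proof (rule that[of h'' "\<lambda>n x. k n (x, cD 1 n)"])
    show "sset_homotopic T Q h h''" by (rule homI[OF Mh(1)]) (simp_all add: Mh h''_def)
    show "sset_map T Q h''" by (rule h'')
    show "h'' n y = h' n y" if "y \<in> DT n" for n y using that G(3)[OF gin[OF that]] fg[OF that] by (simp add: h''_def Mh(3))
    show "sset_map (sset_prod S I1) Q (\<lambda>n x. k n (x, cD 1 n))" using sm_end[OF _ k(1), of 1] by simp
    show "k n ((x, \<tau>), cD 1 n) = h' n (f n x)" if "x \<in> DS n" "\<tau> \<in> Dmap n 1" for n x \<tau>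
      using k(4)[OF that, of "cD 1 n"] G(3) subc_in[OF DS that(1)] by simp
  qed (simp_all add: k G h''_def)
qed

end

section \<open>Nisnevich stalks\<close>

lemma equivclp_inv:
  assumes "equivclp r z z'" "\<And>z z'. r z z' ==> F z = F z'"
  shows "F z = F z'"
  using assms(1) by (induction rule: equivclp_induct) (auto dest: assms(2))

lemma Ar_Sm: "f \<in> Ar (Sm X) ==> Dom (Sm X) f \<in> Ob (Sm X) \<and> Cod (Sm X) f \<in> Ob (Sm X)"
  by (auto simp: Sm_def)

locale stk =
  fixes X :: "'u sch" and Y :: "'u smobj" and y :: 'u
begin

abbreviation "J \<equiv> nis_nbhds X Y y"
abbreviation "ov N \<equiv> Dom (Sm X) (fst (N :: 'u smarr \<times> 'u))"
abbreviation "G A n N a \<equiv> nis_germ X A Y y n (N, a)"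
abbreviation "St A \<equiv> nis_stalk X A Y y"
abbreviation PSm :: "('u smobj, 'u smarr, 'v) spre => bool" where "PSm \<equiv> pointed_spre TYPE('u) (Sm X)"

text \<open>A morphism of Nisnevich neighbourhoods from \<open>N'\<close> to \<open>N\<close>; the
  steps that generate equality of germs are restrictions along such morphisms.\<close>

definition edge :: "'u smarr \<times> 'u => 'u smarr => 'u smarr \<times> 'u => bool" where
  "edge N' g N \<longleftrightarrow> N \<in> J \<and> N' \<in> J \<and> g \<in> homs (Sm X) (ov N') (ov N) \<and> Cmp (Sm X) (fst N) g = fst N' \<and>
     pmap (fst (snd g)) (snd N') = snd N"

lemma J_ob: "N \<in> J ==> ov N \<in> Ob (Sm X)"
  using Ar_Sm by (fastforce simp: nis_nbhds_def)

lemma edgeD: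
  assumes "edge N' g N"
  shows "N \<in> J" "N' \<in> J" "g \<in> Ar (Sm X)" "Dom (Sm X) g = ov N'" "Cod (Sm X) g = ov N"
  using assms by (auto simp: edge_def homs_def)

lemma step_iff: "nis_step X A Y y n (N, a) z' \<longleftrightarrow>
   (\<exists>g N'. edge N' g N \<and> a \<in> cells (sec A (ov N)) n \<and> z' = (N', rst A g n a))"
proof -
  obtain e v e' v' a' where p: "N = (e, v)" "z' = ((e', v'), a')" by (cases z', cases N) (metis surj_pair)
  show ?thesis unfolding p nis_step_def edge_def prod.case fst_conv snd_conv prod.inject
    by (rule iffI) (force simp del: split_paired_Ex)+
qed

lemma edge_map:
  assumes "PSm A" "edge N' g N"
  shows "sset_map (sec A (ov N)) (sec A (ov N')) (rst A g)" "rst A g n (bpt A (ov N) n) = bpt A (ov N') n"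
  using psD(3,8)[OF assms(1) edgeD(3)[OF assms(2)]] edgeD(4,5)[OF assms(2)] by simp_all

lemma germ_self [simp]: "z \<in> nis_germ X A Y y n z"
  by (simp add: nis_germ_def)

lemma germ_inv:
  assumes "z' \<in> nis_germ X A Y y n z"
    and "\<And>N' g N a. edge N' g N ==> a \<in> cells (sec A (ov N)) n ==> F (N', rst A g n a) = F (N, a)"
  shows "F z' = F z"
proof -
  have "F z = F z'"
    by (rule equivclp_inv[OF assms(1)[unfolded nis_germ_def mem_Collect_eq]]) (use assms(2) in \<open>auto simp: step_iff\<close>)
  then show ?thesis by simp
qed

lemma germ_edge:
  assumes "edge N' g N" "a \<in> cells (sec A (ov N)) n"
  shows "G A n N' (rst A g n a) = G A n N a"
proof -
  have "nis_step X A Y y n (N, a) (N', rst A g n a)"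
    unfolding step_iff by (rule exI[of _ g], rule exI[of _ N']) (use assms in simp)
  then have 1: "equivclp (nis_step X A Y y n) (N, a) (N', rst A g n a)" by (rule r_into_equivclp)

  show ?thesis unfolding nis_germ_def
    using equivclp_trans[OF 1] equivclp_trans[OF equivclp_sym[OF 1]] by (intro Collect_cong iffI)
qed

text \<open>A function of representatives that is invariant along edges descends to germs; the lemma
  of the same name shows that the chosen representative is then irrelevant.\<close>

definition lft :: "(('u smarr \<times> 'u) \<times> 'v => 'w) => (('u smarr \<times> 'u) \<times> 'v) set => 'w" where
  "lft F c = F (SOME z. z \<in> c)"

lemma lft:
  assumes "\<And>N' g N a. edge N' g N ==> a \<in> cells (sec A (ov N)) n ==> F (N', rst A g n a) = F (N, a)"
  shows "lft F (G A n N a) = F (N, a)"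
  unfolding lft_def by (rule germ_inv[OF someI[of "\<lambda>z. z \<in> G A n N a", OF germ_self]]) (rule assms)

lemma germ_UN:
  assumes "\<And>N' g N a. edge N' g N ==> a \<in> cells (sec A (ov N)) n ==> F N' (rst A g n a) = F N a"
  shows "(\<Union>(N', a')\<in>G A n N a. F N' a') = F N a"
proof -
  have "case_prod F z' = case_prod F (N, a)" if "z' \<in> G A n N a" for z'
    by (rule germ_inv[OF that]) (simp add: assms)
  then have e: "\<And>N' a'. (N', a') \<in> G A n N a ==> F N' a' = F N a" by fastforce
  show ?thesis using germ_self[of "(N, a)" A n] e by blast
qed

lemma St_cells: "c \<in> cells (St A) n \<longleftrightarrow> (\<exists>N\<in>J. \<exists>a\<in>cells (sec A (ov N)) n. c = G A n N a)"
  unfolding nis_stalk_def sset.simps by blast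

lemma St_E:
  assumes "c \<in> cells (St A) n"
  obtains N a where "N \<in> J" "a \<in> cells (sec A (ov N)) n" "c = G A n N a"
  using assms unfolding St_cells by blast

lemma G_in: "N \<in> J ==> a \<in> cells (sec A (ov N)) n ==> G A n N a \<in> cells (St A) n"
  unfolding St_cells by blast

lemma St_act:
  assumes A: "PSm A" and t: "\<mu> \<in> Dmap m n"
  shows "act (St A) m n \<mu> (G A n N a) = G A m N (act (sec A (ov N)) m n \<mu> a)"
proof -
  have "(\<Union>(N, a)\<in>G A n N a. G A m N (act (sec A (ov N)) m n \<mu> a)) = G A m N (act (sec A (ov N)) m n \<mu> a)"
  proof (rule germ_UN)
    fix N' g N a assume e: "edge N' g N" and a: "a \<in> cells (sec A (ov N)) n"
    have "act (sec A (ov N')) m n \<mu> (rst A g n a) = rst A g m (act (sec A (ov N)) m n \<mu> a)"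
      using sm_nat[OF edge_map(1)[OF A e] t a] by simp
    then show "G A m N' (act (sec A (ov N')) m n \<mu> (rst A g n a)) = G A m N (act (sec A (ov N)) m n \<mu> a)"
      using germ_edge[OF e ss_act[OF psD(1)[OF A J_ob[OF edgeD(1)[OF e]]] t a]] by simp
  qed
  then show ?thesis by (simp add: nis_stalk_def)
qed

lemma is_sset_St:
  assumes A: "PSm A"
  shows "is_sset (St A)"
proof (rule issI)
  have s: "is_sset (sec A (ov N))" if "N \<in> J" for N using psD(1)[OF A J_ob[OF that]] .
  show "act (St A) m n \<mu> c \<in> cells (St A) m" if t: "\<mu> \<in> Dmap m n" and c: "c \<in> cells (St A) n" for m n \<mu> c
    by (rule St_E[OF c]) (simp add: St_act[OF A t] G_in s t)
  show "act (St A) n n (idD n) c = c" if c: "c \<in> cells (St A) n" for n c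
    by (rule St_E[OF c]) (simp add: St_act[OF A id_Dmap] s)
  show "act (St A) l m \<eta> (act (St A) m n \<mu> c) = act (St A) l n (compD l \<mu> \<eta>) c"
    if t: "\<eta> \<in> Dmap l m" "\<mu> \<in> Dmap m n" and c: "c \<in> cells (St A) n" for l m n \<eta> \<mu> c
    by (rule St_E[OF c]) (simp add: St_act[OF A] t comp_Dmap[OF t(2,1)] ss_comp[OF s t])
qed

lemma stalk_map:
  assumes s: "spre_map (Sm X) A \<phi> B" and A: "PSm A"
  shows "nis_stalk_map X (A, \<phi>, B) Y y n (G A n N a) = G B n N (\<phi> (ov N) n a)"
  unfolding nis_stalk_map_def prod.case
proof (rule germ_UN)
  fix N' g N a assume e: "edge N' g N" and a: "a \<in> cells (sec A (ov N)) n"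
  have "\<phi> (ov N') n (rst A g n a) = rst B g n (\<phi> (ov N) n a)"
    using smapD(2)[OF s edgeD(3)[OF e], of a n] edgeD(4,5)[OF e] a by simp
  then show "G B n N' (\<phi> (ov N') n (rst A g n a)) = G B n N (\<phi> (ov N) n a)"
    using germ_edge[OF e sm_in[OF smapD(1)[OF s J_ob[OF edgeD(1)[OF e]]] a]] by simp
qed

lemma stalk_map_map:
  assumes s: "spre_map (Sm X) A \<phi> B" and A: "PSm A" and B: "PSm B"
  shows "sset_map (St A) (St B) (nis_stalk_map X (A, \<phi>, B) Y y)"
proof (rule smI)
  have m: "sset_map (sec A (ov N)) (sec B (ov N)) (\<phi> (ov N))" if "N \<in> J" for N using smapD(1)[OF s J_ob[OF that]] .
  show "nis_stalk_map X (A, \<phi>, B) Y y n c \<in> cells (St B) n" if "c \<in> cells (St A) n" for n c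
    by (rule St_E[OF that]) (simp add: stalk_map[OF s A] G_in sm_in[OF m])
  show "nis_stalk_map X (A, \<phi>, B) Y y m (act (St A) m n \<mu> c) = act (St B) m n \<mu> (nis_stalk_map X (A, \<phi>, B) Y y n c)"
    if t: "\<mu> \<in> Dmap m n" and c: "c \<in> cells (St A) n" for m n \<mu> c
    by (rule St_E[OF c]) (simp add: stalk_map[OF s A] St_act[OF A t] St_act[OF B t] sm_nat[OF m t])
qed

text \<open>The base points need not be identified in the colimit when it is not connected, hence they form a subcomplex.\<close>

definition Db :: "('u smobj, 'u smarr, 'v) spre => nat => (('u smarr \<times> 'u) \<times> 'v) set set" where
  "Db A n = {G A n N (bpt A (ov N) n) | N. N \<in> J}"

lemma DbI: "N \<in> J ==> G A n N (bpt A (ov N) n) \<in> Db A n"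
  unfolding Db_def by blast

lemma DbE:
  assumes "c \<in> Db A n"
  obtains N where "N \<in> J" "c = G A n N (bpt A (ov N) n)"
  using assms unfolding Db_def by blast

lemma subc_Db:
  assumes A: "PSm A"
  shows "subc (St A) (Db A)"
proof (rule subcI)
  show "c \<in> cells (St A) n" if "c \<in> Db A n" for n c
    by (rule DbE[OF that]) (simp add: G_in psD(6)[OF A J_ob])
  show "act (St A) m n \<mu> c \<in> Db A m" if t: "\<mu> \<in> Dmap m n" and c: "c \<in> Db A n" for m n \<mu> c
    by (rule DbE[OF c]) (simp add: St_act[OF A t] psD(7)[OF A J_ob t] DbI)
qed

lemma forget_bpt:
  assumes A: "PSm A" and h: "\<And>N' g N. edge N' g N ==> h N' = h N"
  shows "lft (\<lambda>(N, a). h N) (G A n N a) = h N"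
  by (subst lft) (use h in auto)

lemma bpt_edge:
  assumes A: "PSm A" and e: "edge N' g N"
  shows "G A n N' (bpt A (ov N') n) = G A n N (bpt A (ov N) n)"
  using germ_edge[OF e psD(6)[OF A J_ob[OF edgeD(1)[OF e]]], of n] edge_map(2)[OF A e] by simp

text \<open>Forgetting the section sends a germ over \<open>N\<close> to the germ of the base point
  over \<open>N\<close>. This is well defined between stalks of any two presheaves, and on base
  points it inverts the map of stalks.\<close>

lemma bij_Db:
  assumes s: "spre_map (Sm X) A \<phi> B" and A: "PSm A" and B: "PSm B"
  shows "bij_betw (nis_stalk_map X (A, \<phi>, B) Y y n) (Db A n) (Db B n)"
proof (rule bij_betw_byWitness[where f' = "lft (\<lambda>(N, a). G A n N (bpt A (ov N) n))"])
  have b: "\<phi> (ov N) n (bpt A (ov N) n) = bpt B (ov N) n" if "N \<in> J" for N using smapD(3)[OF s J_ob[OF that]] .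
  have l: "lft (\<lambda>(N, a). G A n N (bpt A (ov N) n)) (G B n N b) = G A n N (bpt A (ov N) n)" for N b
    by (rule forget_bpt[OF B bpt_edge[OF A]])
  show "\<forall>a\<in>Db A n. lft (\<lambda>(N, a). G A n N (bpt A (ov N) n)) (nis_stalk_map X (A, \<phi>, B) Y y n a) = a"
    by (intro ballI, erule DbE) (simp add: stalk_map[OF s A] b l)
  show "\<forall>a'\<in>Db B n. nis_stalk_map X (A, \<phi>, B) Y y n (lft (\<lambda>(N, a). G A n N (bpt A (ov N) n)) a') = a'"
    by (intro ballI, erule DbE) (simp add: stalk_map[OF s A] b l)
  show "nis_stalk_map X (A, \<phi>, B) Y y n ` Db A n \<subseteq> Db B n"
    by (intro image_subsetI, erule DbE) (simp add: stalk_map[OF s A] b DbI)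
  show "lft (\<lambda>(N, a). G A n N (bpt A (ov N) n)) ` Db B n \<subseteq> Db A n"
    by (intro image_subsetI, erule DbE) (simp add: l DbI)
qed

subsection \<open>Maps out of a stalk as a test\<close>

text \<open>A stalk is a colimit, so a map out of it is a compatible family of maps out of the
  sections over all neighbourhoods, and these form the diagram of the test. The values
  \<open>z\<close> at base points may depend on the neighbourhood, since germs of base points need
  not coincide.\<close>

definition stest :: "'z sset => ('u smarr \<times> 'u => nat => 'z) =>
    ('u smarr \<times> 'u, ('u smarr \<times> 'u) \<times> 'u smarr \<times> ('u smarr \<times> 'u), 'u smobj, 'u smarr, 'z) tst" where
  "stest Q z = \<lparr>tI = J, tE = {(N', g, N). edge N' g N}, tsrc = fst, ttgt = snd \<circ> snd, tov = (\<lambda>N. ov N), tav = fst \<circ> snd,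
     tZ = (\<lambda>_. Q), tr = (\<lambda>_ _ x. x), tb = z, tp = True\<rparr>"

lemma stest_simps [simp]:
  "tI (stest Q z) = J" "tov (stest Q z) N = ov N" "tZ (stest Q z) N = Q" "tr (stest Q z) e n x = x"
  "tb (stest Q z) = z" "tp (stest Q z)" "e \<in> tE (stest Q z) \<longleftrightarrow> edge (fst e) (fst (snd e)) (snd (snd e))"
  "tsrc (stest Q z) e = fst e" "ttgt (stest Q z) e = snd (snd e)" "tav (stest Q z) e = fst (snd e)"
  by (auto simp: stest_def)

definition zok :: "'z sset => ('u smarr \<times> 'u => nat => 'z) => bool" where
  "zok Q z \<longleftrightarrow> (\<forall>N\<in>J. \<forall>n. z N n \<in> cells Q n) \<and> (\<forall>N\<in>J. \<forall>m n. \<forall>\<mu>\<in>Dmap m n. act Q m n \<mu> (z N n) = z N m) \<and>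
     (\<forall>N' g N n. edge N' g N \<longrightarrow> z N' n = z N n)"

lemma zokD:
  assumes "zok Q z"
  shows "N \<in> J ==> z N n \<in> cells Q n" "N \<in> J ==> \<mu> \<in> Dmap m n ==> act Q m n \<mu> (z N n) = z N m"
    "edge N' g N ==> z N' n = z N n"
  using assms unfolding zok_def by blast+

lemma wft_stest: "zok Q z ==> wft (Sm X) (stest Q z)"
  using J_ob by (simp add: wft_def zokD edgeD)

lemma wfA_stest: "zok Q z ==> PSm A ==> wfA (stest Q z) A"
  by (rule wfA_ps[OF wft_stest])

text \<open>\<open>stc\<close> and \<open>cts\<close> translate between maps into the
  \<open>TF\<close> of this test and maps out of the stalk with values \<open>z\<close> on base
  points.\<close>

definition stc :: "(nat => 'x => ('u smarr \<times> 'u) => nat => 'v \<times> (nat => nat) => 'z) =>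
    nat => (('u smarr \<times> 'u) \<times> 'v) set \<times> 'x => 'z" where
  "stc \<phi> = (\<lambda>n (c, \<xi>). lft (\<lambda>(N, a). unc \<phi> N n (a, \<xi>)) c)"

definition cts :: "'z sset => ('u smarr \<times> 'u => nat => 'z) => ('u smobj, 'u smarr, 'v) spre => 'x sset =>
    (nat => (('u smarr \<times> 'u) \<times> 'v) set \<times> 'x => 'z) => nat => 'x => ('u smarr \<times> 'u) => nat => 'v \<times> (nat => nat) => 'z" where
  "cts Q z A K \<Psi> = cur (stest Q z) A K (\<lambda>N n (a, \<xi>). \<Psi> n (G A n N a, \<xi>))"

context
  fixes Q :: "'z sset" and z :: "'u smarr \<times> 'u => nat => 'z"
  assumes zk: "zok Q z"
begin

abbreviation "tt \<equiv> stest Q z"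

lemma stc:
  assumes A: "PSm A" and K: "is_sset K" and p: "sset_map K (TF tt A) \<phi>"
  shows "\<xi> \<in> cells K n ==> stc \<phi> n (G A n N a, \<xi>) = unc \<phi> N n (a, \<xi>)"
    and "\<xi> \<in> cells K n ==> N \<in> J ==> stc \<phi> n (G A n N (bpt A (ov N) n), \<xi>) = z N n"
    and "sset_map (sset_prod (St A) K) Q (stc \<phi>)"
proof -
  have g: "gf tt A K (unc \<phi>)" by (rule unc_gf[OF wfA_stest[OF zk A] K p])
  show 1: "stc \<phi> n (G A n N a, \<xi>) = unc \<phi> N n (a, \<xi>)" if "\<xi> \<in> cells K n" for n N a \<xi>
    unfolding stc_def prod.case by (subst lft) (use gfD(3)[OF g, of "(N', g, N)" for N' g N] that in auto)
  show "stc \<phi> n (G A n N (bpt A (ov N) n), \<xi>) = z N n" if "\<xi> \<in> cells K n" "N \<in> J"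
    using gfD(4)[OF g, of N \<xi> n] that 1 by simp
  show "sset_map (sset_prod (St A) K) Q (stc \<phi>)"
  proof (rule sm_prodI)
    show "stc \<phi> n (c, \<xi>) \<in> cells Q n" if "c \<in> cells (St A) n" "\<xi> \<in> cells K n" for n c \<xi>
      by (rule St_E[OF that(1)]) (use gfD(1)[OF g, of _ _ n \<xi>] that in \<open>simp add: 1\<close>)
    show "stc \<phi> m (act (St A) m n \<mu> c, act K m n \<mu> \<xi>) = act Q m n \<mu> (stc \<phi> n (c, \<xi>))"
      if "\<mu> \<in> Dmap m n" "c \<in> cells (St A) n" "\<xi> \<in> cells K n" for m n \<mu> c \<xi>
      by (rule St_E[OF that(2)]) (use gfD(2)[OF g _ that(1) _ that(3)] that K in \<open>simp add: 1 St_act[OF A]\<close>)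
  qed
qed

lemma cts:
  assumes A: "PSm A" and K: "is_sset K" and P: "sset_map (sset_prod (St A) K) Q \<Psi>"
    and b: "\<And>n N \<xi>. N \<in> J ==> \<xi> \<in> cells K n ==> \<Psi> n (G A n N (bpt A (ov N) n), \<xi>) = z N n"
  shows "sset_map K (TF tt A) (cts Q z A K \<Psi>)"
    and "N \<in> J ==> a \<in> cells (sec A (ov N)) n ==> \<xi> \<in> cells K n ==> unc (cts Q z A K \<Psi>) N n (a, \<xi>) = \<Psi> n (G A n N a, \<xi>)"
proof -
  show "N \<in> J ==> a \<in> cells (sec A (ov N)) n ==> \<xi> \<in> cells K n ==> unc (cts Q z A K \<Psi>) N n (a, \<xi>) = \<Psi> n (G A n N a, \<xi>)"
    unfolding cts_def by (subst unc_cur[OF K]) auto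
  have "gf tt A K (\<lambda>N n (a, \<xi>). \<Psi> n (G A n N a, \<xi>))"
  proof (rule gfI, goal_cases)
    case (1 N n a \<xi>) then show ?case using sm_prod_in[OF P G_in] by simp
  next
    case (2 N m n \<mu> a \<xi>) then show ?case using sm_prod_nat[OF P 2(2) G_in] by (simp add: St_act[OF A])
  next
    case (3 e n a \<xi>)
    then show ?case using germ_edge[of "fst e" "fst (snd e)" "snd (snd e)" a A n] by simp
  next
    case (4 N n \<xi>) then show ?case using b by simp
  qed
  then show "sset_map K (TF tt A) (cts Q z A K \<Psi>)" unfolding cts_def by (rule cur_map[OF wfA_stest[OF zk A] K])
qed

lemma TF_stc_eq:
  assumes A: "PSm A" and K: "is_sset K" and U: "subc K U" and p: "sset_map (sub K U) (TF tt A) \<phi>" "sset_map (sub K U) (TF tt A) \<psi>"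
    and e: "\<And>n N a \<xi>. N \<in> J ==> a \<in> cells (sec A (ov N)) n ==> \<xi> \<in> U n ==> unc \<phi> N n (a, \<xi>) = unc \<psi> N n (a, \<xi>)"
    and x: "\<xi> \<in> U n"
  shows "\<phi> n \<xi> = \<psi> n \<xi>"
  by (rule TF_maps_eq_on[OF wfA_stest[OF zk A] p K U x]) (use e in simp)

text \<open>Horns are filled on the stalk relative to base points: \<open>Db A\<close> is the
  subcomplex \<open>V\<close> in \<open>pph\<close>.\<close>

lemma stest_kan:
  assumes A: "PSm A" and Q: "kan_complex Q"
  shows "kan_complex (TF tt A)"
  unfolding kan_complex_def horn_eq
proof (intro conjI allI impI)
  show "is_sset (TF tt A)" using wfA_stest[OF zk A] by simp
  fix n k :: nat and f assume n: "1 \<le> n" "k \<le> n" and f: "sset_map (sub (simplex n) (hn n k)) (TF tt A) f"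
  have H: "is_sset (sub (simplex n) (hn n k))" by simp
  note s = stc[OF A H f]
  define h where "h = (\<lambda>m (\<mu>, c). if \<mu> \<in> hn n k m then stc f m (c, \<mu>) else lft (\<lambda>(N, a). z N m) c)"
  have lz: "lft (\<lambda>(N, a). z N m) (G A m N a) = z N m" for m N a
    by (rule forget_bpt[OF A]) (rule zokD(3)[OF zk])
  have hD: "h m (\<mu>, c) = lft (\<lambda>(N, a). z N m) c" if "c \<in> Db A m" for m \<mu> c
    by (rule DbE[OF that]) (simp add: h_def lz s(2))
  have hm: "sset_map (sub (sset_prod (simplex n) (St A)) (\<lambda>m. {(\<mu>, \<xi>). \<mu> \<in> Dmap m n \<and> \<xi> \<in> cells (St A) m \<and> (\<mu> \<in> hn n k m \<or> \<xi> \<in> Db A m)})) Q h"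
  proof (rule smI, goal_cases)
    case (1 m x)
    then obtain \<mu> c where x: "x = (\<mu>, c)" "c \<in> cells (St A) m" "\<mu> \<in> hn n k m \<or> c \<in> Db A m" by auto
    show ?case
    proof (cases "\<mu> \<in> hn n k m")
      case True then show ?thesis using sm_prod_in[OF s(3) x(2)] by (simp add: x h_def)
    next
      case False
      then have c: "c \<in> Db A m" using x by simp
      show ?thesis by (rule DbE[OF c]) (use hD[OF c] in \<open>simp add: x lz zokD(1)[OF zk]\<close>)
    qed
  next
    case (2 l m \<eta> x)
    then obtain \<mu> c where x: "x = (\<mu>, c)" "c \<in> cells (St A) m" "\<mu> \<in> hn n k m \<or> c \<in> Db A m" by auto
    show ?case
    proof (cases "\<mu> \<in> hn n k m")
      case True
      then show ?thesis using sm_prod_nat[OF s(3) 2(1) x(2), of \<mu>] subc_act[OF subc_hn 2(1) True] by (simp add: x h_def)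
    next
      case False
      then have c: "c \<in> Db A m" using x by simp
      then obtain N where N: "N \<in> J" "c = G A m N (bpt A (ov N) m)" by (rule DbE)
      show ?thesis
        using hD[OF c] hD[OF subc_act[OF subc_Db[OF A] 2(1) c]] N 2(1) by (simp add: x zokD(2)[OF zk] lz St_act[OF A 2(1)])
    qed
  qed
  obtain g where g: "sset_map (sset_prod (simplex n) (St A)) Q g"
    "\<And>m \<mu> \<xi>. \<mu> \<in> hn n k m ==> \<xi> \<in> cells (St A) m ==> g m (\<mu>, \<xi>) = h m (\<mu>, \<xi>)"
    "\<And>m \<mu> \<xi>. \<mu> \<in> Dmap m n ==> \<xi> \<in> Db A m ==> g m (\<mu>, \<xi>) = h m (\<mu>, \<xi>)"
    by (rule pph[OF Q n is_sset_St[OF A] subc_Db[OF A] hm]) (rule that)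
  define c where "c = cts Q z A (simplex n) (\<lambda>m (c, \<mu>). g m (\<mu>, c))"
  have gb: "(\<lambda>m (c, \<mu>). g m (\<mu>, c)) m (G A m N (bpt A (ov N) m), \<xi>) = z N m" if "N \<in> J" "\<xi> \<in> cells (simplex n) m" for m N \<xi>
    using g(3)[OF _ DbI[OF that(1), of A m], of \<xi>] hD[OF DbI[OF that(1), of A m], of \<xi>] that(2) by (simp add: lz)
  note ct = cts[OF A is_sset_simplex sm_swap[OF g(1)] gb, folded c_def]
  have "c m x = f m x" if "x \<in> hn n k m" for m x
  proof (rule TF_stc_eq[OF A is_sset_simplex subc_hn sm_sub[OF ct(1) subc_hn] f _ that])
    fix m N a \<xi> assume N: "N \<in> J" "a \<in> cells (sec A (ov N)) m" "\<xi> \<in> hn n k m"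
    then show "unc c N m (a, \<xi>) = unc f N m (a, \<xi>)"
      using ct(2)[OF _ _ N(1,2), of \<xi>] g(2)[OF N(3) G_in[OF N(1,2)]] s(1)[of \<xi> m N a] subc_in[OF subc_hn N(3)]
      by (simp add: h_def)
  qed
  then show "\<exists>g. sset_map (simplex n) (TF tt A) g \<and> (\<forall>m. \<forall>\<mu>\<in>cells (sub (simplex n) (hn n k)) m. g m \<mu> = f m \<mu>)"
    using ct(1) by (intro exI[of _ c]) simp
qed

end

lemma relmap_stalk:
  assumes s: "spre_map (Sm X) A \<phi> B" and A: "PSm A" and B: "PSm B" and Q: "kan_complex Q"
  shows "relmap (St A) (St B) (nis_stalk_map X (A, \<phi>, B) Y y) (Db A) (Db B) Q"
  by (intro relmap.intro is_sset_St A B stalk_map_map[OF s] subc_Db bij_Db[OF s] Q)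

text \<open>\<open>wrlp_rel\<close> translated through \<open>stc\<close> and \<open>cts\<close>.
  The function \<open>d\<close> reads the prescribed value off a germ by forgetting its
  section.\<close>

lemma stalk_wrlp:
  fixes Q :: "(('u smarr \<times> 'u) \<times> 'v) set sset" and A B :: "('u smobj, 'u smarr, 'v) spre"
    and E :: "(('u smarr \<times> 'u) \<times> 'v) set kt => (('u smarr \<times> 'u) \<times> 'v) set"
  assumes s: "spre_map (Sm X) A \<phi> B" and A: "PSm A" and B: "PSm B" and Q: "kan_complex Q" and zk: "zok Q z"
    and w: "sset_weq (St A) (St B) (nis_stalk_map X (A, \<phi>, B) Y y)" and E: "inj E"
    and K: "is_sset K" and V: "subc K V"
    and x0: "sset_map K (TF (stest Q z) A) x0" and b: "sset_map (sub K V) (TF (stest Q z) B) b"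
    and \<alpha>: "sset_map (sset_prod (sub K V) I1) (TF (stest Q z) A) \<alpha>"
    and \<alpha>0: "\<And>n x. x \<in> V n ==> \<alpha> n (x, cD 0 n) = x0 n x"
    and \<alpha>1: "\<And>n x. x \<in> V n ==> \<alpha> n (x, cD 1 n) = Tpre (stest Q z) A \<phi> n (b n x)"
  obtains b' \<alpha>' where "sset_map K (TF (stest Q z) B) b'" "\<And>n x. x \<in> V n ==> b' n x = b n x"
    "sset_map (sset_prod K I1) (TF (stest Q z) A) \<alpha>'"
    "\<And>n x. x \<in> cells K n ==> \<alpha>' n (x, cD 0 n) = x0 n x"
    "\<And>n x. x \<in> cells K n ==> \<alpha>' n (x, cD 1 n) = Tpre (stest Q z) A \<phi> n (b' n x)"
proof -
  let ?t = "stest Q z" and ?f = "nis_stalk_map X (A, \<phi>, B) Y y"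
  interpret R: relmap "St A" "St B" ?f "Db A" "Db B" Q by (rule relmap_stalk[OF s A B Q])
  have KV: "is_sset (sub K V)" and KI: "is_sset (sset_prod K I1)" and KVI: "is_sset (sset_prod (sub K V) I1)"
    using K V by simp_all
  define d where "d = (\<lambda>n. lft (\<lambda>(N, a :: 'v). z N n))"
  have d: "d n (G B' n N b) = z N n" for n N b and B' :: "('u smobj, 'u smarr, 'v) spre"
    unfolding d_def by (subst lft) (use zokD(3)[OF zk] in auto)
  have fb: "?f n (G A n N (bpt A (ov N) n)) = G B n N (bpt B (ov N) n)" if "N \<in> J" for n N
    using stalk_map[OF s A] smapD(3)[OF s J_ob[OF that]] by simp
  have fin: "\<phi> (ov N) n a \<in> cells (sec B (ov N)) n" if "N \<in> J" "a \<in> cells (sec A (ov N)) n" for N n a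
    using sm_in[OF smapD(1)[OF s J_ob[OF that(1)]] that(2)] .
  note sx = stc[OF zk A K x0] and sb = stc[OF zk B KV b] and sa = stc[OF zk A KVI \<alpha>]
  have ua: "unc \<alpha> N n (a, x, v) = \<alpha> n (x, v) N n (a, idD n)" "unc x0 N n (a, x) = x0 n x N n (a, idD n)"
    for N n a x v by (simp_all add: unc_def)
  note Pt = Tpre_unc[where t = ?t and A = A and f = \<phi>, unfolded stest_simps]
  obtain b' \<alpha>' where r: "sset_map (sset_prod (St B) K) Q b'" "\<And>n y \<xi>. y \<in> cells (St B) n ==> \<xi> \<in> V n ==> b' n (y, \<xi>) = stc b n (y, \<xi>)"
    "\<And>n y \<xi>. y \<in> Db B n ==> \<xi> \<in> cells K n ==> b' n (y, \<xi>) = d n y"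
    "sset_map (sset_prod (St A) (sset_prod K I1)) Q \<alpha>'"
    "\<And>n x \<xi>. x \<in> cells (St A) n ==> \<xi> \<in> cells K n ==> \<alpha>' n (x, \<xi>, cD 0 n) = stc x0 n (x, \<xi>)"
    "\<And>n x \<xi>. x \<in> cells (St A) n ==> \<xi> \<in> cells K n ==> \<alpha>' n (x, \<xi>, cD 1 n) = b' n (?f n x, \<xi>)"
    "\<And>n x \<xi> \<tau>. x \<in> Db A n ==> \<xi> \<in> cells K n ==> \<tau> \<in> Dmap n 1 ==> \<alpha>' n (x, \<xi>, \<tau>) = d n (?f n x)"
  proof (rule R.wrlp_rel[OF sset_weq_heq_Fn[OF w E Q] K V _ sx(3) _ sb(3) _ sa(3), where d = d])
    show "d n c \<in> cells Q n" if "c \<in> Db B n" for n c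
      by (rule DbE[OF that]) (simp add: d zokD[OF zk])
    show "stc x0 n (c, \<xi>) = d n (?f n c)" if "c \<in> Db A n" "\<xi> \<in> cells K n" for n c \<xi>
      by (rule DbE[OF that(1)]) (simp add: d sx(2) fb that)
    show "stc b n (c, \<xi>) = d n c" if "c \<in> Db B n" "\<xi> \<in> V n" for n c \<xi>
      by (rule DbE[OF that(1)]) (simp add: d sb(2) that)
    show "stc \<alpha> n (c, \<xi>, \<tau>) = d n (?f n c)" if "c \<in> Db A n" "\<xi> \<in> V n" "\<tau> \<in> Dmap n 1" for n c \<xi> \<tau>
      by (rule DbE[OF that(1)]) (simp add: d sa(2) fb that)
    show "stc \<alpha> n (c, \<xi>, cD 0 n) = stc x0 n (c, \<xi>)" if "c \<in> cells (St A) n" "\<xi> \<in> V n" for n c \<xi>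
      by (rule St_E[OF that(1)]) (simp add: sa(1) sx(1) that subc_in[OF V] ua \<alpha>0)
    show "stc \<alpha> n (c, \<xi>, cD 1 n) = stc b n (?f n c, \<xi>)" if "c \<in> cells (St A) n" "\<xi> \<in> V n" for n c \<xi>
      by (rule St_E[OF that(1)])
        (use Pt[where \<phi> = b and \<xi> = \<xi> and k = n] in \<open>simp add: sa(1) sb(1) that stalk_map[OF s A] ua \<alpha>1 unc_def\<close>)
  qed (rule that)
  have bb: "b' n (G B n N (bpt B (ov N) n), \<xi>) = z N n" if "N \<in> J" "\<xi> \<in> cells K n" for n N \<xi>
    using r(3)[OF DbI[OF that(1)] that(2)] d by simp
  have ab: "\<alpha>' n (G A n N (bpt A (ov N) n), \<xi>) = z N n" if "N \<in> J" "\<xi> \<in> cells (sset_prod K I1) n" for n N \<xi>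
    using r(7)[OF DbI[OF that(1)], of "fst \<xi>" n "snd \<xi>"] that(2) fb[OF that(1)] d by (cases \<xi>) simp
  define b'' where "b'' = cts Q z B K b'"
  define \<alpha>'' where "\<alpha>'' = cts Q z A (sset_prod K I1) \<alpha>'"
  have cb1: "sset_map K (TF ?t B) b''" unfolding b''_def by (rule cts(1)[OF zk B K r(1)]) (rule bb)
  have cb2: "unc b'' N n (a, \<xi>) = b' n (G B n N a, \<xi>)" if "N \<in> J" "a \<in> cells (sec B (ov N)) n" "\<xi> \<in> cells K n" for N n a \<xi>
    unfolding b''_def by (rule cts(2)[OF zk B K r(1) _ that]) (rule bb)
  have ca1: "sset_map (sset_prod K I1) (TF ?t A) \<alpha>''" unfolding \<alpha>''_def by (rule cts(1)[OF zk A KI r(4)]) (rule ab)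
  have ca2: "unc \<alpha>'' N n (a, \<xi>, \<tau>) = \<alpha>' n (G A n N a, \<xi>, \<tau>)"
    if "N \<in> J" "a \<in> cells (sec A (ov N)) n" "\<xi> \<in> cells K n" "\<tau> \<in> Dmap n 1" for N n a \<xi> \<tau>
    unfolding \<alpha>''_def by (rule cts(2)[OF zk A KI r(4) _ that(1,2)]) (use ab that in auto)
  have wA: "wfA ?t A" and wB: "wfA ?t B" by (rule wfA_stest[OF zk A], rule wfA_stest[OF zk B])
  have ue: "unc (\<lambda>n x. \<alpha>'' n (x, cD e n)) N n (a, \<xi>) = unc \<alpha>'' N n (a, \<xi>, cD e n)" for e N n a \<xi> by (simp add: unc_def)
  show thesis
  proof (rule that[OF cb1 _ ca1])
    fix n x assume x: "x \<in> V n"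
    show "b'' n x = b n x"
      by (rule TF_stc_eq[OF zk B K V sm_sub[OF cb1 V] b _ x]) (simp add: cb2 subc_in[OF V] r(2) G_in sb(1))
  next
    fix n x assume x: "x \<in> cells K n"
    show "\<alpha>'' n (x, cD 0 n) = x0 n x"
      by (rule TF_maps_eq[OF wA sm_end[OF _ ca1, of 0] x0 K x]) (simp_all add: ue ca2 r(5) G_in sx(1))
    show "\<alpha>'' n (x, cD 1 n) = Tpre ?t A \<phi> n (b'' n x)"
      by (rule TF_maps_eq[OF wA sm_end[OF _ ca1, of 1] sm_comp[OF cb1 Tpre_map[OF wA wfm_ar[OF wft_stest[OF zk] s]]] K x])
        (simp_all add: ue ca2 r(6) G_in Pt fin cb2 stalk_map[OF s A])
  qed
qed

text \<open>A homotopy inverse on the full function complexes of stalks need not preserve prescribed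
  base point values. The weak lifting property does pass to the relative situation, and
  \<open>heq_of_wrlp\<close> turns it back into a homotopy equivalence.\<close>

lemma stalk_heq:
  fixes Q :: "(('u smarr \<times> 'u) \<times> 'v) set sset" and A B :: "('u smobj, 'u smarr, 'v) spre"
    and E :: "(('u smarr \<times> 'u) \<times> 'v) set kt => (('u smarr \<times> 'u) \<times> 'v) set"
  assumes s: "spre_map (Sm X) A \<phi> B" and A: "PSm A" and B: "PSm B" and Q: "kan_complex Q" and zk: "zok Q z"
    and w: "sset_weq (St A) (St B) (nis_stalk_map X (A, \<phi>, B) Y y)" and E: "inj E"
  shows "heq (TF (stest Q z) B) (TF (stest Q z) A) (Tpre (stest Q z) A \<phi>)"
proof -
  let ?t = "stest Q z"
  have wA: "wfA ?t A" and wB: "wfA ?t B" by (rule wfA_stest[OF zk A], rule wfA_stest[OF zk B])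
  have sA: "is_sset (TF ?t A)" and sB: "is_sset (sset_prod (TF ?t B) I1)" using wA wB by simp_all
  note W = stalk_wrlp[OF s A B Q zk w E]
  show ?thesis
  proof (rule heq_of_wrlp[OF Tpre_map[OF wA wfm_ar[OF wft_stest[OF zk] s]] stest_kan[OF zk B Q] stest_kan[OF zk A Q]])
    have e: "sset_map (sub (TF ?t A) (\<lambda>_. {})) (TF ?t B) (\<lambda>_ _. undefined)" by (rule smI) auto
    have e2: "sset_map (sset_prod (sub (TF ?t A) (\<lambda>_. {})) I1) (TF ?t A) (\<lambda>_ _. undefined)" by (rule smI) auto
    obtain b' \<alpha>' where r: "sset_map (TF ?t A) (TF ?t B) b'" "sset_map (sset_prod (TF ?t A) I1) (TF ?t A) \<alpha>'"
      "\<And>n x. x \<in> cells (TF ?t A) n ==> \<alpha>' n (x, cD 0 n) = x"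
      "\<And>n x. x \<in> cells (TF ?t A) n ==> \<alpha>' n (x, cD 1 n) = Tpre ?t A \<phi> n (b' n x)"
      by (rule W[OF sA subc_empty sm_id e e2]) (auto intro: that)
    then show "\<exists>b' \<alpha>'. sset_map (TF ?t A) (TF ?t B) b' \<and> sset_map (sset_prod (TF ?t A) I1) (TF ?t A) \<alpha>' \<and>
      (\<forall>n. \<forall>x\<in>cells (TF ?t A) n. \<alpha>' n (x, cD 0 n) = x \<and> \<alpha>' n (x, cD 1 n) = Tpre ?t A \<phi> n (b' n x))" by blast
  next
    fix V x0 b \<alpha>
    assume h: "subc (sset_prod (TF ?t B) I1) V" "sset_map (sset_prod (TF ?t B) I1) (TF ?t A) x0"
      "sset_map (sub (sset_prod (TF ?t B) I1) V) (TF ?t B) b" "sset_map (sset_prod (sub (sset_prod (TF ?t B) I1) V) I1) (TF ?t A) \<alpha>"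
      and h0: "\<And>n x. x \<in> V n ==> \<alpha> n (x, cD 0 n) = x0 n x"
      and h1: "\<And>n x. x \<in> V n ==> \<alpha> n (x, cD 1 n) = Tpre ?t A \<phi> n (b n x)"
    obtain b' where "sset_map (sset_prod (TF ?t B) I1) (TF ?t B) b'" "\<And>n x. x \<in> V n ==> b' n x = b n x"
      by (rule W[OF sB h(1-4) h0 h1]) (auto intro: that)
    then show "\<exists>b'. sset_map (sset_prod (TF ?t B) I1) (TF ?t B) b' \<and> (\<forall>n. \<forall>x\<in>V n. b' n x = b n x)" by blast
  qed
qed

lemma stc_hom:
  assumes zk: "zok Q z" and A: "PSm A" and h: "sset_homotopic (simplex 0) (TF (stest Q z) A) \<phi> \<psi>"
  shows "sset_homotopic (St A) Q (\<lambda>n c. stc \<phi> n (c, cD 0 n)) (\<lambda>n c. stc \<psi> n (c, cD 0 n))"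
proof -
  obtain H where "htpy (simplex 0) (TF (stest Q z) A) \<phi> \<psi> H" by (rule homE[OF h])
  note H = htpyD[OF this]
  have S: "is_sset (sset_prod (simplex 0) I1)" by simp
  note sH = stc[OF zk A S H(1)]
  have p: "sset_map (simplex 0) (TF (stest Q z) A) \<phi>" "sset_map (simplex 0) (TF (stest Q z) A) \<psi>"
    by (rule hom_maps[OF h is_sset_simplex])+
  have c0: "cD 0 n \<in> cells (simplex 0) n" for n by simp
  have u: "unc H N n (a, cD 0 n, cD 0 n) = unc \<phi> N n (a, cD 0 n)" "unc H N n (a, cD 0 n, cD 1 n) = unc \<psi> N n (a, cD 0 n)" for N n a
    by (simp_all add: unc_def H(2,3)[OF c0])
  show ?thesis
  proof (rule homI[where h = "\<lambda>n (c, t). stc H n (c, cD 0 n, t)"])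
    show "sset_map (sset_prod (St A) I1) Q (\<lambda>n (c, t). stc H n (c, cD 0 n, t))"
    proof (rule sm_prodI)
      show "(case (c, t) of (c, t) => stc H n (c, cD 0 n, t)) \<in> cells Q n" if "c \<in> cells (St A) n" "t \<in> cells I1 n" for n c t
        using sm_prod_in[OF sH(3) that(1), of "(cD 0 n, t)"] that(2) by simp
      show "(case (act (St A) m n \<mu> c, act I1 m n \<mu> t) of (c, t) => stc H m (c, cD 0 m, t)) =
          act Q m n \<mu> (case (c, t) of (c, t) => stc H n (c, cD 0 n, t))"
        if "\<mu> \<in> Dmap m n" "c \<in> cells (St A) n" "t \<in> cells I1 n" for m n \<mu> c t
        using sm_prod_nat[OF sH(3) that(1,2), of "(cD 0 n, t)"] that(1,3) by simp
    qed
    show "(case (c, cD 0 n) of (c, t) => stc H n (c, cD 0 n, t)) = stc \<phi> n (c, cD 0 n)" if "c \<in> cells (St A) n" for n c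
      by (rule St_E[OF that]) (simp add: sH(1) stc(1)[OF zk A is_sset_simplex p(1)] u)
    show "(case (c, cD 1 n) of (c, t) => stc H n (c, cD 0 n, t)) = stc \<psi> n (c, cD 0 n)" if "c \<in> cells (St A) n" for n c
      by (rule St_E[OF that]) (simp add: sH(1) stc(1)[OF zk A is_sset_simplex p(2)] u)
  qed
qed

lemma cts_hom:
  assumes zk: "zok Q z" and A: "PSm A" and K: "sset_map (sset_prod (St A) I1) Q K"
    and b: "\<And>n N \<tau>. N \<in> J ==> \<tau> \<in> Dmap n 1 ==> K n (G A n N (bpt A (ov N) n), \<tau>) = z N n"
    and p: "sset_map (simplex 0) (TF (stest Q z) A) \<phi>" "sset_map (simplex 0) (TF (stest Q z) A) \<psi>"
    and e: "\<And>n N a. N \<in> J ==> a \<in> cells (sec A (ov N)) n ==> unc \<phi> N n (a, cD 0 n) = K n (G A n N a, cD 0 n)"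
      "\<And>n N a. N \<in> J ==> a \<in> cells (sec A (ov N)) n ==> unc \<psi> N n (a, cD 0 n) = K n (G A n N a, cD 1 n)"
  shows "sset_homotopic (simplex 0) (TF (stest Q z) A) \<phi> \<psi>"
proof -
  have S: "is_sset (sset_prod (simplex 0) I1)" by simp
  have K': "sset_map (sset_prod (St A) (sset_prod (simplex 0) I1)) Q (\<lambda>n (c, x, t). K n (c, t))"
    by (rule sm_prodI) (use sm_prod_in[OF K] sm_prod_nat[OF K] in auto)
  define H where "H = cts Q z A (sset_prod (simplex 0) I1) (\<lambda>n (c, x, t). K n (c, t))"
  have H1: "sset_map (sset_prod (simplex 0) I1) (TF (stest Q z) A) H"
    unfolding H_def by (rule cts(1)[OF zk A S K']) (use b in auto)
  have H2: "unc H N n (a, x, t) = K n (G A n N a, t)" if "N \<in> J" "a \<in> cells (sec A (ov N)) n" "x \<in> Dmap n 0" "t \<in> Dmap n 1" for N n a x t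
    using cts(2)[OF zk A S K' _ that(1,2), of "(x, t)"] b that(3,4) by (auto simp: H_def)
  have D0: "x = cD 0 n" if "x \<in> Dmap n 0" for x n using that by (auto simp: Dmap_iff fun_eq_iff)
  have ue: "unc (\<lambda>n x. H n (x, cD e n)) N n (a, x) = unc H N n (a, x, cD e n)" for e N n a x by (simp add: unc_def)
  note wA = wfA_stest[OF zk A]
  show ?thesis
  proof (rule homI[OF H1])
    fix n x assume x: "x \<in> cells (simplex 0) n"
    have 1: "unc (\<lambda>n x. H n (x, cD 0 n)) N k (a, \<zeta>) = unc \<phi> N k (a, \<zeta>)" "unc (\<lambda>n x. H n (x, cD 1 n)) N k (a, \<zeta>) = unc \<psi> N k (a, \<zeta>)"
      if "N \<in> J" "a \<in> cells (sec A (ov N)) k" "\<zeta> \<in> Dmap k 0" for N k a \<zeta>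
      using D0[OF that(3)] H2[OF that(1,2)] e[OF that(1,2)] by (simp_all add: ue)
    show "H n (x, cD 0 n) = \<phi> n x"
      by (rule TF_maps_eq[OF wA sm_end[OF _ H1, of 0] p(1) is_sset_simplex x]) (simp_all add: 1)
    show "H n (x, cD 1 n) = \<psi> n x"
      by (rule TF_maps_eq[OF wA sm_end[OF _ H1, of 1] p(2) is_sset_simplex x]) (simp_all add: 1)
  qed
qed

lemma zok_map:
  assumes A: "PSm A" and g: "sset_map (St A) Q g"
  shows "zok Q (\<lambda>N n. g n (G A n N (bpt A (ov N) n)))"
  unfolding zok_def
proof (intro conjI ballI allI impI)
  show "g n (G A n N (bpt A (ov N) n)) \<in> cells Q n" if "N \<in> J" for N n
    using sm_in[OF g G_in[OF that psD(6)[OF A J_ob[OF that]]]] .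
  show "act Q m n \<mu> (g n (G A n N (bpt A (ov N) n))) = g m (G A m N (bpt A (ov N) m))"
    if "N \<in> J" "\<mu> \<in> Dmap m n" for N m n \<mu>
    using sm_nat[OF g that(2) G_in[OF that(1) psD(6)[OF A J_ob[OF that(1)]]]] psD(7)[OF A J_ob[OF that(1)] that(2)]
    by (simp add: St_act[OF A that(2)])
  show "g n (G A n N' (bpt A (ov N') n)) = g n (G A n N (bpt A (ov N) n))" if "edge N' h N" for N' h N n
    using bpt_edge[OF A that] by simp
qed

text \<open>A map \<open>g\<close> out of a stalk determines its own base point values
  \<open>z\<close>, and the test with this \<open>z\<close> provides the extension along the map of
  stalks. For uniqueness, two maps may have different base point values, so \<open>inj_rel\<close>
  first replaces one of them; after that both are vertices of the function complex of one
  test.\<close>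

lemma heq_stalk:
  fixes A B :: "('u smobj, 'u smarr, 'v) spre"
  assumes s: "spre_map (Sm X) A \<phi> B" and A: "PSm A" and B: "PSm B"
    and h: "\<And>(Q :: (('u smarr \<times> 'u) \<times> 'v) set sset) z. kan_complex Q ==> zok Q z ==>
      heq (TF (stest Q z) B) (TF (stest Q z) A) (Tpre (stest Q z) A \<phi>)"
  shows "sset_weq (St A) (St B) (nis_stalk_map X (A, \<phi>, B) Y y)"
  unfolding sset_weq_def
proof (intro conjI allI impI)
  let ?f = "nis_stalk_map X (A, \<phi>, B) Y y"
  show f: "sset_map (St A) (St B) ?f" by (rule stalk_map_map[OF s A B])
  show SA: "is_sset (St A)" and SB: "is_sset (St B)" by (rule is_sset_St[OF A], rule is_sset_St[OF B])
  have fin: "\<phi> (ov N) n a \<in> cells (sec B (ov N)) n" if "N \<in> J" "a \<in> cells (sec A (ov N)) n" for N n a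
    using sm_in[OF smapD(1)[OF s J_ob[OF that(1)]] that(2)] .
  have c0: "cD 0 n \<in> cells (simplex 0) n" for n by simp
  fix Q :: "(('u smarr \<times> 'u) \<times> 'v) set sset" assume Q: "kan_complex Q"
  have pt: "sset_map (sset_prod S (simplex 0)) Q (\<lambda>n (c, x). g n c)" if "sset_map S Q g" for S :: "'x sset" and g
    using sm_comp[OF sm_fst that] by (simp add: case_prod_unfold)
  {
    fix g assume g: "sset_map (St A) Q g"
    define z where "z = (\<lambda>N n. g n (G A n N (bpt A (ov N) n)))"
    have zk: "zok Q z" unfolding z_def by (rule zok_map[OF A g])
    let ?t = "stest Q z"
    define p0 where "p0 = cts Q z A (simplex 0) (\<lambda>n (c, x). g n c)"
    have p01: "sset_map (simplex 0) (TF ?t A) p0"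
      unfolding p0_def by (rule cts(1)[OF zk A is_sset_simplex pt[OF g]]) (simp add: z_def)
    have p02: "unc p0 N n (a, cD 0 n) = g n (G A n N a)" if "N \<in> J" "a \<in> cells (sec A (ov N)) n" for N n a
      unfolding p0_def by (subst cts(2)[OF zk A is_sset_simplex pt[OF g] _ that]) (simp_all add: z_def)
    obtain \<sigma> where "hinv (TF ?t B) (TF ?t A) (Tpre ?t A \<phi>) \<sigma>" by (rule heqE[OF h[OF Q zk]])
    note \<sigma> = hinvD(2,4)[OF this]
    have q: "sset_map (simplex 0) (TF ?t B) (\<lambda>n x. \<sigma> n (p0 n x))" by (rule sm_comp[OF p01 \<sigma>(1)])
    have H: "sset_homotopic (simplex 0) (TF ?t A) (\<lambda>n x. Tpre ?t A \<phi> n (\<sigma> n (p0 n x))) p0" using hom_pre[OF \<sigma>(2) p01] .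
    have Hp: "sset_map (simplex 0) (TF ?t A) (\<lambda>n x. Tpre ?t A \<phi> n (\<sigma> n (p0 n x)))" by (rule hom_maps[OF H is_sset_simplex])
    let ?h = "\<lambda>n c. stc (\<lambda>n x. \<sigma> n (p0 n x)) n (c, cD 0 n)"
    have h1: "sset_map (St B) Q ?h"
      by (rule sm_comp[OF sm_pair[OF sm_id] stc(3)[OF zk B is_sset_simplex q]]) (rule smI, auto)
    have h2: "sset_homotopic (St A) Q (\<lambda>n c. ?h n (?f n c)) g"
    proof (rule hom_cong[OF stc_hom[OF zk A H]])
      fix n c assume c: "c \<in> cells (St A) n"
      obtain N a where N: "N \<in> J" "a \<in> cells (sec A (ov N)) n" "c = G A n N a" by (rule St_E[OF c])
      show "g n c = stc p0 n (c, cD 0 n)" using N p02 by (simp add: stc(1)[OF zk A is_sset_simplex p01])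
      show "?h n (?f n c) = stc (\<lambda>n x. Tpre ?t A \<phi> n (\<sigma> n (p0 n x))) n (c, cD 0 n)"
        using N Tpre_unc[of N ?t a A n \<phi> "\<lambda>n x. \<sigma> n (p0 n x)" "cD 0 n"]
        by (simp add: stc(1)[OF zk A is_sset_simplex Hp] stc(1)[OF zk B is_sset_simplex q] stalk_map[OF s A])
    qed
    show "\<exists>h. sset_map (St B) Q h \<and> sset_homotopic (St A) Q (\<lambda>n x. h n (?f n x)) g" using h1 h2 by blast
  }
  {
    fix h1 h' assume "sset_map (St B) Q h1 \<and> sset_map (St B) Q h' \<and>
      sset_homotopic (St A) Q (\<lambda>n x. h1 n (?f n x)) (\<lambda>n x. h' n (?f n x))"
    then have hh: "sset_map (St B) Q h1" "sset_map (St B) Q h'"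
      "sset_homotopic (St A) Q (\<lambda>n x. h1 n (?f n x)) (\<lambda>n x. h' n (?f n x))" by auto
    interpret R: relmap "St A" "St B" ?f "Db A" "Db B" Q by (rule relmap_stalk[OF s A B Q])
    obtain h'' K where r: "sset_homotopic (St B) Q h1 h''" "sset_map (St B) Q h''" "\<And>n y. y \<in> Db B n ==> h'' n y = h' n y"
      "sset_map (sset_prod (St A) I1) Q K" "\<And>n x. x \<in> cells (St A) n ==> K n (x, cD 0 n) = h'' n (?f n x)"
      "\<And>n x. x \<in> cells (St A) n ==> K n (x, cD 1 n) = h' n (?f n x)"
      "\<And>n x \<tau>. x \<in> Db A n ==> \<tau> \<in> Dmap n 1 ==> K n (x, \<tau>) = h' n (?f n x)" by (rule R.inj_rel[OF hh]) (rule that)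
    define z where "z = (\<lambda>N n. h' n (G B n N (bpt B (ov N) n)))"
    have zk: "zok Q z" unfolding z_def by (rule zok_map[OF B hh(2)])
    let ?t = "stest Q z"
    have zb: "g n (G B n N (bpt B (ov N) n)) = z N n" if "N \<in> J" "\<And>n y. y \<in> Db B n ==> g n y = h' n y" for g n N
      unfolding z_def by (rule that(2)[OF DbI[OF that(1)]])
    have pp: "sset_map (simplex 0) (TF ?t B) (cts Q z B (simplex 0) (\<lambda>n (c, x). g n c))"
      "\<And>N n a. N \<in> J ==> a \<in> cells (sec B (ov N)) n ==> unc (cts Q z B (simplex 0) (\<lambda>n (c, x). g n c)) N n (a, cD 0 n) = g n (G B n N a)"
      if g: "sset_map (St B) Q g" "\<And>n y. y \<in> Db B n ==> g n y = h' n y" for g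
    proof -
      have b: "(\<lambda>n (c, x :: nat => nat). g n c) n (G B n N (bpt B (ov N) n), \<xi>) = z N n" if "N \<in> J" for n N \<xi>
        using zb[OF that g(2)] by simp
      show "sset_map (simplex 0) (TF ?t B) (cts Q z B (simplex 0) (\<lambda>n (c, x). g n c))"
        by (rule cts(1)[OF zk B is_sset_simplex pt[OF g(1)] b])
      show "unc (cts Q z B (simplex 0) (\<lambda>n (c, x). g n c)) N n (a, cD 0 n) = g n (G B n N a)"
        if "N \<in> J" "a \<in> cells (sec B (ov N)) n" for N n a
        using cts(2)[OF zk B is_sset_simplex pt[OF g(1)] b that c0] by simp
    qed
    define q' where "q' = cts Q z B (simplex 0) (\<lambda>n (c, x). h' n c)"
    define q'' where "q'' = cts Q z B (simplex 0) (\<lambda>n (c, x). h'' n c)"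
    note q' = pp[OF hh(2) refl, folded q'_def] and q'' = pp[OF r(2,3), folded q''_def]
    obtain \<sigma> where "hinv (TF ?t B) (TF ?t A) (Tpre ?t A \<phi>) \<sigma>" by (rule heqE[OF h[OF Q zk]])
    note \<sigma> = hinvD(1-3)[OF this]
    have e: "sset_homotopic (simplex 0) (TF ?t A) (\<lambda>n x. Tpre ?t A \<phi> n (q'' n x)) (\<lambda>n x. Tpre ?t A \<phi> n (q' n x))"
    proof (rule cts_hom[OF zk A r(4) _ sm_comp[OF q''(1) \<sigma>(1)] sm_comp[OF q'(1) \<sigma>(1)]])
      have fb: "?f n (G A n N (bpt A (ov N) n)) = G B n N (bpt B (ov N) n)" if "N \<in> J" for n N
        using stalk_map[OF s A] smapD(3)[OF s J_ob[OF that]] by simp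
      show "K n (G A n N (bpt A (ov N) n), \<tau>) = z N n" if "N \<in> J" "\<tau> \<in> Dmap n 1" for n N \<tau>
        using r(7)[OF DbI[OF that(1)] that(2)] fb[OF that(1)] by (simp add: z_def)
      show "unc (\<lambda>n x. Tpre ?t A \<phi> n (q'' n x)) N n (a, cD 0 n) = K n (G A n N a, cD 0 n)"
        if "N \<in> J" "a \<in> cells (sec A (ov N)) n" for n N a
        using that Tpre_unc[of N ?t a A n \<phi> q'' "cD 0 n"] by (simp add: r(5) G_in stalk_map[OF s A] q''(2) fin)
      show "unc (\<lambda>n x. Tpre ?t A \<phi> n (q' n x)) N n (a, cD 0 n) = K n (G A n N a, cD 1 n)"
        if "N \<in> J" "a \<in> cells (sec A (ov N)) n" for n N a
        using that Tpre_unc[of N ?t a A n \<phi> q' "cD 0 n"] by (simp add: r(6) G_in stalk_map[OF s A] q'(2) fin)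
    qed
    have kB: "kan_complex (TF ?t B)" by (rule stest_kan[OF zk B Q])
    have "sset_homotopic (simplex 0) (TF ?t B) q'' q'"
      using hom_trans[OF kB is_sset_simplex hom_sym[OF kB is_sset_simplex hom_pre[OF \<sigma>(3) q''(1)]]
        hom_trans[OF kB is_sset_simplex hom_post[OF e \<sigma>(2)] hom_pre[OF \<sigma>(3) q'(1)]]] .
    then have "sset_homotopic (St B) Q (\<lambda>n c. stc q'' n (c, cD 0 n)) (\<lambda>n c. stc q' n (c, cD 0 n))" by (rule stc_hom[OF zk B])
    then have "sset_homotopic (St B) Q h'' h'"
    proof (rule hom_cong)
      fix n c assume c: "c \<in> cells (St B) n"
      obtain N a where N: "N \<in> J" "a \<in> cells (sec B (ov N)) n" "c = G B n N a" by (rule St_E[OF c])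
      show "h'' n c = stc q'' n (c, cD 0 n)" using N q''(2) by (simp add: stc(1)[OF zk B is_sset_simplex q''(1)])
      show "h' n c = stc q' n (c, cD 0 n)" using N q'(2) by (simp add: stc(1)[OF zk B is_sset_simplex q'(1)])
    qed
    then show "sset_homotopic (St B) Q h1 h'" by (rule hom_trans[OF Q SB r(1)])
  }
qed

end

text \<open>The complexes \<open>Q\<close> are over the type of the stalks, as in the definition of
  \<open>sset_weq\<close> for these stalks.\<close>

definition nisT :: "'u sch => ('u smarr \<times> 'u, ('u smarr \<times> 'u) \<times> 'u smarr \<times> ('u smarr \<times> 'u), 'u smobj, 'u smarr,
    (('u smarr \<times> 'u) \<times> 'u smarr option) set) tst set" where
  "nisT X = {stk.stest X Y y Q z | Y y Q z. Y \<in> Ob (Sm X) \<and> y \<in> topspace (spc (fst Y)) \<and> kan_complex Q \<and> stk.zok X Y y Q z}"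

subsection \<open>Cardinalities\<close>

lemma pair_inj:
  assumes "infinite (UNIV :: 'b set)"
  obtains p :: "'b \<times> 'b => 'b" where "inj p"
proof -
  have "(card_of (UNIV \<times> UNIV :: ('b \<times> 'b) set), card_of (UNIV :: 'b set)) \<in> ordLeq"
    using card_of_Times_same_infinite[OF assms] ordIso_imp_ordLeq by blast
  then show thesis using that unfolding card_of_ordLeq[symmetric] by auto
qed

lemma ex_enc:
  assumes "inj (h :: (nat => nat) => 'v)"
  obtains enc :: "'v \<times> (nat => nat) => 'v" where "inj enc"
proof -
  have "inj (\<lambda>n :: nat. h (\<lambda>_. n))" using assms by (auto simp: inj_def fun_eq_iff)
  then have "infinite (UNIV :: 'v set)" using finite_imageD[OF finite_subset[OF subset_UNIV]] by blast
  then obtain p :: "'v \<times> 'v => 'v" where p: "inj p" by (rule pair_inj)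
  have "inj (\<lambda>(v, f). p (v, h f))"
    by (rule injI) (auto dest!: injD[OF p] injD[OF assms])
  then show thesis by (rule that)
qed

text \<open>A term becomes a sequence: place \<open>0\<close> holds the constructor, places
  \<open>1\<close> and \<open>2\<close> the numbers \<open>N\<close> and \<open>k\<close>, the even
  places from \<open>4\<close> on the values of \<mu>, and the odd places from \<open>3\<close> on
  the codes of the subterms.\<close>

primrec ktenc :: "((nat => 'a) => 'a) => (nat => 'a) => 'a kt => 'a" where
  "ktenc P \<nu> (KB x) = P (\<lambda>i. if i = 0 then \<nu> 0 else x)"
| "ktenc P \<nu> (KF N k h \<mu>) = P (\<lambda>i. if i = 0 then \<nu> 1 else if i = 1 then \<nu> N else if i = 2 then \<nu> k
     else if even i then \<nu> (\<mu> (i div 2 - 2)) else ktenc P \<nu> (h (i div 2 - 1)))"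

lemma inj_ktenc:
  assumes P: "inj P" and \<nu>: "inj \<nu>"
  shows "inj (ktenc P \<nu>)"
proof (rule injI)
  have \<nu>e: "\<nu> a = \<nu> b \<longleftrightarrow> a = b" for a b using \<nu> by (auto dest: injD)
  have Pe: "P f = P g ==> f i = g i" for f g i using P by (auto dest: injD)
  fix x y :: "'a kt" assume "ktenc P \<nu> x = ktenc P \<nu> y"
  then show "x = y"
  proof (induction x arbitrary: y)
    case (KB x)
    show ?case
    proof (cases y)
      case (KB x') then show ?thesis using Pe[OF KB.prems[unfolded KB ktenc.simps], of 1] by simp
    next
      case (KF N k h \<mu>) then show ?thesis using Pe[OF KB.prems[unfolded KF ktenc.simps], of 0] \<nu>e by simp
    qed
  next
    case (KF N k h \<mu>)
    show ?case
    proof (cases y)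
      case (KB x') then show ?thesis using Pe[OF KF.prems[unfolded KB ktenc.simps], of 0] \<nu>e by simp
    next
      case (KF N' k' h' \<mu>')
      note e = Pe[OF KF.prems[unfolded KF ktenc.simps]]
      have "h j = h' j" for j
      proof (rule KF.IH)
        show "ktenc P \<nu> (h j) = ktenc P \<nu> (h' j)" using e[of "2 * j + 3"] by simp
      qed simp
      moreover have "\<mu> j = \<mu>' j" for j using e[of "2 * j + 4"] \<nu>e by simp
      ultimately show ?thesis using e[of 1] e[of 2] \<nu>e KF by (auto simp: fun_eq_iff)
    qed
  qed
qed

text \<open>Sets over an infinite type can code sequences of such sets. Simplices of stalks are
  germs, that is, sets of representatives, so the coding of \<open>kt\<close> is available for
  them.\<close>

lemma ex_ktenc:
  assumes "infinite (UNIV :: 'b set)"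
  obtains E :: "'b set kt => 'b set" where "inj E"
proof -
  obtain e :: "nat => 'b" where e: "inj e" using infinite_countable_subset[OF assms] by auto
  obtain p :: "'b \<times> 'b => 'b" where p: "inj p" by (rule pair_inj[OF assms])
  have pe: "p (a, b) = p (a', b') \<longleftrightarrow> a = a' \<and> b = b'" "e n = e m \<longleftrightarrow> n = m" for a b a' b' n m
    using p e by (auto dest: injD)
  have 1: "inj (\<lambda>f :: nat => 'b set. {p (e n, b) | n b. b \<in> f n})"
  proof (rule injI)
    fix f g :: "nat => 'b set" assume fg: "{p (e n, b) | n b. b \<in> f n} = {p (e n, b) | n b. b \<in> g n}"
    have "f n = g n" for n
    proof -
      have "b \<in> f n \<longleftrightarrow> p (e n, b) \<in> {p (e n, b) | n b. b \<in> f n}" for b by (simp add: pe)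
      moreover have "b \<in> g n \<longleftrightarrow> p (e n, b) \<in> {p (e n, b) | n b. b \<in> g n}" for b by (simp add: pe)
      ultimately show ?thesis using fg by blast
    qed
    then show "f = g" by blast
  qed
  have 2: "inj (\<lambda>n. {e n})" using e by (auto simp: inj_def)
  show thesis by (rule that[OF inj_ktenc[OF 1 2]])
qed

lemma universe_infinite: "universe (u :: 'u itself) ==> infinite (UNIV :: 'u set)"
  unfolding universe_def using finite_subset[OF subset_UNIV] by blast

lemma ex_Sm_enc:
  assumes "infinite (UNIV :: 'u set)"
  obtains enc :: "'u smarr option \<times> (nat => nat) => 'u smarr option" where "inj enc"
proof -
  obtain e :: "nat => 'u" where e: "inj e" using infinite_countable_subset[OF assms] by auto
  \<comment> \<open>A function on \<open>nat\<close> is stored in the point map of a record of type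
    \<open>'u smor\<close>; only its type matters, not that it is a morphism.\<close>
  let ?h = "\<lambda>f :: nat => nat. Some (undefined :: 'u smobj, \<lparr>pmap = \<lambda>x. e (f (inv_into UNIV e x)), smap = \<lambda>_ _. undefined\<rparr> :: 'u smor, undefined :: 'u smobj)"
  have "inj ?h"
  proof (rule injI)
    fix f g assume "?h f = ?h g"
    then have "(\<lambda>x. e (f (inv_into UNIV e x))) = (\<lambda>x. e (g (inv_into UNIV e x)))" by simp
    then have "e (f (inv_into UNIV e (e n))) = e (g (inv_into UNIV e (e n)))" for n by (rule fun_cong)
    then show "f = g" using e by (auto simp: inj_eq fun_eq_iff)
  qed
  then show thesis by (rule ex_enc) (rule that)
qed

lemma site_Sm:
  assumes "inj enc" "infinite (UNIV :: 'u set)"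
  shows "site TYPE('u) (Sm (X :: 'u sch)) enc"
  by unfold_locales (use assms in \<open>auto simp: Sm_def\<close>)

lemma nis_local_Wt:
  fixes X :: "'u sch" and enc :: "'u smarr option \<times> (nat => nat) => 'u smarr option"
  assumes inf: "infinite (UNIV :: 'u set)" and enc: "inj enc"
  shows "nis_local_weqs X = site.Wt (Sm X) TYPE('u) (nisT X)" and "site.good TYPE('u smarr option) (Sm X) TYPE('u) (nisT X)"
proof -
  interpret S: site "Sm X" "TYPE('u)" enc by (rule site_Sm[OF enc inf])
  have "inj (\<lambda>u. ((undefined :: 'u smarr, u :: 'u), undefined :: 'u smarr option))" by (rule injI) simp
  then have "infinite (UNIV :: (('u smarr \<times> 'u) \<times> 'u smarr option) set)"
    using finite_imageD[OF finite_subset[OF subset_UNIV]] inf by blast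
  then obtain E :: "(('u smarr \<times> 'u) \<times> 'u smarr option) set kt => (('u smarr \<times> 'u) \<times> 'u smarr option) set" where E: "inj E"
    by (rule ex_ktenc)
  show "S.good (nisT X)"
    unfolding S.good_def
  proof (intro ballI conjI allI impI)
    fix t :: "('u smarr \<times> 'u, ('u smarr \<times> 'u) \<times> 'u smarr \<times> ('u smarr \<times> 'u), 'u smobj, 'u smarr,
      (('u smarr \<times> 'u) \<times> 'u smarr option) set) tst"
    assume "t \<in> nisT X"
    then obtain Y y Q z where t: "t = stk.stest X Y y Q z" "kan_complex Q" "stk.zok X Y y Q z" unfolding nisT_def by blast
    show "wft (Sm X) t" unfolding t(1) by (rule stk.wft_stest[OF t(3)])
    show "kan_complex (TF t A)" if "S.PS A" for A unfolding t(1) by (rule stk.stest_kan[OF t(3) that t(2)])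
  qed
  show "nis_local_weqs X = S.Wt (nisT X)"
  proof (rule Set.set_eqI)
    fix f :: "'u mar"
    obtain A \<phi> B where f: "f = (A, \<phi>, B)" by (cases f)
    show "f \<in> nis_local_weqs X \<longleftrightarrow> f \<in> S.Wt (nisT X)"
    proof
      assume "f \<in> nis_local_weqs X"
      then have ar: "(A, \<phi>, B) \<in> Ar S.M" and w: "\<And>Y y. Y \<in> Ob (Sm X) ==> y \<in> topspace (spc (fst Y)) ==>
          sset_weq (nis_stalk X A Y y) (nis_stalk X B Y y) (nis_stalk_map X (A, \<phi>, B) Y y)"
        by (simp_all add: nis_local_weqs_def Mot_def f)
      note d = S.ArD[OF ar]
      show "f \<in> S.Wt (nisT X)"
        unfolding f S.Wt_iff
      proof (intro conjI ballI ar)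
        fix t assume "t \<in> nisT X"
        then obtain Y y Q z where t: "t = stk.stest X Y y Q z" "Y \<in> Ob (Sm X)" "y \<in> topspace (spc (fst Y))" "kan_complex Q"
          "stk.zok X Y y Q z" unfolding nisT_def by blast
        show "heq (TF t B) (TF t A) (Tpre t A \<phi>)" unfolding t(1) by (rule stk.stalk_heq[OF d(3,1,2) t(4,5) w[OF t(2,3)] E])
      qed
    next
      assume "f \<in> S.Wt (nisT X)"
      then have ar: "(A, \<phi>, B) \<in> Ar S.M" and w: "\<And>t. t \<in> nisT X ==> heq (TF t B) (TF t A) (Tpre t A \<phi>)"
        by (simp_all add: S.Wt_iff f)
      note d = S.ArD[OF ar]
      show "f \<in> nis_local_weqs X"
        unfolding nis_local_weqs_def Mot_def f mem_Collect_eq fst_conv snd_conv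
      proof (intro conjI ballI ar stk.heq_stalk[OF d(3,1,2)])
        fix Y y z and Q :: "(('u smarr \<times> 'u) \<times> 'u smarr option) set sset"
        assume "Y \<in> Ob (Sm X)" "y \<in> topspace (spc (fst Y))" "kan_complex Q" "stk.zok X Y y Q z"
        then have "stk.stest X Y y Q z \<in> nisT X" unfolding nisT_def by blast
        then show "heq (TF (stk.stest X Y y Q z) B) (TF (stk.stest X Y y Q z) A) (Tpre (stk.stest X Y y Q z) A \<phi>)" by (rule w)
      qed
    qed
  qed
qed

text \<open>The two composites equip \<open>v\<close> with a right and a left homotopy inverse, as
  in the two-out-of-six property.\<close>

lemma heq_middle:
  assumes k: "kan_complex A" "kan_complex B" "kan_complex C" "kan_complex D"
    and u: "sset_map A B u" and v: "sset_map B C v" and w: "sset_map C D w"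
    and vu: "heq A C (\<lambda>n x. v n (u n x))" and wv: "heq B D (\<lambda>n x. w n (v n x))"
  shows "heq B C v"
proof -
  note B = kanD(1)[OF k(2)]
  obtain s where "hinv A C (\<lambda>n x. v n (u n x)) s" by (rule heqE[OF vu])
  note s = hinvD(2,4)[OF this]
  obtain s' where "hinv B D (\<lambda>n x. w n (v n x)) s'" by (rule heqE[OF wv])
  note s' = hinvD(2,3)[OF this]
  have r: "sset_map C B (\<lambda>n x. u n (s n x))" by (rule sm_comp[OF s(1) u])
  have l: "sset_map C B (\<lambda>n x. s' n (w n x))" by (rule sm_comp[OF w s'(1)])
  have rv: "sset_map B B (\<lambda>n x. u n (s n (v n x)))" by (rule sm_comp[OF v r])
  show ?thesis
  proof (rule heqI[OF v r _ s(2)])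
    show "sset_homotopic B B (\<lambda>n x. u n (s n (v n x))) (\<lambda>n x. x)"
      using hom_trans[OF k(2) B hom_sym[OF k(2) B hom_pre[OF s'(2) rv]] hom_trans[OF k(2) B hom_post[OF hom_pre[OF s(2) v] l] s'(2)]] .
  qed
qed

context site
begin

lemma Wt_middle:
  assumes T: "good T" and e: "(A, e, B) \<in> Ar M" and g: "(B, g, D) \<in> Ar M" and k: "(D, k, F) \<in> Ar M"
    and ge: "(A, spre_ext C A (\<lambda>Y n x. g Y n (e Y n x)), D) \<in> Wt T"
    and kg: "(B, spre_ext C B (\<lambda>Y n x. k Y n (g Y n x)), F) \<in> Wt T"
  shows "(B, g, D) \<in> Wt T"
  unfolding Wt_iff
proof (intro conjI ballI g)
  fix t assume t: "t \<in> T"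
  note w = goodD(1)[OF T t]
  have m: "sset_map (TF t Q) (TF t P) (Tpre t P \<upsilon>)" if "(P, \<upsilon>, Q) \<in> Ar M" for P Q \<upsilon>
    using Tpre_map[OF wfA_ps[OF w ArD(1)[OF that]] wfm_ar[OF w ArD(3)[OF that]]] .
  show "heq (TF t D) (TF t B) (Tpre t B g)"
  proof (rule heq_middle[OF goodD(2)[OF T t ArD(2)[OF k]] goodD(2)[OF T t ArD(1)[OF k]] goodD(2)[OF T t ArD(1)[OF g]]
      goodD(2)[OF T t ArD(1)[OF e]] m[OF k] m[OF g] m[OF e]])
    show "heq (TF t F) (TF t B) (\<lambda>n x. Tpre t B g n (Tpre t D k n x))"
      unfolding Tpre_comp[OF w g] using kg t by (simp add: Wt_iff)
    show "heq (TF t D) (TF t A) (\<lambda>n x. Tpre t A e n (Tpre t B g n x))"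
      unfolding Tpre_comp[OF w e] using ge t by (simp add: Wt_iff)
  qed
qed

lemma spre_ext_Ar:
  assumes "(A, \<phi>, B) \<in> Ar M" "\<And>Y n x. Y \<in> Ob C ==> x \<in> cells (sec A Y) n ==> \<psi> Y n x = \<phi> Y n x"
  shows "spre_ext C A \<psi> = \<phi>"
  using smapD(4)[OF ArD(3)[OF assms(1)]] assms(2) by (auto simp: spre_ext_def fun_eq_iff)

subsection \<open>Maps homotopic to the identity\<close>

text \<open>A pointed homotopy from the identity to \<chi>; no class of weak equivalences occurs in
  it, which makes it transferable between classes.\<close>

definition hid :: "('o, 'a, 'v) spre => ('o => nat => 'v => 'v) => bool" where
  "hid E \<chi> \<longleftrightarrow> (\<exists>h. gf (mt C E) E I1 h \<and> (\<forall>Y\<in>Ob C. \<forall>m. \<forall>x\<in>cells (sec E Y) m.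
     h Y m (x, cD 0 m) = x \<and> h Y m (x, cD 1 m) = \<chi> Y m x))"

text \<open>Both ends of the cylinder of the identity are weak equivalences for any good
  \<open>T\<close>. The homotopy is an arrow out of this cylinder which is the identity at one end,
  hence a weak equivalence, and \<chi> at the other end.\<close>

lemma hid_Wt:
  assumes T: "good T" and c: "(E, \<chi>, E) \<in> Ar M" and hi: "hid E \<chi>"
  shows "(E, \<chi>, E) \<in> Wt T"
proof -
  obtain h where h: "gf (mt C E) E I1 h" "\<And>Y m x. Y \<in> Ob C ==> x \<in> cells (sec E Y) m ==> h Y m (x, cD 0 m) = x"
    "\<And>Y m x. Y \<in> Ob C ==> x \<in> cells (sec E Y) m ==> h Y m (x, cD 1 m) = \<chi> Y m x"
    using hi unfolding hid_def by blast
  have E: "PS E" by (rule ArD(1)[OF c])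
  let ?i = "spre_ext C E (\<lambda>Y n x. x)"
  have i: "(E, ?i, E) \<in> Ar M" by (rule id_Ar[OF E])
  obtain k where k: "(Cyl (E, ?i, E), k, E) \<in> Ar M"
    "\<And>Y m x. Y \<in> Ob C ==> x \<in> cells (sec E Y) m ==> k Y m (cB x) = \<chi> Y m x"
    "\<And>Y m a t. Y \<in> Ob C ==> a \<in> cells (sec E Y) m ==> t \<in> Dmap m 1 ==> k Y m (cA E ?i Y m (a, t)) = h Y m (a, t)"
    by (rule cyl_arr[OF i c h(1)]) (auto simp: h intro: that)
  have 1: "(E, ?i, E) = Cmp M (Cyl (E, ?i, E), k, E) (E, iA (E, ?i, E), Cyl (E, ?i, E))"
    using k(3) h(2) by (auto simp: iA_def fun_eq_iff spre_ext_def)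
  have 2: "(E, \<chi>, E) = Cmp M (Cyl (E, ?i, E), k, E) (E, iB (E, ?i, E), Cyl (E, ?i, E))"
    using spre_ext_Ar[OF c, of "\<lambda>Y n x. k Y n (iB (E, ?i, E) Y n x)"] k(2) by (simp add: iB_def)
  have "(Cyl (E, ?i, E), k, E) \<in> Wt T" by (rule Wt_comp(3)[OF T iA_Ar[OF i] k(1) 1 Wt_iA[OF T Wt_id[OF T E]] Wt_id[OF T E]])
  then show ?thesis by (rule Wt_comp(1)[OF T iB_Ar[OF i] k(1) 2 Wt_iB[OF T i]])
qed

end

text \<open>From here on the terminal presheaf \<open>pt_spre\<close> occurs, which fixes the value
  type to an option type.\<close>

locale psite = site C u enc for C :: "('o, 'a) cat" and u :: "'u itself" and enc :: "'a option \<times> (nat => nat) => 'a option"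
begin

subsection \<open>Fibrations\<close>

lemma PS_pt: "PS (pt_spre :: ('o, 'a) ppre)"
  by (rule psI) (auto simp: pt_spre_def is_sset_def sset_map_def intro: small_finite[OF infU])

lemma to_pt_Ar: "PS A ==> to_pt C A \<in> Ar M"
proof -
  assume A: "PS A"
  have "spre_map C A (spre_ext C A (\<lambda>Y n x. None)) pt_spre"
    unfolding spre_map_def
    by (auto simp: sset_map_def spre_ext_def pt_spre_def psD[OF A] ss_act[OF psD(1)[OF A]] DomOb CodOb sm_in[OF psD(3)[OF A]])
  then show ?thesis using A PS_pt by (simp add: to_pt_def Ar_sPre)
qed

lemma pt_arr_eq:
  assumes "(P, \<phi>, pt_spre) \<in> Ar M" "(P, \<psi>, pt_spre) \<in> Ar M"
  shows "\<phi> = (\<psi> :: 'o => nat => 'a option => 'a option)"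
proof (rule spre_map_eqI[OF ArD(3)[OF assms(1)] ArD(3)[OF assms(2)]])
  fix Y n x assume "Y \<in> Ob C" "x \<in> cells (sec P Y) n"
  then show "\<phi> Y n x = \<psi> Y n x"
    using sm_in[OF smapD(1)[OF ArD(3)[OF assms(1)]]] sm_in[OF smapD(1)[OF ArD(3)[OF assms(2)]]] by (simp add: pt_spre_def)
qed

lemma fibsD:
  assumes p: "(E, p, B) \<in> fibs u C W" and i: "(P, \<iota>, Q) \<in> spre_monos u C" "(P, \<iota>, Q) \<in> W"
    and a: "(P, a, E) \<in> Ar M" and b: "(Q, b, B) \<in> Ar M"
    and c: "\<And>Y n x. Y \<in> Ob C ==> x \<in> cells (sec P Y) n ==> p Y n (a Y n x) = b Y n (\<iota> Y n x)"
  obtains h where "(Q, h, E) \<in> Ar M"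
    "\<And>Y n x. Y \<in> Ob C ==> x \<in> cells (sec P Y) n ==> h Y n (\<iota> Y n x) = a Y n x"
    "\<And>Y n x. Y \<in> Ob C ==> x \<in> cells (sec Q Y) n ==> p Y n (h Y n x) = b Y n x"
proof -
  have "has_lift M (P, \<iota>, Q) (E, p, B)" using p i by (simp add: fibs_def triv_cofs_def)
  moreover have "(P, a, E) \<in> homs M P E" "(Q, b, B) \<in> homs M Q B" using a b by (simp_all add: homs_def)
  moreover have "Cmp M (E, p, B) (P, a, E) = Cmp M (Q, b, B) (P, \<iota>, Q)" using c by (auto simp: spre_ext_def fun_eq_iff)
  ultimately obtain h where h: "h \<in> homs M Q E" "Cmp M h (P, \<iota>, Q) = (P, a, E)" "Cmp M (E, p, B) h = (Q, b, B)"
    unfolding has_lift_def by fastforce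
  obtain h' where h': "h = (Q, h', E)" using h(1) by (cases h) (auto simp: homs_def)
  have 1: "spre_ext C P (\<lambda>Y n x. h' Y n (\<iota> Y n x)) = a" "spre_ext C Q (\<lambda>Y n x. p Y n (h' Y n x)) = b"
    using h(2,3) by (simp_all add: h')
  show thesis
  proof (rule that[of h'])
    show "(Q, h', E) \<in> Ar M" using h(1) by (simp add: h' homs_def)
    show "h' Y n (\<iota> Y n x) = a Y n x" if "Y \<in> Ob C" "x \<in> cells (sec P Y) n" for Y n x
      unfolding 1(1)[symmetric] using that by simp
    show "p Y n (h' Y n x) = b Y n x" if "Y \<in> Ob C" "x \<in> cells (sec Q Y) n" for Y n x
      unfolding 1(2)[symmetric] using that by simp
  qed
qed

lemma fibs_exto:
  assumes Z: "to_pt C Z \<in> fibs u C W" "PS Z"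
  shows "exto W Z"
  unfolding exto_def
proof (intro conjI allI impI)
  fix P \<iota> Q \<upsilon> assume i: "(P, \<iota>, Q) \<in> spre_monos u C \<inter> W" and v: "(P, \<upsilon>, Z) \<in> Ar M"
  have ia: "(P, \<iota>, Q) \<in> Ar M" using i by (simp add: spre_monos_def)
  show "\<exists>\<omega>. (Q, \<omega>, Z) \<in> Ar M \<and> (\<forall>Y\<in>Ob C. \<forall>n. \<forall>x\<in>cells (sec P Y) n. \<omega> Y n (\<iota> Y n x) = \<upsilon> Y n x)"
  proof (rule fibsD[OF Z(1)[unfolded to_pt_def] _ _ v to_pt_Ar[OF ArD(2)[OF ia], unfolded to_pt_def]])
    show "spre_ext C Z (\<lambda>Y n x. None) Y n (\<upsilon> Y n x) = spre_ext C Q (\<lambda>Y n x. None) Y n (\<iota> Y n x)"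
      if "Y \<in> Ob C" "x \<in> cells (sec P Y) n" for Y n x
      using that sm_in[OF smapD(1)[OF ArD(3)[OF v]]] sm_in[OF smapD(1)[OF ArD(3)[OF ia]]] by simp
  qed (use i in auto)
qed (rule Z(2))

lemma pt_fib: "to_pt C pt_spre \<in> fibs u C W"
proof -
  have a: "to_pt C pt_spre \<in> Ar M" by (rule to_pt_Ar[OF PS_pt])
  have "has_lift M i (to_pt C pt_spre)" if "i \<in> triv_cofs u C W" for i
    unfolding has_lift_def
  proof (intro ballI impI)
    obtain P \<iota> Q where i: "i = (P, \<iota>, Q)" by (cases i)
    have ia: "(P, \<iota>, Q) \<in> Ar M" using that by (simp add: i triv_cofs_def spre_monos_def)
    fix a b assume a: "a \<in> homs M (Dom M i) (Dom M (to_pt C pt_spre))" and b: "b \<in> homs M (Cod M i) (Cod M (to_pt C pt_spre))"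
    obtain a' where a': "a = (P, a', pt_spre)" using a by (cases a) (auto simp: homs_def i to_pt_def)
    obtain b' where b': "b = (Q, b', pt_spre)" using b by (cases b) (auto simp: homs_def i to_pt_def)
    have aA: "(P, a', pt_spre) \<in> Ar M" and bA: "(Q, b', pt_spre) \<in> Ar M" using a b by (simp_all add: homs_def a' b' i)
    have p: "(pt_spre, spre_ext C pt_spre (\<lambda>Y n x. None), pt_spre) \<in> Ar M" using to_pt_Ar[OF PS_pt] by (simp add: to_pt_def)
    show "\<exists>h\<in>homs M (Cod M i) (Dom M (to_pt C pt_spre)). Cmp M h i = a \<and> Cmp M (to_pt C pt_spre) h = b"
    proof (intro bexI[of _ b] conjI)
      show "Cmp M b i = a" using pt_arr_eq[OF comp_Ar[OF ia bA] aA] by (simp add: i a' b')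
      show "Cmp M (to_pt C pt_spre) b = b" using pt_arr_eq[OF comp_Ar[OF bA p] bA] by (simp add: b' to_pt_def)
      show "b \<in> homs M (Cod M i) (Dom M (to_pt C pt_spre))" using b by (simp add: to_pt_def)
    qed
  qed
  then show ?thesis using a by (simp add: fibs_def)
qed

lemma to_pt_comp_fib:
  assumes p: "(E, p, B) \<in> fibs u C W" and B: "to_pt C B \<in> fibs u C W"
  shows "to_pt C E \<in> fibs u C W"
proof -
  have pA: "(E, p, B) \<in> Ar M" using p by (simp add: fibs_def)
  note E = ArD(1)[OF pA] and PB = ArD(2)[OF pA]
  have "has_lift M i (to_pt C E)" if i: "i \<in> triv_cofs u C W" for i
    unfolding has_lift_def
  proof (intro ballI impI)
    obtain P \<iota> Q where ii: "i = (P, \<iota>, Q)" by (cases i)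
    have ia: "(P, \<iota>, Q) \<in> Ar M" "(P, \<iota>, Q) \<in> spre_monos u C" "(P, \<iota>, Q) \<in> W" using i by (auto simp: ii triv_cofs_def spre_monos_def)
    fix a b assume a: "a \<in> homs M (Dom M i) (Dom M (to_pt C E))" and b: "b \<in> homs M (Cod M i) (Cod M (to_pt C E))"
    obtain a' where a': "a = (P, a', E)" using a by (cases a) (auto simp: homs_def ii to_pt_def)
    obtain b' where b': "b = (Q, b', pt_spre)" using b by (cases b) (auto simp: homs_def ii to_pt_def)
    have aA: "(P, a', E) \<in> Ar M" and bA: "(Q, b', pt_spre) \<in> Ar M" using a b by (simp_all add: homs_def a' b' ii)
    obtain \<omega> where w: "(Q, \<omega>, B) \<in> Ar M"
      "\<And>Y n x. Y \<in> Ob C ==> x \<in> cells (sec P Y) n ==> \<omega> Y n (\<iota> Y n x) = spre_ext C P (\<lambda>Y n x. p Y n (a' Y n x)) Y n x"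
      using fibs_exto[OF B PB] ia comp_Ar[OF aA pA] unfolding exto_def by blast
    obtain h where h: "(Q, h, E) \<in> Ar M"
      "\<And>Y n x. Y \<in> Ob C ==> x \<in> cells (sec P Y) n ==> h Y n (\<iota> Y n x) = a' Y n x"
      by (rule fibsD[OF p ia(2,3) aA w(1)]) (simp add: w(2), rule that)
    have e: "(E, spre_ext C E (\<lambda>Y n x. None), pt_spre) \<in> Ar M" using to_pt_Ar[OF E] by (simp add: to_pt_def)
    show "\<exists>h\<in>homs M (Cod M i) (Dom M (to_pt C E)). Cmp M h i = a \<and> Cmp M (to_pt C E) h = b"
    proof (intro bexI[of _ "(Q, h, E)"] conjI)
      show "Cmp M (Q, h, E) i = a" using spre_ext_Ar[OF aA, of "\<lambda>Y n x. h Y n (\<iota> Y n x)"] h(2) by (simp add: ii a')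
      show "Cmp M (to_pt C E) (Q, h, E) = b" using pt_arr_eq[OF comp_Ar[OF h(1) e] bA] by (simp add: b' to_pt_def)
      show "(Q, h, E) \<in> homs M (Cod M i) (Dom M (to_pt C E))" using h(1) by (simp add: ii to_pt_def homs_def)
    qed
  qed
  then show ?thesis using to_pt_Ar[OF E] by (simp add: fibs_def)
qed

subsection \<open>Bousfield localizations\<close>

text \<open>Mapping spaces into local objects are Kan complexes by \<open>map_space_kan\<close>, so
  they can serve as tests in turn; this is what allows localizations to be iterated.\<close>

definition locT :: "('o, 'a) parr set => ('o, 'a) parr set => ('o, 'a, 'o, 'a, 'a option) tst set" where
  "locT W S = {mt C Z | Z. local_object u C W S Z}"

lemma local_exto: "local_object u C W S Z ==> exto W Z"
  using fibs_exto by (simp add: local_object_def)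

lemma good_locT:
  assumes T: "good T"
  shows "good (locT (Wt T) S)"
  unfolding good_def locT_def using wftmt map_space_kan[OF T local_exto] by (auto simp: local_object_def)

text \<open>Between Kan complexes \<open>sset_weq\<close> and \<open>heq\<close> agree; the
  localization is defined with the former, and \<open>Wt\<close> with the latter.\<close>

lemma bousfield_Wt:
  assumes T: "good T"
  shows "bousfield_weqs u C (Wt T) S = Wt (locT (Wt T) S)"
proof (rule Set.set_eqI)
  fix f :: "('o, 'a) parr"
  obtain A \<phi> B where f: "f = (A, \<phi>, B)" by (cases f)
  have "map_space_weq C (A, \<phi>, B) Z \<longleftrightarrow> heq (TF (mt C Z) B) (TF (mt C Z) A) (Tpre (mt C Z) A \<phi>)"
    if ar: "(A, \<phi>, B) \<in> Ar M" and Z: "local_object u C (Wt T) S Z" for Z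
  proof -
    note k = map_space_kan[OF T local_exto[OF Z] ArD(2)[OF ar]] map_space_kan[OF T local_exto[OF Z] ArD(1)[OF ar]]
    show ?thesis
      unfolding map_space_weq_def fst_conv snd_conv TF_mt[symmetric] Tpre_mt[where Z = Z, symmetric]
      by (rule iffI[OF sset_weq_heq[OF _ k] heq_sset_weq[OF _ kanD(1)[OF k(1)] kanD(1)[OF k(2)]]])
  qed
  then show "f \<in> bousfield_weqs u C (Wt T) S \<longleftrightarrow> f \<in> Wt (locT (Wt T) S)"
    unfolding f bousfield_weqs_def Wt_iff locT_def mem_Collect_eq by (intro conj_cong refl) blast
qed

lemma Wt_locT:
  assumes T: "good T"
  shows "Wt T \<subseteq> Wt (locT (Wt T) S)"
proof
  fix f :: "('o, 'a) parr" assume "f \<in> Wt T"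
  moreover obtain A \<phi> B where f: "f = (A, \<phi>, B)" by (cases f)
  ultimately have w: "(A, \<phi>, B) \<in> Wt T" by simp
  show "f \<in> Wt (locT (Wt T) S)"
    unfolding f Wt_iff
  proof (intro conjI ballI)
    show "(A, \<phi>, B) \<in> Ar M" using w by (simp add: Wt_iff)
    fix t assume "t \<in> locT (Wt T) S"
    then obtain Z where Z: "t = mt C Z" "local_object u C (Wt T) S Z" unfolding locT_def by blast
    show "heq (TF t B) (TF t A) (Tpre t A \<phi>)" unfolding Z(1) by (rule map_space_heq[OF T local_exto[OF Z(2)] w])
  qed
qed

text \<open>Inverting more maps leaves fewer local objects, hence fewer tests to pass.\<close>

lemma locT_antimono: "S \<subseteq> S' ==> Wt (locT W S) \<subseteq> Wt (locT W S')"
  unfolding Wt_def locT_def local_object_def by fast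

lemma fibs_antimono: "W \<subseteq> W' ==> fibs u C W' \<subseteq> fibs u C W"
  unfolding fibs_def triv_cofs_def by blast

subsection \<open>Fibres\<close>

lemma fibre_simps [simp]:
  "cells (sec (fibre (E, p, B)) Y) n = {x \<in> cells (sec E Y) n. p Y n x = bpt B Y n}"
  "act (sec (fibre (E, p, B)) Y) = act (sec E Y)" "rst (fibre (E, p, B)) = rst E" "bpt (fibre (E, p, B)) = bpt E"
  by (simp_all add: fibre_def)

lemma PS_fibre:
  assumes p: "(E, p, B) \<in> Ar M"
  shows "PS (fibre (E, p, B))"
proof (rule psI)
  note E = ArD(1)[OF p] and B = ArD(2)[OF p] and s = ArD(3)[OF p]
  fix Y assume Y: "Y \<in> Ob C"
  note sE = psD(1)[OF E Y]
  show "is_sset (sec (fibre (E, p, B)) Y)"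
  proof (rule issI)
    show "act (sec (fibre (E, p, B)) Y) m n \<mu> x \<in> cells (sec (fibre (E, p, B)) Y) m"
      if "\<mu> \<in> Dmap m n" "x \<in> cells (sec (fibre (E, p, B)) Y) n" for m n \<mu> x
      using that sE sm_nat[OF smapD(1)[OF s Y]] psD(7)[OF B Y] by simp
  qed (use sE ss_comp[OF sE] in auto)
  show "small u (cells (sec (fibre (E, p, B)) Y) n)" for n
    by (rule small_mono[OF psD(2)[OF E Y, of n]]) auto
  show "rst (fibre (E, p, B)) (Idn C Y) n x = x" if "x \<in> cells (sec (fibre (E, p, B)) Y) n" for n x
    using psD(4)[OF E Y] that by simp
  show "bpt (fibre (E, p, B)) Y n \<in> cells (sec (fibre (E, p, B)) Y) n" for n
    using psD(6)[OF E Y] smapD(3)[OF s Y] by simp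
  show "act (sec (fibre (E, p, B)) Y) m n \<mu> (bpt (fibre (E, p, B)) Y n) = bpt (fibre (E, p, B)) Y m"
    if "\<mu> \<in> Dmap m n" for m n \<mu> using psD(7)[OF E Y that] by simp
next
  note E = ArD(1)[OF p] and B = ArD(2)[OF p] and s = ArD(3)[OF p]
  fix f assume f: "f \<in> Ar C"
  show "sset_map (sec (fibre (E, p, B)) (Cod C f)) (sec (fibre (E, p, B)) (Dom C f)) (rst (fibre (E, p, B)) f)"
  proof (rule smI)
    show "rst (fibre (E, p, B)) f n x \<in> cells (sec (fibre (E, p, B)) (Dom C f)) n"
      if "x \<in> cells (sec (fibre (E, p, B)) (Cod C f)) n" for n x
      using that sm_in[OF psD(3)[OF E f]] smapD(2)[OF s f] psD(8)[OF B f] by simp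
  qed (use sm_nat[OF psD(3)[OF E f]] in auto)
  show "rst (fibre (E, p, B)) f n (bpt (fibre (E, p, B)) (Cod C f) n) = bpt (fibre (E, p, B)) (Dom C f) n" for n
    using psD(8)[OF E f] by simp
  show "rst (fibre (E, p, B)) (Cmp C g f) n x = rst (fibre (E, p, B)) f n (rst (fibre (E, p, B)) g n x)"
    if "g \<in> Ar C" "Cod C f = Dom C g" "x \<in> cells (sec (fibre (E, p, B)) (Cod C g)) n" for g n x
    using psD(5)[OF E f that(1,2)] that(3) by simp
qed

lemma fibre_Ar:
  assumes p: "(E, p, B) \<in> Ar M" and p': "(E', p', B') \<in> Ar M" and e: "(E, e, E') \<in> Ar M" and b: "(B, b, B') \<in> Ar M"
    and c: "\<And>Y n x. Y \<in> Ob C ==> x \<in> cells (sec E Y) n ==> p' Y n (e Y n x) = b Y n (p Y n x)"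
  shows "(fibre (E, p, B), spre_ext C (fibre (E, p, B)) e, fibre (E', p', B')) \<in> Ar M"
proof -
  note s = ArD(3)[OF e] and F = PS_fibre[OF p] and F' = PS_fibre[OF p']
  have "spre_map C (fibre (E, p, B)) (spre_ext C (fibre (E, p, B)) e) (fibre (E', p', B'))"
    unfolding spre_map_def
  proof (intro conjI ballI allI impI)
    show "sset_map (sec (fibre (E, p, B)) Y) (sec (fibre (E', p', B')) Y) (spre_ext C (fibre (E, p, B)) e Y)" if Y: "Y \<in> Ob C" for Y
    proof (rule sm_cong[OF _ _ psD(1)[OF F Y]])
      show "sset_map (sec (fibre (E, p, B)) Y) (sec (fibre (E', p', B')) Y) (e Y)"
        by (rule smI) (use sm_in[OF smapD(1)[OF s Y]] sm_nat[OF smapD(1)[OF s Y]] c[OF Y] smapD(3)[OF ArD(3)[OF b] Y] in auto)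
    qed (use Y in simp)
    show "spre_ext C (fibre (E, p, B)) e (Dom C f) n (rst (fibre (E, p, B)) f n x) =
        rst (fibre (E', p', B')) f n (spre_ext C (fibre (E, p, B)) e (Cod C f) n x)"
      if f: "f \<in> Ar C" "x \<in> cells (sec (fibre (E, p, B)) (Cod C f)) n" for f n x
      using f smapD(2)[OF s f(1)] sm_in[OF psD(3)[OF F f(1)] f(2)] DomOb CodOb by simp
    show "spre_ext C (fibre (E, p, B)) e Y n (bpt (fibre (E, p, B)) Y n) = bpt (fibre (E', p', B')) Y n" if "Y \<in> Ob C" for Y n
      using smapD(3)[OF s that] psD(6)[OF F that] that by simp
  qed (auto simp: spre_ext_def)
  then show ?thesis using F F' by (simp add: Ar_sPre)
qed

subsection \<open>Weak equivalences between fibrations\<close>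

text \<open>Extending the identity of \<open>B\<close> over the mapping cylinder of \<open>b\<close>
  gives \<open>b'\<close> and the homotopy \<open>hB\<close> at once. This homotopy is lifted along
  \<open>p\<close> over the cylinder of \<open>e\<close>, so that \<open>hE\<close> covers
  \<open>hB\<close>; as \<open>hB\<close> is stationary at base points, \<open>hE\<close> preserves
  the fibre.\<close>

lemma square_retract:
  assumes T: "good T" and e: "(E, e, E') \<in> Wt T" and b: "(B, b, B') \<in> Wt T"
    and p: "(E, p, B) \<in> fibs u C (Wt T)" and p': "(E', p', B') \<in> Ar M" and B: "to_pt C B \<in> fibs u C (Wt T)"
    and c: "\<And>Y n x. Y \<in> Ob C ==> x \<in> cells (sec E Y) n ==> p' Y n (e Y n x) = b Y n (p Y n x)"
  obtains e' b' where "(E', e', E) \<in> Ar M" "(B', b', B) \<in> Ar M"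
    "\<And>Y n x. Y \<in> Ob C ==> x \<in> cells (sec E' Y) n ==> p Y n (e' Y n x) = b' Y n (p' Y n x)"
    "hid E (\<lambda>Y n x. e' Y n (e Y n x))" "hid B (\<lambda>Y n x. b' Y n (b Y n x))"
    "hid (fibre (E, p, B)) (\<lambda>Y n x. e' Y n (e Y n x))"
proof -
  have pA: "(E, p, B) \<in> Ar M" using p by (simp add: fibs_def)
  have eA: "(E, e, E') \<in> Ar M" and bA: "(B, b, B') \<in> Ar M" using e b by (simp_all add: Wt_iff)
  note PE = ArD(1)[OF pA] and PB = ArD(2)[OF pA]
  obtain r where r: "(Cyl (B, b, B'), r, B) \<in> Ar M"
    "\<And>Y n x. Y \<in> Ob C ==> x \<in> cells (sec B Y) n ==> r Y n (iA (B, b, B') Y n x) = x"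
  proof -
    have "\<exists>\<omega>. (Cyl (B, b, B'), \<omega>, B) \<in> Ar M \<and> (\<forall>Y\<in>Ob C. \<forall>n. \<forall>x\<in>cells (sec B Y) n.
        \<omega> Y n (iA (B, b, B') Y n x) = spre_ext C B (\<lambda>Y n x. x) Y n x)"
      using fibs_exto[OF B PB] iA_mono[OF bA] Wt_iA[OF T b] id_Ar[OF PB] unfolding exto_def by blast
    then show thesis using that by auto
  qed
  define b' where "b' = spre_ext C B' (\<lambda>Y n x. r Y n (iB (B, b, B') Y n x))"
  have b': "(B', b', B) \<in> Ar M" unfolding b'_def by (rule comp_Ar[OF iB_Ar[OF bA] r(1)])
  have b'x: "b' Y n x = r Y n (cB x)" if "Y \<in> Ob C" "x \<in> cells (sec B' Y) n" for Y n x using that by (simp add: b'_def iB_def)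
  define hB where "hB = (\<lambda>Y n (x, t). r Y n (cA B b Y n (x, t)))"
  have hB: "gf (mt C B) B I1 hB"
  proof -
    have 1: "gf (mt C B) (Cyl (B, b, B')) (simplex 0) (\<lambda>Y m (y, \<xi>). r Y m y)" by (rule arr_gf[OF r(1)])
    have 2: "sset_map I1 (sset_prod (simplex 0) I1) (\<lambda>n t. (cD 0 n, t))" by (rule smI) auto
    show ?thesis using gf_precomp[OF gf_CylD[OF 1 wftmt[OF PB] bA] 2] by (simp add: hB_def)
  qed
  have hB0: "hB Y n (x, cD 0 n) = x" if "Y \<in> Ob C" "x \<in> cells (sec B Y) n" for Y n x
    using r(2)[OF that] that by (simp add: hB_def iA_def)
  have bin: "b Y n x \<in> cells (sec B' Y) n" if "Y \<in> Ob C" "x \<in> cells (sec B Y) n" for Y n x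
    using sm_in[OF smapD(1)[OF ArD(3)[OF bA] that(1)] that(2)] .
  have ein: "e Y n x \<in> cells (sec E' Y) n" if "Y \<in> Ob C" "x \<in> cells (sec E Y) n" for Y n x
    using sm_in[OF smapD(1)[OF ArD(3)[OF eA] that(1)] that(2)] .
  have pin: "p Y n x \<in> cells (sec B Y) n" if "Y \<in> Ob C" "x \<in> cells (sec E Y) n" for Y n x
    using sm_in[OF smapD(1)[OF ArD(3)[OF pA] that(1)] that(2)] .
  have p'in: "p' Y n x \<in> cells (sec B' Y) n" if "Y \<in> Ob C" "x \<in> cells (sec E' Y) n" for Y n x
    using sm_in[OF smapD(1)[OF ArD(3)[OF p'] that(1)] that(2)] .
  have hB1: "hB Y n (x, cD 1 n) = b' Y n (b Y n x)" if "Y \<in> Ob C" "x \<in> cells (sec B Y) n" for Y n x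
    using that bin by (simp add: hB_def b'x)
  have hBp: "hB Y n (bpt B Y n, t) = bpt B Y n" if "Y \<in> Ob C" "t \<in> Dmap n 1" for Y n t
    using gfD(4)[OF hB, of Y t n] that by simp
  have hp: "gf (mt C B) E I1 (\<lambda>Y n (x, t). hB Y n (p Y n x, t))"
    using gf_pre[OF wfA_ps[OF wftmt[OF PB] PE] wfm_ar[OF wftmt[OF PB] ArD(3)[OF pA]] hB] by simp
  \<comment> \<open>The map to be lifted along \<open>p\<close>: on \<open>E'\<close> it is
    \<open>b'\<close> after \<open>p'\<close>, and on the cylinder of \<open>E\<close> it is
    \<open>hB\<close> at the image under \<open>p\<close>.\<close>
  obtain k where k: "(Cyl (E, e, E'), k, B) \<in> Ar M"
    "\<And>Y n x. Y \<in> Ob C ==> x \<in> cells (sec E' Y) n ==> k Y n (cB x) = b' Y n (p' Y n x)"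
    "\<And>Y n x t. Y \<in> Ob C ==> x \<in> cells (sec E Y) n ==> t \<in> Dmap n 1 ==> k Y n (cA E e Y n (x, t)) = hB Y n (p Y n x, t)"
  proof (rule cyl_arr[OF eA comp_Ar[OF p' b'] hp])
    show "(case (x, cD 1 n) of (x, t) => hB Y n (p Y n x, t)) = spre_ext C E' (\<lambda>Y n x. b' Y n (p' Y n x)) Y n (e Y n x)"
      if "Y \<in> Ob C" "x \<in> cells (sec E Y) n" for Y n x
      using that by (simp add: hB1 pin ein c)
  qed (rule that, auto)
  obtain s where s: "(Cyl (E, e, E'), s, E) \<in> Ar M"
    "\<And>Y n x. Y \<in> Ob C ==> x \<in> cells (sec E Y) n ==> s Y n (iA (E, e, E') Y n x) = spre_ext C E (\<lambda>Y n x. x) Y n x"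
    "\<And>Y n x. Y \<in> Ob C ==> x \<in> cells (sec (Cyl (E, e, E')) Y) n ==> p Y n (s Y n x) = k Y n x"
  proof (rule fibsD[OF p iA_mono[OF eA] Wt_iA[OF T e] id_Ar[OF PE] k(1)])
    show "p Y n (spre_ext C E (\<lambda>Y n x. x) Y n x) = k Y n (iA (E, e, E') Y n x)"
      if "Y \<in> Ob C" "x \<in> cells (sec E Y) n" for Y n x
      using that by (simp add: iA_def k(3) hB0 pin)
  qed (rule that)
  define e' where "e' = spre_ext C E' (\<lambda>Y n x. s Y n (iB (E, e, E') Y n x))"
  have e': "(E', e', E) \<in> Ar M" unfolding e'_def by (rule comp_Ar[OF iB_Ar[OF eA] s(1)])
  have e'x: "e' Y n x = s Y n (cB x)" if "Y \<in> Ob C" "x \<in> cells (sec E' Y) n" for Y n x using that by (simp add: e'_def iB_def)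
  define hE where "hE = (\<lambda>Y n (x, t). s Y n (cA E e Y n (x, t)))"
  have hE: "gf (mt C E) E I1 hE"
  proof -
    have 1: "gf (mt C E) (Cyl (E, e, E')) (simplex 0) (\<lambda>Y m (y, \<xi>). s Y m y)" by (rule arr_gf[OF s(1)])
    have 2: "sset_map I1 (sset_prod (simplex 0) I1) (\<lambda>n t. (cD 0 n, t))" by (rule smI) auto
    show ?thesis using gf_precomp[OF gf_CylD[OF 1 wftmt[OF PE] eA] 2] by (simp add: hE_def)
  qed
  have hE0: "hE Y n (x, cD 0 n) = x" if "Y \<in> Ob C" "x \<in> cells (sec E Y) n" for Y n x
    using s(2)[OF that] that by (simp add: hE_def iA_def)
  have hE1: "hE Y n (x, cD 1 n) = e' Y n (e Y n x)" if "Y \<in> Ob C" "x \<in> cells (sec E Y) n" for Y n x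
    using that ein by (simp add: hE_def e'x)
  have phE: "p Y n (hE Y n (x, t)) = hB Y n (p Y n x, t)" if "Y \<in> Ob C" "x \<in> cells (sec E Y) n" "t \<in> Dmap n 1" for Y n x t
    using s(3)[OF that(1) cA_in[OF that(2,3)]] k(3)[OF that] by (simp add: hE_def)
  have hF: "gf (mt C (fibre (E, p, B))) (fibre (E, p, B)) I1 hE"
  proof (rule gfI, goal_cases)
    case (1 Y n x t) then show ?case using gfD(1)[OF hE, of Y x n t] phE[of Y x n t] hBp[of Y t n] by simp
  next
    case (2 Y m n \<mu> x t) then show ?case using gfD(2)[OF hE, of Y \<mu> m n x t] by simp
  next
    case (3 f n x t) then show ?case using gfD(3)[OF hE, of f x n t] by simp
  next
    case (4 Y n t) then show ?case using gfD(4)[OF hE, of Y t n] by simp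
  qed
  show thesis
  proof (rule that[OF e' b'])
    show "p Y n (e' Y n x) = b' Y n (p' Y n x)" if "Y \<in> Ob C" "x \<in> cells (sec E' Y) n" for Y n x
      using s(3)[OF that(1) cB_in[OF that(2)]] k(2)[OF that] that by (simp add: e'x)
    show "hid E (\<lambda>Y n x. e' Y n (e Y n x))" unfolding hid_def using hE hE0 hE1 by blast
    show "hid B (\<lambda>Y n x. b' Y n (b Y n x))" unfolding hid_def using hB hB0 hB1 by blast
    show "hid (fibre (E, p, B)) (\<lambda>Y n x. e' Y n (e Y n x))" unfolding hid_def using hF hE0 hE1 by (intro exI[of _ hE]) simp
  qed
qed

lemma hid_ext:
  assumes "hid E \<chi>" shows "hid E (spre_ext C E \<chi>)"
  using assms unfolding hid_def by (auto 0 4)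

lemma hid_comp_Wt:
  assumes T: "good T" and e: "(A, e, B) \<in> Ar M" and g: "(B, g, A) \<in> Ar M" and h: "hid A (\<lambda>Y n x. g Y n (e Y n x))"
  shows "(A, spre_ext C A (\<lambda>Y n x. g Y n (e Y n x)), A) \<in> Wt T"
  by (rule hid_Wt[OF T comp_Ar[OF e g] hid_ext[OF h]])

text \<open>Two out of six for the composites \<open>g e\<close> and \<open>k g\<close> shows that
  \<open>g\<close> is a weak equivalence, and two out of three then gives \<open>e\<close>. As the
  hypotheses are homotopies, this holds in every good class.\<close>

lemma hid_two_sided:
  assumes T: "good T" and e: "(A, e, B) \<in> Ar M" and g: "(B, g, A) \<in> Ar M" and k: "(A, k, B) \<in> Ar M"
    and ge: "hid A (\<lambda>Y n x. g Y n (e Y n x))" and kg: "hid B (\<lambda>Y n x. k Y n (g Y n x))"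
  shows "(A, e, B) \<in> Wt T"
proof -
  have 1: "(A, spre_ext C A (\<lambda>Y n x. g Y n (e Y n x)), A) \<in> Wt T" by (rule hid_comp_Wt[OF T e g ge])
  have 2: "(B, g, A) \<in> Wt T" by (rule Wt_middle[OF T e g k 1 hid_comp_Wt[OF T g k kg]])
  show ?thesis by (rule Wt_comp(2)[OF T e g _ 2 1]) simp
qed

text \<open>Lifting takes place in the class of \<open>T\<close>, and any other good class
  \<open>T'\<close> receives the resulting homotopies. In the tower \<open>T\<close> is
  \<open>TW n\<close> and \<open>T'\<close> is \<open>T0\<close>.\<close>

theorem fibration_square:
  assumes T: "good T" and T': "good T'" and e: "(E, e, E') \<in> Wt T" and b: "(B, b, B') \<in> Wt T"
    and p: "(E, p, B) \<in> fibs u C (Wt T)" and p': "(E', p', B') \<in> fibs u C (Wt T)"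
    and B: "to_pt C B \<in> fibs u C (Wt T)" and B': "to_pt C B' \<in> fibs u C (Wt T)"
    and c: "\<And>Y n x. Y \<in> Ob C ==> x \<in> cells (sec E Y) n ==> p' Y n (e Y n x) = b Y n (p Y n x)"
  shows "(E, e, E') \<in> Wt T'"
    and "(fibre (E, p, B), spre_ext C (fibre (E, p, B)) e, fibre (E', p', B')) \<in> Wt T'"
proof -
  have pA: "(E, p, B) \<in> Ar M" and p'A: "(E', p', B') \<in> Ar M" using p p' by (simp_all add: fibs_def)
  have eA: "(E, e, E') \<in> Ar M" and bA: "(B, b, B') \<in> Ar M" using e b by (simp_all add: Wt_iff)
  obtain g d where g: "(E', g, E) \<in> Ar M" "(B', d, B) \<in> Ar M"
    "\<And>Y n x. Y \<in> Ob C ==> x \<in> cells (sec E' Y) n ==> p Y n (g Y n x) = d Y n (p' Y n x)"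
    "hid E (\<lambda>Y n x. g Y n (e Y n x))" "hid B (\<lambda>Y n x. d Y n (b Y n x))"
    "hid (fibre (E, p, B)) (\<lambda>Y n x. g Y n (e Y n x))" by (rule square_retract[OF T e b p p'A B]) (erule (1) c, rule that)
  \<comment> \<open>The maps of the reversed square are weak equivalences for \<open>T\<close> as
    well, as required for applying \<open>square_retract\<close> to it.\<close>
  have gW: "(E', g, E) \<in> Wt T" by (rule Wt_comp(3)[OF T eA g(1) _ e hid_comp_Wt[OF T eA g(1,4)]]) simp
  have dW: "(B', d, B) \<in> Wt T" by (rule Wt_comp(3)[OF T bA g(2) _ b hid_comp_Wt[OF T bA g(2,5)]]) simp
  obtain k l where k: "(E, k, E') \<in> Ar M" "(B, l, B') \<in> Ar M"
    "\<And>Y n x. Y \<in> Ob C ==> x \<in> cells (sec E Y) n ==> p' Y n (k Y n x) = l Y n (p Y n x)"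
    "hid E' (\<lambda>Y n x. k Y n (g Y n x))" "hid (fibre (E', p', B')) (\<lambda>Y n x. k Y n (g Y n x))"
    by (rule square_retract[OF T gW dW p' pA B']) (erule (1) g(3), rule that)
  show "(E, e, E') \<in> Wt T'" by (rule hid_two_sided[OF T' eA g(1) k(1) g(4) k(4)])
  note fe = fibre_Ar[OF pA p'A eA bA c] and fg = fibre_Ar[OF p'A pA g(1,2,3)] and fk = fibre_Ar[OF pA p'A k(1,2,3)]
  show "(fibre (E, p, B), spre_ext C (fibre (E, p, B)) e, fibre (E', p', B')) \<in> Wt T'"
  proof (rule hid_two_sided[OF T' fe fg fk])
    have cong: "hid A \<chi>'" if "hid A \<chi>" "\<And>Y n x. Y \<in> Ob C ==> x \<in> cells (sec A Y) n ==> \<chi>' Y n x = \<chi> Y n x" for A \<chi> \<chi>'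
      using that unfolding hid_def by simp
    show "hid (fibre (E, p, B)) (\<lambda>Y n x. spre_ext C (fibre (E', p', B')) g Y n (spre_ext C (fibre (E, p, B)) e Y n x))"
    proof (rule cong[OF g(6)])
      fix Y n x assume x: "Y \<in> Ob C" "x \<in> cells (sec (fibre (E, p, B)) Y) n"
      have "spre_ext C (fibre (E, p, B)) e Y n x \<in> cells (sec (fibre (E', p', B')) Y) n"
        by (rule sm_in[OF smapD(1)[OF ArD(3)[OF fe] x(1)] x(2)])
      then show "spre_ext C (fibre (E', p', B')) g Y n (spre_ext C (fibre (E, p, B)) e Y n x) = g Y n (e Y n x)"
        using x by (simp add: spre_ext_def)
    qed
    show "hid (fibre (E', p', B')) (\<lambda>Y n x. spre_ext C (fibre (E, p, B)) k Y n (spre_ext C (fibre (E', p', B')) g Y n x))"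
    proof (rule cong[OF k(5)])
      fix Y n x assume x: "Y \<in> Ob C" "x \<in> cells (sec (fibre (E', p', B')) Y) n"
      have "spre_ext C (fibre (E', p', B')) g Y n x \<in> cells (sec (fibre (E, p, B)) Y) n"
        by (rule sm_in[OF smapD(1)[OF ArD(3)[OF fg] x(1)] x(2)])
      then show "spre_ext C (fibre (E, p, B)) k Y n (spre_ext C (fibre (E', p', B')) g Y n x) = k Y n (g Y n x)"
        using x by (simp add: spre_ext_def)
    qed
  qed
qed

end

section \<open>Localization of categories\<close>

locale cat =
  fixes C :: "('o, 'a) cat"
  assumes Dom_Ob: "f \<in> Ar C ==> Dom C f \<in> Ob C" and Cod_Ob: "f \<in> Ar C ==> Cod C f \<in> Ob C"
    and Idn_homs: "A \<in> Ob C ==> Idn C A \<in> homs C A A"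
    and Cmp_homs: "f \<in> homs C A B ==> g \<in> homs C B D ==> Cmp C g f \<in> homs C A D"
    and Cmp_Idn: "f \<in> homs C A B ==> Cmp C f (Idn C A) = f" and Idn_Cmp: "f \<in> homs C A B ==> Cmp C (Idn C B) f = f"
    and assoc: "f \<in> homs C A B ==> g \<in> homs C B D ==> h \<in> homs C D E ==> Cmp C h (Cmp C g f) = Cmp C (Cmp C h g) f"
begin

lemma inverse_unique:
  assumes "w \<in> homs C A B" "v \<in> homs C B A" "v' \<in> homs C B A" "Cmp C v w = Idn C A" "Cmp C w v' = Idn C B"
  shows "v = v'"
  using Cmp_Idn[OF assms(2)] Idn_Cmp[OF assms(3)] assoc[OF assms(3,1,2)] assms(4,5) by simp

end

lemma functorD:
  assumes "is_functor C D F"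
  shows "A \<in> Ob C ==> fst F A \<in> Ob D" "f \<in> homs C A B ==> snd F f \<in> homs D (fst F A) (fst F B)"
    "A \<in> Ob C ==> snd F (Idn C A) = Idn D (fst F A)"
    "f \<in> homs C A B ==> g \<in> homs C B E ==> snd F (Cmp C g f) = Cmp D (snd F g) (snd F f)"
  using assms by (auto simp: is_functor_def homs_def PiE_iff)

lemma functorI:
  assumes C: "cat C" and ob: "\<And>A. A \<in> Ob C ==> g A \<in> Ob D" and ar: "\<And>f A B. f \<in> homs C A B ==> h f \<in> homs D (g A) (g B)"
    and idn: "\<And>A. A \<in> Ob C ==> h (Idn C A) = Idn D (g A)"
    and cmp: "\<And>f k A B E. f \<in> homs C A B ==> k \<in> homs C B E ==> h (Cmp C k f) = Cmp D (h k) (h f)"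
  shows "is_functor C D (\<lambda>A\<in>Ob C. g A, \<lambda>f\<in>Ar C. h f)"
proof -
  interpret cat C by (rule C)
  have hh: "f \<in> homs C (Dom C f) (Cod C f)" if "f \<in> Ar C" for f using that by (simp add: homs_def)
  have a: "h f \<in> Ar D" "Dom D (h f) = g (Dom C f)" "Cod D (h f) = g (Cod C f)" if "f \<in> Ar C" for f
    using ar[OF hh[OF that]] by (simp_all add: homs_def)
  have i: "Idn C A \<in> Ar C" if "A \<in> Ob C" for A using Idn_homs[OF that] by (simp add: homs_def)
  have c: "Cmp C k f \<in> Ar C" "h (Cmp C k f) = Cmp D (h k) (h f)" if "f \<in> Ar C" "k \<in> Ar C" "Cod C f = Dom C k" for f k
  proof -
    have k: "k \<in> homs C (Cod C f) (Cod C k)" using hh[OF that(2)] that(3) by simp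
    show "Cmp C k f \<in> Ar C" using Cmp_homs[OF hh[OF that(1)] k] by (simp add: homs_def)
    show "h (Cmp C k f) = Cmp D (h k) (h f)" by (rule cmp[OF hh[OF that(1)] k])
  qed
  show ?thesis unfolding is_functor_def using ob a i c idn Dom_Ob Cod_Ob by simp
qed

locale loc = cat C for C :: "('o, 'a) cat" +
  fixes W :: "'a set"
  assumes W: "W \<subseteq> Ar C"
begin

abbreviation "L \<equiv> localization C W"
abbreviation "zp \<equiv> zpath C W"
abbreviation "ze \<equiv> zeq C W"

definition cl :: "'o => 'a zig list => 'o => 'o \<times> 'a zig list set \<times> 'o" where
  "cl A xs B = (A, {ys. ze A B xs ys}, B)"

lemma zp_Ob: "zp A xs B ==> A \<in> Ob C \<and> B \<in> Ob C"
  by (induction rule: zpath.induct) (auto simp: homs_def Dom_Ob Cod_Ob)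

lemma zp_append: "zp A xs B ==> zp B ys D ==> zp A (xs @ ys) D"
  by (induction rule: zpath.induct) (auto intro: zpath.intros)

lemma ze_zp: "ze A B xs ys ==> zp A xs B \<and> zp A ys B"
proof (induction rule: zeq.induct)
  case (4 A us A' B' xs ys vs B) then show ?case using zp_append by blast
next
  case (5 A) then show ?case using Idn_homs by (auto intro!: zpath.intros)
next
  case (6 f A B g D) then show ?case using Cmp_homs[OF 6] by (auto intro!: zpath.intros simp: homs_def Cod_Ob)
next
  case (7 w A B)
  then have "A \<in> Ob C" by (auto simp: homs_def Dom_Ob)
  then show ?case using 7 by (auto intro!: zpath.intros)
next
  case (8 w A B)
  then have "B \<in> Ob C" by (auto simp: homs_def Cod_Ob)
  then show ?case using 8 by (auto intro!: zpath.intros)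
qed auto

lemma ze_append: "ze A B xs xs' ==> ze B D ys ys' ==> ze A D (xs @ ys) (xs' @ ys')"
proof -
  assume x: "ze A B xs xs'" and y: "ze B D ys ys'"
  have p: "zp A xs' B" "zp B ys D" using ze_zp[OF x] ze_zp[OF y] by auto
  have A: "zp A [] A" and D: "zp D [] D" using zp_Ob[OF p(1)] zp_Ob[OF p(2)] by (simp_all add: zpath.intros(1))
  have "ze A D (xs @ ys) (xs' @ ys)" using zeq.intros(4)[OF A x p(2)] by simp
  moreover have "ze A D (xs' @ ys) (xs' @ ys')" using zeq.intros(4)[OF p(1) y D] by simp
  ultimately show ?thesis by (rule zeq.intros(3))
qed

lemma cl_eq_iff: "zp A xs B ==> cl A xs B = cl A ys B \<longleftrightarrow> ze A B xs ys"
proof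
  assume x: "zp A xs B" and "cl A xs B = cl A ys B"
  then have "{zs. ze A B xs zs} = {zs. ze A B ys zs}" by (simp add: cl_def)
  then have "ze A B ys xs" using zeq.intros(1)[OF x] by auto
  then show "ze A B xs ys" by (rule zeq.intros(2))
next
  assume e: "ze A B xs ys"
  have "ze A B xs zs \<longleftrightarrow> ze A B ys zs" for zs
    by (rule iffI[OF zeq.intros(3)[OF zeq.intros(2)[OF e]] zeq.intros(3)[OF e]])
  then show "cl A xs B = cl A ys B" by (simp add: cl_def)
qed

lemma L_simps [simp]: "Ob L = Ob C" "Dom L = fst" "Cod L = (\<lambda>f. snd (snd f))" "Idn L A = cl A [] A"
  by (simp_all add: localization_def cl_def)

lemma Ar_L: "f \<in> Ar L \<longleftrightarrow> (\<exists>A xs B. zp A xs B \<and> f = cl A xs B)"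
  by (auto simp: localization_def cl_def)

lemma cl_homs: "zp A xs B ==> cl A xs B \<in> homs L A B"
  unfolding homs_def using Ar_L by (auto simp: cl_def)

lemma homs_LE:
  assumes "f \<in> homs L A B"
  obtains xs where "zp A xs B" "f = cl A xs B"
  using assms unfolding homs_def by (auto simp: Ar_L cl_def)

lemma Cmp_cl: 
  assumes "zp A xs B" "zp B ys D"
  shows "Cmp L (cl B ys D) (cl A xs B) = cl A (xs @ ys) D"
proof -
  have "(\<exists>xs'\<in>{ys. ze A B xs ys}. \<exists>ys'\<in>{zs. ze B D ys zs}. ze A D (xs' @ ys') zs) \<longleftrightarrow> ze A D (xs @ ys) zs" for zs
  proof
    assume "\<exists>xs'\<in>{ys. ze A B xs ys}. \<exists>ys'\<in>{zs. ze B D ys zs}. ze A D (xs' @ ys') zs"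
    then obtain xs' ys' where e: "ze A B xs xs'" "ze B D ys ys'" "ze A D (xs' @ ys') zs" by auto
    show "ze A D (xs @ ys) zs" by (rule zeq.intros(3)[OF ze_append[OF e(1,2)] e(3)])
  next
    assume "ze A D (xs @ ys) zs"
    then show "\<exists>xs'\<in>{ys. ze A B xs ys}. \<exists>ys'\<in>{zs. ze B D ys zs}. ze A D (xs' @ ys') zs"
      using zeq.intros(1)[OF assms(1)] zeq.intros(1)[OF assms(2)] by blast
  qed
  then show ?thesis by (simp add: localization_def cl_def)
qed

sublocale L: cat L
proof
  show "f \<in> Ar L ==> Dom L f \<in> Ob L" "f \<in> Ar L ==> Cod L f \<in> Ob L" for f
    using zp_Ob by (auto simp: Ar_L cl_def)
  show "A \<in> Ob L ==> Idn L A \<in> homs L A A" for A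
    using cl_homs[OF zpath.intros(1)] by simp
  show "f \<in> homs L A B ==> g \<in> homs L B D ==> Cmp L g f \<in> homs L A D" for f g A B D
    by (elim homs_LE) (auto simp: Cmp_cl intro: cl_homs zp_append)
  have nil: "zp A [] A" "zp B [] B" if "zp A xs B" for A xs B using zp_Ob[OF that] zpath.intros(1) by auto
  show "f \<in> homs L A B ==> Cmp L f (Idn L A) = f" "f \<in> homs L A B ==> Cmp L (Idn L B) f = f" for f A B
    by (elim homs_LE; simp add: Cmp_cl nil)+
  show "f \<in> homs L A B ==> g \<in> homs L B D ==> h \<in> homs L D E ==> Cmp L h (Cmp L g f) = Cmp L (Cmp L h g) f" for f g h A B D E
    by (elim homs_LE) (simp add: Cmp_cl zp_append)
qed

abbreviation "Q \<equiv> loc_functor C W"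

lemma Q_ob: "A \<in> Ob C ==> fst Q A = A"
  and Q_ar: "f \<in> homs C A B ==> snd Q f = cl A [Fwd f] B"
  by (auto simp: loc_functor_def cl_def homs_def)

lemma zp_Fwd: "f \<in> homs C A B ==> zp A [Fwd f] B"
  by (auto intro!: zpath.intros simp: homs_def Cod_Ob)

lemma zp_Bwd: "w \<in> W ==> w \<in> homs C A B ==> zp B [Bwd w] A"
  by (auto intro!: zpath.intros simp: homs_def Dom_Ob)

lemma inverse_cl:
  assumes "w \<in> W" "w \<in> homs C A B"
  shows "Cmp L (cl B [Bwd w] A) (cl A [Fwd w] B) = Idn L A" "Cmp L (cl A [Fwd w] B) (cl B [Bwd w] A) = Idn L B"
  using zeq.intros(7,8)[OF assms] ze_zp[OF zeq.intros(7)[OF assms]] ze_zp[OF zeq.intros(8)[OF assms]]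
  by (simp_all add: Cmp_cl zp_Fwd[OF assms(2)] zp_Bwd[OF assms] cl_eq_iff)

text \<open>Induction along a zigzag: a backward step is inverse to the image of an arrow of
  \<open>W\<close>, so uniqueness of inverses in \<open>D\<close> reduces it to the forward
  case.\<close>

lemma functor_ext:
  assumes D: "cat D" and s: "is_functor L D s" and t: "is_functor L D t" and e: "functor_comp C s Q = functor_comp C t Q"
  shows "s = t"
proof -
  interpret D: cat D by (rule D)
  have ob: "fst s A = fst t A" if "A \<in> Ob C" for A
    using fun_cong[OF arg_cong[OF e, of fst], of A] that by (simp add: functor_comp_def Q_ob)
  have ar: "snd s (cl A [Fwd f] B) = snd t (cl A [Fwd f] B)" if "f \<in> homs C A B" for A f B
    using fun_cong[OF arg_cong[OF e, of snd], of f] that Q_ar[OF that] by (simp add: functor_comp_def homs_def)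
  have bw: "snd s (cl B [Bwd w] A) = snd t (cl B [Bwd w] A)" if w: "w \<in> W" "w \<in> homs C A B" for A w B
  proof (rule D.inverse_unique)
    have AB: "A \<in> Ob C" "B \<in> Ob C" using w(2) by (auto simp: homs_def Dom_Ob Cod_Ob)
    note f = cl_homs[OF zp_Fwd[OF w(2)]] and b = cl_homs[OF zp_Bwd[OF w]]
    show "snd s (cl A [Fwd w] B) \<in> homs D (fst s A) (fst s B)" by (rule functorD(2)[OF s f])
    show "snd s (cl B [Bwd w] A) \<in> homs D (fst s B) (fst s A)" by (rule functorD(2)[OF s b])
    show "snd t (cl B [Bwd w] A) \<in> homs D (fst s B) (fst s A)" using functorD(2)[OF t b] ob AB by simp
    show "Cmp D (snd s (cl B [Bwd w] A)) (snd s (cl A [Fwd w] B)) = Idn D (fst s A)"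
      using functorD(4)[OF s f b] functorD(3)[OF s, of A] inverse_cl(1)[OF w] AB by simp
    show "Cmp D (snd s (cl A [Fwd w] B)) (snd t (cl B [Bwd w] A)) = Idn D (fst s B)"
      using functorD(4)[OF t b f] functorD(3)[OF t, of B] inverse_cl(2)[OF w] AB ob ar[OF w(2)] by simp
  qed
  have cls: "snd s (cl A xs B) = snd t (cl A xs B)" if "zp A xs B" for A xs B
    using that
  proof (induction rule: zpath.induct)
    case (1 A) then show ?case using functorD(3)[OF s, of A] functorD(3)[OF t, of A] ob by simp
  next
    case (2 f A B xs D)
    have "cl A (Fwd f # xs) D = Cmp L (cl B xs D) (cl A [Fwd f] B)" using Cmp_cl[OF zp_Fwd[OF 2(1)] 2(2)] by simp
    then show ?case
      using functorD(4)[OF s cl_homs[OF zp_Fwd[OF 2(1)]] cl_homs[OF 2(2)]] functorD(4)[OF t cl_homs[OF zp_Fwd[OF 2(1)]] cl_homs[OF 2(2)]]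
        2(3) ar[OF 2(1)] by simp
  next
    case (3 w B A xs D)
    have "cl A (Bwd w # xs) D = Cmp L (cl B xs D) (cl A [Bwd w] B)" using Cmp_cl[OF zp_Bwd[OF 3(1,2)] 3(3)] by simp
    then show ?case
      using functorD(4)[OF s cl_homs[OF zp_Bwd[OF 3(1,2)]] cl_homs[OF 3(3)]] functorD(4)[OF t cl_homs[OF zp_Bwd[OF 3(1,2)]] cl_homs[OF 3(3)]]
        3(4) bw[OF 3(1,2)] by simp
  qed
  have "fst s = fst t"
  proof
    show "fst s A = fst t A" for A
      using ob s t by (cases "A \<in> Ob C") (auto simp: is_functor_def PiE_iff extensional_def)
  qed
  moreover have "snd s = snd t"
  proof
    show "snd s f = snd t f" for f
    proof (cases "f \<in> Ar L")
      case True
      then obtain A xs B where "zp A xs B" "f = cl A xs B" unfolding Ar_L by blast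
      then show ?thesis using cls by simp
    next
      case False
      have e: "snd s \<in> extensional (Ar L)" "snd t \<in> extensional (Ar L)" using s t by (simp_all add: is_functor_def PiE_iff)
      show ?thesis unfolding extensional_arb[OF e(1) False] extensional_arb[OF e(2) False] by (rule refl)
    qed
  qed
  ultimately show ?thesis by (rule prod_eqI)
qed

context
  fixes \<tau> :: "('o, 'a, 'o, 'a) fnctr"
  assumes tau: "is_functor C C \<tau>" and tauW: "\<And>w. w \<in> W ==> snd \<tau> w \<in> W"
begin

abbreviation "mz \<equiv> map (map_zig (snd \<tau>))"

lemma mz_zp: "zp A xs B ==> zp (fst \<tau> A) (mz xs) (fst \<tau> B)"
  by (induction rule: zpath.induct) (auto intro: zpath.intros functorD[OF tau] tauW)

lemma mz_ze: "ze A B xs ys ==> ze (fst \<tau> A) (fst \<tau> B) (mz xs) (mz ys)"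
proof (induction rule: zeq.induct)
  case (1 A xs B) then show ?case by (intro zeq.intros(1) mz_zp)
next
  case (2 A B xs ys) show ?case by (rule zeq.intros(2)[OF 2(2)])
next
  case (3 A B xs ys zs) show ?case by (rule zeq.intros(3)[OF 3(3,4)])
next
  case (4 A us A' B' xs ys vs B)
  then show ?case using zeq.intros(4)[OF mz_zp[OF 4(1)] 4(4) mz_zp[OF 4(3)]] by simp
next
  case (5 A) then show ?case using zeq.intros(5)[OF functorD(1)[OF tau 5], of W] functorD(3)[OF tau 5] by simp
next
  case (6 f A B g D)
  then show ?case using zeq.intros(6)[OF functorD(2)[OF tau 6(1)] functorD(2)[OF tau 6(2)], of W] functorD(4)[OF tau 6] by simp
next
  case (7 w A B) then show ?case using zeq.intros(7)[OF tauW[OF 7(1)] functorD(2)[OF tau 7(2)]] by simp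
next
  case (8 w A B) then show ?case using zeq.intros(8)[OF tauW[OF 8(1)] functorD(2)[OF tau 8(2)]] by simp
qed

text \<open>The functor is applied letter by letter to a chosen zigzag of the class; by
  \<open>mz_ze\<close> the result is independent of the choice.\<close>

definition lfun :: "('o, 'o \<times> 'a zig list set \<times> 'o, 'o, 'o \<times> 'a zig list set \<times> 'o) fnctr" where
  "lfun = (\<lambda>A\<in>Ob C. fst \<tau> A, \<lambda>f\<in>Ar L. cl (fst \<tau> (fst f)) (mz (SOME xs. xs \<in> fst (snd f))) (fst \<tau> (snd (snd f))))"

lemma lfun_cl:
  assumes "zp A xs B"
  shows "snd lfun (cl A xs B) = cl (fst \<tau> A) (mz xs) (fst \<tau> B)"
proof -
  have "ze A B xs (SOME ys. ze A B xs ys)" by (rule someI[of _ xs]) (rule zeq.intros(1)[OF assms])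
  then have "ze (fst \<tau> A) (fst \<tau> B) (mz xs) (mz (SOME ys. ze A B xs ys))" by (rule mz_ze)
  then have "cl (fst \<tau> A) (mz xs) (fst \<tau> B) = cl (fst \<tau> A) (mz (SOME ys. ze A B xs ys)) (fst \<tau> B)"
    using cl_eq_iff[OF mz_zp[OF assms]] by blast
  moreover have "cl A xs B \<in> Ar L" using assms Ar_L by blast
  ultimately show ?thesis by (simp add: lfun_def cl_def)
qed

lemma lfun_functor: "is_functor L L lfun"
  unfolding is_functor_def
proof (intro conjI ballI impI)
  show "fst lfun \<in> Ob L \<rightarrow>\<^sub>E Ob L" using functorD(1)[OF tau] by (auto simp: lfun_def)
  have c: "snd lfun f \<in> homs L (fst lfun (fst f)) (fst lfun (snd (snd f)))" if "f \<in> Ar L" for f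
  proof -
    obtain A xs B where f: "zp A xs B" "f = cl A xs B" using \<open>f \<in> Ar L\<close> unfolding Ar_L by blast
    then show ?thesis using lfun_cl[OF f(1)] cl_homs[OF mz_zp[OF f(1)]] zp_Ob[OF f(1)] by (simp add: lfun_def cl_def)
  qed
  show "snd lfun \<in> Ar L \<rightarrow>\<^sub>E Ar L" using c by (auto simp: homs_def lfun_def)
  show "Dom L (snd lfun f) = fst lfun (Dom L f)" "Cod L (snd lfun f) = fst lfun (Cod L f)" if "f \<in> Ar L" for f
    using c[OF that] by (auto simp: homs_def)
  show "snd lfun (Idn L A) = Idn L (fst lfun A)" if "A \<in> Ob L" for A
    using that lfun_cl[OF zpath.intros(1)] by (simp add: lfun_def)
  fix f g assume a: "f \<in> Ar L" "g \<in> Ar L" "Cod L f = Dom L g"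
  obtain A xs B where f: "zp A xs B" "f = cl A xs B" using a(1) unfolding Ar_L by blast
  obtain B' ys D where g: "zp B' ys D" "g = cl B' ys D" using a(2) unfolding Ar_L by blast
  have fg: "zp A xs B" "f = cl A xs B" "zp B ys D" "g = cl B ys D" using f g a(3) by (simp_all add: cl_def)
  show "snd lfun (Cmp L g f) = Cmp L (snd lfun g) (snd lfun f)"
    using fg by (simp add: Cmp_cl lfun_cl zp_append mz_zp)
qed

theorem localization_functor: "\<exists>!t. is_functor L L t \<and> functor_comp C t Q = functor_comp C Q \<tau>"
proof (rule ex1I[of _ lfun])
  have "snd lfun (snd Q f) = snd Q (snd \<tau> f)" if "f \<in> Ar C" for f
  proof -
    have h: "f \<in> homs C (Dom C f) (Cod C f)" using that by (simp add: homs_def)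
    show ?thesis using lfun_cl[OF zp_Fwd[OF h]] Q_ar[OF h] Q_ar[OF functorD(2)[OF tau h]] by simp
  qed
  moreover have "fst lfun (fst Q A) = fst Q (fst \<tau> A)" if "A \<in> Ob C" for A
    using that functorD(1)[OF tau that] by (simp add: Q_ob) (simp add: lfun_def)
  ultimately show l: "is_functor L L lfun \<and> functor_comp C lfun Q = functor_comp C Q \<tau>"
    using lfun_functor by (simp add: functor_comp_def cong: restrict_cong)
  show "t = lfun" if "is_functor L L t \<and> functor_comp C t Q = functor_comp C Q \<tau>" for t
    using functor_ext[OF L.cat_axioms, of t lfun] that l by simp
qed

end

end

section \<open>Category axioms for pointed simplicial presheaves\<close>

context site
begin

lemma M_arrE:
  assumes "f \<in> homs M A B"
  obtains \<phi> where "f = (A, \<phi>, B)" "(A, \<phi>, B) \<in> Ar M"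
  using assms by (cases f) (auto simp: homs_def)

lemma cat_M: "cat M"
proof
  fix f assume "f \<in> Ar M"
  moreover obtain A \<phi> B where "f = (A, \<phi>, B)" by (cases f)
  ultimately show "Dom M f \<in> Ob M" "Cod M f \<in> Ob M" by (auto simp: Ar_sPre)
next
  show "Idn M A \<in> homs M A A" if "A \<in> Ob M" for A using id_Ar[of A] that by (simp add: homs_def)
next
  show "Cmp M g f \<in> homs M A D" if "f \<in> homs M A B" "g \<in> homs M B D" for f g A B D
    by (rule M_arrE[OF that(1)], rule M_arrE[OF that(2)]) (use comp_Ar in \<open>simp add: homs_def\<close>)
next
  fix f A B assume f: "f \<in> homs M A B"
  obtain \<phi> where p: "f = (A, \<phi>, B)" "(A, \<phi>, B) \<in> Ar M" by (rule M_arrE[OF f])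
  show "Cmp M f (Idn M A) = f" using spre_ext_Ar[OF p(2), of "\<lambda>Y n x. \<phi> Y n (spre_ext C A (\<lambda>Y n x. x) Y n x)"] p(1) by simp
  show "Cmp M (Idn M B) f = f"
    using spre_ext_Ar[OF p(2), of "\<lambda>Y n x. spre_ext C B (\<lambda>Y n x. x) Y n (\<phi> Y n x)"] p(1)
      sm_in[OF smapD(1)[OF ArD(3)[OF p(2)]]] by simp
next
  fix f g h A B D E assume f: "f \<in> homs M A B" and g: "g \<in> homs M B D" and h: "h \<in> homs M D E"
  obtain \<phi> where p: "f = (A, \<phi>, B)" "(A, \<phi>, B) \<in> Ar M" by (rule M_arrE[OF f])
  obtain \<psi> where q: "g = (B, \<psi>, D)" by (rule M_arrE[OF g])
  obtain \<chi> where r: "h = (D, \<chi>, E)" by (rule M_arrE[OF h])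
  show "Cmp M h (Cmp M g f) = Cmp M (Cmp M h g) f"
    using sm_in[OF smapD(1)[OF ArD(3)[OF p(2)]]] by (auto simp: p(1) q r spre_ext_def fun_eq_iff)
qed

lemma Cmp_eqD:
  assumes "Cmp M (B, \<psi>, D) (A, \<phi>, B) = Cmp M (B', \<psi>', D') (A', \<phi>', B')" "Y \<in> Ob C" "x \<in> cells (sec A Y) n"
  shows "\<psi> Y n (\<phi> Y n x) = \<psi>' Y n (\<phi>' Y n x)"
proof -
  have "spre_ext C A (\<lambda>Y n x. \<psi> Y n (\<phi> Y n x)) = spre_ext C A (\<lambda>Y n x. \<psi>' Y n (\<phi>' Y n x))" using assms(1) by auto
  then have "spre_ext C A (\<lambda>Y n x. \<psi> Y n (\<phi> Y n x)) Y n x = spre_ext C A (\<lambda>Y n x. \<psi>' Y n (\<phi>' Y n x)) Y n x" by (rule arg_cong)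
  then show ?thesis using assms(2,3) by simp
qed

end

section \<open>The tower\<close>

locale tower =
  fixes X :: "'u sch" and F :: "nat => 'u mar ffact" and enc :: "'u smarr option \<times> (nat => nat) => 'u smarr option"
  assumes enc: "inj enc" and inf: "infinite (UNIV :: 'u set)"
    and FF: "\<And>k. functorial_factorization (Mot X) (WB_triv_cofs X k) (WB_fibs X k) (F k)"
begin

sublocale psite "Sm X" "TYPE('u)" enc
  unfolding psite_def by (rule site_Sm[OF enc inf])

sublocale M: cat M by (rule cat_M)

lemma Ob_homs: "a \<in> homs M A B ==> A \<in> Ob M" "a \<in> homs M A B ==> B \<in> Ob M"
  unfolding homs_def using M.Dom_Ob M.Cod_Ob by blast+

lemma Mot_M: "Mot X = M" by (simp add: Mot_def)

text \<open>\<open>T0\<close> detects the motivic weak equivalences (\<open>motivic_Wt\<close>), and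
  \<open>TW k\<close> those of the localization at \<open>WB X k\<close>
  (\<open>WB_Wt\<close>).\<close>

definition "T0 = locT (Wt (nisT X)) (affine_line_maps X)"
definition "TW k = locT (Wt T0) (WB X k)"

lemma good_nis: "good (nisT X)" by (rule nis_local_Wt(2)[OF inf enc])
lemma good_T0: "good T0" unfolding T0_def by (rule good_locT[OF good_nis])
lemma good_TW: "good (TW k)" unfolding TW_def by (rule good_locT[OF good_T0])

lemma motivic_Wt: "motivic_weqs X = Wt T0"
  unfolding motivic_weqs_def T0_def nis_local_Wt(1)[OF inf enc] by (rule bousfield_Wt[OF good_nis])

lemma WB_Wt: "WB_weqs X k = Wt (TW k)"
  unfolding WB_weqs_def TW_def motivic_Wt by (rule bousfield_Wt[OF good_T0])

lemma T0_TW: "Wt T0 \<subseteq> Wt (TW k)"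
  unfolding TW_def by (rule Wt_locT[OF good_T0])

lemma WB_Suc: "WB X (Suc k) \<subseteq> WB X k"
proof -
  have "enat (Suc k + 1) \<le> x ==> enat (k + 1) \<le> x" for x by (rule order_trans[of _ "enat (Suc k + 1)"]) simp_all
  then show ?thesis unfolding WB_def by blast
qed

lemma fibs_TW: "WB_fibs X k = fibs TYPE('u) (Sm X) (Wt (TW k))"
  by (simp add: WB_fibs_def WB_Wt)

text \<open>A larger codimension bound inverts fewer maps, which leaves fewer trivial cofibrations
  and therefore more fibrations.\<close>

lemma fibs_Suc: "WB_fibs X k \<subseteq> WB_fibs X (Suc k)"
  unfolding fibs_TW TW_def by (rule fibs_antimono[OF locT_antimono[OF WB_Suc]])

lemma FFD:
  assumes "f \<in> homs M A B"
  shows "fleft (F k) f \<in> homs M A (Cod M (fleft (F k) f))" "fright (F k) f \<in> homs M (Cod M (fleft (F k) f)) B"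
    "fleft (F k) f \<in> Wt (TW k)" "fright (F k) f \<in> WB_fibs X k"
    "fmid (F k) f f (Idn M A) (Idn M B) = Idn M (Cod M (fleft (F k) f))"
  using assms FF[of k] unfolding functorial_factorization_def Mot_M homs_def WB_triv_cofs_def triv_cofs_def WB_Wt by auto

lemma FF_square:
  assumes "f \<in> homs M A B" "g \<in> homs M A' B'" "a \<in> homs M A A'" "b \<in> homs M B B'" "Cmp M g a = Cmp M b f"
  shows "square M f g a b"
    "fmid (F k) f g a b \<in> homs M (Cod M (fleft (F k) f)) (Cod M (fleft (F k) g))"
    "Cmp M (fmid (F k) f g a b) (fleft (F k) f) = Cmp M (fleft (F k) g) a"
    "Cmp M (fright (F k) g) (fmid (F k) f g a b) = Cmp M b (fright (F k) f)"
proof -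
  show s: "square M f g a b" using assms by (simp add: square_def homs_def)
  show "fmid (F k) f g a b \<in> homs M (Cod M (fleft (F k) f)) (Cod M (fleft (F k) g))"
    "Cmp M (fmid (F k) f g a b) (fleft (F k) f) = Cmp M (fleft (F k) g) a"
    "Cmp M (fright (F k) g) (fmid (F k) f g a b) = Cmp M b (fright (F k) f)"
    using FF[of k] s unfolding functorial_factorization_def Mot_M by blast+
qed

lemma FF_comp:
  assumes "square M f g a b" "square M g h c d"
  shows "fmid (F k) f h (Cmp M c a) (Cmp M d b) = Cmp M (fmid (F k) g h c d) (fmid (F k) f g a b)"
  using FF[of k] assms unfolding functorial_factorization_def Mot_M by blast

section \<open>Functoriality of the tower\<close>

abbreviation "tle n A \<equiv> tau_le X F n A"
abbreviation "tob n A \<equiv> tau_ob X F n A"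
abbreviation "ta n a \<equiv> tau_ar X F n a"

lemma tl_homs: "A \<in> Ob M ==> tle n A \<in> homs M A (tob n A)"
proof (induction n)
  case 0
  then show ?case using to_pt_Ar[of A] by (simp add: homs_def tau_ob_def Mot_M to_pt_def)
next
  case (Suc n)
  show ?case using FFD(1)[OF Suc.IH[OF Suc.prems], of n] by (simp add: tau_ob_def Mot_M)
qed

lemma to_Suc: "tob (Suc n) A = Cod M (fleft (F n) (tle n A))"
  by (simp add: tau_ob_def Mot_M)

lemma to_Ob: "A \<in> Ob M ==> tob n A \<in> Ob M"
  by (rule Ob_homs(2)[OF tl_homs])

lemma nu_homs: "A \<in> Ob M ==> nu X F n A \<in> homs M (tob (Suc n) A) (tob n A)"
  unfolding nu_def to_Suc by (rule FFD(2)[OF tl_homs])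

lemma nu_fib: "A \<in> Ob M ==> nu X F n A \<in> WB_fibs X n"
  unfolding nu_def by (rule FFD(4)[OF tl_homs])

lemma tl_Suc_Wt: "A \<in> Ob M ==> tle (Suc n) A \<in> Wt (TW n)"
  using FFD(3)[OF tl_homs[of A n], of n] by simp

lemma to_0: "tob 0 A = pt_spre"
  by (simp add: tau_ob_def to_pt_def Mot_M)

text \<open>Stage \<open>Suc n\<close> is fibrant for \<open>WB X n\<close>, being fibred over the
  fibrant stage \<open>n\<close>; \<open>fibs_Suc\<close> then passes to
  \<open>WB X (Suc n)\<close>, the localization in which the next fibration of the tower
  lives.\<close>

lemma to_fib: "A \<in> Ob M ==> to_pt (Sm X) (tob n A) \<in> WB_fibs X n"
proof (induction n)
  case 0
  show ?case unfolding to_0 fibs_TW by (rule pt_fib)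
next
  case (Suc n)
  obtain \<nu> where n: "nu X F n A = (tob (Suc n) A, \<nu>, tob n A)" by (rule M_arrE[OF nu_homs[OF Suc.prems]])
  have "to_pt (Sm X) (tob (Suc n) A) \<in> WB_fibs X n"
    using to_pt_comp_fib[OF nu_fib[OF Suc.prems, of n, unfolded n fibs_TW] Suc.IH[OF Suc.prems, unfolded fibs_TW]] by (simp add: fibs_TW)
  then show ?case using fibs_Suc by blast
qed

lemma ta_sq:
  assumes a: "a \<in> homs M A B"
  shows "ta n a \<in> homs M (tob n A) (tob n B) \<and> Cmp M (tle n B) a = Cmp M (ta n a) (tle n A)"
proof (induction n)
  case 0
  obtain \<alpha> where al: "a = (A, \<alpha>, B)" "(A, \<alpha>, B) \<in> Ar M" by (rule M_arrE[OF a])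
  have A: "PS A" and B: "PS B" using ArD[OF al(2)] by auto
  note p = to_pt_Ar[OF A, unfolded to_pt_def] to_pt_Ar[OF B, unfolded to_pt_def]
  show ?case
    using pt_arr_eq[OF comp_Ar[OF al(2) p(2)] comp_Ar[OF p(1) id_Ar[OF PS_pt]]] id_Ar[OF PS_pt]
    by (simp add: al(1) to_0 Mot_M to_pt_def homs_def)
next
  case (Suc n)
  note AB = Ob_homs[OF a]
  note s = FF_square(2,3)[OF tl_homs[OF AB(1)] tl_homs[OF AB(2)] a conjunct1[OF Suc.IH] conjunct2[OF Suc.IH], of n]
  have d: "Dom M a = A" "Cod M a = B" using a by (simp_all add: homs_def)
  show ?case using s by (simp add: to_Suc Mot_M d[simplified])
qed

lemma ta_Suc: "a \<in> homs M A B ==> ta (Suc n) a = fmid (F n) (tle n A) (tle n B) a (ta n a)"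
  by (simp add: Mot_M homs_def)

lemma tl_square: "a \<in> homs M A B ==> square M (tle n A) (tle n B) a (ta n a)"
  using FF_square(1)[OF tl_homs tl_homs] ta_sq Ob_homs by blast

lemma nu_sq: "a \<in> homs M A B ==> Cmp M (nu X F n B) (ta (Suc n) a) = Cmp M (ta n a) (nu X F n A)"
  unfolding nu_def ta_Suc using FF_square(4)[OF tl_homs tl_homs] ta_sq Ob_homs by blast

lemma ta_Idn: "A \<in> Ob M ==> ta n (Idn M A) = Idn M (tob n A)"
proof (induction n)
  case 0 then show ?case by (simp add: to_0 Mot_M)
next
  case (Suc n)
  show ?case
    unfolding ta_Suc[OF M.Idn_homs[OF Suc.prems]] Suc.IH[OF Suc.prems] to_Suc by (rule FFD(5)[OF tl_homs[OF Suc.prems]])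
qed

lemma ta_Cmp: "a \<in> homs M A B ==> b \<in> homs M B D ==> ta n (Cmp M b a) = Cmp M (ta n b) (ta n a)"
proof (induction n)
  case 0
  have "Idn M pt_spre \<in> homs M pt_spre pt_spre" using M.Idn_homs PS_pt by simp
  then show ?case using M.Cmp_Idn[of "Idn M pt_spre" pt_spre pt_spre] by (simp add: Mot_M del: sPre_simps)
next
  case (Suc n)
  show ?case
    using FF_comp[OF tl_square[OF Suc.prems(1)] tl_square[OF Suc.prems(2)], of n n]
    by (simp only: ta_Suc[OF M.Cmp_homs[OF Suc.prems]] ta_Suc[OF Suc.prems(1)] ta_Suc[OF Suc.prems(2)] Suc.IH[OF Suc.prems])
qed

lemma tau_functor: "is_functor M M (tau X F n)"
  unfolding tau_def Mot_M
  by (rule functorI[OF cat_M]) (simp_all add: to_Ob ta_Idn ta_sq ta_Cmp del: sPre_simps)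

section \<open>The fibres of the tower as a functor\<close>

abbreviation "fb n A \<equiv> fibre (nu X F n A)"

lemma fb_arr:
  assumes a: "a \<in> homs M A B"
  shows "(fb n A, spre_ext (Sm X) (fb n A) (fst (snd (ta (Suc n) a))), fb n B) \<in> homs M (fb n A) (fb n B)"
proof -
  note AB = Ob_homs[OF a]
  obtain \<nu> where n: "nu X F n A = (tob (Suc n) A, \<nu>, tob n A)" "(tob (Suc n) A, \<nu>, tob n A) \<in> Ar M" by (rule M_arrE[OF nu_homs[OF AB(1)]])
  obtain \<nu>' where n': "nu X F n B = (tob (Suc n) B, \<nu>', tob n B)" "(tob (Suc n) B, \<nu>', tob n B) \<in> Ar M" by (rule M_arrE[OF nu_homs[OF AB(2)]])
  obtain e where e: "ta (Suc n) a = (tob (Suc n) A, e, tob (Suc n) B)" "(tob (Suc n) A, e, tob (Suc n) B) \<in> Ar M"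
    by (rule M_arrE[OF conjunct1[OF ta_sq[OF a]]])
  obtain b where b: "ta n a = (tob n A, b, tob n B)" "(tob n A, b, tob n B) \<in> Ar M" by (rule M_arrE[OF conjunct1[OF ta_sq[OF a]]])
  have "(fibre (tob (Suc n) A, \<nu>, tob n A), spre_ext (Sm X) (fibre (tob (Suc n) A, \<nu>, tob n A)) e, fibre (tob (Suc n) B, \<nu>', tob n B)) \<in> Ar M"
    by (rule fibre_Ar[OF n(2) n'(2) e(2) b(2)]) (rule Cmp_eqD[OF nu_sq[OF a, of n, unfolded n(1) n'(1) e(1) b(1)]])
  then show ?thesis unfolding n(1) n'(1) e(1) by (simp add: homs_def)
qed

lemma fb_Ob: "A \<in> Ob M ==> fb n A \<in> Ob M"
  by (rule Ob_homs(1)[OF fb_arr[OF M.Idn_homs]])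

lemma s_functor: "is_functor M M (s_tilde X F n)"
  unfolding s_tilde_def Mot_M
proof (rule functorI[OF cat_M])
  show "fb n A \<in> Ob M" if "A \<in> Ob M" for A by (rule fb_Ob[OF that])
  show "(fb n (Dom M a), spre_ext (Sm X) (fb n (Dom M a)) (fst (snd (ta (Suc n) a))), fb n (Cod M a)) \<in> homs M (fb n A) (fb n B)"
    if "a \<in> homs M A B" for a A B using fb_arr[OF that] that by (simp add: homs_def)
next
  fix A :: "'u mob" assume A: "A \<in> Ob M"
  obtain \<nu> where n: "nu X F n A = (tob (Suc n) A, \<nu>, tob n A)" by (rule M_arrE[OF nu_homs[OF A]])
  have "spre_ext (Sm X) (fb n A) (spre_ext (Sm X) (tob (Suc n) A) (\<lambda>Y n x. x)) = spre_ext (Sm X) (fb n A) (\<lambda>Y n x. x)"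
    unfolding n by (auto simp: spre_ext_def fun_eq_iff)
  then show "(fb n (Dom M (Idn M A)), spre_ext (Sm X) (fb n (Dom M (Idn M A))) (fst (snd (ta (Suc n) (Idn M A)))), fb n (Cod M (Idn M A))) = Idn M (fb n A)"
    by (simp only: ta_Idn[OF A]) simp
next
  fix a b :: "'u mar" and A B D assume a: "a \<in> homs M A B" and b: "b \<in> homs M B D"
  obtain e where e: "ta (Suc n) a = (tob (Suc n) A, e, tob (Suc n) B)" by (rule M_arrE[OF conjunct1[OF ta_sq[OF a]]])
  obtain d where d: "ta (Suc n) b = (tob (Suc n) B, d, tob (Suc n) D)" by (rule M_arrE[OF conjunct1[OF ta_sq[OF b]]])
  obtain \<nu> where n: "nu X F n A = (tob (Suc n) A, \<nu>, tob n A)" by (rule M_arrE[OF nu_homs[OF Ob_homs(1)[OF a]]])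
  have D: "Dom M a = A" "Cod M a = B" "Dom M b = B" "Cod M b = D" "Dom M (Cmp M b a) = A" "Cod M (Cmp M b a) = D"
    using a b M.Cmp_homs[OF a b] by (simp_all add: homs_def)
  have f: "(fb n A, spre_ext (Sm X) (fb n A) e, fb n B) \<in> Ar M" using fb_arr[OF a, of n] by (simp add: homs_def e del: tau_ar.simps)
  have "spre_ext (Sm X) (fb n A) (spre_ext (Sm X) (tob (Suc n) A) (\<lambda>Y n x. d Y n (e Y n x))) =
      spre_ext (Sm X) (fb n A) (\<lambda>Y k x. spre_ext (Sm X) (fb n B) d Y k (spre_ext (Sm X) (fb n A) e Y k x))"
  proof (intro ext)
    fix Y k x
    show "spre_ext (Sm X) (fb n A) (spre_ext (Sm X) (tob (Suc n) A) (\<lambda>Y n x. d Y n (e Y n x))) Y k x =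
      spre_ext (Sm X) (fb n A) (\<lambda>Y k x. spre_ext (Sm X) (fb n B) d Y k (spre_ext (Sm X) (fb n A) e Y k x)) Y k x"
    proof (cases "Y \<in> Ob (Sm X) \<and> x \<in> cells (sec (fb n A) Y) k")
      case True
      then have "spre_ext (Sm X) (fb n A) e Y k x \<in> cells (sec (fb n B) Y) k"
        using sm_in[OF smapD(1)[OF ArD(3)[OF f]]] by blast
      moreover have "x \<in> cells (sec (tob (Suc n) A) Y) k" using True by (simp add: n)
      ultimately show ?thesis using True by simp
    qed (auto simp: spre_ext_def)
  qed
  then show "(fb n (Dom M (Cmp M b a)), spre_ext (Sm X) (fb n (Dom M (Cmp M b a))) (fst (snd (ta (Suc n) (Cmp M b a)))), fb n (Cod M (Cmp M b a))) =
      Cmp M (fb n (Dom M b), spre_ext (Sm X) (fb n (Dom M b)) (fst (snd (ta (Suc n) b))), fb n (Cod M b))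
        (fb n (Dom M a), spre_ext (Sm X) (fb n (Dom M a)) (fst (snd (ta (Suc n) a))), fb n (Cod M a))"
    unfolding D ta_Cmp[OF a b] e d by simp
qed

text \<open>The maps from \<open>A\<close> and \<open>B\<close> to the stages \<open>Suc n\<close>
  are equivalences for \<open>TW n\<close>, so two out of three makes the map between the stages one
  as well. Since the stages are fibrant and joined by fibrations for \<open>TW n\<close>,
  \<open>fibration_square\<close> upgrades this map, and the map of fibres, to the motivic
  class.\<close>

lemma ta_Wt_step:
  assumes a: "a \<in> homs M A B" and w: "a \<in> Wt T0" and IH: "ta n a \<in> Wt T0"
  shows "ta (Suc n) a \<in> Wt T0"
    and "(fb n A, spre_ext (Sm X) (fb n A) (fst (snd (ta (Suc n) a))), fb n B) \<in> Wt T0"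
proof -
  note AB = Ob_homs[OF a]
  obtain \<alpha> where al: "a = (A, \<alpha>, B)" "(A, \<alpha>, B) \<in> Ar M" by (rule M_arrE[OF a])
  obtain \<nu> where n: "nu X F n A = (tob (Suc n) A, \<nu>, tob n A)" by (rule M_arrE[OF nu_homs[OF AB(1)]])
  obtain \<nu>' where n': "nu X F n B = (tob (Suc n) B, \<nu>', tob n B)" by (rule M_arrE[OF nu_homs[OF AB(2)]])
  obtain e where e: "ta (Suc n) a = (tob (Suc n) A, e, tob (Suc n) B)" "(tob (Suc n) A, e, tob (Suc n) B) \<in> Ar M"
    by (rule M_arrE[OF conjunct1[OF ta_sq[OF a]]])
  obtain b where b: "ta n a = (tob n A, b, tob n B)" by (rule M_arrE[OF conjunct1[OF ta_sq[OF a]]])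
  obtain l where l: "tle (Suc n) A = (A, l, tob (Suc n) A)" "(A, l, tob (Suc n) A) \<in> Ar M" by (rule M_arrE[OF tl_homs[OF AB(1)]])
  obtain l' where l': "tle (Suc n) B = (B, l', tob (Suc n) B)" "(B, l', tob (Suc n) B) \<in> Ar M" by (rule M_arrE[OF tl_homs[OF AB(2)]])
  have lW: "(A, l, tob (Suc n) A) \<in> Wt (TW n)" "(B, l', tob (Suc n) B) \<in> Wt (TW n)"
    using tl_Suc_Wt[OF AB(1), of n] tl_Suc_Wt[OF AB(2), of n] unfolding l l' by auto
  \<comment> \<open>Motivic equivalences remain equivalences after the further localization, by
    \<open>T0_TW\<close>.\<close>
  have aW: "(A, \<alpha>, B) \<in> Wt (TW n)" and bW: "(tob n A, b, tob n B) \<in> Wt (TW n)" using w IH T0_TW[of n] al b by auto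
  have q: "Cmp M (B, l', tob (Suc n) B) (A, \<alpha>, B) = Cmp M (tob (Suc n) A, e, tob (Suc n) B) (A, l, tob (Suc n) A)"
    using conjunct2[OF ta_sq[OF a, of "Suc n"]] unfolding l(1) l'(1) e(1) unfolding al(1) .
  have laW: "(A, spre_ext (Sm X) A (\<lambda>Y n x. l' Y n (\<alpha> Y n x)), tob (Suc n) B) \<in> Wt (TW n)"
    by (rule Wt_comp(1)[OF good_TW al(2) l'(2) _ aW lW(2)]) simp
  have eW: "(tob (Suc n) A, e, tob (Suc n) B) \<in> Wt (TW n)"
    by (rule Wt_comp(3)[OF good_TW l(2) e(2) _ lW(1) laW]) (use q in simp)
  have fib: "to_pt (Sm X) (tob n A) \<in> fibs TYPE('u) (Sm X) (Wt (TW n))" "to_pt (Sm X) (tob n B) \<in> fibs TYPE('u) (Sm X) (Wt (TW n))"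
    "(tob (Suc n) A, \<nu>, tob n A) \<in> fibs TYPE('u) (Sm X) (Wt (TW n))" "(tob (Suc n) B, \<nu>', tob n B) \<in> fibs TYPE('u) (Sm X) (Wt (TW n))"
    using to_fib AB nu_fib[of A n] nu_fib[of B n] by (simp_all add: fibs_TW n n')
  note sq = fibration_square[OF good_TW good_T0 eW bW fib(3,4,1,2)]
  show "ta (Suc n) a \<in> Wt T0" unfolding e by (rule sq(1)) (rule Cmp_eqD[OF nu_sq[OF a, of n, unfolded n(1) n'(1) e(1) b(1)]])
  show "(fb n A, spre_ext (Sm X) (fb n A) (fst (snd (ta (Suc n) a))), fb n B) \<in> Wt T0"
    unfolding e n n' fst_conv snd_conv by (rule sq(2)) (rule Cmp_eqD[OF nu_sq[OF a, of n, unfolded n(1) n'(1) e(1) b(1)]])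
qed

lemma ta_Wt:
  assumes a: "a \<in> homs M A B" and w: "a \<in> Wt T0"
  shows "ta n a \<in> Wt T0"
proof (induction n)
  case 0
  \<comment> \<open>Stage \<open>0\<close> is the point, and \<open>tau_ar\<close> is its identity
    there.\<close>
  show ?case using Wt_id[OF good_T0 PS_pt] by (simp add: Mot_M)
qed (rule ta_Wt_step(1)[OF a w])

theorem tower_functors_descend:
  "(\<exists>!t. is_functor (HMot X) (HMot X) t \<and> functor_comp (Mot X) t (Ho X) = functor_comp (Mot X) (Ho X) (tau X F n)) \<and>
   (\<exists>!s. is_functor (HMot X) (HMot X) s \<and> functor_comp (Mot X) s (Ho X) = functor_comp (Mot X) (Ho X) (s_tilde X F n))"
proof -
  interpret loc M "Wt T0" by unfold_locales (auto simp: Wt_def)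
  have h: "w \<in> homs M (Dom M w) (Cod M w)" "w \<in> Ar M" if "w \<in> Wt T0" for w using that by (auto simp: homs_def Wt_def)
  show ?thesis
    unfolding HMot_def Ho_def Mot_M motivic_Wt
  proof (intro conjI localization_functor tau_functor s_functor)
    show "snd (tau X F n) w \<in> Wt T0" if "w \<in> Wt T0" for w
      using ta_Wt[OF h(1)[OF that] that] h(2)[OF that] by (simp add: tau_def Mot_M)
    show "snd (s_tilde X F n) w \<in> Wt T0" if "w \<in> Wt T0" for w
      using ta_Wt_step(2)[OF h(1)[OF that] that ta_Wt[OF h(1)[OF that] that]] h(2)[OF that]
      by (simp add: s_tilde_def Mot_M del: tau_ar.simps)
  qed
qed

end

theorem proposition3p11:
  fixes X :: "'u sch" and F :: "nat \<Rightarrow> 'u mar ffact" and n :: nat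
  assumes "universe TYPE('u)"
    and "small_scheme X" and "noetherian_scheme X" and "separated_scheme X"
    and "finite_krull_dim X"
    and "\<And>k. functorial_factorization (Mot X) (WB_triv_cofs X k) (WB_fibs X k) (F k)"
    and "n \<ge> 1"
  shows "(\<exists>!t. is_functor (HMot X) (HMot X) t \<and>
               functor_comp (Mot X) t (Ho X) = functor_comp (Mot X) (Ho X) (tau X F n)) \<and>
         (\<exists>!s. is_functor (HMot X) (HMot X) s \<and>
               functor_comp (Mot X) s (Ho X) = functor_comp (Mot X) (Ho X) (s_tilde X F n))"
proof -
  have inf: "infinite (UNIV :: 'u set)" by (rule universe_infinite[OF assms(1)])
  obtain enc :: "'u smarr option \<times> (nat => nat) => 'u smarr option" where enc: "inj enc" by (rule ex_Sm_enc[OF inf])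
  interpret tower X F enc by (rule tower.intro[OF enc inf assms(6)])
  show ?thesis by (rule tower_functors_descend)
qed

end
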